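(* Let $U=U(0,1)$ be the open unit ball in $\mathbb{R}^m$, let $1<p<\infty$, and let $\{f_j\}$ be a sequence in $W^1_p(U;\mathcal{Q}_Q(\ell_2))$ such that (1) there exists a compact set $C\subset\ell_2$ such that $f_j(x)\in\mathcal{Q}_Q(C)$ for every $x\in U$ and every $j=1,2,\dots$; (2) $\sup_j\int_U|Df_j|^p\,d\mathcal{L}^m<\infty$. Then there exist a subsequence $\{f_{k(j)}\}$ and $f\in W^1_p(U;\mathcal{Q}_Q(\ell_2))$ such that $\lim_jd_p(f,f_{k(j)})=0$.
   Context: $Q,m\ge1$ are integers; $\mathbb{R}^m$ has its Euclidean norm; $\ell_2$ is the infinite dimensional separable real Hilbert space. $\mathcal{Q}_Q(\ell_2)$ is the quotient of the $Q$-fold Cartesian product of $\ell_2$ by the permutation action of $S_Q$; the class of $(y_1,\dots,y_Q)$ is $[\![y_1,\dots,y_Q]\!]$, $Q[\![0]\!]=[\![0,\dots,0]\!]$, and $\mathcal{G}([\![y_1,\dots,y_Q]\!],[\![y_1',\dots,y_Q']\!])=\min_{\sigma\in S_Q}\big(\sum_i\|y_i-y'_{\sigma(i)}\|^2\big)^{1/2}$. For $C\subset\ell_2$, $\mathcal{Q}_Q(C)$ is the set of $[\![y_1,\dots,y_Q]\!]$ with all $y_i\in C$. $L_p(U;\mathcal{Q}_Q(\ell_2))$: Borel maps $f:U\to\mathcal{Q}_Q(\ell_2)$ with $\int_U\mathcal{G}(f,Q[\![0]\!])^pd\mathcal{L}^m<\infty$; $d_p(f,g)=(\int_U\mathcal{G}(f,g)^pd\mathcal{L}^m)^{1/p}$.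 A Borel map $f:U\to\mathcal{Q}_Q(\ell_2)$ is approximately differentiable at $a\in U$ if there are affine maps $A_1,\dots,A_Q:\mathbb{R}^m\to\ell_2$ such that for every $\varepsilon>0$ the set $\{x:\mathcal{G}(f(x),[\![A_1(x),\dots,A_Q(x)]\!])>\varepsilon\|x-a\|\}$ has $m$-dimensional density $0$ at $a$; the unordered tuple is unique; with $L_i=A_i-A_i(0)$ put $Df(a)=[\![L_1,\dots,L_Q]\!]$ and $|Df(a)|=\big(\sum_{i=1}^Q\sum_{j=1}^m\|L_i(e_j)\|^2\big)^{1/2}$, $e_1,\dots,e_m$ being the canonical basis of $\mathbb{R}^m$. $W^1_p(U;\mathcal{Q}_Q(\ell_2))$: those $f\in L_p(U;\mathcal{Q}_Q(\ell_2))$ for which there are Lipschitz maps $g_j:\mathbb{R}^m\to\mathcal{Q}_Q(\ell_2)$ with $\sup_j\int_U|Dg_j|^pd\mathcal{L}^m<\infty$ and $d_p(f,g_j)\to0$. Lipschitz maps and members of $W^1_p(U;\mathcal{Q}_Q(\ell_2))$ are approximately differentiable $\mathcal{L}^m$-a.e. in $U$. *)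

theory Defs
  imports "HOL-Analysis.Analysis" "HOL-Combinatorics.Permutations"
begin

section \<open>The Hilbert space of square summable real sequences\<close>

typedef ell2 = "{x :: nat \<Rightarrow> real. summable (\<lambda>n. (x n)\<^sup>2)}"
  morphisms coord Abs_ell2
  by (rule exI[of _ "\<lambda>_. 0"]) simp

setup_lifting type_definition_ell2

lemma coord_summable: "summable (\<lambda>n. (coord x n)\<^sup>2)"
  using coord[of x] by simp

lemma summable_mult_ell2:
  fixes x y :: "nat \<Rightarrow> real"
  assumes "summable (\<lambda>n. (x n)\<^sup>2)" "summable (\<lambda>n. (y n)\<^sup>2)"
  shows "summable (\<lambda>n. x n * y n)"
proof (rule summable_comparison_test')
  show "summable (\<lambda>n. (x n)\<^sup>2 + (y n)\<^sup>2)" using assms by (rule summable_add)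
  fix n
  have "2 * (\<bar>x n\<bar> * \<bar>y n\<bar>) \<le> (x n)\<^sup>2 + (y n)\<^sup>2"
    using sum_squares_bound[of "\<bar>x n\<bar>" "\<bar>y n\<bar>"] by (simp add: mult.assoc)
  moreover have "0 \<le> \<bar>x n\<bar> * \<bar>y n\<bar>" by simp
  ultimately show "norm (x n * y n) \<le> (x n)\<^sup>2 + (y n)\<^sup>2"
    by (simp only: real_norm_def abs_mult)
qed

lemma summable_add_ell2:
  fixes x y :: "nat \<Rightarrow> real"
  assumes "summable (\<lambda>n. (x n)\<^sup>2)" "summable (\<lambda>n. (y n)\<^sup>2)"
  shows "summable (\<lambda>n. (x n + y n)\<^sup>2)"
proof -
  have "summable (\<lambda>n. (x n)\<^sup>2 + (y n)\<^sup>2 + 2 * (x n * y n))"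
    by (intro summable_add summable_mult assms summable_mult_ell2)
  then show ?thesis by (simp add: power2_sum mult.assoc)
qed

instantiation ell2 :: real_vector
begin

lift_definition zero_ell2 :: ell2 is "\<lambda>_. 0" by simp
lift_definition plus_ell2 :: "ell2 \<Rightarrow> ell2 \<Rightarrow> ell2" is "\<lambda>x y n. x n + y n"
  by (rule summable_add_ell2)
lift_definition uminus_ell2 :: "ell2 \<Rightarrow> ell2" is "\<lambda>x n. - x n" by simp
lift_definition minus_ell2 :: "ell2 \<Rightarrow> ell2 \<Rightarrow> ell2" is "\<lambda>x y n. x n - y n"
  using summable_add_ell2[of _ "\<lambda>n. - _ n"] by simp
lift_definition scaleR_ell2 :: "real \<Rightarrow> ell2 \<Rightarrow> ell2" is "\<lambda>c x n. c * x n"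
  by (simp add: power_mult_distrib summable_mult)

instance
proof
  fix x y z :: ell2 and a b :: real
  show "x + y + z = x + (y + z)" by transfer (simp add: add.assoc)
  show "x + y = y + x" by transfer (simp add: add.commute)
  show "0 + x = x" by transfer simp
  show "- x + x = 0" by transfer simp
  show "x - y = x + - y" by transfer simp
  show "a *\<^sub>R (x + y) = a *\<^sub>R x + a *\<^sub>R y" by transfer (simp add: distrib_left)
  show "(a + b) *\<^sub>R x = a *\<^sub>R x + b *\<^sub>R x" by transfer (simp add: distrib_right)
  show "a *\<^sub>R b *\<^sub>R x = (a * b) *\<^sub>R x" by transfer (simp add: mult.assoc)
  show "1 *\<^sub>R x = x" by transfer simp
qed

end

instantiation ell2 :: real_inner
begin

lift_definition inner_ell2 :: "ell2 \<Rightarrow> ell2 \<Rightarrow> real" is "\<lambda>x y. \<Sum>n. x n * y n" .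

definition "norm (x :: ell2) = sqrt (inner x x)"
definition "sgn (x :: ell2) = x /\<^sub>R norm x"
definition "dist (x :: ell2) y = norm (x - y)"
definition "(uniformity :: (ell2 \<times> ell2) filter) =
  (INF e\<in>{0 <..}. principal {(x, y). dist x y < e})"
definition "open (U :: ell2 set) =
  (\<forall>x\<in>U. eventually (\<lambda>(x', y). x' = x \<longrightarrow> y \<in> U) uniformity)"

instance
proof
  fix x y z :: ell2 and a :: real
  show "inner x y = inner y x" by transfer (simp add: mult.commute)
  show "inner (x + y) z = inner x z + inner y z"
    by transfer (simp add: distrib_right suminf_add summable_mult_ell2)
  show "inner (a *\<^sub>R x) y = a * inner x y"
    by transfer (simp add: mult.assoc suminf_mult summable_mult_ell2)
  show "0 \<le> inner x x"
    by transfer (auto intro!: suminf_nonneg simp: power2_eq_square)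
  show "inner x x = 0 \<longleftrightarrow> x = 0"
    by transfer (auto simp: power2_eq_square suminf_eq_zero_iff)
qed (simp_all only: norm_ell2_def sgn_ell2_def dist_ell2_def uniformity_ell2_def open_ell2_def)

end

lemma norm_ell2: "norm x = sqrt (\<Sum>n. (coord x n)\<^sup>2)"
  unfolding norm_ell2_def by (simp add: inner_ell2.rep_eq power2_eq_square)

lemma coord_le_norm: "\<bar>coord x n\<bar> \<le> norm x"
proof -
  have "(coord x n)\<^sup>2 \<le> (\<Sum>n. (coord x n)\<^sup>2)"
    using sum_le_suminf[OF coord_summable, of "{n}" x] by simp
  then show ?thesis unfolding norm_ell2 using real_le_rsqrt real_sqrt_abs
    by (metis real_sqrt_le_iff)
qed

instance ell2 :: complete_space
proof
  fix X :: "nat \<Rightarrow> ell2"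
  assume X: "Cauchy X"
  have "Cauchy (\<lambda>k. coord (X k) n)" for n
    unfolding Cauchy_def
  proof (intro allI impI)
    fix e :: real assume "e > 0"
    then obtain M where M: "\<forall>m\<ge>M. \<forall>k\<ge>M. dist (X m) (X k) < e"
      using X unfolding Cauchy_def by blast
    have "dist (coord (X m) n) (coord (X k) n) \<le> dist (X m) (X k)" for m k
      using coord_le_norm[of "X m - X k" n] by (simp add: dist_norm minus_ell2.rep_eq)
    then show "\<exists>M. \<forall>m\<ge>M. \<forall>k\<ge>M. dist (coord (X m) n) (coord (X k) n) < e"
      using M by (meson le_less_trans)
  qed
  then have "\<exists>l. (\<lambda>k. coord (X k) n) \<longlonglongrightarrow> l" for n
    using Cauchy_convergent convergent_def by blast
  then obtain l where l: "\<And>n. (\<lambda>k. coord (X k) n) \<longlonglongrightarrow> l n" by metis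
  have key: "\<exists>M. \<forall>k\<ge>M. \<forall>N. (\<Sum>n<N. (coord (X k) n - l n)\<^sup>2) \<le> e\<^sup>2" if e: "e > 0" for e :: real
  proof -
    obtain M where M: "\<forall>m\<ge>M. \<forall>k\<ge>M. dist (X m) (X k) < e"
      using X e unfolding Cauchy_def by blast
    have "(\<Sum>n<N. (coord (X k) n - l n)\<^sup>2) \<le> e\<^sup>2" if k: "k \<ge> M" for k N
    proof (rule LIMSEQ_le_const2)
      show "(\<lambda>j. \<Sum>n<N. (coord (X k) n - coord (X j) n)\<^sup>2) \<longlonglongrightarrow> (\<Sum>n<N. (coord (X k) n - l n)\<^sup>2)"
        by (intro tendsto_intros l)
      have "(\<Sum>n<N. (coord (X k) n - coord (X j) n)\<^sup>2) \<le> e\<^sup>2" if j: "j \<ge> M" for j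
      proof -
        have "(\<Sum>n<N. (coord (X k - X j) n)\<^sup>2) \<le> (\<Sum>n. (coord (X k - X j) n)\<^sup>2)"
          by (rule sum_le_suminf[OF coord_summable]) auto
        also have "\<dots> = (norm (X k - X j))\<^sup>2"
          unfolding norm_ell2 by (simp add: suminf_nonneg coord_summable)
        also have "\<dots> \<le> e\<^sup>2"
          using M k j by (intro power_mono) (auto simp: dist_norm less_imp_le)
        finally show ?thesis by (simp add: minus_ell2.rep_eq)
      qed
      then show "\<exists>M. \<forall>j\<ge>M. (\<Sum>n<N. (coord (X k) n - coord (X j) n)\<^sup>2) \<le> e\<^sup>2" by blast
    qed
    then show ?thesis by blast
  qed
  have diff_summable: "summable (\<lambda>n. (coord (X k) n - l n)\<^sup>2)"
    if "\<forall>N. (\<Sum>n<N. (coord (X k) n - l n)\<^sup>2) \<le> e\<^sup>2" for k and e :: real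
    using that by (intro summableI_nonneg_bounded[where x="e\<^sup>2"]) auto
  obtain M1 where M1: "\<forall>k\<ge>M1. \<forall>N. (\<Sum>n<N. (coord (X k) n - l n)\<^sup>2) \<le> 1\<^sup>2"
    using key[of 1] by auto
  have "summable (\<lambda>n. (l n - coord (X M1) n)\<^sup>2)"
    using diff_summable[of M1 1] M1 by (simp add: power2_commute)
  then have "summable (\<lambda>n. ((l n - coord (X M1) n) + coord (X M1) n)\<^sup>2)"
    by (rule summable_add_ell2) (rule coord_summable)
  then have "summable (\<lambda>n. (l n)\<^sup>2)" by simp
  then have L: "coord (Abs_ell2 l) = l" by (simp add: Abs_ell2_inverse)
  have "X \<longlonglongrightarrow> Abs_ell2 l"
  proof (rule LIMSEQ_I)
    fix r :: real assume r: "r > 0"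
    then obtain M where M: "\<forall>k\<ge>M. \<forall>N. (\<Sum>n<N. (coord (X k) n - l n)\<^sup>2) \<le> (r/2)\<^sup>2"
      using key[of "r/2"] by auto
    have "norm (X k - Abs_ell2 l) < r" if "k \<ge> M" for k
    proof -
      have "(\<Sum>n. (coord (X k) n - l n)\<^sup>2) \<le> (r/2)\<^sup>2"
        using M that by (intro suminf_le_const diff_summable[of k "r/2"]) auto
      then have "norm (X k - Abs_ell2 l) \<le> r/2"
        unfolding norm_ell2 minus_ell2.rep_eq L using r by (intro real_le_lsqrt) auto
      then show ?thesis using r by simp
    qed
    then show "\<exists>M. \<forall>k\<ge>M. norm (X k - Abs_ell2 l) < r" by blast
  qed
  then show "convergent X" by (auto simp: convergent_def)
qed

text \<open>Truncations of square summable sequences to rational lists form a countable dense set.\<close>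

lemma ell2_separable:
  "\<exists>D :: ell2 set. countable D \<and> (\<forall>x. \<forall>e>0. \<exists>d\<in>D. dist d x < e)"
proof -
  define v where "v qs n = (if n < length qs then real_of_rat (qs ! n) else 0)" for qs n
  have v: "coord (Abs_ell2 (v qs)) = v qs" for qs
    by (rule Abs_ell2_inverse)
      (auto simp: v_def intro!: summable_finite[of "{..<length qs}"] split: if_splits)
  have "\<exists>qs. dist (Abs_ell2 (v qs)) x < e" if e: "e > 0" for x and e :: real
  proof -
    have e2: "e\<^sup>2 / 2 > 0" using e by simp
    obtain N where N: "norm (\<Sum>i. (coord x (i + N))\<^sup>2) < e\<^sup>2 / 2"
      using suminf_exist_split[OF e2 coord_summable[of x]] by auto
    define c where "c = e / (2 * real (Suc N))"
    have c: "c > 0" using e by (simp add: c_def)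
    have "\<exists>q. \<bar>real_of_rat q - coord x n\<bar> < c" for n
    proof -
      obtain q where "coord x n < real_of_rat q" "real_of_rat q < coord x n + c"
        using of_rat_dense[of "coord x n" "coord x n + c"] c by auto
      then show ?thesis by (intro exI[of _ q]) simp
    qed
    then obtain q where q: "\<And>n. \<bar>real_of_rat (q n) - coord x n\<bar> < c" by metis
    define qs where "qs = map q [0..<N]"
    let ?d = "\<lambda>n. (coord (Abs_ell2 (v qs) - x) n)\<^sup>2"
    have "(\<Sum>n. ?d n) = (\<Sum>n. ?d (n + N)) + (\<Sum>n<N. ?d n)"
      by (rule suminf_split_initial_segment[OF coord_summable])
    also have "(\<Sum>n. ?d (n + N)) = (\<Sum>i. (coord x (i + N))\<^sup>2)"
      by (simp add: minus_ell2.rep_eq v v_def qs_def)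
    also have "\<dots> < e\<^sup>2 / 2" using N by simp
    also have "(\<Sum>n<N. ?d n) \<le> (\<Sum>n<N. c\<^sup>2)"
    proof (rule sum_mono)
      fix n assume "n \<in> {..<N}"
      then have "?d n = \<bar>real_of_rat (q n) - coord x n\<bar>\<^sup>2"
        by (simp add: minus_ell2.rep_eq v v_def qs_def)
      also have "\<dots> \<le> c\<^sup>2" using q[of n] by (intro power_mono) auto
      finally show "?d n \<le> c\<^sup>2" .
    qed
    also have "(\<Sum>n<N. c\<^sup>2) \<le> e\<^sup>2 / 2"
    proof -
      have "real N \<le> 2 * (real (Suc N))\<^sup>2" by (simp add: power2_eq_square algebra_simps)
      then have "real N * e\<^sup>2 \<le> 2 * (real (Suc N))\<^sup>2 * e\<^sup>2" by (rule mult_right_mono) simp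
      then show ?thesis unfolding c_def
        by (simp add: power_divide power_mult_distrib field_simps del: of_nat_Suc)
    qed
    finally have "(\<Sum>n. ?d n) < e\<^sup>2" by simp
    then have "dist (Abs_ell2 (v qs)) x < e"
      unfolding dist_norm norm_ell2 using e by (intro real_less_lsqrt) auto
    then show ?thesis by blast
  qed
  then show ?thesis
    by (intro exI[of _ "range (\<lambda>qs. Abs_ell2 (v qs))"]) auto
qed

instance ell2 :: polish_space
proof
  obtain D :: "ell2 set" where D: "countable D" "\<And>x e. e > 0 \<Longrightarrow> \<exists>d\<in>D. dist d x < e"
    using ell2_separable by blast
  define B where "B = (\<lambda>(d, r). ball d (real_of_rat r)) ` (D \<times> UNIV)"
  have "topological_basis B"
  proof (rule topological_basisI)
    show "open b" if "b \<in> B" for b using that by (auto simp: B_def)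
    fix S :: "ell2 set" and x assume "open S" "x \<in> S"
    then obtain e where e: "e > 0" "ball x e \<subseteq> S" by (auto simp: open_contains_ball)
    obtain r where r: "0 < real_of_rat r" "real_of_rat r < e / 2"
      using of_rat_dense[of 0 "e/2"] e by auto
    obtain d where d: "d \<in> D" "dist d x < real_of_rat r" using D(2)[OF r(1)] by blast
    have "ball d (real_of_rat r) \<subseteq> ball x e"
    proof
      fix y assume "y \<in> ball d (real_of_rat r)"
      then have "dist x y < e"
        using dist_triangle[of x y d] d(2) r(2) by (simp add: dist_commute)
      then show "y \<in> ball x e" by simp
    qed
    moreover have "x \<in> ball d (real_of_rat r)" using d(2) by simp
    moreover have "ball d (real_of_rat r) \<in> B" using d(1) by (auto simp: B_def)
    ultimately show "\<exists>b\<in>B. x \<in> b \<and> b \<subseteq> S" using e(2) by blast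
  qed
  moreover have "countable B" using D(1) by (auto simp: B_def)
  ultimately show "\<exists>B :: ell2 set set. countable B \<and> open = generate_topology B"
    using topological_basis_imp_subbasis by blast
qed


section \<open>Unordered tuples\<close>

text \<open>The class of \<open>(y\<^sub>1, \<dots>, y\<^sub>Q)\<close> under permutation of the entries is the multiset of its
  entries, so the quotient of the \<open>Q\<close>-fold product of \<open>C\<close> consists of the multisets of size
  \<open>Q\<close> with entries in \<open>C\<close>.\<close>

definition Qtuples :: "nat \<Rightarrow> 'a set \<Rightarrow> 'a multiset set" where
  "Qtuples Q C = {A. size A = Q \<and> set_mset A \<subseteq> C}"

text \<open>The minimum ranges over all enumerations of \<open>A\<close> and \<open>B\<close> as well as over the
  permutations; by \<open>qdist_mset\<close> below, the enumerations may be fixed. The value \<open>0\<close> for tuples of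
  different sizes is only there to make the function symmetric.\<close>

definition qdist :: "'a::real_normed_vector multiset \<Rightarrow> 'a multiset \<Rightarrow> real" where
  "qdist A B = (if size A = size B
     then Min {sqrt (\<Sum>i<size A. (norm (xs ! i - ys ! \<sigma> i))\<^sup>2) | xs ys \<sigma>.
                 mset xs = A \<and> mset ys = B \<and> \<sigma> permutes {..<size A}}
     else 0)"

definition tuple_cost :: "'a::real_normed_vector list \<Rightarrow> 'a list \<Rightarrow> (nat \<Rightarrow> nat) \<Rightarrow> real" where
  "tuple_cost xs ys \<sigma> = sqrt (\<Sum>i<length xs. (norm (xs ! i - ys ! \<sigma> i))\<^sup>2)"

lemma tuple_cost_L2: "tuple_cost xs ys \<sigma> = L2_set (\<lambda>i. norm (xs ! i - ys ! \<sigma> i)) {..<length xs}"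
  by (simp add: tuple_cost_def L2_set_def)

lemma tuple_cost_rearrange:
  assumes len: "length xs = length ys" and xs': "mset xs' = mset xs" and ys': "mset ys' = mset ys"
    and \<sigma>: "\<sigma> permutes {..<length xs}"
  shows "\<exists>\<tau>. \<tau> permutes {..<length xs} \<and> tuple_cost xs' ys' \<sigma> = tuple_cost xs ys \<tau>"
proof -
  let ?I = "{..<length xs}"
  have len': "length xs' = length xs" "length ys' = length xs"
    using xs' ys' len by (metis mset_eq_length)+
  obtain a where a: "a permutes ?I" "permute_list a xs = xs'"
    using mset_eq_permutation[OF xs'] by auto
  obtain b where b: "b permutes ?I" "permute_list b ys = ys'"
    using mset_eq_permutation[OF ys'] len by auto
  have xi: "xs' ! i = xs ! a i" if "i < length xs" for i
    using a that permute_list_nth[of a xs i] by simp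
  have yi: "ys' ! i = ys ! b i" if "i < length xs" for i
    using b that len permute_list_nth[of b ys i] by simp
  define \<tau> where "\<tau> = b \<circ> \<sigma> \<circ> inv a"
  have \<tau>: "\<tau> permutes ?I"
    unfolding \<tau>_def by (intro permutes_compose permutes_inv a b \<sigma>)
  have "(\<Sum>i<length xs. (norm (xs' ! i - ys' ! \<sigma> i))\<^sup>2)
      = (\<Sum>i<length xs. (norm (xs ! a i - ys ! \<tau> (a i)))\<^sup>2)"
  proof (rule sum.cong[OF refl])
    fix i assume i: "i \<in> ?I"
    have "\<sigma> i \<in> ?I" using permutes_in_image[OF \<sigma>] i by blast
    then show "(norm (xs' ! i - ys' ! \<sigma> i))\<^sup>2 = (norm (xs ! a i - ys ! \<tau> (a i)))\<^sup>2"
      using i xi yi by (simp add: \<tau>_def permutes_inverses[OF a(1)])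
  qed
  also have "\<dots> = (\<Sum>i<length xs. (norm (xs ! i - ys ! \<tau> i))\<^sup>2)"
    using sum.permute[OF a(1), of "\<lambda>i. (norm (xs ! i - ys ! \<tau> i))\<^sup>2"] by (simp add: comp_def)
  finally show ?thesis using \<tau> len' by (auto simp: tuple_cost_def)
qed

lemma qdist_mset:
  assumes "length xs = length ys"
  shows "qdist (mset xs) (mset ys) =
    Min ((\<lambda>\<sigma>. sqrt (\<Sum>i<length xs. (norm (xs ! i - ys ! \<sigma> i))\<^sup>2)) ` {\<sigma>. \<sigma> permutes {..<length xs}})"
proof -
  have "{sqrt (\<Sum>i<size (mset xs). (norm (xs' ! i - ys' ! \<sigma> i))\<^sup>2) | xs' ys' \<sigma>.
           mset xs' = mset xs \<and> mset ys' = mset ys \<and> \<sigma> permutes {..<size (mset xs)}}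
      = (\<lambda>\<sigma>. tuple_cost xs ys \<sigma>) ` {\<sigma>. \<sigma> permutes {..<length xs}}" (is "?L = ?R")
  proof
    show "?R \<subseteq> ?L" by (fastforce simp: tuple_cost_def)
    show "?L \<subseteq> ?R"
    proof
      fix r assume "r \<in> ?L"
      then obtain xs' ys' \<sigma> where *: "mset xs' = mset xs" "mset ys' = mset ys"
        "\<sigma> permutes {..<length xs}" "r = sqrt (\<Sum>i<length xs. (norm (xs' ! i - ys' ! \<sigma> i))\<^sup>2)"
        by auto
      have "r = tuple_cost xs' ys' \<sigma>"
        using *(4) mset_eq_length[OF *(1)] by (simp add: tuple_cost_def)
      then show "r \<in> ?R"
        using tuple_cost_rearrange[OF assms *(1-3)] by auto
    qed
  qed
  then show ?thesis using assms by (simp add: qdist_def tuple_cost_def)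
qed

lemma qdist_attained:
  assumes "length xs = length ys"
  shows "\<exists>ys'. mset ys' = mset ys \<and>
    qdist (mset xs) (mset ys) = L2_set (\<lambda>i. norm (xs ! i - ys' ! i)) {..<length xs}"
proof -
  let ?P = "{\<sigma>. \<sigma> permutes {..<length xs}}"
  have "qdist (mset xs) (mset ys) \<in> tuple_cost xs ys ` ?P"
    unfolding qdist_mset[OF assms] tuple_cost_def
    by (rule Min_in) (auto simp: finite_permutations intro: permutes_id)
  then obtain \<sigma> where \<sigma>: "\<sigma> permutes {..<length xs}" "qdist (mset xs) (mset ys) = tuple_cost xs ys \<sigma>"
    by auto
  have "permute_list \<sigma> ys ! i = ys ! \<sigma> i" if "i < length xs" for i
    using \<sigma>(1) assms that by (simp add: permute_list_nth)
  then have "tuple_cost xs ys \<sigma> = L2_set (\<lambda>i. norm (xs ! i - permute_list \<sigma> ys ! i)) {..<length xs}"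
    unfolding tuple_cost_L2 by (intro L2_set_cong) auto
  moreover have "mset (permute_list \<sigma> ys) = mset ys" using \<sigma>(1) assms by simp
  ultimately show ?thesis using \<sigma>(2) by metis
qed

lemma qdist_le:
  assumes "length xs = length ys"
  shows "qdist (mset xs) (mset ys) \<le> L2_set (\<lambda>i. norm (xs ! i - ys ! i)) {..<length xs}"
proof -
  have "qdist (mset xs) (mset ys) \<le> tuple_cost xs ys id"
    unfolding qdist_mset[OF assms]
    by (rule Min_le) (auto simp: finite_permutations tuple_cost_def permutes_id intro!: image_eqI[of _ _ id])
  then show ?thesis by (simp add: tuple_cost_L2)
qed

lemma qdist_nonneg: "0 \<le> qdist A B"
proof (cases "size A = size B")
  case True
  obtain xs ys where "A = mset xs" "B = mset ys" by (metis ex_mset)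
  then show ?thesis using qdist_attained[of xs ys] True by auto
qed (simp add: qdist_def)

lemma qdist_commute: "qdist A B = qdist B A"
proof (cases "size A = size B")
  case True
  have *: "qdist B A \<le> qdist A B" if "size A = size B" for A B :: "'a multiset"
  proof -
    obtain xs ys where AB: "A = mset xs" "B = mset ys" by (metis ex_mset)
    then have len: "length xs = length ys" using that by simp
    obtain ys' where ys': "mset ys' = mset ys"
      "qdist A B = L2_set (\<lambda>i. norm (xs ! i - ys' ! i)) {..<length xs}"
      using qdist_attained[OF len] AB by auto
    have "length ys' = length xs" using len mset_eq_length[OF ys'(1)] by simp
    then show ?thesis using qdist_le[of ys' xs] ys' AB by (simp add: norm_minus_commute)
  qed
  show ?thesis using *[of A B] *[of B A] True by simp
qed (simp add: qdist_def)

lemma qdist_triangle: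
  assumes "size A = Q" "size B = Q" "size C = Q"
  shows "qdist A C \<le> qdist A B + qdist B C"
proof -
  obtain xs where A: "A = mset xs" by (metis ex_mset)
  obtain ys0 where B: "B = mset ys0" by (metis ex_mset)
  obtain zs0 where C: "C = mset zs0" by (metis ex_mset)
  have l: "length xs = Q" "length ys0 = Q" "length zs0 = Q" using assms A B C by auto
  obtain ys where ys: "mset ys = B" "qdist A B = L2_set (\<lambda>i. norm (xs ! i - ys ! i)) {..<Q}"
    using qdist_attained[of xs ys0] A B l by auto
  have ly: "length ys = Q" using ys(1) assms(2) by (metis size_mset)
  obtain zs where zs: "mset zs = C" "qdist B C = L2_set (\<lambda>i. norm (ys ! i - zs ! i)) {..<Q}"
    using qdist_attained[of ys zs0] ys(1) C l ly by auto
  have lz: "length zs = Q" using zs(1) assms(3) by (metis size_mset)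
  have "qdist A C \<le> L2_set (\<lambda>i. norm (xs ! i - zs ! i)) {..<Q}"
    using qdist_le[of xs zs] A zs(1) l lz by auto
  also have "\<dots> \<le> L2_set (\<lambda>i. norm (xs ! i - ys ! i) + norm (ys ! i - zs ! i)) {..<Q}"
    by (rule L2_set_mono) (auto intro: order_trans[OF _ norm_triangle_ineq])
  also have "\<dots> \<le> qdist A B + qdist B C"
    unfolding ys(2) zs(2) by (rule L2_set_triangle_ineq)
  finally show ?thesis .
qed

lemma qdist_eq_0:
  assumes "size A = size B"
  shows "qdist A B = 0 \<longleftrightarrow> A = B"
proof
  obtain xs ys where AB: "A = mset xs" "B = mset ys" by (metis ex_mset)
  have len: "length xs = length ys" using AB assms by simp
  {
    assume "qdist A B = 0"
    then obtain zs where zs: "mset zs = B" "L2_set (\<lambda>i. norm (xs ! i - zs ! i)) {..<length xs} = 0"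
      using qdist_attained[OF len] AB by auto
    have "length zs = length xs" using zs(1) AB len by (metis size_mset)
    then have "xs = zs" using zs(2) by (intro nth_equalityI) (auto simp: L2_set_eq_0_iff)
    then show "A = B" using AB zs by simp
  next
    assume "A = B"
    then show "qdist A B = 0"
      using qdist_le[of xs xs] qdist_nonneg[of A B] AB by (simp add: L2_set_def)
  }
qed

lemma Metric_space_Qtuples: "Metric_space (Qtuples Q UNIV) qdist"
  by unfold_locales
    (auto simp: Qtuples_def qdist_nonneg qdist_eq_0 intro: qdist_commute qdist_triangle)

definition qspace :: "nat \<Rightarrow> 'a::real_normed_vector multiset metric" where
  "qspace Q = metric (Qtuples Q UNIV, qdist)"

lemma mspace_qspace [simp]: "mspace (qspace Q) = Qtuples Q UNIV"
  by (simp add: qspace_def Metric_space.mspace_metric[OF Metric_space_Qtuples])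

lemma mdist_qspace [simp]: "mdist (qspace Q) = qdist"
  by (simp add: qspace_def Metric_space.mdist_metric[OF Metric_space_Qtuples])

definition qborel :: "nat \<Rightarrow> 'a::real_normed_vector multiset measure" where
  "qborel Q = sigma (Qtuples Q UNIV) {V. openin (mtopology_of (qspace Q)) V}"


section \<open>Spaces of maps into unordered tuples\<close>

text \<open>Maps are total functions, of which only the values on \<open>U\<close> matter.\<close>

definition borel_maps ::
    "nat \<Rightarrow> (real^'m) set \<Rightarrow> (real^'m \<Rightarrow> 'a::real_normed_vector multiset) set" where
  "borel_maps Q U = restrict_space borel U \<rightarrow>\<^sub>M qborel Q"

definition Lp ::
    "nat \<Rightarrow> real \<Rightarrow> (real^'m) set \<Rightarrow> (real^'m \<Rightarrow> 'a::real_normed_vector multiset) set" where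
  "Lp Q p U = {f \<in> borel_maps Q U.
     (\<integral>\<^sup>+x\<in>U. ennreal (qdist (f x) (replicate_mset Q 0) powr p) \<partial>lebesgue) < \<infinity>}"

text \<open>Intended for members of \<open>Lp\<close> only: on these the integral is finite, so that
  \<^const>\<open>enn2real\<close> does not truncate.\<close>

definition dp :: "real \<Rightarrow> (real^'m) set \<Rightarrow> (real^'m \<Rightarrow> 'a::real_normed_vector multiset) \<Rightarrow>
    (real^'m \<Rightarrow> 'a multiset) \<Rightarrow> real" where
  "dp p U f g =
     enn2real (\<integral>\<^sup>+x\<in>U. ennreal (qdist (f x) (g x) powr p) \<partial>lebesgue) powr (1 / p)"

text \<open>Intended for Lebesgue measurable \<open>S\<close>, since \<^const>\<open>measure\<close> vanishes on other sets.\<close>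

definition density_zero :: "(real^'m) set \<Rightarrow> real^'m \<Rightarrow> bool" where
  "density_zero S a \<longleftrightarrow>
     ((\<lambda>r. measure lebesgue (S \<inter> cball a r) / measure lebesgue (cball a r)) \<longlongrightarrow> 0) (at_right 0)"

definition affine_map :: "('b::real_vector \<Rightarrow> 'a::real_vector) \<Rightarrow> bool" where
  "affine_map A \<longleftrightarrow> linear (\<lambda>x. A x - A 0)"

definition approx_affine :: "nat \<Rightarrow> (real^'m) set \<Rightarrow>
    (real^'m \<Rightarrow> 'a::real_normed_vector multiset) \<Rightarrow> real^'m \<Rightarrow> (real^'m \<Rightarrow> 'a) multiset \<Rightarrow> bool" where
  "approx_affine Q U f a \<A> \<longleftrightarrow> \<A> \<in> Qtuples Q (Collect affine_map) \<and>
     (\<forall>\<epsilon>>0. density_zero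
        {x \<in> U. qdist (f x) (image_mset (\<lambda>A. A x) \<A>) > \<epsilon> * norm (x - a)} a)"

text \<open>\<open>f\<close> is approximately differentiable at \<open>a\<close> if some \<open>\<A>\<close> with
  \<open>approx_affine Q U f a \<A>\<close> exists; for Borel \<open>f\<close> and \<open>a\<close> in the open set \<open>U\<close> it is then unique.\<close>

definition Df :: "nat \<Rightarrow> (real^'m) set \<Rightarrow> (real^'m \<Rightarrow> 'a::real_normed_vector multiset) \<Rightarrow>
    real^'m \<Rightarrow> (real^'m \<Rightarrow> 'a) multiset" where
  "Df Q U f a = image_mset (\<lambda>A x. A x - A 0) (THE \<A>. approx_affine Q U f a \<A>)"

definition norm_Df :: "nat \<Rightarrow> (real^'m) set \<Rightarrow>
    (real^'m \<Rightarrow> 'a::real_normed_vector multiset) \<Rightarrow> real^'m \<Rightarrow> real" where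
  "norm_Df Q U f a = sqrt (\<Sum>L\<in>#Df Q U f a. \<Sum>j\<in>UNIV. (norm (L (axis j 1)))\<^sup>2)"

text \<open>Points at which \<open>f\<close> is not approximately differentiable contribute an unspecified value
  to the integrand; for the maps considered they form a null set.\<close>

definition energy :: "nat \<Rightarrow> real \<Rightarrow> (real^'m) set \<Rightarrow>
    (real^'m \<Rightarrow> 'a::real_normed_vector multiset) \<Rightarrow> ennreal" where
  "energy Q p U f = (\<integral>\<^sup>+x\<in>U. ennreal (norm_Df Q U f x powr p) \<partial>lebesgue)"

text \<open>Requiring \<open>g j \<in> Lp Q p U\<close> makes the distance meaningful; for bounded \<open>U\<close> it
  follows from the Lipschitz condition.\<close>

definition W1p ::
    "nat \<Rightarrow> real \<Rightarrow> (real^'m) set \<Rightarrow> (real^'m \<Rightarrow> 'a::real_normed_vector multiset) set" where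
  "W1p Q p U = {f \<in> Lp Q p U. \<exists>g :: nat \<Rightarrow> real^'m \<Rightarrow> 'a multiset.
     (\<forall>j. Lipschitz_continuous_map euclidean_metric (qspace Q) (g j) \<and> g j \<in> Lp Q p U) \<and>
     (SUP j. energy Q p U (g j)) < \<infinity> \<and>
     (\<lambda>j. dp p U f (g j)) \<longlonglongrightarrow> 0}"

end

theory Submission
  imports Defs "HOL-Library.Diagonal_Subsequence"
begin

text \<open>The proof works with the bound \<open>\<integral> G(f(x), f(x + v))\<^sup>p dx \<le> M |v|\<^sup>p\<close> for all \<open>v\<close>, the
  integral being over the \<open>x\<close> with \<open>x, x + v \<in> U\<close>.

  Members of \<open>W\<^sup>1\<^sub>p\<close> satisfy it, since it holds for Lipschitz maps and passes to limits, and then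
  \<open>M\<close> can be chosen in terms of the energy of \<open>f\<close> alone. Indeed, for \<open>p > 1\<close> strict convexity forces
  the difference quotients of Hilbert space valued maps with this bound to be equicontinuous in the
  mean, so that such maps, and by local selections of the entries also tuple valued ones, are
  approximately differentiable almost everywhere; and the increment over \<open>v\<close> is the sum of the
  increments over \<open>v / N\<close>, which the differential controls as \<open>N\<close> tends to infinity.

  Conversely, sample \<open>f\<close> on a lattice of small mesh. By the bound the resulting step function is
  close to \<open>f\<close> in the mean, uniformly in \<open>f\<close>; as the tuples with entries in \<open>C\<close> are totally bounded,
  the given sequence has a Cauchy subsequence. Its limit satisfies the bound as well. The samples of
  the limit become a Lipschitz map by contracting the step function to constants near the lattice
  points, one class of widely separated lattice points after the other; the energy of this map is
  controlled by the differences of neighbouring samples, hence by \<open>M\<close>.\<close>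

text \<open>Membership in \<open>W1p\<close> bounds the energies of some Lipschitz approximants,
  separately for each map, and its definition does not relate that bound to the energy of the map
  itself. A bound on the energies of the sequence therefore gives no uniform estimate until it is
  known how the differential controls increments. This forces a bootstrap: a translation bound with
  an uncontrolled \<open>M\<close> yields differentiability almost everywhere, and the differential
  then yields a bound in which \<open>M\<close> no longer occurs.

  The entries lie in an infinite dimensional space, where differentiating coordinate by coordinate
  gives no control in norm; strict convexity supplies that control. Likewise the Lipschitz
  approximants are built inside the tuple space, by contraction, instead of through an embedding
  into a linear space.

  \<open>norm_Df\<close> is not shown to be measurable, so energies are handled by monotonicity, and
  splitting a sum needs the special \<open>nn_integral_add_le\<close>.\<close>

abbreviation lborel_integral :: "('a::euclidean_space => ennreal) => ennreal" (binder "\<integral>\<^sup>+" 10) where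
  "lborel_integral f \<equiv> \<integral>\<^sup>+x. f x \<partial>lborel"

abbreviation leb :: "'a::euclidean_space set => ennreal" where
  "leb \<equiv> emeasure lborel"

abbreviation enorm :: "'a::real_normed_vector => ennreal" where
  "enorm x \<equiv> ennreal (norm x)"

abbreviation qcost :: "real => 'a::real_normed_vector multiset => 'a multiset => ennreal" where
  "qcost p X Y \<equiv> ennreal (qdist X Y powr p)"

section \<open>Maximal inequality and density points\<close>

lemma sets_borel_balls [measurable]:
  fixes x :: "'a::euclidean_space"
  shows "cball x r \<in> sets borel" "ball x r \<in> sets borel" by auto

lemma nn_integral_translate:
  fixes f :: "'a::euclidean_space => ennreal"
  assumes [measurable]: "f \<in> borel_measurable borel"
  shows "(\<integral>\<^sup>+x. f (x + a)) = (\<integral>\<^sup>+x. f x)"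
proof -
  have "(\<integral>\<^sup>+x. f x) = (\<integral>\<^sup>+x. f x \<partial>distr lborel borel ((+) a))" by (simp add: lborel_distr_plus)
  also have "... = (\<integral>\<^sup>+x. f (a + x))" by (rule nn_integral_distr) auto
  finally show ?thesis by (simp add: add.commute)
qed

lemma nn_integral_rescale:
  fixes f :: "'a::euclidean_space => ennreal"
  assumes [measurable]: "f \<in> borel_measurable borel" and "c > 0"
  shows "(\<integral>\<^sup>+x. f x) = ennreal (c ^ DIM('a)) * (\<integral>\<^sup>+x. f (a + c *\<^sub>R x))"
proof -
  have "(\<integral>\<^sup>+x. f x)
      = (\<integral>\<^sup>+x. f x \<partial>density (distr lborel borel (\<lambda>x. a + c *\<^sub>R x)) (\<lambda>_. ennreal (\<bar>c\<bar> ^ DIM('a))))"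
    using \<open>c > 0\<close> by (subst lborel_affine[of c a]) auto
  also have "... = (\<integral>\<^sup>+x. ennreal (\<bar>c\<bar> ^ DIM('a)) * f (a + c *\<^sub>R x))"
    by (subst nn_integral_density) (auto simp: nn_integral_distr)
  finally show ?thesis using \<open>c > 0\<close> by (simp add: nn_integral_cmult)
qed

lemma nn_integral_cball_rescale:
  fixes f :: "'a::euclidean_space => ennreal"
  assumes [measurable]: "f \<in> borel_measurable borel" and "r > 0"
  shows "(\<integral>\<^sup>+y. f y * indicator (cball x (r * \<rho>)) y)
    = ennreal (r ^ DIM('a)) * (\<integral>\<^sup>+s. f (x + r *\<^sub>R s) * indicator (cball 0 \<rho>) s)"
proof -
  have "indicator (cball x (r * \<rho>)) (x + r *\<^sub>R s) = (indicator (cball 0 \<rho>) s :: ennreal)" for s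
    using \<open>r > 0\<close> by (simp add: indicator_def dist_norm)
  then show ?thesis by (subst nn_integral_rescale[OF _ \<open>r > 0\<close>, where a=x]) simp_all
qed

lemma emeasure_cball_scale:
  fixes x y :: "'a::euclidean_space"
  assumes "0 <= c" "0 <= r"
  shows "leb (cball x (c * r)) = ennreal (c ^ DIM('a)) * leb (cball y r)"
  using assms by (simp add: emeasure_cball power_mult_distrib mult_ac flip: ennreal_mult)

text \<open>The index set is whatever countable family the covering lemma returns; writing the sum
  as an integral over \<open>count_space\<close> lets it be exchanged with other integrals.\<close>

lemma emeasure_UN_countable_le:
  assumes "countable C" and [measurable]: "\<And>i. i \<in> C ==> X i \<in> sets M"
  shows "emeasure M (\<Union>i\<in>C. X i) <= (\<integral>\<^sup>+i. emeasure M (X i) \<partial>count_space C)"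
proof -
  have [measurable]: "(\<Union>i\<in>C. X i) \<in> sets M" using assms by auto
  have "emeasure M (\<Union>i\<in>C. X i) = (\<integral>\<^sup>+x. indicator (\<Union>i\<in>C. X i) x \<partial>M)" by simp
  also have "... <= (\<integral>\<^sup>+x. \<integral>\<^sup>+i. indicator (X i) x \<partial>count_space C \<partial>M)"
  proof (rule nn_integral_mono, goal_cases)
    case (1 x)
    show ?case
    proof (cases "x \<in> (\<Union>i\<in>C. X i)")
      case True
      then obtain i where "i \<in> C" "x \<in> X i" by auto
      then show ?thesis using nn_integral_ge_point[of i C "\<lambda>i. indicator (X i) x"] True by simp
    qed simp
  qed
  also have "... = (\<integral>\<^sup>+i. emeasure M (X i) \<partial>count_space C)"
    by (subst nn_integral_count_space_nn_integral) (auto simp: assms intro!: nn_integral_cong)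
  finally show ?thesis .
qed

text \<open>Vitali's covering lemma gives disjoint bad balls whose five-fold enlargements cover all
  bad centres. Each enlargement has measure at most \<open>5 ^ DIM('a) / l\<close> times the
  integral of \<open>\<Phi>\<close> over its own ball, and disjoint balls share the total integral.
  The exceptional set is delivered as the Borel union of the enlarged balls, so that no maximal
  function has to be measured. The cap 1 on the radii meets the boundedness requirement of the
  covering lemma.\<close>

lemma weak_type_maximal:
  fixes \<Phi> :: "'a::euclidean_space => ennreal"
  assumes [measurable]: "\<Phi> \<in> borel_measurable borel" and "0 < l"
  obtains T where "T \<in> sets borel" 
    "leb T <= ennreal (5 ^ DIM('a) / l) * (\<integral>\<^sup>+y. \<Phi> y)"
    "\<And>x r. 0 < r ==> r <= 1 ==>
      ennreal l * leb (cball x r) < (\<integral>\<^sup>+y. \<Phi> y * indicator (cball x r) y) ==> x \<in> T"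
proof -
  define K where "K = {(x, r). 0 < r \<and> r <= 1 \<and>
    ennreal l * leb (cball x r) < (\<integral>\<^sup>+y. \<Phi> y * indicator (cball x r) y)}"
  have 1: "fst ` K \<subseteq> (\<Union>i\<in>K. cball (fst i) (snd i))" by (force simp: K_def)
  have 2: "0 < snd i \<and> snd i <= 1" if "i \<in> K" for i using that by (auto simp: K_def)
  obtain C where C: "countable C" "C \<subseteq> K"
     "pairwise (\<lambda>i j. disjnt (cball (fst i) (snd i)) (cball (fst j) (snd j))) C"
     "fst ` K \<subseteq> (\<Union>i\<in>C. cball (fst i) (5 * snd i))"
    by (rule Vitali_covering_lemma_cballs[OF 1 2]) (assumption, rule that)
  define T where "T = (\<Union>i\<in>C. cball (fst i) (5 * snd i))"
  have disj: "disjoint_family_on (\<lambda>i. cball (fst i) (snd i)) C"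
    using C(3) by (auto simp: disjoint_family_on_def pairwise_def disjnt_def)
  let ?c = "ennreal (5 ^ DIM('a) / l)"
  have "leb T <= (\<integral>\<^sup>+i. leb (cball (fst i) (5 * snd i)) \<partial>count_space C)"
    unfolding T_def by (rule emeasure_UN_countable_le) (auto simp: C)
  also have "... <= (\<integral>\<^sup>+i. ?c * (\<integral>\<^sup>+y. \<Phi> y * indicator (cball (fst i) (snd i)) y) \<partial>count_space C)"
  proof (rule nn_integral_mono)
    fix i assume "i \<in> space (count_space C)"
    then have i: "0 < snd i" "ennreal l * leb (cball (fst i) (snd i))
        <= (\<integral>\<^sup>+y. \<Phi> y * indicator (cball (fst i) (snd i)) y)" using C(2) by (auto simp: K_def)
    have "leb (cball (fst i) (5 * snd i))
        = ennreal (5 ^ DIM('a)) * leb (cball (fst i) (snd i))" using i by (intro emeasure_cball_scale) auto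
    also have "... = ?c * (ennreal l * leb (cball (fst i) (snd i)))"
      using \<open>0 < l\<close> by (simp add: mult.assoc[symmetric] ennreal_mult[symmetric])
    also have "... <= ?c * (\<integral>\<^sup>+y. \<Phi> y * indicator (cball (fst i) (snd i)) y)" by (intro mult_left_mono i) auto
    finally show "leb (cball (fst i) (5 * snd i)) <= ..." .
  qed
  also have "... = ?c * (\<integral>\<^sup>+i. (\<integral>\<^sup>+y. \<Phi> y * indicator (cball (fst i) (snd i)) y) \<partial>count_space C)"
    by (rule nn_integral_cmult) auto
  also have "(\<integral>\<^sup>+i. (\<integral>\<^sup>+y. \<Phi> y * indicator (cball (fst i) (snd i)) y) \<partial>count_space C)
      = (\<integral>\<^sup>+y. (\<integral>\<^sup>+i. \<Phi> y * indicator (cball (fst i) (snd i)) y \<partial>count_space C))"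
    by (subst nn_integral_count_space_nn_integral) (auto simp: C)
  also have "... <= (\<integral>\<^sup>+y. \<Phi> y)"
  proof (rule nn_integral_mono, goal_cases)
    case (1 y)
    have "(\<integral>\<^sup>+i. \<Phi> y * indicator (cball (fst i) (snd i)) y \<partial>count_space C)
        = \<Phi> y * (\<integral>\<^sup>+i. indicator (cball (fst i) (snd i)) y \<partial>count_space C)" by (rule nn_integral_cmult) auto
    also have "(\<integral>\<^sup>+i. indicator (cball (fst i) (snd i)) y \<partial>count_space C)
        = (\<integral>\<^sup>+i. of_bool (y \<in> cball (fst i) (snd i)) \<partial>count_space C)"
      by (auto intro!: nn_integral_cong simp: indicator_def)
    also have "... = of_bool (\<exists>i\<in>C. y \<in> cball (fst i) (snd i))" by (rule of_bool_Bex_eq_nn_integral[symmetric])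
        (use disj in \<open>unfold disjoint_family_on_def, blast\<close>)
    also have "\<Phi> y * of_bool (\<exists>i\<in>C. y \<in> cball (fst i) (snd i)) <= \<Phi> y * 1" by (rule mult_left_mono) auto
    finally show ?case by simp
  qed
  finally have "leb T <= ?c * (\<integral>\<^sup>+y. \<Phi> y)"  by (simp add: mult_left_mono)
  moreover have "T \<in> sets borel" unfolding T_def using C(1) by auto
  moreover have "x \<in> T" if "0 < r" "r <= 1"
    "ennreal l * leb (cball x r) < (\<integral>\<^sup>+y. \<Phi> y * indicator (cball x r) y)" for x r
  proof -
    have "x \<in> fst ` K" using that by (force simp: K_def)
    then show ?thesis using C(4) unfolding T_def by blast
  qed
  ultimately show ?thesis using that by blast
qed

text \<open>The exceptional set itself may be nonmeasurable: Borel covers of measure tending to 0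
  suffice.\<close>

lemma AE_not_in_of_small_covers:
  assumes "\<And>k::nat. T k \<in> sets M" "\<And>k. emeasure M (T k) <= ennreal (c * (1/2) ^ k)" "0 <= c"
    and "\<And>x. N x ==> \<forall>k. x \<in> T k"
  shows "AE x in M. \<not> N x"
proof -
  have "emeasure M (\<Inter>k. T k) <= ennreal (c * (1/2) ^ k)" for k
    by (rule order_trans[OF emeasure_mono assms(2)]) (auto simp: assms)
  moreover have "(\<lambda>k. ennreal (c * (1/2) ^ k)) \<longlonglongrightarrow> ennreal (c * 0)"
    by (intro tendsto_ennrealI tendsto_intros LIMSEQ_power_zero) auto
  ultimately have "emeasure M (\<Inter>k. T k) <= 0" by (intro LIMSEQ_le_const[of "\<lambda>k. ennreal (c * (1/2) ^ k)"]) auto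
  then have "(\<Inter>k. T k) \<in> null_sets M" using assms(1) by (intro null_setsI) auto
  then show ?thesis by (rule AE_I') (use assms(4) in auto)
qed

text \<open>For \<open>x\<close> in \<open>P\<close> and an open \<open>V\<close> containing
  \<open>P\<close>, small balls about \<open>x\<close> lie in \<open>V\<close>, so the part of such
  a ball outside \<open>P\<close> lies in \<open>V - P\<close>. Outer regularity makes
  \<open>V - P\<close> small, and the weak type estimate for its indicator does the rest.\<close>

lemma density_points:
  fixes P :: "'a::euclidean_space set"
  assumes P[measurable]: "P \<in> sets borel"
  shows "AE x in lborel. x \<in> P --> (\<forall>\<e>>0. \<exists>\<delta>>0. \<forall>r. 0 < r --> r <= \<delta> -->
    leb (cball x r - P) <= ennreal \<e> * leb (cball x r))"
proof -
  define N where "N n x \<longleftrightarrow> x \<in> P \<and> (\<forall>\<delta>>0. \<exists>r. 0 < r \<and> r <= \<delta> \<and>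
    ennreal (1 / real (Suc n)) * leb (cball x r) < leb (cball x r - P))" for n x
  have "AE x in lborel. \<not> N n x" for n
  proof -
    have "\<exists>T. T \<in> sets borel \<and> leb T <= ennreal ((5 ^ DIM('a) * real (Suc n)) * (1/2) ^ k)
      \<and> (\<forall>x. N n x --> x \<in> T)" for k
    proof -
      obtain V where V: "open V" "P \<subseteq> V" "leb (V - P) < ennreal ((1/2) ^ k)"
        by (rule outer_regular_lborel[OF P, of "(1/2)^k"]) auto
      have [measurable]: "V \<in> sets borel" using V by auto
      obtain T where T: "T \<in> sets borel" 
        "leb T <= ennreal (5 ^ DIM('a) / (1 / real (Suc n))) * (\<integral>\<^sup>+y. indicator (V - P) y)"
        "\<And>x r. 0 < r ==> r <= 1 ==>
          ennreal (1 / real (Suc n)) * leb (cball x r)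
             < (\<integral>\<^sup>+y. indicator (V - P) y * indicator (cball x r) y) ==> x \<in> T"
        by (rule weak_type_maximal[of "indicator (V - P)" "1 / real (Suc n)"]) auto
      note T(2)
      also have "ennreal (5 ^ DIM('a) / (1 / real (Suc n))) * (\<integral>\<^sup>+y. indicator (V - P) y)
          <= ennreal (5 ^ DIM('a) * real (Suc n)) * ennreal ((1/2) ^ k)" using V(3) by (intro mult_mono) auto
      also have "... = ennreal ((5 ^ DIM('a) * real (Suc n)) * (1/2) ^ k)" by (rule ennreal_mult[symmetric]) auto
      finally have "leb T <= ..." .
      moreover have "x \<in> T" if N: "N n x" for x
      proof -
        have "x \<in> V" using that V by (auto simp: N_def)
        then obtain \<delta> where \<delta>: "\<delta> > 0" "cball x \<delta> \<subseteq> V" using V(1) open_contains_cball by metis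
        from \<delta>(1) have "min \<delta> 1 > 0" by simp
        then obtain r where r: "0 < r" "r <= min \<delta> 1"
            "ennreal (1 / real (Suc n)) * leb (cball x r) < leb (cball x r - P)"
          using conjunct2[OF N[unfolded N_def], rule_format, of "min \<delta> 1"] by metis
        have "cball x r \<subseteq> V" using \<delta> r by auto
        then have "indicator (V - P) y * indicator (cball x r) y = (indicator (cball x r - P) y :: ennreal)" for y
          by (auto simp: indicator_def)
        then show ?thesis using r by (intro T(3)[of r x]) auto
      qed
      ultimately show ?thesis using T(1) by blast
    qed
    then obtain T where "\<And>k. T k \<in> sets borel"
      "\<And>k. leb (T k) <= ennreal ((5 ^ DIM('a) * real (Suc n)) * (1/2) ^ k)"
      "\<And>k x. N n x ==> x \<in> T k" by metis
    then show ?thesis by (intro AE_not_in_of_small_covers[of T lborel "5 ^ DIM('a) * real (Suc n)"]) auto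
  qed
  then have "AE x in lborel. \<forall>n. \<not> N n x" by (simp add: AE_all_countable)
  then show ?thesis
  proof (eventually_elim, intro impI allI)
    fix x and \<e> :: real assume *: "\<forall>n. \<not> N n x" "x \<in> P" "\<e> > 0"
    obtain n where n: "1 / real (Suc n) < \<e>" using \<open>\<e> > 0\<close> nat_approx_posE by blast
    have "\<not> N n x" using * by blast
    then obtain \<delta> where \<delta>: "\<delta> > 0" "\<And>r. 0 < r ==> r <= \<delta> ==> leb (cball x r - P)
        <= ennreal (1 / real (Suc n)) * leb (cball x r)"
      using \<open>x \<in> P\<close> unfolding N_def not_ex not_all de_Morgan_conj not_imp by (metis not_less)
    have "ennreal (1 / real (Suc n)) * leb (cball x r) <= ennreal \<e> * leb (cball x r)" for r
      using n by (intro mult_right_mono ennreal_leI) auto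
    then show "\<exists>\<delta>>0. \<forall>r. 0 < r --> r <= \<delta> --> leb (cball x r - P) <= ennreal \<e> * leb (cball x r)"
      using \<delta> by (meson order_trans)
  qed
qed

section \<open>Translation estimates\<close>

lemma powr_sum_le:
  fixes a :: "nat => real"
  assumes "1 <= p" "\<And>i. 0 <= a i"
  shows "(\<Sum>i<N. a i) powr p <= real N powr (p - 1) * (\<Sum>i<N. a i powr p)"
proof -
  \<comment> \<open>Convexity of the power is applied to the positive terms only; dropping zero
    terms can only decrease their number.\<close>
  define S where "S = {i. i < N \<and> 0 < a i}"
  have S: "finite S" "S \<subseteq> {..<N}" by (auto simp: S_def)
  have zero: "a i = 0" if "i \<in> {..<N} - S" for i using that assms(2)[of i] by (auto simp: S_def)
  have eq: "(\<Sum>i<N. a i) = (\<Sum>i\<in>S. a i)" "(\<Sum>i<N. a i powr p) = (\<Sum>i\<in>S. a i powr p)"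
    using S zero by (auto intro!: sum.mono_neutral_right)
  show ?thesis
  proof (cases "S = {}")
    case True
    then show ?thesis unfolding eq by simp
  next
    case False
    define k where "k = real (card S)"
    have k: "0 < k" "k <= real N" using False S card_mono[of "{..<N}" S] by (auto simp: k_def card_gt_0_iff)
    have "(\<Sum>i\<in>S. (1 / k) *\<^sub>R a i) powr p <= (\<Sum>i\<in>S. (1 / k) * a i powr p)"
      using False S k(1) by (intro convex_on_sum[OF _ _ powr_convex[OF assms(1)]])
        (auto simp: S_def k_def)
    then have "((\<Sum>i\<in>S. a i) / k) powr p <= (\<Sum>i\<in>S. a i powr p) / k" by (simp add: sum_divide_distrib)
    then have "(\<Sum>i\<in>S. a i) powr p <= k powr p * ((\<Sum>i\<in>S. a i powr p) / k)"
      using k assms(2) by (simp add: powr_divide sum_nonneg field_simps)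
    also have "... = k powr (p - 1) * (\<Sum>i\<in>S. a i powr p)" using k by (simp add: powr_diff)
    also have "... <= real N powr (p - 1) * (\<Sum>i\<in>S. a i powr p)"
      using k assms by (intro mult_right_mono powr_mono2 sum_nonneg) auto
    finally show ?thesis unfolding eq .
  qed
qed

lemma dist_chain_le:
  fixes d :: "'a::real_vector => 'a => real"
  assumes "\<And>x. d x x = 0" "\<And>x y z. d x z <= d x y + d y z"
  shows "d x (x + real N *\<^sub>R u) <= (\<Sum>i<N. d (x + real i *\<^sub>R u) (x + real (Suc i) *\<^sub>R u))"
proof (induction N)
  case (Suc N)
  have "d x (x + real (Suc N) *\<^sub>R u) <= d x (x + real N *\<^sub>R u) + d (x + real N *\<^sub>R u) (x + real (Suc N) *\<^sub>R u)"
    by (rule assms)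
  then show ?case using Suc by simp
qed (simp add: assms)

text \<open>The factor \<open>N powr p\<close> consists of \<open>N powr (p - 1)\<close> from the
  power mean inequality and \<open>N\<close> from the translated copies of one integral. A bound
  proportional to \<open>norm v powr p\<close> for short increments thus extends to long ones with
  the same constant. Convexity of \<open>B\<close> keeps the intermediate points inside.\<close>

lemma translation_subdivide:
  fixes d :: "'a::euclidean_space => 'a => real"
  assumes [measurable]: "case_prod d \<in> borel_measurable (borel \<Otimes>\<^sub>M borel)"
    and d: "\<And>x. d x x = 0" "\<And>x y. 0 <= d x y" "\<And>x y z. d x z <= d x y + d y z"
    and p: "1 <= p" and B: "convex B" and [measurable]: "B \<in> sets borel" and N: "N \<ge> 1"
  shows "(\<integral>\<^sup>+x. ennreal (d x (x + real N *\<^sub>R u) powr p) * indicator {x. x \<in> B \<and> x + real N *\<^sub>R u \<in> B} x)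
    <= ennreal (real N powr p) * (\<integral>\<^sup>+x. ennreal (d x (x + u) powr p) * indicator {x. x \<in> B \<and> x + u \<in> B} x)"
proof -
  let ?F = "\<lambda>x. ennreal (d x (x + u) powr p) * indicator {x. x \<in> B \<and> x + u \<in> B} x"
  have [measurable]: "?F \<in> borel_measurable borel" by measurable
  have "ennreal (d x (x + real N *\<^sub>R u) powr p) * indicator {x. x \<in> B \<and> x + real N *\<^sub>R u \<in> B} x
      <= ennreal (real N powr (p - 1)) * (\<Sum>i<N. ?F (x + real i *\<^sub>R u))" for x
  proof (cases "x \<in> B \<and> x + real N *\<^sub>R u \<in> B")
    case True
    have mem: "x + real i *\<^sub>R u \<in> B" if "i <= N" for i
    proof -
      have "(1 - real i / real N) *\<^sub>R x + (real i / real N) *\<^sub>R (x + real N *\<^sub>R u) \<in> B"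
        using True that N by (intro convexD[OF B]) (auto simp: field_simps)
      also have "(1 - real i / real N) *\<^sub>R x + (real i / real N) *\<^sub>R (x + real N *\<^sub>R u) = x + real i *\<^sub>R u"
        using N by (simp add: algebra_simps)
      finally show ?thesis .
    qed
    let ?a = "\<lambda>i. d (x + real i *\<^sub>R u) (x + real (Suc i) *\<^sub>R u)"
    have "d x (x + real N *\<^sub>R u) powr p <= (\<Sum>i<N. ?a i) powr p" using p d by (intro powr_mono2 dist_chain_le) auto
    also have "... <= real N powr (p - 1) * (\<Sum>i<N. ?a i powr p)" using p d by (intro powr_sum_le) auto
    finally have "ennreal (d x (x + real N *\<^sub>R u) powr p)
        <= ennreal (real N powr (p - 1)) * (\<Sum>i<N. ennreal (?a i powr p))"
      by (simp add: ennreal_mult[symmetric] sum_ennreal sum_nonneg ennreal_leI)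
    also have "(\<Sum>i<N. ennreal (?a i powr p)) = (\<Sum>i<N. ?F (x + real i *\<^sub>R u))"
    proof (rule sum.cong[OF refl])
      fix i assume "i \<in> {..<N}"
      then show "ennreal (?a i powr p) = ?F (x + real i *\<^sub>R u)"
        using mem[of i] mem[of "Suc i"] by (simp add: algebra_simps)
    qed
    finally show ?thesis using True by simp
  qed simp
  then have "(\<integral>\<^sup>+x. ennreal (d x (x + real N *\<^sub>R u) powr p) * indicator {x. x \<in> B \<and> x + real N *\<^sub>R u \<in> B} x)
     <= (\<integral>\<^sup>+x. ennreal (real N powr (p - 1)) * (\<Sum>i<N. ?F (x + real i *\<^sub>R u)))" by (intro nn_integral_mono) auto
  also have "... = ennreal (real N powr (p - 1)) * (\<Sum>i<N. \<integral>\<^sup>+x. ?F (x + real i *\<^sub>R u) \<partial>lborel)"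
    by (subst nn_integral_cmult, measurable) (subst nn_integral_sum, auto)
  also have "(\<Sum>i<N. \<integral>\<^sup>+x. ?F (x + real i *\<^sub>R u) \<partial>lborel) = (\<Sum>i<N. \<integral>\<^sup>+x. ?F x \<partial>lborel)"
    by (intro sum.cong refl nn_integral_translate) simp
  also have "ennreal (real N powr (p - 1)) * ... = ennreal (real N powr p) * (\<integral>\<^sup>+x. ?F x)"
  proof -
    have "real N powr (p - 1) * real N = real N powr p" using N by (simp add: powr_diff)
    then show ?thesis by (simp add: ennreal_of_nat_eq_real_of_nat mult.assoc[symmetric] ennreal_mult[symmetric])
  qed
  finally show ?thesis .
qed

section \<open>Maps with small difference quotients in the mean\<close>

lemma indicator_cball_measurable [measurable (raw)]:
  fixes f g :: "'c => 'a::euclidean_space"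
  assumes [measurable]: "f \<in> borel_measurable M" "g \<in> borel_measurable M"
  shows "(\<lambda>z. indicator (cball (f z) r) (g z) :: ennreal) \<in> borel_measurable M"
proof -
  have "(\<lambda>z. indicator (cball (f z) r) (g z) :: ennreal) = (\<lambda>z. if dist (f z) (g z) <= r then 1 else 0)"
    by (auto simp: indicator_def)
  also have "... \<in> borel_measurable M" by measurable
  finally show ?thesis .
qed

context
  fixes e :: "'a::euclidean_space => 'b::{real_normed_vector, second_countable_topology}"
  assumes e[measurable]: "e \<in> borel_measurable borel"
begin

text \<open>A pair of points in the ball is \<open>y\<close> and \<open>y + r *\<^sub>R s\<close>
  with \<open>norm s \<le> 2\<close>, and this increment is divided into \<open>N\<close> steps of
  size \<open>h\<close>. So the oscillation on a coarse ball is governed by difference quotients at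
  one fine step, and a single application of the weak type estimate serves all coarser
  radii.\<close>

lemma pair_oscillation_le:
  assumes r: "r = real N * h" and "N \<ge> 1" "h > 0"
  shows "(\<integral>\<^sup>+y. (\<integral>\<^sup>+z. enorm (e z - e y) * indicator (cball x r) z)
       * indicator (cball x r) y)
    <= ennreal (r ^ DIM('a) * real N) * (\<integral>\<^sup>+y. (\<integral>\<^sup>+s. enorm (e (y + h *\<^sub>R s) - e y)
       * indicator (cball 0 2) s) * indicator (cball x r) y)"
proof -
  have "r > 0" using assms by auto
  let ?B = "cball x r" and ?m = "ennreal (r ^ DIM('a))"
  let ?d = "\<lambda>y z. norm (e z - e y)"
  have "(\<integral>\<^sup>+y. (\<integral>\<^sup>+z. ennreal (?d y z) * indicator ?B z) * indicator ?B y)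
     <= (\<integral>\<^sup>+y. (\<integral>\<^sup>+s. ?m * (ennreal (?d y (y + r *\<^sub>R s)) * indicator ?B (y + r *\<^sub>R s) * indicator (cball 0 2) s
          * indicator ?B y)))"
  proof (rule nn_integral_mono, goal_cases)
    case (1 y)
    show ?case
    proof (cases "y \<in> ?B")
      case True
      have "s \<in> cball 0 2" if "y + r *\<^sub>R s \<in> ?B" for s
      proof -
        have "norm (r *\<^sub>R s) <= dist x (y + r *\<^sub>R s) + dist x y"
          by (metis add_diff_cancel_left' dist_commute dist_norm dist_triangle)
        also have "... <= r * 2" using that True by simp
        finally show ?thesis using \<open>r > 0\<close> by simp
      qed
      then have "ennreal (?d y (y + r *\<^sub>R s)) * indicator ?B (y + r *\<^sub>R s)
          = ennreal (?d y (y + r *\<^sub>R s)) * indicator ?B (y + r *\<^sub>R s) * indicator (cball 0 2) s" for s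
        by (auto simp: indicator_def)
      then show ?thesis using True
        by (subst nn_integral_rescale[OF _ \<open>r > 0\<close>, where a=y]) (simp_all add: nn_integral_cmult)
    qed simp
  qed
  also have "... = (\<integral>\<^sup>+s. (\<integral>\<^sup>+y. ?m * (ennreal (?d y (y + r *\<^sub>R s)) * indicator ?B (y + r *\<^sub>R s) * indicator (cball 0 2) s
          * indicator ?B y)))" by (rule lborel_pair.Fubini') measurable
  also have "... <= (\<integral>\<^sup>+s. (\<integral>\<^sup>+y. ennreal (r ^ DIM('a) * real N) * (ennreal (?d y (y + h *\<^sub>R s)) * indicator (cball 0 2) s
          * indicator ?B y)))"
  proof (rule nn_integral_mono)
    fix s :: 'a
    let ?u = "h *\<^sub>R s"
    have "(\<integral>\<^sup>+y. ?m * (ennreal (?d y (y + r *\<^sub>R s)) * indicator ?B (y + r *\<^sub>R s) * indicator (cball 0 2) s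
          * indicator ?B y))
        = (\<integral>\<^sup>+y. (?m * indicator (cball 0 2) s) * (ennreal (?d y (y + real N *\<^sub>R ?u) powr 1)
          * indicator {y. y \<in> ?B \<and> y + real N *\<^sub>R ?u \<in> ?B} y))"
      unfolding r by (intro nn_integral_cong) (auto simp: indicator_def mult_ac)
    also have "... = (?m * indicator (cball 0 2) s) * (\<integral>\<^sup>+y. (ennreal (?d y (y + real N *\<^sub>R ?u) powr 1)
          * indicator {y. y \<in> ?B \<and> y + real N *\<^sub>R ?u \<in> ?B} y))" by (rule nn_integral_cmult) measurable
    also have "... <= (?m * indicator (cball 0 2) s) * (ennreal (real N powr 1) *
         (\<integral>\<^sup>+y. (ennreal (?d y (y + ?u) powr 1) * indicator {y. y \<in> ?B \<and> y + ?u \<in> ?B} y)))"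
    proof (intro mult_left_mono translation_subdivide)
      fix x y z
      show "?d x z <= ?d x y + ?d y z" by (metis norm_triangle_ineq add.commute diff_add_cancel diff_add_eq)
    qed (use \<open>N \<ge> 1\<close> in auto)
    also have "... <= (?m * indicator (cball 0 2) s) * (ennreal (real N powr 1) *
         (\<integral>\<^sup>+y. (ennreal (?d y (y + ?u)) * indicator ?B y)))"
      by (intro mult_left_mono nn_integral_mono) (auto simp: indicator_def)
    also have "... = (?m * indicator (cball 0 2) s * ennreal (real N)) *
         (\<integral>\<^sup>+y. (ennreal (?d y (y + ?u)) * indicator ?B y))" by (simp add: mult_ac)
    also have "... = (\<integral>\<^sup>+y. (?m * indicator (cball 0 2) s * ennreal (real N)) *
         (ennreal (?d y (y + ?u)) * indicator ?B y))" by (rule nn_integral_cmult[symmetric]) measurable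
    also have "... = (\<integral>\<^sup>+y. ennreal (r ^ DIM('a) * real N) * (ennreal (?d y (y + ?u)) * indicator (cball 0 2) s
          * indicator ?B y))" using \<open>r > 0\<close> by (intro nn_integral_cong) (simp add: ennreal_mult mult_ac)
    finally show "(\<integral>\<^sup>+y. ?m * (ennreal (?d y (y + r *\<^sub>R s)) * indicator ?B (y + r *\<^sub>R s) * indicator (cball 0 2) s
          * indicator ?B y)) <= ..." .
  qed
  also have "... = (\<integral>\<^sup>+y. (\<integral>\<^sup>+s. ennreal (r ^ DIM('a) * real N) * (ennreal (?d y (y + h *\<^sub>R s)) * indicator (cball 0 2) s
          * indicator ?B y)))" by (rule lborel_pair.Fubini'[symmetric]) measurable
  also have "... = ennreal (r ^ DIM('a) * real N) * (\<integral>\<^sup>+y. (\<integral>\<^sup>+s. ennreal (?d y (y + h *\<^sub>R s))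
       * indicator (cball 0 2) s) * indicator ?B y)" by (simp add: nn_integral_cmult nn_integral_multc)
  finally show ?thesis .
qed

end

context
  fixes e :: "'a::euclidean_space => 'b::{real_normed_vector, second_countable_topology}"
    and \<e> :: real
  assumes e[measurable]: "e \<in> borel_measurable borel"
    and transl: "\<And>v. (\<integral>\<^sup>+x. enorm (e (x + v) - e x)) <= ennreal (\<e> * norm v)"
    and \<e>: "0 <= \<e>"
begin

private lemma ball_average_integral_le:
  assumes "h \<ge> 0" "\<rho> \<ge> 0"
  shows "(\<integral>\<^sup>+x. (\<integral>\<^sup>+s. enorm (e (x + h *\<^sub>R s) - e x) * indicator (cball 0 \<rho>) s))
    <= ennreal (\<e> * h * \<rho> * (unit_ball_vol DIM('a) * \<rho> ^ DIM('a)))"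
proof -
  have "(\<integral>\<^sup>+x. (\<integral>\<^sup>+s. enorm (e (x + h *\<^sub>R s) - e x) * indicator (cball 0 \<rho>) s))
      = (\<integral>\<^sup>+s. (\<integral>\<^sup>+x. enorm (e (x + h *\<^sub>R s) - e x) * indicator (cball 0 \<rho>) s))"
    by (rule lborel_pair.Fubini'[symmetric]) measurable
  also have "... = (\<integral>\<^sup>+s. (\<integral>\<^sup>+x. enorm (e (x + h *\<^sub>R s) - e x)) * indicator (cball 0 \<rho>) s)"
    by (intro nn_integral_cong nn_integral_multc) measurable
  also have "... <= (\<integral>\<^sup>+s. ennreal (\<e> * h * \<rho>) * indicator (cball (0::'a) \<rho>) s)"
  proof (rule nn_integral_mono)
    fix s :: 'a
    have "(\<integral>\<^sup>+x. enorm (e (x + h *\<^sub>R s) - e x)) <= ennreal (\<e> * h * \<rho>)" if "norm s <= \<rho>"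
    proof -
      have "\<e> * norm (h *\<^sub>R s) <= \<e> * h * \<rho>" using \<open>h \<ge> 0\<close> that \<e> by (simp add: mult.assoc mult_left_mono)
      then show ?thesis using transl[of "h *\<^sub>R s"] by (meson ennreal_leI order_trans)
    qed
    then show "(\<integral>\<^sup>+x. enorm (e (x + h *\<^sub>R s) - e x)) * indicator (cball 0 \<rho>) s
      <= ennreal (\<e> * h * \<rho>) * indicator (cball 0 \<rho>) s" by (auto simp: indicator_def)
  qed
  also have "... = ennreal (\<e> * h * \<rho>) * leb (cball (0::'a) \<rho>)" by (subst nn_integral_cmult) auto
  also have "... = ennreal (\<e> * h * \<rho> * (unit_ball_vol DIM('a) * \<rho> ^ DIM('a)))"
    using assms \<e> by (simp add: emeasure_cball ennreal_mult[symmetric])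
  finally show ?thesis .
qed

text \<open>\<open>pair_osc\<close> compares pairs of points and is therefore controlled by
  \<open>pair_quot\<close> at any finer scale. \<open>ball_osc\<close> compares with the value at
  the centre, which is what is wanted, but it has to be recovered from \<open>pair_osc\<close> by
  summing over scales. Volumes are not divided out; \<open>ball_osc\<close> is written in rescaled
  coordinates.\<close>

private definition "rad n = (1 / 2 :: real) ^ n"
private definition "pair_osc n x = (\<integral>\<^sup>+y. (\<integral>\<^sup>+z. enorm (e z - e y) * indicator (cball x (rad n)) z)
       * indicator (cball x (rad n)) y)"
private definition "ball_osc n x = (\<integral>\<^sup>+s. enorm (e (x + rad n *\<^sub>R s) - e x) * indicator (cball 0 1) s)"
private definition "pair_quot K y = ennreal (1 / rad K) * (\<integral>\<^sup>+s. enorm (e (y + rad K *\<^sub>R s) - e y) * indicator (cball 0 2) s)"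

private lemma rad: "0 < rad n" "rad n <= 1" "rad (Suc n) = rad n / 2" by (auto simp: rad_def power_le_one)

private lemma pair_osc_measurable [measurable]: "pair_osc n \<in> borel_measurable borel"
  unfolding pair_osc_def by measurable
private lemma ball_osc_measurable [measurable]: "ball_osc n \<in> borel_measurable borel"
  unfolding ball_osc_def by measurable
private lemma pair_quot_measurable [measurable]: "pair_quot n \<in> borel_measurable borel"
  unfolding pair_quot_def by measurable

private lemma pair_osc_le_pair_quot:
  assumes "n <= K"
  shows "pair_osc n x <= ennreal (rad n ^ (DIM('a) + 1)) * (\<integral>\<^sup>+y. pair_quot K y * indicator (cball x (rad n)) y)"
proof -
  have r: "rad n = real (2 ^ (K - n)) * rad K"
  proof -
    have "(2::real) ^ K = 2 ^ (K - n) * 2 ^ n" using assms by (simp flip: power_add)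
    then show ?thesis by (simp add: rad_def power_one_over field_simps)
  qed
  have "pair_osc n x <= ennreal (rad n ^ DIM('a) * real (2 ^ (K - n))) * (\<integral>\<^sup>+y. (\<integral>\<^sup>+s. enorm (e (y + rad K *\<^sub>R s) - e y)
       * indicator (cball 0 2) s) * indicator (cball x (rad n)) y)"
    unfolding pair_osc_def by (rule pair_oscillation_le[OF e r]) (auto simp: rad)
  also have "real (2 ^ (K - n)) = rad n / rad K" using r rad(1)[of K] by (simp add: field_simps)
  also have "ennreal (rad n ^ DIM('a) * (rad n / rad K)) = ennreal (rad n ^ (DIM('a) + 1)) * ennreal (1 / rad K)"
    using rad(1)[of n] rad(1)[of K] by (simp add: ennreal_mult[symmetric] mult_ac)
  finally show ?thesis unfolding pair_quot_def by (simp add: mult.assoc nn_integral_cmult)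
qed

private lemma pair_quot_integral: "(\<integral>\<^sup>+y. pair_quot K y) <= ennreal (2 * \<e> * unit_ball_vol DIM('a) * 2 ^ DIM('a))"
proof -
  have "(\<integral>\<^sup>+y. pair_quot K y)
      = ennreal (1 / rad K) * (\<integral>\<^sup>+y. (\<integral>\<^sup>+s. enorm (e (y + rad K *\<^sub>R s) - e y) * indicator (cball 0 2) s))"
    unfolding pair_quot_def by (rule nn_integral_cmult) measurable
  also have "... <= ennreal (1 / rad K) * ennreal (\<e> * rad K * 2 * (unit_ball_vol DIM('a) * 2 ^ DIM('a)))"
    using rad(1)[of K] by (intro mult_left_mono ball_average_integral_le) auto
  also have "... = ennreal (2 * \<e> * unit_ball_vol DIM('a) * 2 ^ DIM('a))"
    using rad(1)[of K] \<e> by (simp add: ennreal_mult[symmetric] mult_ac)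
  finally show ?thesis .
qed

text \<open>Takes the place of Lebesgue's differentiation theorem: the integral of
  \<open>ball_osc n\<close> is of order \<open>rad n\<close>, so the series over \<open>n\<close>
  has a finite integral and converges almost everywhere.\<close>

private lemma ball_osc_tendsto_0: "AE x in lborel. (\<lambda>n. ball_osc n x) \<longlonglongrightarrow> 0"
proof -
  have "(\<integral>\<^sup>+x. (\<Sum>n. ball_osc n x)) = (\<Sum>n. \<integral>\<^sup>+x. ball_osc n x \<partial>lborel)" by (rule nn_integral_suminf) measurable
  also have "... <= (\<Sum>n. ennreal (\<e> * unit_ball_vol DIM('a) * (1/2) ^ n))"
  proof (rule suminf_le)
    fix n
    show "(\<integral>\<^sup>+x. ball_osc n x) <= ennreal (\<e> * unit_ball_vol DIM('a) * (1/2) ^ n)"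
      unfolding ball_osc_def using ball_average_integral_le[of "rad n" 1] rad(1)[of n] by (simp add: rad_def mult_ac)
  qed auto
  also have "... < \<infinity>" using \<e> by (subst suminf_ennreal2) (auto intro!: summable_mult summable_geometric)
  finally have "AE x in lborel. (\<Sum>n. ball_osc n x) \<noteq> \<infinity>" by (intro nn_integral_PInf_AE) auto
  then show ?thesis
  proof eventually_elim
    case (elim x)
    have fin: "ball_osc n x < top" for n
      using elim ennreal_suminf_lessD[of "\<lambda>n. ball_osc n x" top n] by (simp add: less_top)
    then have eq: "ennreal (enn2real (ball_osc n x)) = ball_osc n x" for n by simp
    have "summable (\<lambda>n. enn2real (ball_osc n x))" using elim by (intro summable_suminf_not_top) (auto simp: eq)
    then have "(\<lambda>n. ennreal (enn2real (ball_osc n x))) \<longlonglongrightarrow> ennreal 0" by (intro tendsto_ennrealI summable_LIMSEQ_zero)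
    then show ?case by (simp add: eq)
  qed
qed

text \<open>Average the triangle inequality through \<open>z\<close> over \<open>y\<close> in the
  ball of radius \<open>rad n\<close> and \<open>z\<close> in the ball of half that radius. The
  factor \<open>2 ^ DIM('a)\<close> is the ratio of the volumes.\<close>

private lemma ball_osc_step:
  assumes "0 <= t" "pair_osc n x <= ennreal (t * unit_ball_vol DIM('a) * rad n ^ (2 * DIM('a) + 1))"
  shows "ball_osc n x <= ennreal (2 ^ DIM('a) * t * rad n) + ball_osc (Suc n) x"
proof -
  define m where "m = DIM('a)"
  define w where "w = unit_ball_vol m"
  define r where "r = rad n"
  have r: "0 < r" "rad (Suc n) = r / 2" using rad by (auto simp: r_def)
  have w: "0 < w" by (simp add: w_def)
  let ?B = "cball x r" and ?B' = "cball x (r / 2)"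
  have vol: "leb (cball x \<rho>) = ennreal (w * \<rho> ^ m)" if "0 <= \<rho>" for \<rho>
    using that by (simp add: emeasure_cball w_def m_def)
  have a: "(\<integral>\<^sup>+y. enorm (e y - e x) * indicator (cball x (rad k)) y)
      = ennreal (rad k ^ m) * ball_osc k x" for k
    using nn_integral_cball_rescale[of "\<lambda>y. enorm (e y - e x)" "rad k" x 1] rad(1)[of k]
    by (simp add: ball_osc_def m_def)
  have "ennreal (w * (r / 2) ^ m) * (ennreal (r ^ m) * ball_osc n x)
      = (\<integral>\<^sup>+y. (\<integral>\<^sup>+z. enorm (e y - e x) * indicator ?B' z) * indicator ?B y)"
  proof -
    have "(\<integral>\<^sup>+y. (\<integral>\<^sup>+z. enorm (e y - e x) * indicator ?B' z) * indicator ?B y)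
        = (\<integral>\<^sup>+y. ennreal (w * (r / 2) ^ m) * (enorm (e y - e x) * indicator ?B y))"
      using r vol[of "r / 2"] by (intro nn_integral_cong) (simp add: nn_integral_cmult mult_ac)
    also have "... = ennreal (w * (r / 2) ^ m) * (ennreal (r ^ m) * ball_osc n x)"
      using a[of n] by (simp add: nn_integral_cmult r_def)
    finally show ?thesis ..
  qed
  also have "... <= (\<integral>\<^sup>+y. ((\<integral>\<^sup>+z. enorm (e z - e y) * indicator ?B z)
      + (\<integral>\<^sup>+z. enorm (e z - e x) * indicator ?B' z)) * indicator ?B y)"
  proof (intro nn_integral_mono mult_right_mono)
    fix y
    have "(\<integral>\<^sup>+z. enorm (e y - e x) * indicator ?B' z)
        <= (\<integral>\<^sup>+z. enorm (e z - e y) * indicator ?B z + enorm (e z - e x) * indicator ?B' z)"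
    proof (rule nn_integral_mono, goal_cases)
      case (1 z)
      have "norm (e y - e x) <= norm (e z - e y) + norm (e z - e x)"
        by (metis norm_minus_commute norm_triangle_sub add_diff_eq diff_add_eq norm_triangle_ineq4 diff_diff_eq2 diff_add_cancel)
      then show ?case
        using r by (auto simp: indicator_def ennreal_plus[symmetric] simp del: ennreal_plus intro!: ennreal_leI)
    qed
    also have "... = (\<integral>\<^sup>+z. enorm (e z - e y) * indicator ?B z)
        + (\<integral>\<^sup>+z. enorm (e z - e x) * indicator ?B' z)" by (rule nn_integral_add) measurable
    finally show "(\<integral>\<^sup>+z. enorm (e y - e x) * indicator ?B' z) <= ..." .
  qed auto
  also have "... = pair_osc n x + (\<integral>\<^sup>+z. enorm (e z - e x) * indicator ?B' z) * leb ?B"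
    unfolding pair_osc_def r_def[symmetric] distrib_right by (subst nn_integral_add) (auto simp: nn_integral_cmult)
  also have "... = pair_osc n x + (ennreal ((r / 2) ^ m) * ball_osc (Suc n) x) * ennreal (w * r ^ m)"
    using a[of "Suc n"] vol[of r] r by simp
  also have "... <= ennreal (t * w * r ^ (2 * m + 1)) + (ennreal ((r / 2) ^ m) * ball_osc (Suc n) x) * ennreal (w * r ^ m)"
    using assms by (intro add_right_mono) (simp add: w_def m_def r_def)
  also have "... = ennreal (w * (r / 2) ^ m * r ^ m) * (ennreal (2 ^ m * t * r) + ball_osc (Suc n) x)"
  proof -
    have 1: "ennreal (t * w * r ^ (2 * m + 1)) = ennreal (w * (r / 2) ^ m * r ^ m) * ennreal (2 ^ m * t * r)"
    proof -
      have "t * w * r ^ (2 * m + 1) = (w * (r / 2) ^ m * r ^ m) * (2 ^ m * t * r)"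
        by (simp add: power_divide mult_2 power_add)
      then show ?thesis using w r assms(1) by (subst ennreal_mult[symmetric]) auto
    qed
    have 2: "ennreal (w * (r / 2) ^ m * r ^ m) = ennreal ((r / 2) ^ m) * ennreal (w * r ^ m)"
      using w r by (simp add: ennreal_mult[symmetric] mult_ac)
    show ?thesis unfolding 1 distrib_left unfolding 2 by (simp add: mult_ac)
  qed
  also have "ennreal (w * (r / 2) ^ m) * (ennreal (r ^ m) * ball_osc n x) = ennreal (w * (r / 2) ^ m * r ^ m) * ball_osc n x"
    using w r by (simp add: ennreal_mult mult_ac)
  finally show ?thesis using w r by (subst (asm) ennreal_mult_le_mult_iff) (auto simp: m_def r_def)
qed

text \<open>\<open>e\<close> will be a map minus its mollification, with a small constant
  \<open>\<e>\<close>. The points to be excluded have a large \<open>pair_osc\<close> at some scale;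
  at the others the oscillations about the centre telescope over the dyadic scales, and the last
  term vanishes in the limit.\<close>

lemma oscillation_weak_type:
  assumes "0 < \<eta>"
  obtains A where "A \<in> sets borel"
    "leb A <= ennreal (8 * 40 ^ DIM('a) * unit_ball_vol DIM('a) * \<e> / \<eta>)"
    "AE x in lborel. x \<notin> A --> (\<forall>r. 0 < r --> r <= 1 -->
      (\<integral>\<^sup>+y. enorm (e y - e x) * indicator (cball x r) y) <= ennreal (\<eta> * r ^ (DIM('a) + 1)))"
proof -
  define m where "m = DIM('a)"
  define w where "w = unit_ball_vol m"
  have w: "0 < w" by (simp add: w_def)
  \<comment> \<open>\<open>4 ^ (m + 1)\<close> collects \<open>2 ^ m\<close> from
    \<open>ball_osc_step\<close>, 2 from the geometric series of the radii, and
    \<open>2 ^ (m + 1)\<close> from replacing \<open>r\<close> by a dyadic radius below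
    \<open>2 * r\<close>.\<close>
  define t where "t = \<eta> / 4 ^ (m + 1)"
  have t: "0 < t" using assms by (simp add: t_def)
  \<comment> \<open>\<open>pair_quot K\<close> controls just the scales \<open>n \<le> K\<close>, so
    these are treated first; the bound does not depend on \<open>K\<close> and survives the
    increasing union.\<close>
  define A where "A K = {x. \<exists>n\<le>K. ennreal (t * w * rad n ^ (2 * m + 1)) < pair_osc n x}" for K
  have [measurable]: "A K \<in> sets borel" for K unfolding A_def by measurable
  have A_le: "leb (A K) <= ennreal (8 * 40 ^ m * w * \<e> / \<eta>)" for K
  proof -
    obtain T where T: "T \<in> sets borel" 
      "leb T <= ennreal (5 ^ m / t) * (\<integral>\<^sup>+y. pair_quot K y)"
      "\<And>x r. 0 < r ==> r <= 1 ==>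
        ennreal t * leb (cball x r) < (\<integral>\<^sup>+y. pair_quot K y * indicator (cball x r) y) ==> x \<in> T"
      using weak_type_maximal[OF pair_quot_measurable t, of K] unfolding m_def by blast
    have "A K \<subseteq> T"
    proof
      fix x assume "x \<in> A K"
      then obtain n where n: "n <= K" "ennreal (t * w * rad n ^ (2 * m + 1)) < pair_osc n x" by (auto simp: A_def)
      note n(2)
      also have "pair_osc n x <= ennreal (rad n ^ (m + 1)) * (\<integral>\<^sup>+y. pair_quot K y * indicator (cball x (rad n)) y)"
        unfolding m_def by (rule pair_osc_le_pair_quot[OF n(1)])
      also have "ennreal (t * w * rad n ^ (2 * m + 1)) = ennreal (rad n ^ (m + 1)) * (ennreal t * leb (cball x (rad n)))"
        proof -
          have "t * w * rad n ^ (2 * m + 1) = rad n ^ (m + 1) * (t * (w * rad n ^ m))" by (simp add: power_add mult_2)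
          moreover have "leb (cball x (rad n)) = ennreal (w * rad n ^ m)"
            using rad(1)[of n] by (simp add: emeasure_cball w_def m_def)
          ultimately show ?thesis using t w rad(1)[of n] by (simp add: ennreal_mult[symmetric])
        qed
      finally have "ennreal t * leb (cball x (rad n)) < (\<integral>\<^sup>+y. pair_quot K y * indicator (cball x (rad n)) y)"
        by (meson leD leI mult_left_mono zero_le)
      then show "x \<in> T" using rad by (intro T(3)[of "rad n" x]) auto
    qed
    then have "leb (A K) <= leb T" using T(1) by (intro emeasure_mono) auto
    also note T(2)
    also have "ennreal (5 ^ m / t) * (\<integral>\<^sup>+y. pair_quot K y) <= ennreal (5 ^ m / t) * ennreal (2 * \<e> * w * 2 ^ m)"
      using pair_quot_integral[of K] by (intro mult_left_mono) (auto simp: w_def m_def)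
    also have "... = ennreal (8 * 40 ^ m * w * \<e> / \<eta>)"
    proof -
      have "(40::real) ^ m = 5 ^ m * (2 ^ m * 4 ^ m)" by (simp flip: power_mult_distrib)
      then show ?thesis using \<e> w t by (subst ennreal_mult[symmetric]) (auto simp: t_def field_simps)
    qed
    finally show ?thesis .
  qed
  have "incseq A" unfolding A_def incseq_def by (auto intro: order_trans)
  then have "(\<lambda>K. leb (A K)) \<longlonglongrightarrow> leb (\<Union>K. A K)" by (intro Lim_emeasure_incseq) auto
  then have A: "leb (\<Union>K. A K) <= ennreal (8 * 40 ^ m * w * \<e> / \<eta>)" by (rule LIMSEQ_le_const2) (use A_le in auto)
  have "AE x in lborel. x \<notin> (\<Union>K. A K) --> (\<forall>r. 0 < r --> r <= 1 -->
      (\<integral>\<^sup>+y. enorm (e y - e x) * indicator (cball x r) y) <= ennreal (\<eta> * r ^ (m + 1)))" using ball_osc_tendsto_0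
  proof (eventually_elim, intro impI allI)
    fix x and r :: real
    assume lim: "(\<lambda>n. ball_osc n x) \<longlonglongrightarrow> 0" and x: "x \<notin> (\<Union>K. A K)" and r: "0 < r" "r <= 1"
    have "pair_osc n x <= ennreal (t * w * rad n ^ (2 * m + 1))" for n
    proof -
      have "x \<notin> A n" using x by blast
      then show ?thesis unfolding A_def by (auto simp: not_less)
    qed
    then have step: "ball_osc n x <= ennreal (2 ^ m * t * rad n) + ball_osc (Suc n) x" for n
      using ball_osc_step[of t n x] t by (simp add: w_def m_def)
    have sum: "ball_osc n x <= ennreal (2 ^ m * t * (2 * rad n - 2 * rad (n + k))) + ball_osc (n + k) x" for n k
    proof (induction k)
      case (Suc k)
      have le: "rad (n + k) <= rad n" by (simp add: rad_def power_decreasing)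
      note Suc
      also have "ball_osc (n + k) x <= ennreal (2 ^ m * t * rad (n + k)) + ball_osc (n + Suc k) x"
        using step[of "n + k"] by simp
      also have "ennreal (2 ^ m * t * (2 * rad n - 2 * rad (n + k))) + (ennreal (2 ^ m * t * rad (n + k)) + ball_osc (n + Suc k) x)
          = ennreal (2 ^ m * t * (2 * rad n - 2 * rad (n + k)) + 2 ^ m * t * rad (n + k)) + ball_osc (n + Suc k) x"
        using t le rad(1)[of "n + k"] by (subst ennreal_plus) (auto simp: add.assoc)
      also have "2 ^ m * t * (2 * rad n - 2 * rad (n + k)) + 2 ^ m * t * rad (n + k) = 2 ^ m * t * (2 * rad n - 2 * rad (n + Suc k))"
        using rad(3)[of "n + k"] by (simp add: algebra_simps)
      finally show ?case by (simp add: add_left_mono)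
    qed simp
    have b: "ball_osc n x <= ennreal (2 ^ m * t * (2 * rad n))" for n
    proof -
      have "ball_osc n x <= ennreal (2 ^ m * t * (2 * rad n)) + ball_osc (n + k) x" for k
        using sum[of n k] t rad(1)[of "n + k"]
        by (auto intro!: order_trans[OF sum[of n k]] add_right_mono ennreal_leI mult_left_mono)
      moreover have "(\<lambda>k. ennreal (2 ^ m * t * (2 * rad n)) + ball_osc (n + k) x) \<longlonglongrightarrow> ennreal (2 ^ m * t * (2 * rad n)) + 0"
        using LIMSEQ_ignore_initial_segment[OF lim, of n] by (intro tendsto_add tendsto_const) (simp add: add.commute)
      ultimately have "ball_osc n x <= ennreal (2 ^ m * t * (2 * rad n)) + 0" by (intro LIMSEQ_le_const) auto
      then show ?thesis by simp
    qed
    obtain n where n: "rad (Suc n) < r" "r <= rad n"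
    proof -
      have "\<exists>n. rad n < r" using r real_arch_pow_inv[of r "1/2"] by (auto simp: rad_def)
      then have *: "rad (LEAST n. rad n < r) < r" by (rule LeastI_ex)
      then obtain k where k: "(LEAST n. rad n < r) = Suc k" using r by (cases "LEAST n. rad n < r") (auto simp: rad_def)
      then have "\<not> rad k < r" using not_less_Least[of k "\<lambda>n. rad n < r"] by simp
      then show ?thesis using that[of k] * k by simp
    qed
    have "(\<integral>\<^sup>+y. enorm (e y - e x) * indicator (cball x r) y)
       <= (\<integral>\<^sup>+y. enorm (e y - e x) * indicator (cball x (rad n * 1)) y)"
      using n by (intro nn_integral_mono) (auto simp: indicator_def)
    also have "... = ennreal (rad n ^ m) * ball_osc n x"
      unfolding m_def ball_osc_def by (rule nn_integral_cball_rescale) (auto simp: rad)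
    also have "... <= ennreal (rad n ^ m) * ennreal (2 ^ m * t * (2 * rad n))" by (intro mult_left_mono b) auto
    also have "... = ennreal (2 ^ m * t * 2 * rad n ^ (m + 1))"
      using t rad(1)[of n] by (simp add: ennreal_mult[symmetric] mult_ac)
    also have "... <= ennreal (2 ^ m * t * 2 * (2 * r) ^ (m + 1))"
      using n t rad(1)[of n] rad(3)[of n] by (intro ennreal_leI mult_left_mono power_mono) auto
    also have "2 ^ m * t * 2 * (2 * r) ^ (m + 1) = \<eta> * r ^ (m + 1)"
    proof -
      have "(4::real) ^ m = 2 ^ m * 2 ^ m" by (simp flip: power_mult_distrib)
      then show ?thesis by (simp add: t_def power_mult_distrib)
    qed
    finally show "(\<integral>\<^sup>+y. enorm (e y - e x) * indicator (cball x r) y) <= ennreal (\<eta> * r ^ (m + 1))" .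
  qed
  then show ?thesis using that[of "\<Union>K. A K"] A by (simp add: m_def w_def)
qed

end

section \<open>Equicontinuity of difference quotients by convexity\<close>

text \<open>This is \<open>sqrt (1 + (norm a)\<^sup>2) - 1\<close>, written as a norm so that
  convexity and the Lipschitz bound are the triangle inequality. It is strictly convex, as distinct
  vectors \<open>(1, a)\<close> are never parallel, yet grows only linearly, so that L1 bounds
  control its integrals.\<close>

definition psi :: "'b::real_inner => real" where
  "psi a = norm (1::real, a) - 1"

definition psi_gap :: "'b::real_inner => 'b => real" where
  "psi_gap a b = (psi a + psi b) / 2 - psi ((a + b) /\<^sub>R 2)"

lemma psi_measurable [measurable]:
  "psi \<in> borel_measurable (borel :: 'b::{real_inner, second_countable_topology} measure)"
  unfolding psi_def by measurable

lemma psi_nonneg: "0 <= psi a" using norm_ge_zero[of a] by (simp add: psi_def norm_Pair real_le_rsqrt)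

lemma psi_lipschitz: "psi a <= psi b + norm (a - b)"
  using norm_triangle_sub[of "(1::real, a)" "(1, b)"] by (simp add: psi_def norm_Pair)

lemma psi_0 [simp]: "psi 0 = 0" by (simp add: psi_def norm_Pair)

lemma psi_le_norm: "psi a <= norm a" using psi_lipschitz[of a 0] by simp

lemma psi_convex: "convex_on UNIV (psi :: 'b::real_inner => real)"
proof (intro convex_onI)
  fix t :: real and x y :: 'b
  assume t: "0 < t" "t < 1"
  have "(1::real, (1 - t) *\<^sub>R x + t *\<^sub>R y) = (1 - t) *\<^sub>R (1, x) + t *\<^sub>R (1, y)" by simp
  then have "norm (1::real, (1 - t) *\<^sub>R x + t *\<^sub>R y) <= (1 - t) * norm (1::real, x) + t * norm (1::real, y)"
    using norm_triangle_ineq[of "(1 - t) *\<^sub>R (1::real, x)" "t *\<^sub>R (1, y)"] t by (simp del: scaleR_Pair)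
  then show "psi ((1 - t) *\<^sub>R x + t *\<^sub>R y) <= (1 - t) * psi x + t * psi y" by (simp add: psi_def algebra_simps)
qed simp

lemma psi_average_le:
  assumes "N \<ge> 1"
  shows "psi ((\<Sum>i<N. a i) /\<^sub>R real N) <= (\<Sum>i<N. psi (a i)) / real N"
proof -
  have "psi (\<Sum>i<N. (1 / real N) *\<^sub>R a i) <= (\<Sum>i<N. (1 / real N) * psi (a i))"
    using assms by (intro convex_on_sum[OF _ _ psi_convex]) (auto simp: lessThan_empty_iff)
  then show ?thesis by (simp add: scaleR_sum_right inverse_eq_divide sum_divide_distrib)
qed

lemma psi_gap_nonneg: "0 <= psi_gap a b"
  using convex_onD[OF psi_convex, of "1/2" a b] by (simp add: psi_gap_def scaleR_add_right field_simps)

text \<open>The Gram determinant of \<open>(1, a)\<close> and \<open>(1, b)\<close> is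
  \<open>(norm (a - b))\<^sup>2\<close> plus the Gram determinant of \<open>a\<close> and
  \<open>b\<close>. It factors, and one factor contains the deficit in the triangle inequality for
  the two vectors, which is twice the gap. The weight \<open>R ^ 3\<close> reflects that
  \<open>psi\<close> looks like a cone far out.\<close>

lemma psi_gap_lower_bound:
  assumes "psi a + 1 <= R" "psi b + 1 <= R"
  shows "(norm (a - b))\<^sup>2 <= 8 * R ^ 3 * psi_gap a b"
proof -
  define A where "A = (1::real, a)"
  define B where "B = (1::real, b)"
  have R: "1 <= norm A" "1 <= norm B" "norm A <= R" "norm B <= R"
    using assms psi_nonneg[of a] psi_nonneg[of b] by (auto simp: psi_def A_def B_def)
  have gap: "2 * psi_gap a b = norm A + norm B - norm (A + B)"
  proof -
    have "(1::real, (a + b) /\<^sub>R 2) = (A + B) /\<^sub>R 2" by (simp add: A_def B_def)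
    then have "norm (1::real, (a + b) /\<^sub>R 2) = norm (A + B) / 2" by simp
    then show ?thesis unfolding psi_gap_def psi_def by (simp add: A_def B_def field_simps)
  qed
  have nA: "(norm A)\<^sup>2 = 1 + (norm a)\<^sup>2" and nB: "(norm B)\<^sup>2 = 1 + (norm b)\<^sup>2"
    and AB: "inner A B = 1 + inner a b" by (simp_all add: A_def B_def norm_Pair inner_Pair)
  have "(norm (a - b))\<^sup>2 = (norm a)\<^sup>2 + (norm b)\<^sup>2 - 2 * inner a b"
    by (simp add: power2_norm_eq_inner inner_diff inner_commute)
  also have "... <= (norm a)\<^sup>2 + (norm b)\<^sup>2 - 2 * inner a b + ((norm a * norm b)\<^sup>2 - (inner a b)\<^sup>2)"
    using Cauchy_Schwarz_ineq2[of a b] by (simp add: abs_le_square_iff[symmetric])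
  also have "... = (norm A)\<^sup>2 * (norm B)\<^sup>2 - (inner A B)\<^sup>2"
    unfolding nA nB AB by (simp add: power2_eq_square algebra_simps)
  also have "... = (norm A * norm B - inner A B) * (norm A * norm B + inner A B)"
    by (simp add: power2_eq_square algebra_simps)
  also have "... <= (norm A * norm B - inner A B) * (2 * R\<^sup>2)"
  proof (rule mult_left_mono)
    have "norm A * norm B <= R * R" using R by (intro mult_mono) auto
    then show "norm A * norm B + inner A B <= 2 * R\<^sup>2" using norm_cauchy_schwarz[of A B] by (simp add: power2_eq_square)
  qed (use norm_cauchy_schwarz[of A B] in auto)
  also have "norm A * norm B - inner A B = ((norm A + norm B)\<^sup>2 - (norm (A + B))\<^sup>2) / 2"
  proof -
    have "(norm (A + B))\<^sup>2 = (norm A)\<^sup>2 + (norm B)\<^sup>2 + 2 * inner A B"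
      by (simp add: power2_norm_eq_inner inner_add inner_commute)
    then show ?thesis by (simp add: power2_sum)
  qed
  also have "((norm A + norm B)\<^sup>2 - (norm (A + B))\<^sup>2) / 2 * (2 * R\<^sup>2)
      = (2 * psi_gap a b) * (norm A + norm B + norm (A + B)) * R\<^sup>2"
    unfolding gap by (simp add: power2_eq_square field_simps)
  also have "... <= (2 * psi_gap a b) * (4 * R) * R\<^sup>2" using R norm_triangle_ineq[of A B] psi_gap_nonneg[of a b]
    by (intro mult_right_mono mult_left_mono) auto
  finally show ?thesis by (simp add: power3_eq_cube power2_eq_square mult_ac)
qed

text \<open>The quadratic lower bound for the gap is effective for bounded vectors only; large ones
  are absorbed by the powers, and this is where \<open>1 < p\<close> is essential. In the bounded
  range one may assume \<open>norm (a - b) > \<e>\<close> and divide by \<open>\<e>\<close> to make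
  the bound linear.\<close>

lemma norm_diff_le_psi_gap:
  assumes "1 < p" "0 < \<e>"
  shows "\<exists>K\<ge>0. \<forall>a b :: 'b::real_inner.
    norm (a - b) <= \<e> * (1 + norm a powr p + norm b powr p) + K * psi_gap a b"
proof -
  \<comment> \<open>Beyond the radius \<open>s\<close>, four times the norm is at most
    \<open>\<e>\<close> times its \<open>p\<close>-th power.\<close>
  define s where "s = max 1 ((4 / \<e>) powr (1 / (p - 1)))"
  have s: "1 <= s" by (simp add: s_def)
  have "4 / \<e> = ((4 / \<e>) powr (1 / (p - 1))) powr (p - 1)" using assms by (simp add: powr_powr)
  also have "... <= s powr (p - 1)" using assms by (intro powr_mono2) (auto simp: s_def)
  finally have s2: "4 <= \<e> * s powr (p - 1)" using assms by (simp add: field_simps)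
  define K where "K = 8 * (2 * s) ^ 3 / \<e>"
  have K: "0 <= K" using s assms by (simp add: K_def)
  have large: "norm (a - b) <= \<e> * norm c powr p"
    if c: "psi c + 1 > 2 * s" "psi a <= psi c" "psi b <= psi c" for a b c :: 'b
  proof -
    have nc: "norm c \<ge> s" "psi c + 1 <= 2 * norm c" using c s psi_le_norm[of c] by auto
    have "norm x <= psi x + 1" for x :: 'b unfolding psi_def by (simp add: norm_Pair real_le_rsqrt)
    then have "norm (a - b) <= 4 * norm c" using norm_triangle_ineq4[of a b] c nc by (smt (verit))
    also have "... <= (\<e> * s powr (p - 1)) * norm c" using s2 by (intro mult_right_mono) auto
    also have "... <= (\<e> * norm c powr (p - 1)) * norm c"
      using nc s assms by (intro mult_right_mono mult_left_mono powr_mono2) auto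
    also have "... = \<e> * norm c powr p" using nc s by (simp add: powr_diff)
    finally show ?thesis .
  qed
  have "norm (a - b) <= \<e> * (1 + norm a powr p + norm b powr p) + K * psi_gap a b" for a b :: 'b
  proof -
    have ge: "\<e> * norm a powr p \<ge> 0" "\<e> * norm b powr p \<ge> 0" "K * psi_gap a b \<ge> 0"
      using assms K psi_gap_nonneg[of a b] by auto
    consider "norm (a - b) <= \<e>" | "norm (a - b) > \<e>" "psi a + 1 <= 2 * s" "psi b + 1 <= 2 * s"
      | "psi a + 1 > 2 * s" "psi b <= psi a" | "psi b + 1 > 2 * s" "psi a <= psi b" by linarith
    then show ?thesis
    proof cases
      case 1
      then show ?thesis using ge unfolding distrib_left by linarith
    next
      case 2
      have "norm (a - b) * \<e> <= norm (a - b) * norm (a - b)" using 2 by (intro mult_left_mono) auto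
      also have "... <= 8 * (2 * s) ^ 3 * psi_gap a b"
        using psi_gap_lower_bound[OF 2(2,3)] by (simp add: power2_eq_square)
      finally have "norm (a - b) <= K * psi_gap a b" using assms by (simp add: K_def field_simps)
      then show ?thesis using ge assms unfolding distrib_left by linarith
    next
      case 3
      then have "norm (a - b) <= \<e> * norm a powr p" by (intro large) auto
      then show ?thesis using ge assms unfolding distrib_left by linarith
    next
      case 4
      then have "norm (a - b) <= \<e> * norm b powr p" by (intro large) auto
      then show ?thesis using ge assms unfolding distrib_left by linarith
    qed
  qed
  then show ?thesis using K by blast
qed

text \<open>Cut off entries of tuple valued maps are of this kind, by
  \<open>cutoff_sobolev_map\<close>. \<open>M\<close> enters only qualitatively, as the aim is
  differentiability almost everywhere.\<close>

locale sobolev_map =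
  fixes \<phi> :: "'a::euclidean_space => 'b::{real_inner, second_countable_topology}"
    and R M p :: real
  assumes meas [measurable]: "\<phi> \<in> borel_measurable borel"
    and support: "\<And>x. R < norm x ==> \<phi> x = 0"
    and transl: "\<And>v. (\<integral>\<^sup>+x. ennreal (norm (\<phi> (x + v) - \<phi> x) powr p)) <= ennreal (M * norm v powr p)"
    and p: "1 < p" and M: "0 <= M" and R: "0 <= R"
begin

text \<open>For \<open>norm v \<le> 1\<close> the increment lives on the ball of radius
  \<open>R + 1\<close>, where the quotient \<open>b\<close> satisfies
  \<open>b \<le> 1 + b powr p\<close>; the constant term is paid for by the volume of that ball.
  Longer increments are subdivided.\<close>

lemma transl_1:
  "\<exists>M1\<ge>0. \<forall>v. (\<integral>\<^sup>+x. enorm (\<phi> (x + v) - \<phi> x)) <= ennreal (M1 * norm v)"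
proof -
  define M1 where "M1 = unit_ball_vol DIM('a) * (R + 1) ^ DIM('a) + M"
  have M1: "0 <= M1" using M R by (simp add: M1_def)
  have small: "(\<integral>\<^sup>+x. enorm (\<phi> (x + v) - \<phi> x)) <= ennreal (M1 * norm v)"
    if v: "0 < norm v" "norm v <= 1" for v
  proof -
    let ?a = "\<lambda>x. norm (\<phi> (x + v) - \<phi> x)"
    have "(\<integral>\<^sup>+x. ennreal (?a x))
        <= (\<integral>\<^sup>+x. enorm v * indicator (cball 0 (R + 1)) x + ennreal (norm v * norm v powr - p) * ennreal (?a x powr p))"
    proof (rule nn_integral_mono, goal_cases)
      case (1 x)
      show ?case
      proof (cases "x \<in> cball 0 (R + 1)")
        case True
        define b where "b = ?a x / norm v"
        have b: "0 <= b" "?a x = norm v * b" using v by (auto simp: b_def)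
        have "b <= 1 + b powr p"
        proof (cases "b <= 1")
          case False
          then have "b powr 1 <= b powr p" using p by (intro powr_mono) auto
          then show ?thesis using False by simp
        qed (use powr_ge_zero[of b p] in linarith)
        then have "?a x <= norm v * (1 + b powr p)" unfolding b(2) using v by (intro mult_left_mono) auto
        also have "... = norm v + norm v * norm v powr - p * ?a x powr p"
          using b(1) v unfolding b(2) by (simp add: distrib_left powr_mult powr_minus field_simps)
        finally have "ennreal (?a x) <= ennreal (norm v + norm v * norm v powr - p * ?a x powr p)" by (rule ennreal_leI)
        also have "... = enorm v + ennreal (norm v * norm v powr - p) * ennreal (?a x powr p)"
          by (subst ennreal_mult[symmetric]) auto
        finally show ?thesis using True by simp
      next
        case False
        have "norm x <= norm (x + v) + norm v" using norm_triangle_ineq4[of "x + v" v] by simp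
        then have "\<phi> (x + v) = 0" "\<phi> x = 0" using False v by (auto intro!: support)
        then show ?thesis by simp
      qed
    qed
    also have "... = enorm v * leb (cball (0::'a) (R + 1))
        + ennreal (norm v * norm v powr - p) * (\<integral>\<^sup>+x. ennreal (?a x powr p))"
      by (subst nn_integral_add) (auto simp: nn_integral_cmult)
    also have "... <= enorm v * ennreal (unit_ball_vol DIM('a) * (R + 1) ^ DIM('a))
        + ennreal (norm v * norm v powr - p) * ennreal (M * norm v powr p)"
      using R by (intro add_mono mult_left_mono transl) (auto simp: emeasure_cball)
    also have "... = ennreal (norm v * (unit_ball_vol DIM('a) * (R + 1) ^ DIM('a)) + (norm v * norm v powr - p) * (M * norm v powr p))"
      using M R by (subst ennreal_plus) (auto simp: ennreal_mult)
    also have "norm v * (unit_ball_vol DIM('a) * (R + 1) ^ DIM('a)) + (norm v * norm v powr - p) * (M * norm v powr p) = M1 * norm v"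
      using v by (simp add: M1_def powr_minus field_simps)
    finally show ?thesis .
  qed
  have "(\<integral>\<^sup>+x. enorm (\<phi> (x + v) - \<phi> x)) <= ennreal (M1 * norm v)" for v
  proof (cases "v = 0")
    case False
    define N where "N = Suc (nat \<lceil>norm v\<rceil>)"
    have N: "N \<ge> 1" "norm v <= real N" unfolding N_def by linarith+
    define u where "u = v /\<^sub>R real N"
    have v: "v = real N *\<^sub>R u" using N by (simp add: u_def)
    have u: "0 < norm u" "norm u <= 1" using N False by (auto simp: u_def field_simps)
    have "(\<integral>\<^sup>+x. enorm (\<phi> (x + v) - \<phi> x))
      = (\<integral>\<^sup>+x. ennreal (norm (\<phi> (x + real N *\<^sub>R u) - \<phi> x) powr 1) * indicator {x. x \<in> UNIV \<and> x + real N *\<^sub>R u \<in> UNIV} x)"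
      by (simp add: v)
    also have "... <= ennreal (real N powr 1) * (\<integral>\<^sup>+x. ennreal (norm (\<phi> (x + u) - \<phi> x) powr 1) * indicator {x. x \<in> UNIV \<and> x + u \<in> UNIV} x)"
    proof (rule translation_subdivide[where d="\<lambda>x y. norm (\<phi> y - \<phi> x)"])
      fix x y z
      show "norm (\<phi> z - \<phi> x) <= norm (\<phi> y - \<phi> x) + norm (\<phi> z - \<phi> y)"
        using norm_triangle_ineq[of "\<phi> z - \<phi> y" "\<phi> y - \<phi> x"] by simp
    qed (use N in auto)
    also have "... = ennreal (real N) * (\<integral>\<^sup>+x. enorm (\<phi> (x + u) - \<phi> x))" by simp
    also have "... <= ennreal (real N) * ennreal (M1 * norm u)" using u by (intro mult_left_mono small) auto
    also have "... = ennreal (M1 * norm v)" using M1 v by (simp add: ennreal_mult[symmetric] mult_ac)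
    finally show ?thesis .
  qed simp
  then show ?thesis using M1 by blast
qed

end

context sobolev_map
begin

definition diff_quot :: "real => 'a => 'a => 'b" where
  "diff_quot h u x = (\<phi> (x + h *\<^sub>R u) - \<phi> x) /\<^sub>R h"

lemma diff_quot_measurable [measurable]: "diff_quot h u \<in> borel_measurable borel" unfolding diff_quot_def by measurable

lemma diff_quot_average:
  assumes "N \<ge> 1" "h > 0"
  shows "diff_quot (real N * h) u x = (\<Sum>i<N. diff_quot h u (x + (real i * h) *\<^sub>R u)) /\<^sub>R real N"
proof -
  have "(\<Sum>i<N. diff_quot h u (x + (real i * h) *\<^sub>R u))
     = (\<Sum>i<N. \<phi> (x + (real (Suc i) * h) *\<^sub>R u) - \<phi> (x + (real i * h) *\<^sub>R u)) /\<^sub>R h"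
    by (simp add: diff_quot_def scaleR_sum_right algebra_simps)
  also have "... = (\<phi> (x + (real N * h) *\<^sub>R u) - \<phi> x) /\<^sub>R h" by (subst sum_lessThan_telescope) simp
  finally have eq: "(\<Sum>i<N. diff_quot h u (x + (real i * h) *\<^sub>R u)) = ..." .
  have "diff_quot (real N * h) u x = ((\<phi> (x + (real N * h) *\<^sub>R u) - \<phi> x) /\<^sub>R h) /\<^sub>R real N"
    unfolding diff_quot_def by (simp add: mult.commute)
  then show ?thesis unfolding eq .
qed

text \<open>Jensen's inequality and translation invariance. Together with
  \<open>diff_quot_average\<close> it shows that multiplying the step cannot increase the integral
  of \<open>psi\<close> of difference quotients or of their midpoints.\<close>

lemma psi_average_integral_le:
  assumes [measurable]: "g \<in> borel_measurable borel" and "N \<ge> 1"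
  shows "(\<integral>\<^sup>+x. ennreal (psi ((\<Sum>i<N. g (x + real i *\<^sub>R w)) /\<^sub>R real N :: 'b)))
    <= (\<integral>\<^sup>+x. ennreal (psi (g (x::'a))))"
proof -
  have "(\<integral>\<^sup>+x. ennreal (psi ((\<Sum>i<N. g (x + real i *\<^sub>R w)) /\<^sub>R real N)))
      <= (\<integral>\<^sup>+x. ennreal (1 / real N) * (\<Sum>i<N. ennreal (psi (g (x + real i *\<^sub>R w)))))"
  proof (rule nn_integral_mono, goal_cases)
    case (1 x)
    have "psi ((\<Sum>i<N. g (x + real i *\<^sub>R w)) /\<^sub>R real N) <= (1 / real N) * (\<Sum>i<N. psi (g (x + real i *\<^sub>R w)))"
      using psi_average_le[OF assms(2)] by (simp add: divide_inverse mult.commute)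
    then have "ennreal (psi ((\<Sum>i<N. g (x + real i *\<^sub>R w)) /\<^sub>R real N))
        <= ennreal ((1 / real N) * (\<Sum>i<N. psi (g (x + real i *\<^sub>R w))))" by (rule ennreal_leI)
    then show ?case
      by (simp only: sum_ennreal psi_nonneg ennreal_mult[symmetric] sum_nonneg zero_le_divide_1_iff of_nat_0_le_iff)
  qed
  also have "... = ennreal (1 / real N) * (\<Sum>i<N. \<integral>\<^sup>+x. ennreal (psi (g (x + real i *\<^sub>R w))) \<partial>lborel)"
    by (subst nn_integral_cmult, measurable) (subst nn_integral_sum, auto)
  also have "(\<Sum>i<N. \<integral>\<^sup>+x. ennreal (psi (g (x + real i *\<^sub>R w))) \<partial>lborel) = (\<Sum>i<N. \<integral>\<^sup>+x. ennreal (psi (g x)) \<partial>lborel)"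
    by (intro sum.cong refl nn_integral_translate[of "\<lambda>x. ennreal (psi (g x))"]) simp
  also have "ennreal (1 / real N) * ... = (\<integral>\<^sup>+x. ennreal (psi (g x)))"
    using assms(2) by (simp add: ennreal_of_nat_eq_real_of_nat mult.assoc[symmetric] ennreal_mult[symmetric])
  finally show ?thesis .
qed

lemma diff_quot_powr_integral:
  assumes "norm u = 1" "h > 0"
  shows "(\<integral>\<^sup>+x. ennreal (norm (diff_quot h u x) powr p)) <= ennreal M"
proof -
  have "(\<integral>\<^sup>+x. ennreal (norm (diff_quot h u x) powr p))
      = (\<integral>\<^sup>+x. ennreal (h powr - p) * ennreal (norm (\<phi> (x + h *\<^sub>R u) - \<phi> x) powr p))"
    using assms by (intro nn_integral_cong) (simp add: diff_quot_def powr_mult powr_minus ennreal_mult[symmetric] inverse_powr)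
  also have "... = ennreal (h powr - p) * (\<integral>\<^sup>+x. ennreal (norm (\<phi> (x + h *\<^sub>R u) - \<phi> x) powr p))"
    by (rule nn_integral_cmult) measurable
  also have "... <= ennreal (h powr - p) * ennreal (M * h powr p)"
    using transl[of "h *\<^sub>R u"] assms by (intro mult_left_mono) auto
  also have "... = ennreal M" using M assms by (simp add: ennreal_mult[symmetric] powr_minus)
  finally show ?thesis .
qed

text \<open>The integrals of \<open>psi\<close> of the difference quotients increase when the step is divided, so
  they are nearly maximal at some step \<open>H\<close>. Averaging a pair of difference quotients of step
  \<open>H / N\<close>, one of them translated, back to step \<open>H\<close> shows that their midpoint cannot have a much
  smaller integral, and by strict convexity the pair is close in the mean.\<close>

lemma diff_quot_equicontinuous:
  assumes u: "norm u = 1" and "0 < \<e>"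
  shows "\<exists>t>0. \<exists>H>0. \<forall>z N. norm z <= t --> N \<ge> 1 -->
    (\<integral>\<^sup>+x. enorm (diff_quot (H / real N) u x - diff_quot (H / real N) u (x + z))) <= ennreal \<e>"
proof -
  obtain M1 where M1: "0 <= M1" 
    "\<And>v. (\<integral>\<^sup>+x. enorm (\<phi> (x + v) - \<phi> x)) <= ennreal (M1 * norm v)" using transl_1 by blast
  define J where "J h = (\<integral>\<^sup>+x. ennreal (psi (diff_quot h u x)))" for h
  have J_le: "J h <= ennreal M1" if "h > 0" for h
  proof -
    have "J h <= (\<integral>\<^sup>+x. ennreal (1 / h) * enorm (\<phi> (x + h *\<^sub>R u) - \<phi> x))" unfolding J_def
    proof (intro nn_integral_mono, goal_cases)
      case (1 x)
      have "psi (diff_quot h u x) <= 1 / h * norm (\<phi> (x + h *\<^sub>R u) - \<phi> x)"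
        using psi_le_norm[of "diff_quot h u x"] that by (simp add: diff_quot_def divide_inverse mult.commute)
      then show ?case using that by (subst ennreal_mult[symmetric]) (auto intro: ennreal_leI)
    qed
    also have "... = ennreal (1 / h) * (\<integral>\<^sup>+x. enorm (\<phi> (x + h *\<^sub>R u) - \<phi> x))" by (rule nn_integral_cmult) measurable
    also have "... <= ennreal (1 / h) * ennreal (M1 * norm (h *\<^sub>R u))" by (intro mult_left_mono M1) auto
    also have "... = ennreal M1" using u that M1(1) by (simp add: ennreal_mult[symmetric])
    finally show ?thesis .
  qed
  define vol where "vol = unit_ball_vol DIM('a) * (R + 2) ^ DIM('a)"
  have vol: "0 <= vol" "leb (cball (0::'a) (R + 2)) = ennreal vol" using R by (auto simp: vol_def emeasure_cball)
  \<comment> \<open>\<open>\<e>2\<close> makes the power terms contribute at most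
    \<open>\<e> / 2\<close>, and \<open>\<e>1\<close> below does the same for the gap, whose
    integral will be at most \<open>2 * \<e>1\<close>.\<close>
  define \<e>2 where "\<e>2 = \<e> / (2 * (vol + 2 * M + 1))"
  have \<e>2: "0 < \<e>2" using \<open>0 < \<e>\<close> vol M by (simp add: \<e>2_def)
  obtain K where K: "0 <= K" 
    "\<And>a b :: 'b. norm (a - b) <= \<e>2 * (1 + norm a powr p + norm b powr p) + K * psi_gap a b"
    using norm_diff_le_psi_gap[OF p \<e>2] by blast
  define \<e>1 where "\<e>1 = \<e> / (4 * (K + 1))"
  have \<e>1: "0 < \<e>1" using \<open>0 < \<e>\<close> K by (simp add: \<e>1_def)
  define S where "S = (SUP h\<in>{0<..1}. J h)"
  have S_fin: "S <= ennreal M1" unfolding S_def by (rule SUP_least) (auto intro: J_le)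
  have "\<exists>H\<in>{0<..1}. S <= J H + ennreal \<e>1"
  proof (cases "S = 0")
    case False
    then have "S - ennreal \<e>1 < S"
      using S_fin \<e>1 by (intro ennreal_between) (auto simp: top_unique less_top[symmetric] zero_less_iff_neq_zero)
    then obtain H where "H \<in> {0<..1}" "S - ennreal \<e>1 < J H" unfolding S_def by (auto simp: less_SUP_iff)
    then show ?thesis by (intro bexI[of _ H]) (auto simp: ennreal_minus_le_iff add.commute dest: less_imp_le)
  qed (auto intro!: exI[of _ "1::real"])
  then obtain H where H: "0 < H" "H <= 1" "S <= J H + ennreal \<e>1" by auto
  \<comment> \<open>The step \<open>H\<close> is fixed before \<open>t\<close>: at this one step a
    translation by \<open>z\<close> changes the quotient in the mean by at most a multiple of
    \<open>norm z / H\<close>, while the steps \<open>H / N\<close> become arbitrarily fine.\<close>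
  define t where "t = min 1 (\<e>1 * H / (M1 + 1))"
  have t: "0 < t" "t <= 1" "M1 * t / H <= \<e>1"
  proof -
    show "0 < t" using H \<e>1 M1 by (simp add: t_def)
    have "M1 * t <= M1 * (\<e>1 * H / (M1 + 1))" using M1(1) by (intro mult_left_mono) (auto simp: t_def)
    also have "... <= \<e>1 * H" using M1(1) H \<e>1 by (simp add: field_simps)
    finally show "M1 * t / H <= \<e>1" using H by (simp add: field_simps)
  qed (simp add: t_def)
  have "(\<integral>\<^sup>+x. enorm (diff_quot (H / real N) u x - diff_quot (H / real N) u (x + z))) <= ennreal \<e>"
    if z: "norm z <= t" and N: "N \<ge> 1" for z N
  proof -
    define h where "h = H / real N"
    have h: "0 < h" "h <= 1" "H = real N * h" using H N by (auto simp: h_def field_simps)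
    let ?D = "diff_quot h u"
    \<comment> \<open>\<open>?G\<close> will be the average of \<open>N\<close> translates of
      \<open>?g\<close>, so \<open>psi\<close> of \<open>?G\<close> has the smaller
      integral.\<close>
    let ?g = "\<lambda>x. (?D x + ?D (x + z)) /\<^sub>R 2"
    let ?G = "\<lambda>x. (diff_quot H u x + diff_quot H u (x + z)) /\<^sub>R 2"
    let ?gap = "\<lambda>x. psi_gap (?D x) (?D (x + z))"
    have [measurable]: "?gap \<in> borel_measurable borel" unfolding psi_gap_def by measurable
    have "?G x = (\<Sum>i<N. ?g (x + real i *\<^sub>R (h *\<^sub>R u))) /\<^sub>R real N" for x
    proof -
      have comm: "x + z + real i *\<^sub>R (h *\<^sub>R u) = x + real i *\<^sub>R (h *\<^sub>R u) + z" for i by (simp add: add_ac)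
      show ?thesis unfolding h(3) diff_quot_average[OF N h(1)] scaleR_scaleR[symmetric] comm
        by (simp add: scaleR_sum_right sum.distrib scaleR_add_right mult.commute)
    qed
    then have G: "(\<integral>\<^sup>+x. ennreal (psi (?G x))) <= (\<integral>\<^sup>+x. ennreal (psi (?g x)))"
      using psi_average_integral_le[of ?g N "h *\<^sub>R u"] N by simp
    have "J H <= (\<integral>\<^sup>+x. ennreal (psi (?G x)) + ennreal (norm (diff_quot H u (x + z) - diff_quot H u x) / 2))"
      unfolding J_def
    proof (rule nn_integral_mono, goal_cases)
      case (1 x)
      have "diff_quot H u x - ?G x = (diff_quot H u x - diff_quot H u (x + z)) /\<^sub>R 2"
        by (simp add: scaleR_diff_right scaleR_add_right algebra_simps flip: scaleR_add_left)
      then have "psi (diff_quot H u x) <= psi (?G x) + norm (diff_quot H u (x + z) - diff_quot H u x) / 2"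
        using psi_lipschitz[of "diff_quot H u x" "?G x"] by (simp add: norm_minus_commute)
      then show ?case
        by (subst ennreal_plus[symmetric]) (auto simp: psi_nonneg simp del: ennreal_plus intro: ennreal_leI)
    qed
    also have "... = (\<integral>\<^sup>+x. ennreal (psi (?G x))) + (\<integral>\<^sup>+x. ennreal (norm (diff_quot H u (x + z) - diff_quot H u x) / 2))"
      by (rule nn_integral_add) measurable
    also have "(\<integral>\<^sup>+x. ennreal (norm (diff_quot H u (x + z) - diff_quot H u x) / 2)) <= ennreal \<e>1"
    proof -
      let ?E = "\<lambda>x. \<phi> (x + z) - \<phi> x"
      have "(\<integral>\<^sup>+x. ennreal (norm (diff_quot H u (x + z) - diff_quot H u x) / 2))
          <= (\<integral>\<^sup>+x. ennreal (1 / (2 * H)) * (enorm (?E (x + H *\<^sub>R u)) + enorm (?E x)))"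
      proof (rule nn_integral_mono, goal_cases)
        case (1 x)
        have eq: "diff_quot H u (x + z) - diff_quot H u x = (?E (x + H *\<^sub>R u) - ?E x) /\<^sub>R H"
          unfolding diff_quot_def by (simp add: scaleR_diff_right add_ac)
        have n: "norm (y /\<^sub>R H) / 2 = 1 / (2 * H) * norm y" for y :: 'b using H(1) by (simp add: field_simps)
        have "norm (diff_quot H u (x + z) - diff_quot H u x) / 2 = 1 / (2 * H) * norm (?E (x + H *\<^sub>R u) - ?E x)"
          unfolding eq by (rule n)
        also have "... <= 1 / (2 * H) * (norm (?E (x + H *\<^sub>R u)) + norm (?E x))"
          using H by (intro mult_left_mono norm_triangle_ineq4) auto
        finally have "ennreal (norm (diff_quot H u (x + z) - diff_quot H u x) / 2)
            <= ennreal (1 / (2 * H) * (norm (?E (x + H *\<^sub>R u)) + norm (?E x)))" by (rule ennreal_leI)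
        also have "... = ennreal (1 / (2 * H)) * (enorm (?E (x + H *\<^sub>R u)) + enorm (?E x))"
          using H(1) by (subst ennreal_mult) auto
        finally show ?case .
      qed
      also have "... = ennreal (1 / (2 * H)) * ((\<integral>\<^sup>+x. enorm (?E (x + H *\<^sub>R u))) + (\<integral>\<^sup>+x. enorm (?E x)))"
        by (subst nn_integral_cmult, measurable) (subst nn_integral_add, auto)
      also have "(\<integral>\<^sup>+x. enorm (?E (x + H *\<^sub>R u))) = (\<integral>\<^sup>+x. enorm (?E x))"
        by (rule nn_integral_translate[of "\<lambda>x. enorm (?E x)"]) measurable
      also have "ennreal (1 / (2 * H)) * ((\<integral>\<^sup>+x. enorm (?E x)) + (\<integral>\<^sup>+x. enorm (?E x)))
          <= ennreal (1 / (2 * H)) * (ennreal (M1 * norm z) + ennreal (M1 * norm z))"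
        by (intro mult_left_mono add_mono M1) auto
      also have "... = ennreal (M1 * norm z / H)"
        using M1(1) H by (simp add: ennreal_mult[symmetric] ennreal_plus[symmetric] del: ennreal_plus)
      also have "... <= ennreal (M1 * t / H)"
        using M1(1) z H by (intro ennreal_leI divide_right_mono mult_left_mono) auto
      also have "... <= ennreal \<e>1" using t by (intro ennreal_leI) auto
      finally show ?thesis .
    qed
    finally have JH: "J H <= (\<integral>\<^sup>+x. ennreal (psi (?g x))) + ennreal \<e>1"
      using G by (meson add_mono order_refl order_trans)
    \<comment> \<open>The gap is exactly what \<open>psi\<close> loses between the quotients and
      their midpoints. As \<open>J h\<close> is at most \<open>S\<close> and the midpoints already
      reach \<open>J H\<close> up to \<open>\<e>1\<close>, little can be lost.\<close>
    have split: "(\<integral>\<^sup>+x. ennreal (?gap x)) + (\<integral>\<^sup>+x. ennreal (psi (?g x))) = J h"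
    proof -
      have "(\<integral>\<^sup>+x. ennreal (?gap x)) + (\<integral>\<^sup>+x. ennreal (psi (?g x)))
        = (\<integral>\<^sup>+x. ennreal (?gap x) + ennreal (psi (?g x)))" by (rule nn_integral_add[symmetric]) measurable
      also have "... = (\<integral>\<^sup>+x. ennreal (1/2) * (ennreal (psi (?D x)) + ennreal (psi (?D (x + z)))))"
      proof (rule nn_integral_cong, goal_cases)
        case (1 x)
        have "?gap x + psi (?g x) = 1/2 * (psi (?D x) + psi (?D (x + z)))" by (simp add: psi_gap_def)
        then have "ennreal (?gap x + psi (?g x)) = ennreal (1/2 * (psi (?D x) + psi (?D (x + z))))" by (rule arg_cong)
        then show ?case by (subst (asm) ennreal_mult) (auto simp: psi_nonneg psi_gap_nonneg)
      qed
      also have "... = ennreal (1/2) * (J h + (\<integral>\<^sup>+x. ennreal (psi (?D (x + z)))))"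
        unfolding J_def by (subst nn_integral_cmult, measurable) (subst nn_integral_add, auto)
      also have "(\<integral>\<^sup>+x. ennreal (psi (?D (x + z)))) = J h"
        unfolding J_def by (rule nn_integral_translate[of "\<lambda>x. ennreal (psi (?D x))"]) measurable
      also have "ennreal (1/2) * (J h + J h) = J h"
      proof -
        have "ennreal (1/2) + ennreal (1/2) = 1" by (subst ennreal_plus[symmetric]) auto
        then show ?thesis by (simp only: distrib_left distrib_right[symmetric] mult_1)
      qed
      finally show ?thesis .
    qed
    have "J h <= S" unfolding S_def using h by (intro SUP_upper) auto
    also note H(3)
    also note JH
    finally have "(\<integral>\<^sup>+x. ennreal (?gap x)) + (\<integral>\<^sup>+x. ennreal (psi (?g x)))
        <= (\<integral>\<^sup>+x. ennreal (psi (?g x))) + (ennreal \<e>1 + ennreal \<e>1)" unfolding split by (simp add: add.assoc)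
    moreover have "(\<integral>\<^sup>+x. ennreal (psi (?g x))) \<noteq> \<infinity>"
    proof -
      have "(\<integral>\<^sup>+x. ennreal (psi (?g x))) <= J h" unfolding split[symmetric] by simp
      also have "... < \<infinity>" using J_le[OF h(1)] by (auto simp: less_top[symmetric] top_unique)
      finally show ?thesis by simp
    qed
    ultimately have gap: "(\<integral>\<^sup>+x. ennreal (?gap x)) <= ennreal (2 * \<e>1)"
      using \<e>1 by (simp add: add.commute[of "\<integral>\<^sup>+x. ennreal (?gap x)"] ennreal_add_left_cancel_le
        ennreal_plus[symmetric] del: ennreal_plus)
    have "(\<integral>\<^sup>+x. enorm (?D x - ?D (x + z)))
        <= (\<integral>\<^sup>+x. ennreal \<e>2 * (indicator (cball 0 (R + 2)) x + ennreal (norm (?D x) powr p) + ennreal (norm (?D (x + z)) powr p))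
           + ennreal K * ennreal (?gap x))"
    proof (rule nn_integral_mono, goal_cases)
      case (1 x)
      show ?case
      proof (cases "x \<in> cball 0 (R + 2)")
        case True
        have "enorm (?D x - ?D (x + z)) <= ennreal (\<e>2 * (1 + norm (?D x) powr p + norm (?D (x + z)) powr p) + K * ?gap x)"
          by (intro ennreal_leI K)
        then show ?thesis using True \<e>2 K(1) psi_gap_nonneg[of "?D x" "?D (x + z)"] by (simp add: ennreal_mult)
      next
        case False
        have far: "R < norm (x + w)" if "norm w <= 2" for w using norm_triangle_ineq4[of "x + w" w] False that by simp
        have "norm (h *\<^sub>R u) <= 1" using h u by simp
        moreover have "norm z <= 1" using z t by simp
        ultimately have "norm (z + h *\<^sub>R u) <= 2" "norm (h *\<^sub>R u) <= 2" "norm z <= 2"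
          using norm_triangle_ineq[of z "h *\<^sub>R u"] by auto
        from this[THEN far] far[of 0] have "?D x = 0" "?D (x + z) = 0" by (auto simp: diff_quot_def support add_ac)
        then show ?thesis by simp
      qed
    qed
    also have "... = ennreal \<e>2 * (ennreal vol + (\<integral>\<^sup>+x. ennreal (norm (?D x) powr p)) + (\<integral>\<^sup>+x. ennreal (norm (?D (x + z)) powr p)))
        + ennreal K * (\<integral>\<^sup>+x. ennreal (?gap x))" by (simp add: nn_integral_add nn_integral_cmult vol)
    also have "(\<integral>\<^sup>+x. ennreal (norm (?D (x + z)) powr p)) = (\<integral>\<^sup>+x. ennreal (norm (?D x) powr p))"
      by (rule nn_integral_translate[of "\<lambda>x. ennreal (norm (?D x) powr p)"]) measurable
    also have "ennreal \<e>2 * (ennreal vol + (\<integral>\<^sup>+x. ennreal (norm (?D x) powr p)) + (\<integral>\<^sup>+x. ennreal (norm (?D x) powr p)))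
        + ennreal K * (\<integral>\<^sup>+x. ennreal (?gap x))
      <= ennreal \<e>2 * (ennreal vol + ennreal M + ennreal M) + ennreal K * ennreal (2 * \<e>1)"
      by (intro add_mono mult_left_mono gap diff_quot_powr_integral u h) auto
    also have "... = ennreal (\<e>2 * (vol + M + M) + K * (2 * \<e>1))"
      using \<e>2 \<e>1 vol(1) M K(1) by (simp add: ennreal_plus[symmetric] ennreal_mult[symmetric] del: ennreal_plus)
    also have "... <= ennreal \<e>"
    proof (rule ennreal_leI)
      have "\<e>2 * (vol + M + M) <= \<e>2 * (vol + 2 * M + 1)" using \<e>2 by (intro mult_left_mono) auto
      moreover
      have "\<e> / (2 * X) * X = \<e> / 2" if "0 < X" for X using that by simp
      from this[of "vol + 2 * M + 1"] have "\<e>2 * (vol + 2 * M + 1) = \<e> / 2" using vol(1) M unfolding \<e>2_def by linarith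
      ultimately have 1: "\<e>2 * (vol + M + M) <= \<e> / 2" by linarith
      have "K * (2 * \<e>1) <= (K + 1) * (2 * \<e>1)" using \<e>1 by (intro mult_right_mono) auto
      also have "... = \<e> / 2"
      proof -
        have "Y * (2 * (\<e> / (4 * Y))) = \<e> / 2" if "0 < Y" for Y using that by simp
        from this[of "K + 1"] show ?thesis using K(1) unfolding \<e>1_def by linarith
      qed
      finally show "\<e>2 * (vol + M + M) + K * (2 * \<e>1) <= \<e>" using 1 by simp
    qed
    finally show ?thesis unfolding h_def .
  qed
  then show ?thesis using t(1) H(1) by blast
qed

text \<open>The L1 size of the mixed second difference of \<open>\<phi>\<close> in \<open>z\<close>
  and \<open>v\<close>. For fixed \<open>z\<close> it is subadditive in \<open>v\<close>, which
  reduces all \<open>v\<close> to short multiples of basis vectors. A small multiple of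
  \<open>norm v\<close> as a bound expresses that increments hardly change under translation by
  \<open>z\<close>.\<close>

definition second_diff :: "'a => 'a => ennreal" where
  "second_diff z v = (\<integral>\<^sup>+x. enorm ((\<phi> (x + v) - \<phi> (x + v + z)) - (\<phi> x - \<phi> (x + z))))"

lemma second_diff_add: "second_diff z (v + w) <= second_diff z v + second_diff z w"
proof -
  let ?E = "\<lambda>x. \<phi> x - \<phi> (x + z)"
  have "second_diff z (v + w) <= (\<integral>\<^sup>+x. enorm (?E (x + v) - ?E x) + enorm (?E (x + v + w) - ?E (x + v)))"
    unfolding second_diff_def
  proof (rule nn_integral_mono, goal_cases)
    case (1 x)
    have "(\<phi> (x + (v + w)) - \<phi> (x + (v + w) + z)) - (\<phi> x - \<phi> (x + z)) = (?E (x + v) - ?E x) + (?E (x + v + w) - ?E (x + v))"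
      by (simp add: add.assoc)
    then show ?case using norm_triangle_ineq[of "?E (x + v) - ?E x" "?E (x + v + w) - ?E (x + v)"]
      by (subst ennreal_plus[symmetric])
        (simp_all only: norm_ge_zero ennreal_leI)
  qed
  also have "... = second_diff z v + (\<integral>\<^sup>+x. enorm (?E (x + v + w) - ?E (x + v)))"
    unfolding second_diff_def by (rule nn_integral_add) measurable
  also have "(\<integral>\<^sup>+x. enorm (?E (x + v + w) - ?E (x + v))) = second_diff z w" unfolding second_diff_def
    using nn_integral_translate[of "\<lambda>x. enorm (?E (x + w) - ?E x)" v] by simp
  finally show ?thesis .
qed

lemma second_diff_uminus: "second_diff z (- v) = second_diff z v"
proof -
  let ?E = "\<lambda>x. \<phi> x - \<phi> (x + z)"
  have "second_diff z v = (\<integral>\<^sup>+x. enorm (?E (x - v + v) - ?E (x - v)))" unfolding second_diff_def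
    using nn_integral_translate[of "\<lambda>x. enorm (?E (x + v) - ?E x)" "- v"] by simp
  also have "... = second_diff z (- v)" unfolding second_diff_def by (simp add: norm_minus_commute)
  finally show ?thesis ..
qed

lemma second_diff_scale: "second_diff z (real k *\<^sub>R v) <= of_nat k * second_diff z v"
proof (induction k)
  case 0
  then show ?case by (simp add: second_diff_def)
next
  case (Suc k)
  have "second_diff z (real (Suc k) *\<^sub>R v) <= second_diff z (real k *\<^sub>R v) + second_diff z v"
    using second_diff_add[of z "real k *\<^sub>R v" v] by (simp add: scaleR_add_left add.commute)
  also have "... <= of_nat (Suc k) * second_diff z v" using Suc by (simp add: distrib_right add.commute add_left_mono)
  finally show ?case .
qed

text \<open>Multiples of the step \<open>H / N\<close> follow from equicontinuity by subadditivity.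
  What remains of \<open>s\<close> is at most one step long and costs at most \<open>2 * M1\<close>
  times the step, which vanishes as \<open>N\<close> grows.\<close>

lemma second_diff_direction:
  assumes u: "norm u = 1" and \<e>: "0 < \<e>"
  shows "\<exists>t>0. \<forall>z s. norm z <= t --> second_diff z (s *\<^sub>R u) <= ennreal (\<e> * \<bar>s\<bar>)"
proof -
  obtain M1 where M1: "0 <= M1" 
    "\<And>v. (\<integral>\<^sup>+x. enorm (\<phi> (x + v) - \<phi> x)) <= ennreal (M1 * norm v)" using transl_1 by blast
  have M2: "second_diff z v <= ennreal (2 * M1 * norm v)" for z v
  proof -
    have "second_diff z v <= (\<integral>\<^sup>+x. enorm (\<phi> (x + v) - \<phi> x) + enorm (\<phi> (x + z + v) - \<phi> (x + z)))"
      unfolding second_diff_def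
    proof (rule nn_integral_mono, goal_cases)
      case (1 x)
      show ?case using norm_triangle_ineq4[of "\<phi> (x + v) - \<phi> x" "\<phi> (x + z + v) - \<phi> (x + z)"]
        by (subst ennreal_plus[symmetric]) (auto simp: algebra_simps simp del: ennreal_plus intro!: ennreal_leI)
    qed
    also have "... = (\<integral>\<^sup>+x. enorm (\<phi> (x + v) - \<phi> x)) + (\<integral>\<^sup>+x. enorm (\<phi> (x + z + v) - \<phi> (x + z)))"
      by (rule nn_integral_add) measurable
    also have "(\<integral>\<^sup>+x. enorm (\<phi> (x + z + v) - \<phi> (x + z))) = (\<integral>\<^sup>+x. enorm (\<phi> (x + v) - \<phi> x))"
      by (rule nn_integral_translate[of "\<lambda>x. enorm (\<phi> (x + v) - \<phi> x)"]) measurable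
    also have "(\<integral>\<^sup>+x. enorm (\<phi> (x + v) - \<phi> x)) + (\<integral>\<^sup>+x. enorm (\<phi> (x + v) - \<phi> x))
        <= ennreal (M1 * norm v) + ennreal (M1 * norm v)" by (intro add_mono M1)
    also have "... = ennreal (2 * M1 * norm v)" using M1(1) by (simp add: ennreal_plus[symmetric] del: ennreal_plus)
    finally show ?thesis .
  qed
  obtain t H where t12: "0 < t" "0 < H" and t3: "\<forall>z N. norm z <= t --> N \<ge> 1 -->
    (\<integral>\<^sup>+x. enorm (diff_quot (H / real N) u x - diff_quot (H / real N) u (x + z))) <= ennreal \<e>"
    using diff_quot_equicontinuous[OF u \<e>] by blast
  note t = t12 t3[rule_format]
  have step: "second_diff z ((H / real N) *\<^sub>R u) <= ennreal (H / real N * \<e>)" if "norm z <= t" "N \<ge> 1" for z N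
  proof -
    define h where "h = H / real N"
    have h: "0 < h" using t that by (simp add: h_def)
    have "second_diff z (h *\<^sub>R u) = (\<integral>\<^sup>+x. ennreal h * enorm (diff_quot h u x - diff_quot h u (x + z)))"
      unfolding second_diff_def
    proof (rule nn_integral_cong, goal_cases)
      case (1 x)
      have comm: "x + z + h *\<^sub>R u = x + h *\<^sub>R u + z" by (simp add: add_ac)
      have eq: "diff_quot h u x - diff_quot h u (x + z) = ((\<phi> (x + h *\<^sub>R u) - \<phi> (x + h *\<^sub>R u + z)) - (\<phi> x - \<phi> (x + z))) /\<^sub>R h"
        unfolding diff_quot_def comm by (simp add: scaleR_diff_right)
      have "h * norm (diff_quot h u x - diff_quot h u (x + z)) = norm ((\<phi> (x + h *\<^sub>R u) - \<phi> (x + h *\<^sub>R u + z)) - (\<phi> x - \<phi> (x + z)))"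
        unfolding eq norm_scaleR using h by (simp add: abs_of_pos)
      then show ?case using h by (simp add: ennreal_mult[symmetric])
    qed
    also have "... = ennreal h * (\<integral>\<^sup>+x. enorm (diff_quot h u x - diff_quot h u (x + z)))"
      by (rule nn_integral_cmult) measurable
    also have "... <= ennreal h * ennreal \<e>" unfolding h_def by (intro mult_left_mono t that) auto
    finally show ?thesis using h \<e> by (simp add: ennreal_mult[symmetric] h_def)
  qed
  have pos: "second_diff z (s *\<^sub>R u) <= ennreal (\<e> * s)" if z: "norm z <= t" and s: "0 <= s" for z s
  proof -
    have "second_diff z (s *\<^sub>R u) <= ennreal (\<e> * s + 2 * M1 * H / real (Suc n))" for n
    proof -
      define h where "h = H / real (Suc n)"
      have h: "0 < h" using t by (simp add: h_def)
      define k where "k = nat \<lfloor>s / h\<rfloor>"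
      have "real k <= s / h" "s / h < real k + 1" using s h by (auto simp: k_def intro: floor_correct)
      then have k: "real k * h <= s" "s - real k * h <= h" using h by (auto simp: field_simps)
      have "s *\<^sub>R u = real k *\<^sub>R (h *\<^sub>R u) + (s - real k * h) *\<^sub>R u" by (simp add: algebra_simps)
      then have "second_diff z (s *\<^sub>R u) <= second_diff z (real k *\<^sub>R (h *\<^sub>R u)) + second_diff z ((s - real k * h) *\<^sub>R u)"
        by (metis second_diff_add)
      also have "... <= of_nat k * ennreal (h * \<e>) + ennreal (2 * M1 * norm ((s - real k * h) *\<^sub>R u))"
        using step[OF z, of "Suc n"]
        by (intro add_mono M2 order_trans[OF second_diff_scale] mult_left_mono) (auto simp: h_def)
      also have "... = ennreal (real k * (h * \<e>) + 2 * M1 * (s - real k * h))"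
        using k u h \<e> M1(1) by (simp add: ennreal_of_nat_eq_real_of_nat ennreal_mult[symmetric] ennreal_plus[symmetric] del: ennreal_plus)
      also have "... <= ennreal (\<e> * s + 2 * M1 * h)"
      proof (intro ennreal_leI add_mono)
        show "real k * (h * \<e>) <= \<e> * s" using k(1) \<e> mult_right_mono[OF k(1), of \<e>] by (simp add: mult_ac)
        show "2 * M1 * (s - real k * h) <= 2 * M1 * h" using k M1(1) by (intro mult_left_mono) auto
      qed
      finally show ?thesis by (simp add: h_def)
    qed
    moreover have "(\<lambda>n. ennreal (\<e> * s + 2 * M1 * H / real (Suc n))) \<longlonglongrightarrow> ennreal (\<e> * s + 0)"
      by (intro tendsto_ennrealI tendsto_add tendsto_const) (rule LIMSEQ_Suc[OF lim_const_over_n])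
    ultimately have "second_diff z (s *\<^sub>R u) <= ennreal (\<e> * s + 0)" by (intro LIMSEQ_le_const) auto
    then show ?thesis by simp
  qed
  have "second_diff z (s *\<^sub>R u) <= ennreal (\<e> * \<bar>s\<bar>)" if "norm z <= t" for z s
  proof (cases "0 <= s")
    case False
    then show ?thesis using pos[OF that, of "- s"] by (simp add: second_diff_uminus)
  qed (use pos[OF that] in auto)
  then show ?thesis using t(1) by blast
qed

lemma second_diff_equicontinuous:
  assumes \<e>: "0 < \<e>"
  shows "\<exists>t>0. \<forall>z v. norm z <= t --> second_diff z v <= ennreal (\<e> * norm v)"
proof -
  let ?m = "real DIM('a)"
  have "\<forall>b\<in>Basis. \<exists>t>0. \<forall>z s. norm z <= t --> second_diff z (s *\<^sub>R b) <= ennreal (\<e> / ?m * \<bar>s\<bar>)"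
    using \<e> by (intro ballI second_diff_direction) auto
  then obtain T where T: "\<And>b. b \<in> Basis ==> 0 < T b"
    "\<And>b z s. b \<in> Basis ==> norm z <= T b ==> second_diff z (s *\<^sub>R b) <= ennreal (\<e> / ?m * \<bar>s\<bar>)" by metis
  define t where "t = Min (T ` Basis)"
  have t: "0 < t" "\<And>b. b \<in> Basis ==> t <= T b" using T(1) by (auto simp: t_def)
  have "second_diff z v <= ennreal (\<e> * norm v)" if z: "norm z <= t" for z v
  proof -
    have "second_diff z (\<Sum>b\<in>B. (v \<bullet> b) *\<^sub>R b) <= (\<Sum>b\<in>B. second_diff z ((v \<bullet> b) *\<^sub>R b))" if "finite B" for B using that
    proof induction
      case (insert b B)
      then show ?case by (simp add: order_trans[OF second_diff_add] add_left_mono)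
    qed (simp add: second_diff_def)
    from this[OF finite_Basis] have "second_diff z v <= (\<Sum>b\<in>Basis. second_diff z ((v \<bullet> b) *\<^sub>R b))"
      by (simp add: euclidean_representation)
    also have "... <= (\<Sum>b\<in>(Basis :: 'a set). ennreal (\<e> / ?m * norm v))"
    proof (rule sum_mono)
      fix b :: 'a assume b: "b \<in> Basis"
      have "second_diff z ((v \<bullet> b) *\<^sub>R b) <= ennreal (\<e> / ?m * \<bar>v \<bullet> b\<bar>)" using t(2)[OF b] z by (intro T b) auto
      also have "... <= ennreal (\<e> / ?m * norm v)"
        using \<e> Basis_le_norm[OF b, of v] by (intro ennreal_leI mult_left_mono) auto
      finally show "second_diff z ((v \<bullet> b) *\<^sub>R b) <= ennreal (\<e> / ?m * norm v)" .
    qed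
    also have "... = ennreal (\<e> * norm v)" using \<e> by (simp add: ennreal_of_nat_eq_real_of_nat ennreal_mult[symmetric])
    finally show ?thesis .
  qed
  then show ?thesis using t(1) by blast
qed

end

section \<open>Approximate differentiability\<close>

subsection \<open>Smoothing kernels\<close>

text \<open>Squaring the positive part gives a second order Taylor bound on the whole space, across
  the boundary of the support; this is all the regularity that mollification requires below.\<close>

definition bump :: "'a::euclidean_space => real" where
  "bump z = (max 0 (1 - (norm z)\<^sup>2))\<^sup>2"

definition bump_grad :: "'a::euclidean_space => 'a" where
  "bump_grad z = (- 4 * max 0 (1 - (norm z)\<^sup>2)) *\<^sub>R z"

lemma max_square_second_order:
  fixes s r :: real
  shows "\<bar>(max 0 (s + r))\<^sup>2 - (max 0 s)\<^sup>2 - 2 * max 0 s * r\<bar> <= r\<^sup>2"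
proof -
  consider "0 <= s" "0 <= s + r" | "0 <= s" "s + r < 0" | "s < 0" "0 <= s + r" | "s < 0" "s + r < 0" by linarith
  then show ?thesis
  proof cases
    case 1
    then show ?thesis by (simp add: max_def power2_eq_square algebra_simps)
  next
    case 2
    have "(s + r)\<^sup>2 - r\<^sup>2 = s\<^sup>2 + 2 * s * r" by (simp add: power2_eq_square algebra_simps)
    moreover have "s\<^sup>2 + 2 * s * r <= 0"
    proof -
      have "s * (s + 2 * r) <= 0" using 2 by (intro mult_nonneg_nonpos) auto
      then show ?thesis by (simp add: power2_eq_square algebra_simps)
    qed
    moreover have "0 <= (s + r)\<^sup>2" by simp
    ultimately have "- s\<^sup>2 - 2 * s * r <= r\<^sup>2" "0 <= - s\<^sup>2 - 2 * s * r" by linarith+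
    then show ?thesis using 2 by (simp add: max_def)
  next
    case 3
    then have "(s + r)\<^sup>2 <= r\<^sup>2" by (intro power_mono) auto
    then show ?thesis using 3 by (simp add: max_def)
  qed (simp add: max_def)
qed

text \<open>For \<open>norm z \<le> 2\<close> the increment \<open>r\<close> of
  \<open>1 - (norm z)\<^sup>2\<close> is at most \<open>5 * norm v\<close>. So 27 is
  \<open>5\<^sup>2\<close>, from the remainder of the squared positive part, plus 2, from the
  quadratic term of \<open>r\<close>. For larger \<open>z\<close> both values and the gradient
  vanish.\<close>

lemma bump_second_order:
  assumes v: "norm v <= 1"
  shows "\<bar>bump (z + v) - bump z - bump_grad z \<bullet> v\<bar> <= 27 * (norm v)\<^sup>2"
proof (cases "norm z <= 2")
  case True
  define s where "s = 1 - (norm z)\<^sup>2"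
  define r where "r = - (2 * (z \<bullet> v) + (norm v)\<^sup>2)"
  have sr: "1 - (norm (z + v))\<^sup>2 = s + r" by (simp add: s_def r_def power2_norm_eq_inner inner_add inner_commute)
  have zv: "\<bar>z \<bullet> v\<bar> <= 2 * norm v" using Cauchy_Schwarz_ineq2[of z v] mult_right_mono[OF True, of "norm v"] by simp
  have v2: "(norm v)\<^sup>2 <= norm v" using v by (simp add: power2_eq_square mult_left_le)
  have "\<bar>r\<bar> <= 5 * norm v" unfolding r_def using zv v2 by (smt (verit) zero_le_power2)
  then have "\<bar>r\<bar>\<^sup>2 <= (5 * norm v)\<^sup>2" by (intro power_mono) auto
  then have r2: "r\<^sup>2 <= 25 * (norm v)\<^sup>2" by (simp add: power_mult_distrib)
  have "bump (z + v) - bump z - bump_grad z \<bullet> v = ((max 0 (s + r))\<^sup>2 - (max 0 s)\<^sup>2 - 2 * max 0 s * r) - 2 * max 0 s * (norm v)\<^sup>2"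
    unfolding bump_def bump_grad_def sr s_def[symmetric] by (simp add: r_def algebra_simps)
  moreover have "\<bar>2 * max 0 s * (norm v)\<^sup>2\<bar> <= 2 * (norm v)\<^sup>2" by (simp add: abs_mult s_def mult_left_le_one_le)
  ultimately show ?thesis using max_square_second_order[of s r] r2 by linarith
next
  case False
  have "norm z <= norm (z + v) + norm v" using norm_triangle_ineq4[of "z + v" v] by simp
  then have "1 <= norm (z + v)" "1 <= norm z" using False v by auto
  then have "1 <= (norm (z + v))\<^sup>2" "1 <= (norm z)\<^sup>2" by auto
  then show ?thesis by (simp add: bump_def bump_grad_def max_def)
qed

lemma bump_grad_bound: "norm (bump_grad z) <= 4"
proof (cases "norm z <= 1")
  case True
  have "max 0 (1 - (norm z)\<^sup>2) * norm z <= 1 * 1" using True by (intro mult_mono) auto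
  then show ?thesis by (simp add: bump_grad_def abs_mult)
next
  case False
  then have "1 <= (norm z)\<^sup>2" by auto
  then show ?thesis by (simp add: bump_grad_def max_def)
qed

lemma smoothing_kernel:
  assumes "0 < t"
  obtains k :: "'a::euclidean_space => real" and g :: "'a => 'a" and C :: real
  where "k \<in> borel_measurable borel" "g \<in> borel_measurable borel" "0 <= C"
    "\<And>z. 0 <= k z" "\<And>z. t < norm z ==> k z = 0" "\<And>z. k z <= C" "(\<integral>\<^sup>+z. ennreal (k z)) = 1"
    "\<And>z v. norm v <= t ==> \<bar>k (z + v) - k z - g z \<bullet> v\<bar> <= C * (norm v)\<^sup>2"
    "\<And>z. norm (g z) <= C"
proof -
  have [measurable]: "bump \<in> borel_measurable (borel :: 'a measure)" "bump_grad \<in> borel_measurable (borel :: 'a measure)"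
    unfolding bump_def bump_grad_def by measurable
  define b where "b z = bump (z /\<^sub>R t)" for z :: 'a
  have [measurable]: "b \<in> borel_measurable borel" unfolding b_def by measurable
  have b_zero: "b z = 0" if "t < norm z" for z
  proof -
    have "1 <= norm (z /\<^sub>R t)" using that assms by (simp add: field_simps)
    then have "1 <= (norm (z /\<^sub>R t))\<^sup>2" by (metis one_le_power)
    then show ?thesis by (simp only: b_def bump_def) (simp add: max_def)
  qed
  have b_nonneg: "0 <= b z" for z by (simp add: b_def bump_def)
  have b_le: "b z <= 1" for z unfolding b_def bump_def by (intro power_le_one) auto
  define I where "I = (\<integral>\<^sup>+z. ennreal (b z))"
  have "I <= (\<integral>\<^sup>+z. indicator (cball (0::'a) t) z)" unfolding I_def
  proof (rule nn_integral_mono)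
    fix z :: 'a
    show "ennreal (b z) <= indicator (cball 0 t) z" using b_le[of z] b_zero[of z] by (cases "norm z <= t") auto
  qed
  also have "... < \<infinity>" using emeasure_lborel_cball_finite[of "0::'a" t] by simp
  finally have I_fin: "I < \<infinity>" .
  \<comment> \<open>A positive lower bound for the mass, so that the kernel can be
    normalised.\<close>
  have "ennreal (1/4) * leb (cball (0::'a) (t / 2)) = (\<integral>\<^sup>+z. ennreal (1/4) * indicator (cball (0::'a) (t / 2)) z)"
    by (subst nn_integral_cmult) auto
  also have "... <= I" unfolding I_def
  proof (rule nn_integral_mono)
    fix z :: 'a
    have "1/4 <= b z" if "norm z <= t / 2"
    proof -
      define n where "n = norm (z /\<^sub>R t)"
      have "n <= 1/2" "0 <= n" using that assms by (simp_all add: n_def field_simps)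
      then have "n * n <= 1/2 * (1/2)" by (intro mult_mono) auto
      then have "1/2 <= max 0 (1 - (norm (z /\<^sub>R t))\<^sup>2)" unfolding n_def[symmetric] power2_eq_square by simp
      then have "(1/2)\<^sup>2 <= b z" unfolding b_def bump_def by (rule power_mono) simp
      then show ?thesis by (simp add: power2_eq_square)
    qed
    then show "ennreal (1/4) * indicator (cball (0::'a) (t / 2)) z <= ennreal (b z)"
      by (auto simp: indicator_def intro: ennreal_leI)
  qed
  finally have "ennreal (1/4) * leb (cball (0::'a) (t / 2)) <= I" .
  moreover have "0 < ennreal (1/4) * leb (cball (0::'a) (t / 2))"
    using assms by (simp add: emeasure_cball ennreal_zero_less_mult_iff)
  ultimately have I_pos: "0 < I" by simp
  define c where "c = enn2real I"
  have c: "0 < c" "I = ennreal c" using I_fin I_pos by (auto simp: c_def enn2real_positive_iff)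
  define k where "k z = b z / c" for z
  define g where "g z = (1 / (c * t)) *\<^sub>R bump_grad (z /\<^sub>R t)" for z :: 'a
  define C where "C = 1 / c + 27 / (c * t\<^sup>2) + 4 / (c * t)"
  have Cle: "1 / c <= C" "27 / (c * t\<^sup>2) <= C" "4 / (c * t) <= C" using c(1) assms by (auto simp: C_def)
  show ?thesis
  proof
    show "k \<in> borel_measurable borel" "g \<in> borel_measurable borel" unfolding k_def g_def by measurable
    show "0 <= C" using Cle(1) c(1) by (meson order_trans less_imp_le zero_le_divide_1_iff)
    show "0 <= k z" for z using b_nonneg[of z] c by (simp add: k_def)
    show "k z = 0" if "t < norm z" for z using b_zero[OF that] by (simp add: k_def)
    show "k z <= C" for z
    proof -
      have "k z <= 1 / c" unfolding k_def using b_le[of z] c(1) by (intro divide_right_mono) auto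
      then show ?thesis using Cle(1) by simp
    qed
    have "(\<integral>\<^sup>+z. ennreal (k z)) = (\<integral>\<^sup>+z. ennreal (1 / c) * ennreal (b z))"
      using c b_nonneg by (intro nn_integral_cong) (simp add: k_def ennreal_mult[symmetric])
    also have "... = ennreal (1 / c) * ennreal c"
      by (subst nn_integral_cmult) (auto simp: I_def[symmetric] c(2)[symmetric])
    finally show "(\<integral>\<^sup>+z. ennreal (k z)) = 1" using c(1) by (simp add: ennreal_mult[symmetric])
    show "norm (g z) <= C" for z
    proof -
      have "norm (g z) <= (1 / (c * t)) * 4"
        unfolding g_def using c(1) assms bump_grad_bound[of "z /\<^sub>R t"] by (simp add: divide_right_mono)
      then show ?thesis using Cle(3) by simp
    qed
    show "\<bar>k (z + v) - k z - g z \<bullet> v\<bar> <= C * (norm v)\<^sup>2" if v: "norm v <= t" for z v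
    proof -
      have v1: "norm (v /\<^sub>R t) <= 1" using v assms by (simp add: field_simps)
      have "k (z + v) - k z - g z \<bullet> v
          = (bump (z /\<^sub>R t + v /\<^sub>R t) - bump (z /\<^sub>R t) - bump_grad (z /\<^sub>R t) \<bullet> (v /\<^sub>R t)) / c"
        using c(1) assms by (simp add: k_def b_def g_def scaleR_add_right diff_divide_distrib divide_inverse algebra_simps)
      then have "\<bar>k (z + v) - k z - g z \<bullet> v\<bar> 
          = \<bar>bump (z /\<^sub>R t + v /\<^sub>R t) - bump (z /\<^sub>R t) - bump_grad (z /\<^sub>R t) \<bullet> (v /\<^sub>R t)\<bar> / c"
        using c(1) by (simp only: abs_divide abs_of_pos)
      also have "... <= (27 * (norm (v /\<^sub>R t))\<^sup>2) / c" using c(1) by (intro divide_right_mono bump_second_order v1) auto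
      also have "... = 27 / (c * t\<^sup>2) * (norm v)\<^sup>2"
        using assms c(1) by (simp add: power_mult_distrib power_inverse divide_inverse)
      also have "... <= C * (norm v)\<^sup>2" using Cle(2) by (intro mult_right_mono) auto
      finally show ?thesis .
    qed
  qed
qed

subsection \<open>From mean oscillation to a derivative\<close>

text \<open>The deviation from the affine map has a mean of order \<open>\<kappa> * r\<close> on
  small balls; the volume constant is left inside \<open>\<kappa>\<close>. With
  \<open>\<kappa>\<close> fixed, \<open>L\<close> is only an approximate derivative of a certain
  quality; the derivative arises as a limit of such maps.\<close>

definition mean_diff :: "('a::euclidean_space => 'b::real_normed_vector) => 'a => ('a => 'b) => real => bool" where
  "mean_diff \<phi> a L \<kappa> \<longleftrightarrow> (\<exists>\<delta>>0. \<forall>r. 0 < r --> r <= \<delta> -->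
     (\<integral>\<^sup>+y. enorm (\<phi> y - \<phi> a - L (y - a)) * indicator (cball a r) y) <= ennreal (\<kappa> * r ^ (DIM('a) + 1)))"

text \<open>For \<open>norm s \<le> 1/2\<close> the points \<open>s\<close> and
  \<open>s + b /\<^sub>R 2\<close> both lie in the unit ball, and the values of \<open>D\<close>
  there differ by half of \<open>D b\<close>.\<close>

lemma linear_mean_lower_bound:
  fixes D :: "'a::euclidean_space => 'b::{real_normed_vector, second_countable_topology}"
  assumes D: "linear D" and b: "norm b = 1"
  shows "enorm (D b) * ennreal (unit_ball_vol DIM('a) * (1/2) ^ DIM('a) / 4)
    <= (\<integral>\<^sup>+s. enorm (D s) * indicator (cball 0 1) s)" (is "_ <= ?I")
proof -
  have [measurable]: "D \<in> borel_measurable borel"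
    using linear_continuous_on[OF linear_conv_bounded_linear[THEN iffD1, OF D]]
    by (rule borel_measurable_continuous_onI)
  have "ennreal (norm (D b) / 2) * ennreal (unit_ball_vol DIM('a) * (1/2) ^ DIM('a))
      = (\<integral>\<^sup>+s. ennreal (norm (D b) / 2) * indicator (cball (0::'a) (1/2)) s)"
    by (subst nn_integral_cmult) (auto simp: emeasure_cball)
  also have "... <= (\<integral>\<^sup>+s. enorm (D (s + b /\<^sub>R 2)) * indicator (cball 0 1) (s + b /\<^sub>R 2) + enorm (D s) * indicator (cball 0 1) s)"
  proof (rule nn_integral_mono)
    fix s :: 'a
    show "ennreal (norm (D b) / 2) * indicator (cball (0::'a) (1/2)) s
        <= enorm (D (s + b /\<^sub>R 2)) * indicator (cball 0 1) (s + b /\<^sub>R 2) + enorm (D s) * indicator (cball 0 1) s"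
    proof (cases "s \<in> cball 0 (1/2)")
      case True
      then have "norm (s + b /\<^sub>R 2) <= 1" using norm_triangle_ineq[of s "b /\<^sub>R 2"] b by simp
      moreover have "norm (D b) / 2 <= norm (D (s + b /\<^sub>R 2)) + norm (D s)"
        using norm_triangle_ineq4[of "D (s + b /\<^sub>R 2)" "D s"] by (simp add: linear_add[OF D] linear_scale[OF D])
      ultimately show ?thesis using True
        by (auto simp: ennreal_plus[symmetric] simp del: ennreal_plus intro: ennreal_leI)
    qed simp
  qed
  also have "... = (\<integral>\<^sup>+s. enorm (D (s + b /\<^sub>R 2)) * indicator (cball 0 1) (s + b /\<^sub>R 2)) + ?I"
    by (rule nn_integral_add) measurable
  also have "(\<integral>\<^sup>+s. enorm (D (s + b /\<^sub>R 2)) * indicator (cball 0 1) (s + b /\<^sub>R 2)) = ?I"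
    by (rule nn_integral_translate[of "\<lambda>s. enorm (D s) * indicator (cball 0 1) s"]) measurable
  finally have "ennreal (1/2) * (ennreal (norm (D b) / 2) * ennreal (unit_ball_vol DIM('a) * (1/2) ^ DIM('a))) <= ennreal (1/2) * (?I + ?I)"
    by (intro mult_left_mono) auto
  also have "ennreal (1/2) * (?I + ?I) = ?I"
  proof -
    have "ennreal (1/2) + ennreal (1/2) = 1" by (subst ennreal_plus[symmetric]) auto
    then show ?thesis by (simp only: distrib_left distrib_right[symmetric] mult_1)
  qed
  finally have le: "ennreal (1/2) * (ennreal (norm (D b) / 2) * ennreal (unit_ball_vol DIM('a) * (1/2) ^ DIM('a))) <= ?I" .
  have "enorm (D b) * ennreal (V / 4) = ennreal (1/2) * (ennreal (norm (D b) / 2) * ennreal V)" if "0 <= V" for V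
  proof -
    have "enorm (D b) * ennreal (V / 4) = ennreal (norm (D b) * (V / 4))"
      using that by (intro ennreal_mult[symmetric]) auto
    also have "norm (D b) * (V / 4) = 1/2 * (norm (D b) / 2 * V)" by simp
    also have "ennreal ... = ennreal (1/2) * ennreal (norm (D b) / 2 * V)" using that by (intro ennreal_mult) auto
    also have "ennreal (norm (D b) / 2 * V) = ennreal (norm (D b) / 2) * ennreal V"
      using that by (intro ennreal_mult) auto
    finally show ?thesis .
  qed
  then show ?thesis using le by simp
qed

text \<open>The difference of the two linear maps has a small mean on balls, and a linear map is
  controlled by such a mean.\<close>

lemma mean_diff_combine:
  fixes \<phi> :: "'a::euclidean_space => 'b::{real_normed_vector, second_countable_topology}"
  assumes [measurable]: "\<phi> \<in> borel_measurable borel"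
    and L: "linear L" "mean_diff \<phi> a L \<kappa>" and L': "linear L'" "mean_diff \<phi> a L' \<kappa>'"
    and b: "norm b = 1" and \<kappa>: "0 <= \<kappa>" "0 <= \<kappa>'"
  shows "norm (L b - L' b) * (unit_ball_vol DIM('a) * (1/2) ^ DIM('a) / 4) <= \<kappa> + \<kappa>'"
proof -
  define D where "D s = L s - L' s" for s
  have D: "linear D" unfolding D_def by (intro linear_compose_sub L L')
  have [measurable]: "L \<in> borel_measurable borel" "L' \<in> borel_measurable borel" "D \<in> borel_measurable borel"
    using L(1) L'(1) D
    by (auto intro!: borel_measurable_continuous_onI linear_continuous_on linear_conv_bounded_linear[THEN iffD1])
  obtain \<delta> \<delta>' where d: "0 < \<delta>" "0 < \<delta>'"
    "\<And>r. 0 < r ==> r <= \<delta> ==> (\<integral>\<^sup>+y. enorm (\<phi> y - \<phi> a - L (y - a)) * indicator (cball a r) y) <= ennreal (\<kappa> * r ^ (DIM('a) + 1))"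
    "\<And>r. 0 < r ==> r <= \<delta>' ==> (\<integral>\<^sup>+y. enorm (\<phi> y - \<phi> a - L' (y - a)) * indicator (cball a r) y) <= ennreal (\<kappa>' * r ^ (DIM('a) + 1))"
    using L(2) L'(2) unfolding mean_diff_def by blast
  define r where "r = min \<delta> \<delta>'"
  have r: "0 < r" "r <= \<delta>" "r <= \<delta>'" using d by (auto simp: r_def)
  have "ennreal (r ^ (DIM('a) + 1)) * (\<integral>\<^sup>+s. enorm (D s) * indicator (cball 0 1) s)
      = ennreal (r ^ DIM('a)) * (\<integral>\<^sup>+s. ennreal r * (enorm (D s) * indicator (cball 0 1) s))"
    using r(1) by (subst nn_integral_cmult) (auto simp: ennreal_mult mult_ac)
  also have "(\<integral>\<^sup>+s. ennreal r * (enorm (D s) * indicator (cball 0 1) s))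
      = (\<integral>\<^sup>+s. enorm (D (a + r *\<^sub>R s - a)) * indicator (cball 0 1) s)"
    using r(1) by (intro nn_integral_cong) (simp add: linear_scale[OF D] ennreal_mult mult_ac)
  also have "ennreal (r ^ DIM('a)) * ... = (\<integral>\<^sup>+y. enorm (D (y - a)) * indicator (cball a (r * 1)) y)"
    by (rule nn_integral_cball_rescale[symmetric, OF _ r(1)]) measurable
  also have "... <= (\<integral>\<^sup>+y. enorm (\<phi> y - \<phi> a - L (y - a)) * indicator (cball a r) y
      + enorm (\<phi> y - \<phi> a - L' (y - a)) * indicator (cball a r) y)"
  proof (rule nn_integral_mono, goal_cases)
    case (1 y)
    have "norm (D (y - a)) <= norm (\<phi> y - \<phi> a - L (y - a)) + norm (\<phi> y - \<phi> a - L' (y - a))"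
      unfolding D_def using norm_triangle_ineq4[of "\<phi> y - \<phi> a - L' (y - a)" "\<phi> y - \<phi> a - L (y - a)"] by simp
    then show ?case by (auto simp: indicator_def ennreal_plus[symmetric] simp del: ennreal_plus intro: ennreal_leI)
  qed
  also have "... = (\<integral>\<^sup>+y. enorm (\<phi> y - \<phi> a - L (y - a)) * indicator (cball a r) y)
      + (\<integral>\<^sup>+y. enorm (\<phi> y - \<phi> a - L' (y - a)) * indicator (cball a r) y)" by (rule nn_integral_add) measurable
  also have "... <= ennreal (\<kappa> * r ^ (DIM('a) + 1)) + ennreal (\<kappa>' * r ^ (DIM('a) + 1))"
    using r by (intro add_mono d) auto
  also have "... = ennreal (r ^ (DIM('a) + 1)) * ennreal (\<kappa> + \<kappa>')"
    using r \<kappa> by (simp add: ennreal_mult[symmetric] ennreal_plus[symmetric] algebra_simps del: ennreal_plus)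
  finally have "(\<integral>\<^sup>+s. enorm (D s) * indicator (cball 0 1) s) <= ennreal (\<kappa> + \<kappa>')"
    using r(1) by (subst (asm) ennreal_mult_le_mult_iff) auto
  then have "enorm (D b) * ennreal (unit_ball_vol DIM('a) * (1/2) ^ DIM('a) / 4) <= ennreal (\<kappa> + \<kappa>')"
    using linear_mean_lower_bound[OF D b] by (rule order_trans[rotated])
  then have "ennreal (norm (D b) * (unit_ball_vol DIM('a) * (1/2) ^ DIM('a) / 4)) <= ennreal (\<kappa> + \<kappa>')"
    by (subst ennreal_mult) auto
  then show ?thesis using \<kappa> by (subst (asm) ennreal_le_iff) (auto simp: D_def)
qed

text \<open>By \<open>mean_diff_combine\<close>, approximate derivatives of quality
  \<open>(1/2) ^ n\<close> are Cauchy on each basis vector. The target is complete, and the domain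
  has finite dimension, so the limit map is approached uniformly on balls.\<close>

lemma mean_diff_limit:
  fixes \<phi> :: "'a::euclidean_space => 'b::{banach, second_countable_topology}"
  assumes [measurable]: "\<phi> \<in> borel_measurable borel"
    and ex: "\<And>\<kappa>. 0 < \<kappa> ==> \<exists>L. linear L \<and> mean_diff \<phi> a L \<kappa>"
  shows "\<exists>L. linear L \<and> (\<forall>\<kappa>>0. mean_diff \<phi> a L \<kappa>)"
proof -
  define c where "c = unit_ball_vol DIM('a) * (1/2) ^ DIM('a) / 4"
  have c: "0 < c" by (simp add: c_def)
  have "\<forall>n. \<exists>L. linear L \<and> mean_diff \<phi> a L ((1/2) ^ n)" using ex by simp
  then obtain L where L: "\<And>n. linear (L n)" "\<And>n. mean_diff \<phi> a (L n) ((1/2) ^ n)" by metis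
  have close: "norm (L n b - L k b) <= (2 / c) * (1/2) ^ N" if "b \<in> Basis" "N <= n" "N <= k" for n k N b
  proof -
    have "norm (L n b - L k b) * c <= (1/2) ^ n + (1/2) ^ k"
      unfolding c_def by (rule mean_diff_combine[OF _ L L]) (use that in auto)
    also have "... <= (1/2) ^ N + (1/2) ^ N" using that by (intro add_mono power_decreasing) auto
    finally show ?thesis using c by (simp add: field_simps)
  qed
  have "\<exists>l. (\<lambda>n. L n b) \<longlonglongrightarrow> l" if b: "b \<in> Basis" for b
  proof -
    have "Cauchy (\<lambda>n. L n b)"
    proof (rule metric_CauchyI)
      fix e :: real assume "0 < e"
      have "(\<lambda>N. (2 / c) * (1/2) ^ N) \<longlonglongrightarrow> (2 / c) * 0" by (intro tendsto_intros LIMSEQ_power_zero) auto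
      then have "\<forall>\<^sub>F N in sequentially. (2 / c) * (1/2) ^ N < e" using \<open>0 < e\<close> by (intro order_tendstoD(2)) auto
      then obtain N where "(2 / c) * (1/2) ^ N < e" by (auto simp: eventually_sequentially)
      then show "\<exists>M. \<forall>m\<ge>M. \<forall>n\<ge>M. dist (L m b) (L n b) < e"
        using close[OF b] by (intro exI[of _ N]) (auto simp: dist_norm intro: le_less_trans)
    qed
    then show ?thesis using Cauchy_convergent convergent_def by blast
  qed
  then obtain l where l: "\<And>b. b \<in> Basis ==> (\<lambda>n. L n b) \<longlonglongrightarrow> l b" by metis
  define M where "M v = (\<Sum>b\<in>Basis. (v \<bullet> b) *\<^sub>R l b)" for v :: 'a
  have M: "linear M"
    unfolding M_def by (intro linearI) (simp_all add: inner_add_left scaleR_add_left sum.distrib scaleR_sum_right)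
  have lim: "norm (L N b - l b) <= (2 / c) * (1/2) ^ N" if "b \<in> Basis" for b N
  proof (rule LIMSEQ_le_const2)
    show "(\<lambda>n. norm (L N b - L n b)) \<longlonglongrightarrow> norm (L N b - l b)" by (intro tendsto_intros l that)
  qed (use close[OF that, of N N] in auto)
  have LM: "norm (L N v - M v) <= (real DIM('a) * (2 / c) * (1/2) ^ N) * norm v" for N v
  proof -
    have "L N v = L N (\<Sum>b\<in>Basis. (v \<bullet> b) *\<^sub>R b)" by (simp add: euclidean_representation)
    also have "... = (\<Sum>b\<in>Basis. (v \<bullet> b) *\<^sub>R L N b)" by (simp add: linear_sum[OF L(1)] linear_scale[OF L(1)])
    finally have "L N v - M v = (\<Sum>b\<in>Basis. (v \<bullet> b) *\<^sub>R (L N b - l b))"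
      by (simp add: M_def sum_subtractf scaleR_diff_right)
    also have "norm ... <= (\<Sum>b\<in>(Basis :: 'a set). norm v * ((2 / c) * (1/2) ^ N))"
    proof (intro sum_norm_le)
      fix b :: 'a assume b: "b \<in> Basis"
      show "norm ((v \<bullet> b) *\<^sub>R (L N b - l b)) <= norm v * ((2 / c) * (1/2) ^ N)"
        unfolding norm_scaleR by (intro mult_mono lim b Basis_le_norm) auto
    qed
    finally show ?thesis by (simp add: mult_ac)
  qed
  have "mean_diff \<phi> a M \<kappa>" if \<kappa>: "0 < \<kappa>" for \<kappa>
  proof -
    define w where "w = unit_ball_vol DIM('a)"
    define F where "F = 1 + real DIM('a) * (2 / c) * w"
    have F: "0 < F" using c by (simp add: F_def w_def add_pos_nonneg)
    have "(\<lambda>N. F * (1/2) ^ N) \<longlonglongrightarrow> F * 0" by (intro tendsto_intros LIMSEQ_power_zero) auto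
    then have "\<forall>\<^sub>F N in sequentially. F * (1/2) ^ N < \<kappa>" using \<kappa> by (intro order_tendstoD(2)) auto
    then obtain N where N: "F * (1/2) ^ N < \<kappa>" by (auto simp: eventually_sequentially)
    obtain \<delta> where d: "0 < \<delta>" "\<And>r. 0 < r ==> r <= \<delta> ==>
       (\<integral>\<^sup>+y. enorm (\<phi> y - \<phi> a - L N (y - a)) * indicator (cball a r) y) <= ennreal ((1/2) ^ N * r ^ (DIM('a) + 1))"
      using L(2)[of N] unfolding mean_diff_def by blast
    have "(\<integral>\<^sup>+y. enorm (\<phi> y - \<phi> a - M (y - a)) * indicator (cball a r) y) <= ennreal (\<kappa> * r ^ (DIM('a) + 1))"
      if r: "0 < r" "r <= \<delta>" for r
    proof -
      let ?q = "real DIM('a) * (2 / c) * (1/2) ^ N * r"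
      have [measurable]: "L N \<in> borel_measurable borel"
        using L(1)[of N] by (auto intro!: borel_measurable_continuous_onI linear_continuous_on linear_conv_bounded_linear[THEN iffD1])
      have q: "0 <= ?q" using r c by simp
      have "(\<integral>\<^sup>+y. enorm (\<phi> y - \<phi> a - M (y - a)) * indicator (cball a r) y)
         <= (\<integral>\<^sup>+y. enorm (\<phi> y - \<phi> a - L N (y - a)) * indicator (cball a r) y + ennreal ?q * indicator (cball a r) y)"
      proof (rule nn_integral_mono, goal_cases)
        case (1 y)
        have "norm (\<phi> y - \<phi> a - M (y - a)) <= norm (\<phi> y - \<phi> a - L N (y - a)) + ?q" if "y \<in> cball a r"
        proof -
          have "norm (L N (y - a) - M (y - a)) <= (real DIM('a) * (2 / c) * (1/2) ^ N) * norm (y - a)" by (rule LM)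
          also have "... <= ?q" using that c by (intro mult_left_mono) (auto simp: dist_norm norm_minus_commute)
          finally show ?thesis using norm_triangle_ineq[of "\<phi> y - \<phi> a - L N (y - a)" "L N (y - a) - M (y - a)"] by simp
        qed
        then show ?case
          using q by (auto simp: indicator_def ennreal_plus[symmetric] simp del: ennreal_plus intro: ennreal_leI)
      qed
      also have "... = (\<integral>\<^sup>+y. enorm (\<phi> y - \<phi> a - L N (y - a)) * indicator (cball a r) y) + ennreal ?q * leb (cball a r)"
        by (subst nn_integral_add) (auto simp: nn_integral_cmult)
      also have "... <= ennreal ((1/2) ^ N * r ^ (DIM('a) + 1)) + ennreal ?q * ennreal (w * r ^ DIM('a))"
        using r by (intro add_mono d) (auto simp: emeasure_cball w_def)
      also have "... = ennreal (F * (1/2) ^ N * r ^ (DIM('a) + 1))"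
      proof -
        have "F * (1/2) ^ N * r ^ (DIM('a) + 1) = (1/2) ^ N * r ^ (DIM('a) + 1) + ?q * (w * r ^ DIM('a))"
          by (simp add: F_def algebra_simps)
        moreover have "ennreal ?q * ennreal (w * r ^ DIM('a)) = ennreal (?q * (w * r ^ DIM('a)))"
          using q r by (intro ennreal_mult[symmetric]) (auto simp: w_def)
        moreover have "0 <= (1/2) ^ N * r ^ (DIM('a) + 1)" "0 <= ?q * (w * r ^ DIM('a))"
          using r by (simp, intro mult_nonneg_nonneg q, simp_all add: w_def)
        ultimately show ?thesis by (simp only: ennreal_plus)
      qed
      also have "... <= ennreal (\<kappa> * r ^ (DIM('a) + 1))" using N r by (intro ennreal_leI mult_right_mono) auto
      finally show ?thesis .
    qed
    then show ?thesis unfolding mean_diff_def using d(1) by blast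
  qed
  then show ?thesis using M by blast
qed

text \<open>Density zero in terms of \<open>lborel\<close> and extended reals, which suits Borel
  sets and covering arguments; \<open>density_zeroI\<close> passes to
  \<open>density_zero\<close>.\<close>

definition dens0 :: "'a::euclidean_space set => 'a => bool" where
  "dens0 S a \<longleftrightarrow> (\<forall>\<kappa>>0. \<exists>\<delta>>0. \<forall>r. 0 < r --> r <= \<delta> -->
     leb (S \<inter> cball a r) <= ennreal \<kappa> * leb (cball a r))"

lemma dens0_Un:
  assumes "dens0 S a" "dens0 T a" and [measurable]: "S \<in> sets borel" "T \<in> sets borel"
  shows "dens0 (S \<union> T) a" unfolding dens0_def
proof (intro allI impI)
  fix \<kappa> :: real assume "0 < \<kappa>"
  then have k: "0 < \<kappa> / 2" by simp
  obtain \<delta> where 1: "0 < \<delta>"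
    "\<forall>r. 0 < r --> r <= \<delta> --> leb (S \<inter> cball a r) <= ennreal (\<kappa> / 2) * leb (cball a r)"
    using assms(1)[unfolded dens0_def, rule_format, OF k] by blast
  obtain \<delta>' where 2: "0 < \<delta>'"
    "\<forall>r. 0 < r --> r <= \<delta>' --> leb (T \<inter> cball a r) <= ennreal (\<kappa> / 2) * leb (cball a r)"
    using assms(2)[unfolded dens0_def, rule_format, OF k] by blast
  note d = 1 2
  have "leb ((S \<union> T) \<inter> cball a r) <= ennreal \<kappa> * leb (cball a r)" if r: "0 < r" "r <= min \<delta> \<delta>'" for r
  proof -
    have "leb ((S \<union> T) \<inter> cball a r) <= leb (S \<inter> cball a r) + leb (T \<inter> cball a r)"
      unfolding Int_Un_distrib2 by (rule emeasure_subadditive) auto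
    also have "... <= ennreal (\<kappa> / 2) * leb (cball a r) + ennreal (\<kappa> / 2) * leb (cball a r)"
      using d r by (intro add_mono) auto
    also have "... = (ennreal (\<kappa> / 2) + ennreal (\<kappa> / 2)) * leb (cball a r)" by (simp only: distrib_right)
    also have "ennreal (\<kappa> / 2) + ennreal (\<kappa> / 2) = ennreal \<kappa>" using \<open>0 < \<kappa>\<close> by (subst ennreal_plus[symmetric]) auto
    finally show ?thesis .
  qed
  then show "\<exists>\<delta>>0. \<forall>r. 0 < r --> r <= \<delta> --> leb ((S \<union> T) \<inter> cball a r) <= ennreal \<kappa> * leb (cball a r)"
    using d by (intro exI[of _ "min \<delta> \<delta>'"]) auto
qed

lemma mean_diff_imp_dens0:
  fixes \<phi> :: "'a::euclidean_space => 'b::{real_normed_vector, second_countable_topology}"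
  assumes [measurable]: "\<phi> \<in> borel_measurable borel" and L: "linear L"
    and md: "\<And>\<kappa>. 0 < \<kappa> ==> mean_diff \<phi> a L \<kappa>" and \<e>: "0 < \<e>"
  shows "dens0 {y. \<e> * norm (y - a) < norm (\<phi> y - \<phi> a - L (y - a))} a" unfolding dens0_def
proof (intro allI impI)
  let ?E = "\<lambda>y. norm (\<phi> y - \<phi> a - L (y - a))"
  have [measurable]: "L \<in> borel_measurable borel"
    using L by (auto intro!: borel_measurable_continuous_onI linear_continuous_on linear_conv_bounded_linear[THEN iffD1])
  define m where "m = DIM('a)"
  have m: "m \<ge> 1" unfolding m_def by simp
  define w where "w = unit_ball_vol m"
  have w: "0 < w" by (simp add: w_def)
  fix \<kappa> :: real assume \<kappa>: "0 < \<kappa>"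
  \<comment> \<open>Close to \<open>a\<close> the threshold \<open>\<e> * norm (y - a)\<close> is
    too weak for Markov's inequality, so the ball of radius \<open>\<theta> * r\<close> is given
    away at the price \<open>\<theta> ^ m \<le> \<kappa> / 2\<close>; \<open>k\<close> below makes
    Markov's inequality cost the other half.\<close>
  define \<theta> where "\<theta> = min 1 (\<kappa> / 2)"
  have \<theta>: "0 < \<theta>" "\<theta> <= 1" "\<theta> <= \<kappa> / 2" using \<kappa> by (auto simp: \<theta>_def)
  have \<theta>m: "\<theta> ^ m <= \<kappa> / 2"
  proof -
    have "\<theta> ^ m <= \<theta> ^ 1" using \<theta> m by (intro power_decreasing) auto
    then show ?thesis using \<theta> by simp
  qed
  define k where "k = \<kappa> / 2 * (\<e> * \<theta> * w)"
  have k: "0 < k" using \<kappa> \<e> \<theta> w by (simp add: k_def)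
  obtain \<delta> where d: "0 < \<delta>" "\<And>r. 0 < r ==> r <= \<delta> ==>
     (\<integral>\<^sup>+y. ennreal (?E y) * indicator (cball a r) y) <= ennreal (k * r ^ (DIM('a) + 1))"
    using md[OF k] unfolding mean_diff_def by blast
  have "leb ({y. \<e> * norm (y - a) < ?E y} \<inter> cball a r) <= ennreal \<kappa> * leb (cball a r)"
    if r: "0 < r" "r <= \<delta>" for r
  proof -
    let ?B = "cball a r"
    have "{y. \<e> * norm (y - a) < ?E y} \<inter> ?B \<subseteq> cball a (\<theta> * r) \<union> {y\<in>?B. 1 <= ennreal (1 / (\<e> * \<theta> * r)) * ennreal (?E y)}"
    proof
      fix y assume y: "y \<in> {y. \<e> * norm (y - a) < ?E y} \<inter> ?B"
      show "y \<in> cball a (\<theta> * r) \<union> {y\<in>?B. 1 <= ennreal (1 / (\<e> * \<theta> * r)) * ennreal (?E y)}"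
      proof (cases "y \<in> cball a (\<theta> * r)")
        case False
        then have "\<e> * (\<theta> * r) <= \<e> * norm (y - a)"
          using \<e> by (intro mult_left_mono) (auto simp: dist_norm norm_minus_commute)
        also have "... < ?E y" using y by simp
        finally have "1 <= 1 / (\<e> * \<theta> * r) * ?E y" using \<e> \<theta> r by (simp add: field_simps)
        then have "ennreal 1 <= ennreal (1 / (\<e> * \<theta> * r) * ?E y)" by (rule ennreal_leI)
        also have "... = ennreal (1 / (\<e> * \<theta> * r)) * ennreal (?E y)" using \<e> \<theta> r by (intro ennreal_mult) auto
        finally show ?thesis using y by simp
      qed simp
    qed
    then have "leb ({y. \<e> * norm (y - a) < ?E y} \<inter> ?B)
        <= leb (cball a (\<theta> * r) \<union> {y\<in>?B. 1 <= ennreal (1 / (\<e> * \<theta> * r)) * ennreal (?E y)})"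
      by (rule emeasure_mono) measurable
    also have "... <= leb (cball a (\<theta> * r)) + leb {y\<in>?B. 1 <= ennreal (1 / (\<e> * \<theta> * r)) * ennreal (?E y)}"
      by (rule emeasure_subadditive) measurable
    also have "leb {y\<in>?B. 1 <= ennreal (1 / (\<e> * \<theta> * r)) * ennreal (?E y)}
        <= ennreal (1 / (\<e> * \<theta> * r)) * (\<integral>\<^sup>+y. ennreal (?E y) * indicator ?B y)"
      by (rule nn_integral_Markov_inequality) auto
    also have "... <= ennreal (1 / (\<e> * \<theta> * r)) * ennreal (k * r ^ (DIM('a) + 1))" by (intro mult_left_mono d r) auto
    also have "... = ennreal (\<kappa> / 2 * (w * r ^ m))"
    proof -
      have "1 / (\<e> * \<theta> * r) * (k * r ^ (DIM('a) + 1)) = \<kappa> / 2 * (w * r ^ m)" using \<e> \<theta> r by (simp add: k_def m_def)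
      moreover have "ennreal (1 / (\<e> * \<theta> * r)) * ennreal (k * r ^ (DIM('a) + 1)) = ennreal (1 / (\<e> * \<theta> * r) * (k * r ^ (DIM('a) + 1)))"
        using \<e> \<theta> r k by (intro ennreal_mult[symmetric]) auto
      ultimately show ?thesis by (simp only:)
    qed
    also have "leb (cball a (\<theta> * r)) = ennreal (\<theta> ^ m * (w * r ^ m))"
      using \<theta> r by (simp add: emeasure_cball w_def m_def power_mult_distrib mult_ac)
    also have "ennreal (\<theta> ^ m * (w * r ^ m)) + ennreal (\<kappa> / 2 * (w * r ^ m)) <= ennreal (\<kappa> / 2 * (w * r ^ m)) + ennreal (\<kappa> / 2 * (w * r ^ m))"
      using \<theta>m w r by (intro add_right_mono ennreal_leI mult_right_mono) auto
    also have "... = ennreal (\<kappa> * (w * r ^ m))" using \<kappa> w r by (subst ennreal_plus[symmetric]) auto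
    also have "... = ennreal \<kappa> * leb ?B" using \<kappa> w r by (simp add: emeasure_cball w_def m_def ennreal_mult)
    finally show ?thesis by (simp add: add_left_mono add_right_mono)
  qed
  then show "\<exists>\<delta>>0. \<forall>r. 0 < r --> r <= \<delta> --> leb ({y. \<e> * norm (y - a) < ?E y} \<inter> cball a r) <= ennreal \<kappa> * leb (cball a r)"
    using d(1) by blast
qed

locale banach_sobolev_map = sobolev_map \<phi> R M p
  for \<phi> :: "'a::euclidean_space => 'b::{real_inner, banach, second_countable_topology}" and R M p
begin

lemma integrable: "integrable lborel \<phi>"
proof (rule integrableI_bounded)
  obtain M1 where M1: "0 <= M1" 
    "\<And>v. (\<integral>\<^sup>+x. enorm (\<phi> (x + v) - \<phi> x)) <= ennreal (M1 * norm v)" using transl_1 by blast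
  obtain b :: 'a where b: "b \<in> Basis" using nonempty_Basis by blast
  \<comment> \<open>A translation by more than \<open>2 * R\<close> moves the support off itself, so
    one increment of \<open>\<phi>\<close> already dominates \<open>\<phi>\<close>.\<close>
  define v where "v = (2 * R + 1) *\<^sub>R b"
  have v: "norm v = 2 * R + 1" using b R by (simp add: v_def)
  have "(\<integral>\<^sup>+x. enorm (\<phi> x)) <= (\<integral>\<^sup>+x. enorm (\<phi> (x + v) - \<phi> x))"
  proof (rule nn_integral_mono, goal_cases)
    case (1 x)
    show ?case
    proof (cases "norm x <= R")
      case True
      have "norm v <= norm (x + v) + norm x" using norm_triangle_ineq4[of "x + v" x] by simp
      then have "\<phi> (x + v) = 0" using True v R by (intro support) auto
      then show ?thesis by simp
    qed (simp add: support)
  qed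
  also have "... < \<infinity>" using M1(2)[of v] by (auto simp: less_top[symmetric] top_unique)
  finally show "(\<integral>\<^sup>+x. enorm (\<phi> x)) < \<infinity>" .
qed measurable

text \<open>Approximation by mollification: the kernel is once differentiable with Lipschitz gradient,
  which makes the convolution with an integrable map differentiable.\<close>

lemma smooth_approximation:
  assumes "0 < \<e>"
  obtains w where "w \<in> borel_measurable borel"
    "\<And>v. (\<integral>\<^sup>+x. enorm ((\<phi> (x + v) - w (x + v)) - (\<phi> x - w x))) <= ennreal (\<e> * norm v)"
    "\<And>a. \<exists>L. linear L \<and> (\<forall>\<e>>0. \<exists>\<delta>>0. \<forall>v. norm v <= \<delta> --> norm (w (a + v) - w a - L v) <= \<e> * norm v)"
proof -
  obtain t where t: "0 < t" "\<And>z v. norm z <= t ==> second_diff z v <= ennreal (\<e> * norm v)"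
    using second_diff_equicontinuous[OF assms] by blast
  obtain k :: "'a => real" and g :: "'a => 'a" and C :: real where
    km [measurable]: "k \<in> borel_measurable borel" and gm [measurable]: "g \<in> borel_measurable borel" and C: "0 <= C"
    and k: "\<And>z. 0 <= k z" "\<And>z. t < norm z ==> k z = 0" "\<And>z. k z <= C" "(\<integral>\<^sup>+z. ennreal (k z)) = 1"
    and kd: "\<And>z v. norm v <= t ==> \<bar>k (z + v) - k z - g z \<bullet> v\<bar> <= C * (norm v)\<^sup>2"
    and g: "\<And>z. norm (g z) <= C" by (rule smoothing_kernel[OF t(1)]) blast
  \<comment> \<open>With the variable inside the kernel, \<open>w\<close> inherits the regularity of
    \<open>k\<close>; \<open>w_alt\<close> moves it into \<open>\<phi>\<close> instead, which suits
    the translation estimate.\<close>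
  define w where "w x = (\<integral>y. k (y - x) *\<^sub>R \<phi> y \<partial>lborel)" for x
  have [measurable]: "w \<in> borel_measurable borel" unfolding w_def by measurable
  have int1: "integrable lborel (\<lambda>y. h y *\<^sub>R \<phi> y)" if "h \<in> borel_measurable borel" "\<And>y. \<bar>h y\<bar> <= B" for h B
  proof (rule Bochner_Integration.integrable_bound)
    show "integrable lborel (\<lambda>y. B *\<^sub>R \<phi> y)" using integrable by simp
    show "(\<lambda>y. h y *\<^sub>R \<phi> y) \<in> borel_measurable lborel" using that(1) by measurable
    have "0 <= B" using that(2)[of 0] by linarith
    then show "AE y in lborel. norm (h y *\<^sub>R \<phi> y) <= norm (B *\<^sub>R \<phi> y)" using that(2) by (auto intro!: mult_right_mono)
  qed
  have intk: "integrable lborel (\<lambda>y. k (y - x) *\<^sub>R \<phi> y)" for x using k(1,3) by (intro int1[where B=C]) auto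
  have kint: "integrable lborel k" "(\<integral>z. k z \<partial>lborel) = 1"
    using k by (auto intro!: integrableI_nonneg simp: integral_eq_nn_integral)
  have w_alt: "w x = (\<integral>z. k z *\<^sub>R \<phi> (x + z) \<partial>lborel)" "integrable lborel (\<lambda>z. k z *\<^sub>R \<phi> (x + z))" for x
  proof -
    have eq: "lborel = distr lborel borel ((+) x)" by (rule lborel_distr_plus[symmetric])
    show "w x = (\<integral>z. k z *\<^sub>R \<phi> (x + z) \<partial>lborel)" unfolding w_def by (subst eq, subst integral_distr) (auto simp: )
    have "integrable (distr lborel borel ((+) x)) (\<lambda>y. k (y - x) *\<^sub>R \<phi> y)"
      using intk[of x] by (simp add: lborel_distr_plus)
    then show "integrable lborel (\<lambda>z. k z *\<^sub>R \<phi> (x + z))" by (subst (asm) integrable_distr_eq) auto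
  qed
  \<comment> \<open>\<open>\<phi> - w\<close> averages differences of \<open>\<phi>\<close> with its
    translates by \<open>z\<close>, so its increments average second differences with
    \<open>norm z \<le> t\<close>.\<close>
  have e_eq: "(\<phi> (x + v) - w (x + v)) - (\<phi> x - w x)
      = (\<integral>z. k z *\<^sub>R ((\<phi> (x + v) - \<phi> (x + v + z)) - (\<phi> x - \<phi> (x + z))) \<partial>lborel)" (is "_ = integral\<^sup>L lborel ?F")
    and e_int: "integrable lborel (\<lambda>z. k z *\<^sub>R ((\<phi> (x + v) - \<phi> (x + v + z)) - (\<phi> x - \<phi> (x + z))))" for x v
  proof -
    have c: "\<phi> x = (\<integral>z. k z *\<^sub>R \<phi> x \<partial>lborel)" for x using kint by simp
    have ci: "integrable lborel (\<lambda>z. k z *\<^sub>R \<phi> x)" for x using kint by simp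
    note i = ci[of "x + v"] ci[of x] w_alt(2)[of "x + v"] w_alt(2)[of x]
    show "(\<phi> (x + v) - w (x + v)) - (\<phi> x - w x) = (\<integral>z. k z *\<^sub>R ((\<phi> (x + v) - \<phi> (x + v + z)) - (\<phi> x - \<phi> (x + z))) \<partial>lborel)"
      unfolding w_alt(1) scaleR_diff_right using i kint by (simp add: Bochner_Integration.integral_diff)
    show "integrable lborel (\<lambda>z. k z *\<^sub>R ((\<phi> (x + v) - \<phi> (x + v + z)) - (\<phi> x - \<phi> (x + z))))"
      unfolding scaleR_diff_right using i by (intro Bochner_Integration.integrable_diff) auto
  qed
  have transl_e: "(\<integral>\<^sup>+x. enorm ((\<phi> (x + v) - w (x + v)) - (\<phi> x - w x))) <= ennreal (\<e> * norm v)" for v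
  proof -
    let ?X = "\<lambda>x z. norm ((\<phi> (x + v) - \<phi> (x + v + z)) - (\<phi> x - \<phi> (x + z)))"
    have "(\<integral>\<^sup>+x. enorm ((\<phi> (x + v) - w (x + v)) - (\<phi> x - w x)))
       <= (\<integral>\<^sup>+x. (\<integral>\<^sup>+z. ennreal (k z) * ennreal (?X x z)))"
    proof (rule nn_integral_mono, goal_cases)
      case (1 x)
      have "enorm ((\<phi> (x + v) - w (x + v)) - (\<phi> x - w x))
          <= (\<integral>\<^sup>+z. enorm (k z *\<^sub>R ((\<phi> (x + v) - \<phi> (x + v + z)) - (\<phi> x - \<phi> (x + z)))))"
        unfolding e_eq by (rule integral_norm_bound_ennreal[OF e_int])
      then show ?case using k(1) by (simp add: ennreal_mult abs_of_nonneg)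
    qed
    also have "... = (\<integral>\<^sup>+z. (\<integral>\<^sup>+x. ennreal (k z) * ennreal (?X x z)))"
      by (rule lborel_pair.Fubini'[symmetric]) measurable
    also have "... = (\<integral>\<^sup>+z. ennreal (k z) * second_diff z v)"
      unfolding second_diff_def by (intro nn_integral_cong nn_integral_cmult) measurable
    also have "... <= (\<integral>\<^sup>+z. ennreal (k z) * ennreal (\<e> * norm v))"
    proof (rule nn_integral_mono, goal_cases)
      case (1 z)
      show ?case using k(2)[of z] t(2)[of z v] by (cases "norm z <= t") (auto intro: mult_left_mono)
    qed
    also have "... = ennreal (\<e> * norm v)" using k(4) by (simp add: nn_integral_multc)
    finally show ?thesis .
  qed
  have diff: "\<exists>L. linear L \<and> (\<forall>\<e>>0. \<exists>\<delta>>0. \<forall>v. norm v <= \<delta> --> norm (w (a + v) - w a - L v) <= \<e> * norm v)" for a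
  proof -
    \<comment> \<open>The minus sign is there because the variable enters the kernel as
      \<open>y - x\<close>.\<close>
    define L where "L v = (\<integral>y. (g (y - a) \<bullet> (- v)) *\<^sub>R \<phi> y \<partial>lborel)" for v
    have intg: "integrable lborel (\<lambda>y. (g (y - a) \<bullet> v) *\<^sub>R \<phi> y)" for v
    proof (rule int1[where B="C * norm v"])
      fix y
      have "\<bar>g (y - a) \<bullet> v\<bar> <= norm (g (y - a)) * norm v" by (rule Cauchy_Schwarz_ineq2)
      also have "... <= C * norm v" using g by (intro mult_right_mono) auto
      finally show "\<bar>g (y - a) \<bullet> v\<bar> <= C * norm v" .
    qed measurable
    have "linear L"
    proof (rule linearI)
      fix u v and c :: real
      have "(\<lambda>y. (g (y - a) \<bullet> - (u + v)) *\<^sub>R \<phi> y) = (\<lambda>y. (g (y - a) \<bullet> - u) *\<^sub>R \<phi> y + (g (y - a) \<bullet> - v) *\<^sub>R \<phi> y)"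
        by (simp add: inner_diff_right algebra_simps)
      then show "L (u + v) = L u + L v" unfolding L_def by (simp only: Bochner_Integration.integral_add intg)
      have "(\<lambda>y. (g (y - a) \<bullet> - (c *\<^sub>R v)) *\<^sub>R \<phi> y) = (\<lambda>y. c *\<^sub>R ((g (y - a) \<bullet> - v) *\<^sub>R \<phi> y))" by simp
      then show "L (c *\<^sub>R v) = c *\<^sub>R L v" unfolding L_def by (simp only: integral_scaleR_right)
    qed
    moreover have "\<exists>\<delta>>0. \<forall>v. norm v <= \<delta> --> norm (w (a + v) - w a - L v) <= \<e> * norm v" if \<e>: "0 < \<e>" for \<e> :: real
    proof -
      define I where "I = (\<integral>y. norm (\<phi> y) \<partial>lborel)"
      have I: "0 <= I" by (simp add: I_def)
      have quad: "norm (w (a + v) - w a - L v) <= (C * (norm v)\<^sup>2) * I" if v: "norm v <= t" for v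
      proof -
        have eq: "w (a + v) - w a - L v = (\<integral>y. (k (y - a + (- v)) - k (y - a) - g (y - a) \<bullet> (- v)) *\<^sub>R \<phi> y \<partial>lborel)"
          unfolding w_def L_def scaleR_diff_left using intk[of "a + v"] intk[of a] intg[of "- v"]
          by (simp add: Bochner_Integration.integral_diff Bochner_Integration.integrable_diff algebra_simps)
        have "norm (w (a + v) - w a - L v) <= (\<integral>y. norm ((k (y - a + (- v)) - k (y - a) - g (y - a) \<bullet> (- v)) *\<^sub>R \<phi> y) \<partial>lborel)"
          unfolding eq by (rule integral_norm_bound)
        also have "... <= (\<integral>y. (C * (norm v)\<^sup>2) * norm (\<phi> y) \<partial>lborel)"
        proof (rule Bochner_Integration.integral_mono)
          have b: "\<bar>k (y - a + (- v)) - k (y - a) - g (y - a) \<bullet> (- v)\<bar> <= C * (norm v)\<^sup>2" for y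
            using kd[of "- v" "y - a"] v by simp
          show "integrable lborel (\<lambda>y. norm ((k (y - a + (- v)) - k (y - a) - g (y - a) \<bullet> (- v)) *\<^sub>R \<phi> y))"
            by (intro integrable_norm int1[OF _ b]) measurable
          show "norm ((k (y - a + (- v)) - k (y - a) - g (y - a) \<bullet> (- v)) *\<^sub>R \<phi> y) <= (C * (norm v)\<^sup>2) * norm (\<phi> y)" for y
            unfolding norm_scaleR real_norm_def using b[of y] by (intro mult_right_mono) auto
        qed (use integrable in auto)
        finally show ?thesis by (simp add: I_def)
      qed
      define \<delta> where "\<delta> = min t (\<e> / (C * I + 1))"
      have "0 < C * I + 1" using C I by (simp add: add_nonneg_pos)
      moreover have "\<delta> <= \<e> / (C * I + 1)" by (simp add: \<delta>_def)
      ultimately have \<delta>: "0 < \<delta>" "\<delta> * (C * I + 1) <= \<e>"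
        using t(1) \<e> pos_le_divide_eq[of "C * I + 1" \<delta> \<e>] by (simp add: \<delta>_def, blast)
      have "norm (w (a + v) - w a - L v) <= \<e> * norm v" if v: "norm v <= \<delta>" for v
      proof -
        have "norm (w (a + v) - w a - L v) <= (norm v * (C * I)) * norm v"
          using quad[of v] v by (simp add: \<delta>_def power2_eq_square mult_ac)
        also have "... <= (\<delta> * (C * I + 1)) * norm v" using v C I \<delta> by (intro mult_right_mono mult_mono) auto
        also have "... <= \<e> * norm v" using \<delta> by (intro mult_right_mono) auto
        finally show ?thesis .
      qed
      then show ?thesis using \<delta>(1) by blast
    qed
    ultimately show ?thesis by blast
  qed
  show ?thesis by (rule that[of w]) (use transl_e diff in auto)
qed

lemma mean_diff_from_approximation:
  assumes [measurable]: "w \<in> borel_measurable borel" and \<eta>: "0 < \<eta>"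
    and osc: "\<And>r. 0 < r ==> r <= 1 ==>
      (\<integral>\<^sup>+y. enorm ((\<phi> y - w y) - (\<phi> a - w a)) * indicator (cball a r) y) <= ennreal (\<eta> * r ^ (DIM('a) + 1))"
    and diff: "linear L" "\<forall>\<e>>0. \<exists>\<delta>>0. \<forall>v. norm v <= \<delta> --> norm (w (a + v) - w a - L v) <= \<e> * norm v"
  shows "mean_diff \<phi> a L (\<eta> * (1 + unit_ball_vol DIM('a)))"
proof -
  have [measurable]: "L \<in> borel_measurable borel"
    using diff(1) by (auto intro!: borel_measurable_continuous_onI linear_continuous_on linear_conv_bounded_linear[THEN iffD1])
  obtain \<delta> where \<delta>: "0 < \<delta>" "\<And>v. norm v <= \<delta> ==> norm (w (a + v) - w a - L v) <= \<eta> * norm v" using diff(2) \<eta> by blast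
  have "(\<integral>\<^sup>+y. enorm (\<phi> y - \<phi> a - L (y - a)) * indicator (cball a r) y)
      <= ennreal (\<eta> * (1 + unit_ball_vol DIM('a)) * r ^ (DIM('a) + 1))" if r: "0 < r" "r <= min 1 \<delta>" for r
  proof -
    have "(\<integral>\<^sup>+y. enorm (\<phi> y - \<phi> a - L (y - a)) * indicator (cball a r) y)
        <= (\<integral>\<^sup>+y. enorm ((\<phi> y - w y) - (\<phi> a - w a)) * indicator (cball a r) y + ennreal (\<eta> * r) * indicator (cball a r) y)"
    proof (rule nn_integral_mono, goal_cases)
      case (1 y)
      have "norm (\<phi> y - \<phi> a - L (y - a)) <= norm ((\<phi> y - w y) - (\<phi> a - w a)) + \<eta> * r" if "y \<in> cball a r"
      proof -
        have ya: "norm (y - a) <= r" using that by (simp add: dist_norm norm_minus_commute)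
        have "norm (w (a + (y - a)) - w a - L (y - a)) <= \<eta> * norm (y - a)" using ya r by (intro \<delta>) auto
        also have "... <= \<eta> * r" using ya \<eta> by (intro mult_left_mono) auto
        finally have "norm (w y - w a - L (y - a)) <= \<eta> * r" by simp
        then show ?thesis
          using norm_triangle_ineq[of "(\<phi> y - w y) - (\<phi> a - w a)" "w y - w a - L (y - a)"] by (simp add: algebra_simps)
      qed
      then show ?case
        using \<eta> r by (auto simp: indicator_def ennreal_plus[symmetric] simp del: ennreal_plus intro: ennreal_leI)
    qed
    also have "... = (\<integral>\<^sup>+y. enorm ((\<phi> y - w y) - (\<phi> a - w a)) * indicator (cball a r) y) + ennreal (\<eta> * r) * leb (cball a r)"
      by (subst nn_integral_add) (auto simp: nn_integral_cmult)
    also have "... <= ennreal (\<eta> * r ^ (DIM('a) + 1)) + ennreal (\<eta> * r) * ennreal (unit_ball_vol DIM('a) * r ^ DIM('a))"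
      using r by (intro add_mono osc) (auto simp: emeasure_cball)
    also have "... = ennreal (\<eta> * r ^ (DIM('a) + 1) + \<eta> * r * (unit_ball_vol DIM('a) * r ^ DIM('a)))"
      using r \<eta> by (subst ennreal_mult[symmetric]) (auto simp: ennreal_plus[symmetric] simp del: ennreal_plus)
    also have "\<eta> * r ^ (DIM('a) + 1) + \<eta> * r * (unit_ball_vol DIM('a) * r ^ DIM('a)) = \<eta> * (1 + unit_ball_vol DIM('a)) * r ^ (DIM('a) + 1)"
      by (simp add: algebra_simps)
    finally show ?thesis .
  qed
  then show ?thesis unfolding mean_diff_def using \<delta>(1) by (intro exI[of _ "min 1 \<delta>"]) auto
qed

text \<open>Split \<open>\<phi>\<close> into a differentiable mollification \<open>w n\<close> and a
  remainder with translation constant \<open>(1/4) ^ n\<close>. The weak type estimate at level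
  \<open>(1/2) ^ n\<close> excludes a set of measure of order \<open>(1/2) ^ n\<close>, and by
  Borel-Cantelli almost every point is excluded only finitely often.\<close>

lemma AE_mean_differentiable:
  "AE a in lborel. \<exists>L. linear L \<and> (\<forall>\<kappa>>0. mean_diff \<phi> a L \<kappa>)"
proof -
  define c where "c = 8 * 40 ^ DIM('a) * unit_ball_vol DIM('a)"
  have c: "0 <= c" by (simp add: c_def)
  define P where "P n w A \<longleftrightarrow> w \<in> borel_measurable borel \<and> A \<in> sets borel \<and> leb A <= ennreal (c * (1/2) ^ n) \<and>
    (AE x in lborel. x \<notin> A --> (\<forall>r. 0 < r --> r <= 1 -->
      (\<integral>\<^sup>+y. enorm ((\<phi> y - w y) - (\<phi> x - w x)) * indicator (cball x r) y) <= ennreal ((1/2) ^ n * r ^ (DIM('a) + 1)))) \<and>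
    (\<forall>a. \<exists>L. linear L \<and> (\<forall>\<e>>0. \<exists>\<delta>>0. \<forall>v. norm v <= \<delta> --> norm (w (a + v) - w a - L v) <= \<e> * norm v))" for n w A
  have "\<exists>w A. P n w A" for n
  proof -
    have pos: "(0::real) < (1/4) ^ n" "(0::real) < (1/2) ^ n" by auto
    obtain w where w [measurable]: "w \<in> borel_measurable borel"
      and tw: "\<And>v. (\<integral>\<^sup>+x. enorm ((\<phi> (x + v) - w (x + v)) - (\<phi> x - w x))) <= ennreal ((1/4) ^ n * norm v)"
      and dw: "\<And>a. \<exists>L. linear L \<and> (\<forall>\<e>>0. \<exists>\<delta>>0. \<forall>v. norm v <= \<delta> --> norm (w (a + v) - w a - L v) <= \<e> * norm v)"
      by (rule smooth_approximation[OF pos(1)]) blast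
    obtain A where A: "A \<in> sets borel"
      "leb A <= ennreal (8 * 40 ^ DIM('a) * unit_ball_vol DIM('a) * (1/4) ^ n / (1/2) ^ n)"
      "AE x in lborel. x \<notin> A --> (\<forall>r. 0 < r --> r <= 1 -->
        (\<integral>\<^sup>+y. enorm ((\<phi> y - w y) - (\<phi> x - w x)) * indicator (cball x r) y) <= ennreal ((1/2) ^ n * r ^ (DIM('a) + 1)))"
      by (rule oscillation_weak_type[of "\<lambda>x. \<phi> x - w x" "(1/4) ^ n" "(1/2) ^ n"]) (use tw in auto)
    have "8 * 40 ^ DIM('a) * unit_ball_vol DIM('a) * (1/4) ^ n / (1/2) ^ n = c * (1/2::real) ^ n"
    proof -
      have "(4::real) ^ n = 2 ^ n * 2 ^ n" by (simp flip: power_mult_distrib)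
      then show ?thesis by (simp add: c_def power_one_over)
    qed
    then have "P n w A" using A w dw unfolding P_def by simp
    then show ?thesis by blast
  qed
  then obtain w A where P: "\<And>n. P n (w n) (A n)" by metis
  have w: "\<And>n. w n \<in> borel_measurable borel" and A: "\<And>n. A n \<in> sets borel"
    "\<And>n. leb (A n) <= ennreal (c * (1/2) ^ n)"
    and osc: "\<And>n. AE x in lborel. x \<notin> A n --> (\<forall>r. 0 < r --> r <= 1 -->
      (\<integral>\<^sup>+y. enorm ((\<phi> y - w n y) - (\<phi> x - w n x)) * indicator (cball x r) y) <= ennreal ((1/2) ^ n * r ^ (DIM('a) + 1)))"
    and diff: "\<And>n a. \<exists>L. linear L \<and> (\<forall>\<e>>0. \<exists>\<delta>>0. \<forall>v. norm v <= \<delta> --> norm (w n (a + v) - w n a - L v) <= \<e> * norm v)"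
    using P unfolding P_def by simp_all
  have fin: "leb (A n) < \<infinity>" for n using A(2)[of n] by (auto simp: less_top[symmetric] top_unique)
  have "AE x in lborel. \<forall>\<^sub>F n in sequentially. x \<in> space lborel - A n"
  proof (rule borel_cantelli_AE1)
    show "summable (\<lambda>n. measure lborel (A n))"
    proof (rule summable_comparison_test')
      show "summable (\<lambda>n. c * (1/2) ^ n)" by (intro summable_mult summable_geometric) auto
      show "norm (measure lborel (A n)) <= c * (1/2) ^ n" for n
        using A(2)[of n] fin[of n] c by (simp add: emeasure_eq_ennreal_measure)
    qed
  qed (use A(1) fin in auto)
  moreover have "AE x in lborel. \<forall>n. x \<notin> A n --> (\<forall>r. 0 < r --> r <= 1 -->
      (\<integral>\<^sup>+y. enorm ((\<phi> y - w n y) - (\<phi> x - w n x)) * indicator (cball x r) y) <= ennreal ((1/2) ^ n * r ^ (DIM('a) + 1)))"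
    using osc by (simp add: AE_all_countable)
  ultimately show ?thesis
  proof eventually_elim
    case (elim a)
    show ?case
    proof (rule mean_diff_limit)
      fix \<kappa> :: real assume \<kappa>: "0 < \<kappa>"
      have "(\<lambda>n. (1/2) ^ n * (1 + unit_ball_vol DIM('a))) \<longlonglongrightarrow> 0 * (1 + unit_ball_vol DIM('a))"
        by (intro tendsto_intros LIMSEQ_power_zero) auto
      then have "\<forall>\<^sub>F n in sequentially. (1/2) ^ n * (1 + unit_ball_vol DIM('a)) < \<kappa>"
        using \<kappa> by (intro order_tendstoD(2)) auto
      then have "\<forall>\<^sub>F n in sequentially. (1/2) ^ n * (1 + unit_ball_vol DIM('a)) < \<kappa> \<and> a \<notin> A n"
        using elim(1) by eventually_elim auto
      then obtain n where n: "(1/2) ^ n * (1 + unit_ball_vol DIM('a)) < \<kappa>" "a \<notin> A n"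
        by (auto simp: eventually_sequentially)
      obtain L where L: "linear L" "\<forall>\<e>>0. \<exists>\<delta>>0. \<forall>v. norm v <= \<delta> --> norm (w n (a + v) - w n a - L v) <= \<e> * norm v"
        using diff by blast
      have "mean_diff \<phi> a L ((1/2) ^ n * (1 + unit_ball_vol DIM('a)))"
        by (rule mean_diff_from_approximation[OF w[of n] _ _ L]) (use elim(2) n in auto)
      then have "mean_diff \<phi> a L \<kappa>"
      proof -
        have "(1/2) ^ n * (1 + unit_ball_vol DIM('a)) * r ^ (DIM('a) + 1) <= \<kappa> * r ^ (DIM('a) + 1)" if "0 < r" for r :: real
          using n(1) that by (intro mult_right_mono) auto
        then show ?thesis using \<open>mean_diff \<phi> a L ((1/2) ^ n * (1 + unit_ball_vol DIM('a)))\<close>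
          unfolding mean_diff_def by (meson ennreal_leI order_trans)
      qed
      then show "\<exists>L. linear L \<and> mean_diff \<phi> a L \<kappa>" using L(1) by blast
    qed measurable
  qed
qed

lemma AE_approx_differentiable:
  "AE a in lborel. \<exists>L. linear L \<and> (\<forall>\<e>>0. dens0 {y. \<e> * norm (y - a) < norm (\<phi> y - \<phi> a - L (y - a))} a)"
  using AE_mean_differentiable by eventually_elim (blast intro: mean_diff_imp_dens0[OF meas])

end

section \<open>Borel maps into unordered tuples\<close>

lemma Qtuples_UNIV [simp]: "Y \<in> Qtuples Q UNIV \<longleftrightarrow> size Y = Q" by (simp add: Qtuples_def)

lemma size_imp_list: "size Y = Q ==> \<exists>ys. mset ys = Y \<and> length ys = Q" using ex_mset[of Y] by (metis size_mset)

lemma qdist_matching: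
  assumes "size Y = Q" "mset xs = X" "length xs = Q"
  obtains ys where "mset ys = Y" "length ys = Q" "qdist X Y = L2_set (\<lambda>i. norm (xs ! i - ys ! i)) {..<Q}"
proof -
  obtain ys0 where "mset ys0 = Y" "length ys0 = Q" using size_imp_list[OF assms(1)] by blast
  then obtain ys where "mset ys = Y" "qdist X Y = L2_set (\<lambda>i. norm (xs ! i - ys ! i)) {..<Q}"
    using qdist_attained[of xs ys0] assms by auto
  then show ?thesis using that[of ys] assms(1) by (metis size_mset)
qed

lemma qdist_permutation:
  assumes "length xs = Q" "length ys = Q"
  obtains \<sigma> where "\<sigma> permutes {..<Q}" "qdist (mset xs) (mset ys) = L2_set (\<lambda>i. norm (xs ! i - ys ! \<sigma> i)) {..<Q}"
proof -
  let ?P = "{\<sigma>. \<sigma> permutes {..<length xs}}"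
  have "qdist (mset xs) (mset ys) \<in> (\<lambda>\<sigma>. sqrt (\<Sum>i<length xs. (norm (xs ! i - ys ! \<sigma> i))\<^sup>2)) ` ?P"
    using assms by (subst qdist_mset) (auto intro!: Min_in simp: finite_permutations intro: permutes_id)
  then show ?thesis using that assms by (auto simp: L2_set_def)
qed

lemma norm_le_L2: "(i::nat) < Q ==> norm (f i) <= L2_set (\<lambda>i. norm (f i)) {..<Q}" by (rule member_le_L2_set) auto

lemma L2_le_sum_bound:
  assumes "\<And>i. i < Q ==> norm (f i) <= b"
  shows "L2_set (\<lambda>i. norm (f i)) {..<Q} <= real Q * b"
proof -
  have "L2_set (\<lambda>i. norm (f i)) {..<Q} <= (\<Sum>i<Q. norm (f i))" by (rule L2_set_le_sum) auto
  also have "... <= (\<Sum>i<Q. b)" using assms by (intro sum_mono) auto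
  finally show ?thesis by simp
qed

lemma qdist_self [simp]: "qdist Y Y = 0" by (simp add: qdist_eq_0)

lemma openin_qspace_iff:
  fixes V :: "'b::real_normed_vector multiset set"
  shows "openin (mtopology_of (qspace Q)) V \<longleftrightarrow>
    V \<subseteq> Qtuples Q UNIV \<and> (\<forall>Y\<in>V. \<exists>r>0. \<forall>Z. size Z = Q --> qdist Y Z < r --> Z \<in> V)"
proof -
  interpret Metric_space "Qtuples Q (UNIV :: 'b set)" qdist by (rule Metric_space_Qtuples)
  have eq: "mtopology_of (qspace Q) = mtopology" unfolding qspace_def mtopology_of_def by simp
  have b: "mball Y r \<subseteq> V \<longleftrightarrow> (\<forall>Z. size Z = Q --> qdist Y Z < r --> Z \<in> V)" if "size Y = Q" for Y r
    using that unfolding subset_iff in_mball by auto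
  show ?thesis unfolding eq openin_mtopology
  proof (rule conj_cong[OF refl])
    assume "V \<subseteq> Qtuples Q UNIV"
    then have "size Y = Q" if "Y \<in> V" for Y using that by auto
    with b show "(\<forall>Y. Y \<in> V --> (\<exists>r>0. mball Y r \<subseteq> V))
        = (\<forall>Y\<in>V. \<exists>r>0. \<forall>Z. size Z = Q --> qdist Y Z < r --> Z \<in> V)" unfolding Ball_def by metis
  qed
qed

lemma openin_qspace_subset: "{V. openin (mtopology_of (qspace Q)) V} \<subseteq> Pow (Qtuples Q UNIV)"
  unfolding openin_qspace_iff by blast

lemma space_qborel [simp]: "space (qborel Q) = Qtuples Q UNIV"
  unfolding qborel_def by (rule space_measure_of[OF openin_qspace_subset])

lemma qborel_open: "openin (mtopology_of (qspace Q)) V ==> V \<in> sets (qborel Q)"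
proof -
  have *: "{V. openin (mtopology_of (qspace Q)) V} \<subseteq> Pow (Qtuples Q UNIV)"  by (rule openin_qspace_subset)
  assume "openin (mtopology_of (qspace Q)) V"
  then show ?thesis unfolding qborel_def using * by auto
qed

lemma lipschitz_borel_measurable_qborel:
  fixes F :: "'b::real_normed_vector multiset => 'c::metric_space"
  assumes lip: "\<And>Y Z. size Y = Q ==> size Z = Q ==> dist (F Y) (F Z) <= C * qdist Y Z"
  shows "F \<in> borel_measurable (qborel Q)"
proof (rule borel_measurableI)
  fix S :: "'c set" assume S: "open S"
  have "openin (mtopology_of (qspace Q)) (F -` S \<inter> Qtuples Q UNIV)" unfolding openin_qspace_iff
  proof (intro conjI ballI)
    fix Y assume Y: "Y \<in> F -` S \<inter> Qtuples Q UNIV"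
    then obtain e where e: "0 < e" "\<And>y. dist y (F Y) < e ==> y \<in> S" using S unfolding open_dist by auto
    have "Z \<in> F -` S \<inter> Qtuples Q UNIV" if Z: "size Z = Q" "qdist Y Z < e / (\<bar>C\<bar> + 1)" for Z
    proof -
      have "dist (F Z) (F Y) <= C * qdist Y Z" using lip[of Y Z] Y Z by (simp add: dist_commute)
      also have "... <= (\<bar>C\<bar> + 1) * qdist Y Z" by (intro mult_right_mono qdist_nonneg) auto
      also have "... < e" using Z by (simp add: field_simps)
      finally show ?thesis using e(2) Z by auto
    qed
    then show "\<exists>r>0. \<forall>Z. size Z = Q --> qdist Y Z < r --> Z \<in> F -` S \<inter> Qtuples Q UNIV"
      using e(1) by (intro exI[of _ "e / (\<bar>C\<bar> + 1)"]) auto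
  qed auto
  then show "F -` S \<inter> space (qborel Q) \<in> sets (qborel Q)" using qborel_open by auto
qed

lemma qdist_triangle2:
  assumes "size A = Q" "size B = Q" "size C = Q"
  shows "\<bar>qdist A C - qdist B C\<bar> <= qdist A B"
  using qdist_triangle[OF assms] qdist_triangle[of B Q A C] assms by (simp add: qdist_commute abs_le_iff)

lemma qdist_const_measurable [measurable]:
  assumes "size Z = Q"
  shows "(\<lambda>Y. qdist Y Z) \<in> borel_measurable (qborel Q)"
  by (rule lipschitz_borel_measurable_qborel[where C=1]) (use qdist_triangle2 assms in \<open>auto simp: dist_real_def\<close>)

lemma dense_Qtuples:
  obtains D :: "'b::{real_normed_vector, second_countable_topology} multiset set"
  where "countable D" "\<And>d. d \<in> D ==> size d = Q"
    "\<And>Y e. size Y = Q ==> 0 < e ==> \<exists>d\<in>D. qdist Y d < e"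
proof -
  obtain D0 :: "'b set" where D0: "countable D0" "\<And>X. open X ==> X \<noteq> {} ==> \<exists>d\<in>D0. d \<in> X"
    by (rule countable_dense_setE) auto
  define D where "D = mset ` {ds \<in> lists D0. length ds = Q}"
  show ?thesis
  proof
    show "countable D" unfolding D_def using D0(1)
      by (intro countable_image countable_subset[OF _ countable_lists[OF D0(1)]]) auto
    show "size d = Q" if "d \<in> D" for d using that by (auto simp: D_def)
    fix Y :: "'b multiset" and e :: real assume Y: "size Y = Q" and e: "0 < e"
    obtain ys where ys: "mset ys = Y" "length ys = Q" using size_imp_list[OF Y] by blast
    define \<delta> where "\<delta> = e / (real Q + 1)"
    have \<delta>: "0 < \<delta>" "real Q * \<delta> < e" using e by (auto simp: \<delta>_def field_simps)
    have "\<exists>d\<in>D0. dist d y < \<delta>" for y using D0(2)[of "ball y \<delta>"] \<delta>(1) by (auto simp: dist_commute)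
    then obtain d where d: "\<And>y. d y \<in> D0" "\<And>y. dist (d y) y < \<delta>" by metis
    have "qdist Y (mset (map d ys)) <= L2_set (\<lambda>i. norm (ys ! i - map d ys ! i)) {..<Q}"
      using qdist_le[of ys "map d ys"] ys by simp
    also have "... <= real Q * \<delta>"
      using d(2) ys(2) by (intro L2_le_sum_bound) (auto simp: dist_norm norm_minus_commute intro: less_imp_le)
    finally have "qdist Y (mset (map d ys)) < e" using \<delta>(2) by simp
    moreover have "mset (map d ys) \<in> D" unfolding D_def by (rule imageI) (use d(1) ys(2) in auto)
    ultimately show "\<exists>d\<in>D. qdist Y d < e" by blast
  qed
qed

text \<open>\<open>qdist (f x) (g x) < t\<close> holds exactly when some \<open>d\<close> in a
  countable dense set has \<open>qdist (f x) d + qdist (g x) d < t\<close>; this avoids the product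
  sigma-algebra on pairs of tuples.\<close>

lemma qdist_measurable [measurable (raw)]:
  fixes f g :: "'a => 'b::{real_normed_vector, second_countable_topology} multiset"
  assumes f [measurable]: "f \<in> M \<rightarrow>\<^sub>M qborel Q" and g [measurable]: "g \<in> M \<rightarrow>\<^sub>M qborel Q"
  shows "(\<lambda>x. qdist (f x) (g x)) \<in> borel_measurable M"
proof -
  have size: "size (f x) = Q" "size (g x) = Q" if "x \<in> space M" for x
    using measurable_space[OF f that] measurable_space[OF g that] by auto
  obtain D :: "'b multiset set" where D: "countable D" "\<And>d. d \<in> D ==> size d = Q"
    "\<And>Y e. size Y = Q ==> 0 < e ==> \<exists>d\<in>D. qdist Y d < e" by (rule dense_Qtuples[where 'b='b and Q=Q]) blast
  have "{x \<in> space M. qdist (f x) (g x) < t} \<in> sets M" for t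
  proof -
    have m: "(\<lambda>x. qdist (f x) d) \<in> borel_measurable M" "(\<lambda>x. qdist (g x) d) \<in> borel_measurable M" if "d \<in> D" for d
      using measurable_compose[OF f qdist_const_measurable[OF D(2)[OF that]]]
        measurable_compose[OF g qdist_const_measurable[OF D(2)[OF that]]] by auto
    have "{x \<in> space M. qdist (f x) (g x) < t} = (\<Union>d\<in>D. {x \<in> space M. qdist (f x) d + qdist (g x) d < t})"
    proof (intro equalityI subsetI)
      fix x assume "x \<in> {x \<in> space M. qdist (f x) (g x) < t}"
      then have x: "x \<in> space M" "qdist (f x) (g x) < t" by auto
      then obtain d where d: "d \<in> D" "qdist (f x) d < (t - qdist (f x) (g x)) / 2"
        using D(3)[OF size(1)[OF x(1)], of "(t - qdist (f x) (g x)) / 2"] by auto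
      have "qdist (g x) d <= qdist (g x) (f x) + qdist (f x) d"
        using size[OF x(1)] D(2)[OF d(1)] by (intro qdist_triangle[where Q=Q])
      then have "qdist (f x) d + qdist (g x) d < t" using d(2) by (simp add: qdist_commute field_simps)
      then show "x \<in> (\<Union>d\<in>D. {x \<in> space M. qdist (f x) d + qdist (g x) d < t})" using d x by auto
    next
      fix x assume "x \<in> (\<Union>d\<in>D. {x \<in> space M. qdist (f x) d + qdist (g x) d < t})"
      then obtain d where d: "d \<in> D" "x \<in> space M" "qdist (f x) d + qdist (g x) d < t" by auto
      have "qdist (f x) (g x) <= qdist (f x) d + qdist d (g x)"
        using size[OF d(2)] D(2)[OF d(1)] by (intro qdist_triangle[where Q=Q])
      then show "x \<in> {x \<in> space M. qdist (f x) (g x) < t}" using d by (simp add: qdist_commute)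
    qed
    also have "... \<in> sets M" using D(1) m by (intro sets.countable_UN'') auto
    finally show ?thesis .
  qed
  then show ?thesis by (simp add: borel_measurable_iff_less)
qed

lemma lipschitz_into_qborel:
  fixes h :: "'a::metric_space => 'b::real_normed_vector multiset"
  assumes "\<And>x. size (h x) = Q" "\<And>x y. qdist (h x) (h y) <= C * dist x y"
  shows "h \<in> borel \<rightarrow>\<^sub>M qborel Q" unfolding qborel_def
proof (rule measurable_measure_of)
  show "{V. openin (mtopology_of (qspace Q)) V} \<subseteq> Pow (Qtuples Q UNIV)" by (rule openin_qspace_subset)
  show "h \<in> space borel \<rightarrow> Qtuples Q UNIV" using assms(1) by auto
  fix V :: "'b multiset set" assume "V \<in> {V. openin (mtopology_of (qspace Q)) V}"
  then have V: "openin (mtopology_of (qspace Q)) V" by simp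
  have "open (h -` V)" unfolding open_dist
  proof (intro ballI)
    fix x assume "x \<in> h -` V"
    then obtain r where r: "0 < r" "\<And>Z. size Z = Q ==> qdist (h x) Z < r ==> Z \<in> V"
      using V unfolding openin_qspace_iff by blast
    have "y \<in> h -` V" if "dist y x < r / (\<bar>C\<bar> + 1)" for y
    proof -
      have "qdist (h x) (h y) <= (\<bar>C\<bar> + 1) * dist y x"
        using assms(2)[of x y] by (smt (verit) dist_commute mult_right_mono zero_le_dist)
      also have "... < r" using that by (simp add: field_simps)
      finally show ?thesis using r(2) assms(1) by auto
    qed
    then show "\<exists>e>0. \<forall>y. dist y x < e --> y \<in> h -` V" using r(1) by (intro exI[of _ "r / (\<bar>C\<bar> + 1)"]) auto
  qed
  then show "h -` V \<inter> space borel \<in> sets borel" by simp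
qed

section \<open>Selecting the entries of a tuple\<close>

text \<open>A truncation that is the identity up to radius \<open>\<rho>\<close>, zero from
  \<open>2 * \<rho>\<close> on, and 3-Lipschitz whatever \<open>\<rho>\<close> is.\<close>

definition radial_cut :: "real => 'b::real_normed_vector => 'b" where
  "radial_cut \<rho> y = max 0 (min 1 (2 - norm y / \<rho>)) *\<^sub>R y"

lemma radial_cut_lipschitz:
  fixes y z :: "'b::real_normed_vector"
  assumes "0 < \<rho>"
  shows "norm (radial_cut \<rho> y - radial_cut \<rho> z) <= 3 * norm (y - z)"
proof -
  define l where "l y = max 0 (min 1 (2 - norm y / \<rho>))" for y :: 'b
  have l01: "0 <= l y" "l y <= 1" for y by (auto simp: l_def)
  have l0: "l y = 0" if "2 * \<rho> < norm y" for y using that assms by (simp add: l_def field_simps)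
  have llip: "\<bar>l y - l z\<bar> <= norm (y - z) / \<rho>" for y z
  proof -
    have "\<bar>l y - l z\<bar> <= \<bar>norm y / \<rho> - norm z / \<rho>\<bar>" unfolding l_def by linarith
    also have "... = \<bar>norm y - norm z\<bar> / \<rho>" using assms by (simp add: diff_divide_distrib[symmetric])
    also have "... <= norm (y - z) / \<rho>" using assms by (intro divide_right_mono norm_triangle_ineq3) auto
    finally show ?thesis .
  qed
  have main: "norm (l y *\<^sub>R y - l z *\<^sub>R z) <= 3 * norm (y - z)" if "norm y <= norm z" for y z
  proof (cases "2 * \<rho> < norm y")
    case False
    have "l y *\<^sub>R y - l z *\<^sub>R z = (l y - l z) *\<^sub>R y + l z *\<^sub>R (y - z)" by (simp add: algebra_simps)
    then have "norm (l y *\<^sub>R y - l z *\<^sub>R z) <= \<bar>l y - l z\<bar> * norm y + l z * norm (y - z)"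
      using norm_triangle_ineq[of "(l y - l z) *\<^sub>R y" "l z *\<^sub>R (y - z)"] l01[of z] by simp
    also have "... <= (norm (y - z) / \<rho>) * (2 * \<rho>) + 1 * norm (y - z)"
      using False assms l01 by (intro add_mono mult_mono llip) auto
    also have "... = 3 * norm (y - z)" using assms by simp
    finally show ?thesis .
  qed (use that l0 in auto)
  have "norm (l y *\<^sub>R y - l z *\<^sub>R z) <= 3 * norm (y - z)"
    using main[of y z] main[of z y] by (metis linear norm_minus_commute)
  then show ?thesis by (simp add: radial_cut_def l_def)
qed

lemma radial_cut_bound: "0 < \<rho> ==> norm (radial_cut \<rho> y) <= 2 * \<rho>"
proof (cases "2 * \<rho> < norm y")
  case False
  assume "0 < \<rho>"
  have "norm (radial_cut \<rho> y) <= 1 * norm y" unfolding radial_cut_def norm_scaleR by (intro mult_right_mono) auto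
  then show ?thesis using False by simp
qed (simp add: radial_cut_def field_simps)

lemma radial_cut_inside: "norm y <= \<rho> ==> radial_cut \<rho> y = y"
proof (cases "0 < \<rho>")
  case True
  assume "norm y <= \<rho>"
  then have "1 <= 2 - norm y / \<rho>" using True by (simp add: field_simps)
  then show ?thesis by (simp add: radial_cut_def)
next
  case False
  assume "norm y <= \<rho>"
  then have "y = 0" using False norm_ge_zero[of y] by (simp only: not_less) (metis norm_le_zero_iff order_trans)
  then show ?thesis by (simp add: radial_cut_def)
qed

lemma radial_cut_outside: "0 < \<rho> ==> 2 * \<rho> <= norm y ==> radial_cut \<rho> y = 0" by (simp add: radial_cut_def field_simps)

text \<open>The sum is symmetric in the entries, which makes this a globally defined Lipschitz
  function of the tuple. If the entries close to the centre \<open>c ! i\<close> are all equal and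
  as many as the centre has copies, each contributes the same displacement, and dividing by the
  number of copies returns it.\<close>

definition entry_near :: "real => 'b::real_normed_vector list => nat => 'b multiset => 'b" where
  "entry_near \<rho> c i Y =
    (\<Sum>y\<in>#Y. radial_cut \<rho> (y - c ! i)) /\<^sub>R real (card {j. j < length c \<and> c ! j = c ! i})"

lemma sum_mset_list: "(\<Sum>y\<in>#mset ys. h y) = (\<Sum>i<length ys. h (ys ! i))"
  by (simp add: sum_mset_sum_list sum_list_sum_nth atLeast0LessThan flip: mset_map)

lemma entry_near_lipschitz:
  assumes "0 < \<rho>" "i < length c" "size Y = Q" "size Z = Q"
  shows "norm (entry_near \<rho> c i Y - entry_near \<rho> c i Z) <= 3 * real Q * qdist Y Z"
proof -
  obtain ys where ys: "mset ys = Y" "length ys = Q" using size_imp_list assms by blast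
  obtain zs where zs: "mset zs = Z" "length zs = Q" "qdist Y Z = L2_set (\<lambda>i. norm (ys ! i - zs ! i)) {..<Q}"
    using qdist_matching[OF assms(4) ys] by blast
  define k where "k = card {j. j < length c \<and> c ! j = c ! i}"
  have "{j. j < length c \<and> c ! j = c ! i} \<noteq> {}" using assms(2) by auto
  then have k: "1 <= real k" by (simp add: k_def card_gt_0_iff Suc_le_eq)
  have "norm ((\<Sum>y\<in>#Y. radial_cut \<rho> (y - c ! i)) - (\<Sum>y\<in>#Z. radial_cut \<rho> (y - c ! i)))
      = norm (\<Sum>j<Q. radial_cut \<rho> (ys ! j - c ! i) - radial_cut \<rho> (zs ! j - c ! i))"
    unfolding ys(1)[symmetric] zs(1)[symmetric] sum_mset_list by (simp add: ys zs sum_subtractf)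
  also have "... <= (\<Sum>j<Q. 3 * qdist Y Z)"
  proof (rule sum_norm_le)
    fix j assume j: "j \<in> {..<Q}"
    have "norm (radial_cut \<rho> (ys ! j - c ! i) - radial_cut \<rho> (zs ! j - c ! i)) <= 3 * norm (ys ! j - zs ! j)"
      using radial_cut_lipschitz[OF assms(1), of "ys ! j - c ! i" "zs ! j - c ! i"] by simp
    also have "... <= 3 * qdist Y Z" unfolding zs(3) using norm_le_L2[of j Q "\<lambda>j. ys ! j - zs ! j"] j by simp
    finally show "norm (radial_cut \<rho> (ys ! j - c ! i) - radial_cut \<rho> (zs ! j - c ! i)) <= 3 * qdist Y Z" .
  qed
  also have "... = 3 * real Q * qdist Y Z" by simp
  finally have *: "norm ((\<Sum>y\<in>#Y. radial_cut \<rho> (y - c ! i)) - (\<Sum>y\<in>#Z. radial_cut \<rho> (y - c ! i))) <= 3 * real Q * qdist Y Z" .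
  have "norm (entry_near \<rho> c i Y - entry_near \<rho> c i Z)
      = norm ((\<Sum>y\<in>#Y. radial_cut \<rho> (y - c ! i)) - (\<Sum>y\<in>#Z. radial_cut \<rho> (y - c ! i))) / real k"
    unfolding entry_near_def k_def[symmetric] scaleR_diff_right[symmetric] norm_scaleR by (simp add: divide_inverse mult.commute)
  also have "... <= norm ((\<Sum>y\<in>#Y. radial_cut \<rho> (y - c ! i)) - (\<Sum>y\<in>#Z. radial_cut \<rho> (y - c ! i))) / 1"
    using k by (intro divide_left_mono) auto
  finally show ?thesis using * by simp
qed

lemma entry_near_bound:
  assumes "0 < \<rho>" "i < length c" "size Y = Q"
  shows "norm (entry_near \<rho> c i Y) <= 2 * real Q * \<rho>"
proof -
  obtain ys where ys: "mset ys = Y" "length ys = Q" using size_imp_list assms by blast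
  define k where "k = card {j. j < length c \<and> c ! j = c ! i}"
  have "{j. j < length c \<and> c ! j = c ! i} \<noteq> {}" using assms(2) by auto
  then have k: "1 <= real k" by (simp add: k_def card_gt_0_iff Suc_le_eq)
  have "norm (\<Sum>y\<in>#Y. radial_cut \<rho> (y - c ! i)) <= (\<Sum>j<Q. 2 * \<rho>)"
    unfolding ys(1)[symmetric] sum_mset_list ys(2) by (intro sum_norm_le radial_cut_bound assms)
  then have *: "norm (\<Sum>y\<in>#Y. radial_cut \<rho> (y - c ! i)) <= 2 * real Q * \<rho>" by simp
  have "norm (entry_near \<rho> c i Y) = norm (\<Sum>y\<in>#Y. radial_cut \<rho> (y - c ! i)) / real k"
    unfolding entry_near_def k_def[symmetric] norm_scaleR by (simp add: divide_inverse mult.commute)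
  also have "... <= norm (\<Sum>y\<in>#Y. radial_cut \<rho> (y - c ! i)) / 1" using k by (intro divide_left_mono) auto
  finally show ?thesis using * by simp
qed

definition selected :: "real => 'b::real_normed_vector list => 'b multiset => 'b multiset" where
  "selected \<rho> c Y = mset (map (\<lambda>i. c ! i + entry_near \<rho> c i Y) [0..<length c])"

lemma size_selected [simp]: "size (selected \<rho> c Y) = length c" by (simp add: selected_def)

lemma selected_lipschitz:
  assumes "0 < \<rho>" "length c = Q" "size Y = Q" "size Z = Q"
  shows "qdist (selected \<rho> c Y) (selected \<rho> c Z) <= real Q * (3 * real Q * qdist Y Z)"
proof -
  let ?s = "\<lambda>Y. map (\<lambda>i. c ! i + entry_near \<rho> c i Y) [0..<length c]"
  have "qdist (selected \<rho> c Y) (selected \<rho> c Z) <= L2_set (\<lambda>i. norm (?s Y ! i - ?s Z ! i)) {..<Q}"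
    unfolding selected_def using qdist_le[of "?s Y" "?s Z"] assms by simp
  also have "... <= real Q * (3 * real Q * qdist Y Z)"
    using assms by (intro L2_le_sum_bound) (auto intro!: entry_near_lipschitz)
  finally show ?thesis .
qed

text \<open>Entries belonging to a different centre are at least \<open>3 * \<rho> - \<rho>\<close>
  away and are cut to 0. Those belonging to the centre are equal and within \<open>\<rho>\<close>,
  where the cut is the identity.\<close>

lemma selected_agrees:
  assumes \<rho>: "0 < \<rho>" and len: "length xs = length c"
    and near: "\<And>i. i < length c ==> norm (xs ! i - c ! i) <= \<rho>"
    and eq: "\<And>i j. i < length c ==> j < length c ==> c ! i = c ! j ==> xs ! i = xs ! j"
    and sep: "\<And>i j. i < length c ==> j < length c ==> c ! i \<noteq> c ! j ==> 3 * \<rho> <= norm (c ! i - c ! j)"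
  shows "selected \<rho> c (mset xs) = mset xs"
proof -
  have "c ! i + entry_near \<rho> c i (mset xs) = xs ! i" if i: "i < length c" for i
  proof -
    let ?J = "{j. j < length c \<and> c ! j = c ! i}"
    have "radial_cut \<rho> (xs ! j - c ! i) = (if j \<in> ?J then xs ! i - c ! i else 0)" if j: "j < length c" for j
    proof (cases "c ! j = c ! i")
      case True
      have "xs ! j = xs ! i" by (rule eq[OF j i True])
      then have "radial_cut \<rho> (xs ! j - c ! i) = xs ! i - c ! i" by (simp only:) (rule radial_cut_inside[OF near[OF i]])
      moreover have "j \<in> ?J" using True j by blast
      ultimately show ?thesis by (simp only: if_True)
    next
      case False
      have "norm (c ! j - c ! i) <= norm (xs ! j - c ! i) + norm (xs ! j - c ! j)"
        using norm_triangle_ineq4[of "xs ! j - c ! i" "xs ! j - c ! j"] by simp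
      then have "2 * \<rho> <= norm (xs ! j - c ! i)" using sep[OF j i False] near[OF j] by linarith
      then show ?thesis using False \<rho> by (simp add: radial_cut_outside)
    qed
    then have "(\<Sum>y\<in>#mset xs. radial_cut \<rho> (y - c ! i)) = (\<Sum>j<length c. if j \<in> ?J then xs ! i - c ! i else 0)"
      unfolding sum_mset_list len by (intro sum.cong) auto
    also have "... = (\<Sum>j\<in>?J. xs ! i - c ! i)" by (rule sum.mono_neutral_cong_right) auto
    also have "... = real (card ?J) *\<^sub>R (xs ! i - c ! i)" by (simp add: scaleR_conv_of_real sum_constant_scaleR)
    finally have s: "(\<Sum>y\<in>#mset xs. radial_cut \<rho> (y - c ! i)) = real (card ?J) *\<^sub>R (xs ! i - c ! i)" .
    have "?J \<noteq> {}" using i by auto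
    then have "card ?J \<noteq> 0" by simp
    then show ?thesis unfolding entry_near_def s by simp
  qed
  then have "map (\<lambda>i. c ! i + entry_near \<rho> c i (mset xs)) [0..<length c] = xs" using len by (intro nth_equalityI) auto
  then show ?thesis by (simp add: selected_def)
qed

text \<open>Rounding the entries of \<open>Y\<close> into a countable dense set, each by its value,
  keeps equal entries equal. With \<open>5 * \<rho>\<close> below the least distance of distinct
  entries and a rounding error below \<open>\<rho>\<close>, distinct centres stay
  \<open>3 * \<rho>\<close> apart. Countably many selections are enough for statements almost
  everywhere.\<close>

lemma countable_selections:
  obtains I :: "(real \<times> 'b::{real_normed_vector, second_countable_topology} list) set"
  where "countable I" "\<And>\<rho> c. (\<rho>, c) \<in> I ==> 0 < \<rho> \<and> length c = Q"
    "\<And>Y. size Y = Q ==> \<exists>(\<rho>, c)\<in>I. selected \<rho> c Y = Y"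
proof -
  obtain D :: "'b set" where D: "countable D" "\<And>X. open X ==> X \<noteq> {} ==> \<exists>d\<in>D. d \<in> X"
    by (rule countable_dense_setE) auto
  define I where "I = (range (\<lambda>n. 1 / real (Suc n))) \<times> {c \<in> lists D. length c = Q}"
  show ?thesis
  proof
    show "countable I" unfolding I_def
      using D(1) by (intro countable_SIGMA countable_subset[OF _ countable_lists[OF D(1)]]) auto
    show "0 < \<rho> \<and> length c = Q" if "(\<rho>, c) \<in> I" for \<rho> c using that by (auto simp: I_def)
    fix Y :: "'b multiset" assume Y: "size Y = Q"
    obtain xs where xs: "mset xs = Y" "length xs = Q" using size_imp_list[OF Y] by blast
    \<comment> \<open>The 1 takes care of tuples whose entries all coincide.\<close>
    define S where "S = insert 1 ((\<lambda>(x, y). dist x y) ` ((set xs \<times> set xs) \<inter> {(x, y). x \<noteq> y}))"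
    have S: "finite S" "S \<noteq> {}" "\<And>s. s \<in> S ==> 0 < s" by (auto simp: S_def)
    define s where "s = Min S"
    have s: "0 < s" using S by (simp add: s_def)
    have s_le: "s <= dist x y" if "x \<in> set xs" "y \<in> set xs" "x \<noteq> y" for x y
      unfolding s_def using S(1) that by (intro Min_le) (auto simp: S_def)
    obtain n where n: "1 / real (Suc n) < s / 5" using s nat_approx_posE[of "s / 5"] by auto
    define \<rho> where "\<rho> = 1 / real (Suc n)"
    have \<rho>: "0 < \<rho>" "5 * \<rho> < s" using n by (auto simp: \<rho>_def)
    have "\<exists>d\<in>D. dist d y < \<rho>" for y using D(2)[of "ball y \<rho>"] \<rho>(1) by (auto simp: dist_commute)
    then obtain d where d: "\<And>y. d y \<in> D" "\<And>y. dist (d y) y < \<rho>" by metis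
    define c where "c = map d xs"
    have "selected \<rho> c (mset xs) = mset xs"
    proof (rule selected_agrees[OF \<rho>(1)])
      show "length xs = length c" by (simp add: c_def)
      show "norm (xs ! i - c ! i) <= \<rho>" if "i < length c" for i
        using that d(2)[of "xs ! i"] by (simp add: c_def dist_norm norm_minus_commute)
      fix i j assume ij: "i < length c" "j < length c"
      have tri: "dist (xs ! i) (xs ! j) <= dist (d (xs ! i)) (d (xs ! j)) + 2 * \<rho>"
        using dist_triangle[of "xs ! i" "xs ! j" "d (xs ! i)"] dist_triangle[of "d (xs ! i)" "xs ! j" "d (xs ! j)"]
          d(2)[of "xs ! i"] d(2)[of "xs ! j"] by (simp add: dist_commute)
      show "xs ! i = xs ! j" if "c ! i = c ! j"
        using that tri s_le[of "xs ! i" "xs ! j"] ij \<rho> by (fastforce simp: c_def)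
      show "3 * \<rho> <= norm (c ! i - c ! j)" if "c ! i \<noteq> c ! j"
      proof -
        have "xs ! i \<noteq> xs ! j" using that ij by (auto simp: c_def)
        then show ?thesis using tri s_le[of "xs ! i" "xs ! j"] ij \<rho> by (simp add: c_def dist_norm)
      qed
    qed
    moreover have "(\<rho>, c) \<in> I" using d(1) xs(2) by (auto simp: I_def \<rho>_def c_def)
    ultimately show "\<exists>(\<rho>, c)\<in>I. selected \<rho> c Y = Y" using xs(1) by blast
  qed
qed

section \<open>Tuple valued maps with difference quotients in \<open>L\<^sub>p\<close>\<close>

lemma powr_add_le:
  fixes a b p :: real
  assumes "0 <= a" "0 <= b" "0 <= p"
  shows "(a + b) powr p <= 2 powr p * (a powr p + b powr p)"
proof -
  have "(a + b) powr p <= (2 * max a b) powr p" using assms by (intro powr_mono2) auto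
  also have "... = 2 powr p * max a b powr p" using assms by (simp add: powr_mult)
  also have "... <= 2 powr p * (a powr p + b powr p)" by (intro mult_left_mono) (auto simp: max_def)
  finally show ?thesis .
qed

abbreviation unit_disk :: "'a::euclidean_space set" where
  "unit_disk \<equiv> ball 0 1"

definition transl_bound :: "real => ('a::euclidean_space => 'b::real_normed_vector multiset) => real => bool" where
  "transl_bound p f M \<longleftrightarrow> (\<forall>v. (\<integral>\<^sup>+x. qcost p (f x) (f (x + v))
      * indicator {x. x \<in> unit_disk \<and> x + v \<in> unit_disk} x) <= ennreal (M * norm v powr p))"

definition cutoff :: "nat => 'a::euclidean_space => real" where
  "cutoff n x = max 0 (min 1 (real n * (1 - norm x)))"

lemma cutoff_bounds: "0 <= cutoff n x" "cutoff n x <= 1" by (auto simp: cutoff_def)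

lemma cutoff_lipschitz: "\<bar>cutoff n x - cutoff n y\<bar> <= real n * norm (x - y)"
proof -
  have "\<bar>cutoff n x - cutoff n y\<bar> <= \<bar>real n * (1 - norm x) - real n * (1 - norm y)\<bar>" unfolding cutoff_def by linarith
  also have "... = real n * \<bar>norm x - norm y\<bar>" by (simp add: abs_mult right_diff_distrib[symmetric] abs_minus_commute)
  also have "... <= real n * norm (x - y)" by (intro mult_left_mono norm_triangle_ineq3) auto
  finally show ?thesis .
qed

lemma cutoff_outside: "x \<notin> unit_disk ==> cutoff n x = 0"
proof -
  assume "x \<notin> unit_disk"
  then have "real n * (1 - norm x) <= 0" by (intro mult_nonneg_nonpos) auto
  then show ?thesis by (simp add: cutoff_def)
qed

text \<open>An increment of the product is an increment of \<open>F (f x)\<close>, which counts only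
  where both points lie in the disk, plus an increment of the cutoff times a bounded value. The
  constant grows with \<open>n\<close>; this is harmless, as differentiability is local.\<close>

lemma cutoff_sobolev_map:
  fixes f :: "'a::euclidean_space => 'b::{real_inner, banach, second_countable_topology} multiset"
    and F :: "'b multiset => 'b"
  assumes f [measurable]: "f \<in> borel \<rightarrow>\<^sub>M qborel Q" and T: "transl_bound p f M" and p: "1 < p" and M: "0 <= M"
    and lip: "\<And>Y Z. size Y = Q ==> size Z = Q ==> norm (F Y - F Z) <= C * qdist Y Z" and C: "0 <= C"
    and bound: "\<And>Y. size Y = Q ==> norm (F Y) <= B"
  shows "\<exists>M'. banach_sobolev_map (\<lambda>x. cutoff n x *\<^sub>R F (f x)) 1 M' p"
proof -
  have size: "size (f x) = Q" for x using measurable_space[OF f, of x] by simp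
  have B: "0 <= B" using bound[OF size] norm_ge_zero order_trans by blast
  have [measurable]: "F \<in> borel_measurable (qborel Q)"
    by (rule lipschitz_borel_measurable_qborel[where C=C]) (use lip in \<open>auto simp: dist_norm\<close>)
  have [measurable]: "cutoff n \<in> borel_measurable borel" unfolding cutoff_def by measurable
  define V where "V = unit_ball_vol DIM('a)"
  define M' where "M' = 2 powr p * (C powr p * M + 2 * ((real n * B) powr p * V))"
  let ?\<phi> = "\<lambda>x. cutoff n x *\<^sub>R F (f x)"
  let ?U = "unit_disk :: 'a set"
  have "(\<integral>\<^sup>+x. ennreal (norm (?\<phi> (x + v) - ?\<phi> x) powr p)) <= ennreal (M' * norm v powr p)" for v
  proof -
    let ?d = "\<lambda>x. qdist (f x) (f (x + v))"
    let ?D = "{x. x \<in> ?U \<and> x + v \<in> ?U}"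
    let ?b = "(real n * B * norm v) powr p"
    have pt: "norm (?\<phi> (x + v) - ?\<phi> x) powr p <= 2 powr p * ((C * ?d x) powr p * indicator ?D x
        + ?b * (indicator ?U x + indicator ?U (x + v)))" for x
    proof (cases "x \<in> ?U \<or> x + v \<in> ?U")
      case True
      have tri: "norm (?\<phi> (x + v) - ?\<phi> x) <= C * ?d x * indicator ?D x + real n * B * norm v"
      proof (cases "x \<in> ?U")
        case x: True
        have eq: "?\<phi> (x + v) - ?\<phi> x = cutoff n (x + v) *\<^sub>R (F (f (x + v)) - F (f x)) + (cutoff n (x + v) - cutoff n x) *\<^sub>R F (f x)"
          by (simp add: algebra_simps)
        have 1: "norm (cutoff n (x + v) *\<^sub>R (F (f (x + v)) - F (f x))) <= C * ?d x * indicator ?D x"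
        proof (cases "x + v \<in> ?U")
          case xv: True
          have "norm (cutoff n (x + v) *\<^sub>R (F (f (x + v)) - F (f x))) <= 1 * (C * ?d x)"
            unfolding norm_scaleR using lip[of "f (x + v)" "f x"] size cutoff_bounds[of n "x + v"]
            by (intro mult_mono) (auto simp: qdist_commute)
          then show ?thesis using x xv by simp
        qed (simp add: cutoff_outside)
        have 2: "norm ((cutoff n (x + v) - cutoff n x) *\<^sub>R F (f x)) <= real n * B * norm v"
        proof -
          have "norm ((cutoff n (x + v) - cutoff n x) *\<^sub>R F (f x)) <= (real n * norm v) * B"
            unfolding norm_scaleR using cutoff_lipschitz[of n "x + v" x] bound[OF size] B by (intro mult_mono) auto
          then show ?thesis by (simp add: mult_ac)
        qed
        show ?thesis unfolding eq by (rule order_trans[OF norm_triangle_ineq add_mono[OF 1 2]])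
      next
        case False
        then have "norm (?\<phi> (x + v) - ?\<phi> x) = norm ((cutoff n (x + v) - cutoff n x) *\<^sub>R F (f (x + v)))"
          by (simp add: cutoff_outside)
        also have "... <= (real n * norm v) * B"
          unfolding norm_scaleR using cutoff_lipschitz[of n "x + v" x] bound[OF size] B by (intro mult_mono) auto
        finally show ?thesis using False by (simp add: mult_ac)
      qed
      have "norm (?\<phi> (x + v) - ?\<phi> x) powr p <= (C * ?d x * indicator ?D x + real n * B * norm v) powr p"
        using p by (intro powr_mono2 tri) auto
      also have "... <= 2 powr p * ((C * ?d x * indicator ?D x) powr p + ?b)"
        using p C B by (intro powr_add_le) (auto simp: indicator_def intro!: mult_nonneg_nonneg qdist_nonneg)
      also have "(C * ?d x * indicator ?D x) powr p = (C * ?d x) powr p * indicator ?D x" by (simp add: indicator_def)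
      also have "2 powr p * ((C * ?d x) powr p * indicator ?D x + ?b) <= 2 powr p * ((C * ?d x) powr p * indicator ?D x
        + ?b * (indicator ?U x + indicator ?U (x + v)))"
        using True by (intro mult_left_mono add_left_mono) (auto simp: indicator_def)
      finally show ?thesis .
    qed (simp add: cutoff_outside)
    have "(\<integral>\<^sup>+x. ennreal (norm (?\<phi> (x + v) - ?\<phi> x) powr p))
        <= (\<integral>\<^sup>+x. ennreal (2 powr p) * (ennreal (C powr p) * (ennreal (?d x powr p) * indicator ?D x)
            + ennreal ?b * (indicator ?U x + indicator ?U (x + v))))"
    proof (rule nn_integral_mono, goal_cases)
      case (1 x)
      have "ennreal (norm (?\<phi> (x + v) - ?\<phi> x) powr p) <= ennreal (2 powr p * ((C * ?d x) powr p * indicator ?D x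
        + ?b * (indicator ?U x + indicator ?U (x + v))))" by (intro ennreal_leI pt)
      also have "... = ennreal (2 powr p) * (ennreal (C powr p) * (ennreal (?d x powr p) * indicator ?D x)
            + ennreal ?b * (indicator ?U x + indicator ?U (x + v)))"
        by (auto simp: indicator_def ennreal_mult qdist_nonneg C powr_mult)
      finally show ?case .
    qed
    also have "... = ennreal (2 powr p) * (ennreal (C powr p) * (\<integral>\<^sup>+x. ennreal (?d x powr p) * indicator ?D x)
            + ennreal ?b * (leb ?U + (\<integral>\<^sup>+x. indicator ?U (x + v))))" by (simp add: nn_integral_cmult nn_integral_add)
    also have "(\<integral>\<^sup>+x. indicator ?U (x + v)) = leb ?U" using nn_integral_translate[of "indicator ?U" v] by simp
    also have "leb ?U = ennreal V" by (simp add: emeasure_ball V_def)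
    also have "ennreal (2 powr p) * (ennreal (C powr p) * (\<integral>\<^sup>+x. ennreal (?d x powr p) * indicator ?D x)
            + ennreal ?b * (ennreal V + ennreal V))
        <= ennreal (2 powr p) * (ennreal (C powr p) * ennreal (M * norm v powr p) + ennreal ?b * (ennreal V + ennreal V))"
      using T unfolding transl_bound_def by (intro mult_left_mono add_right_mono) auto
    also have "... = ennreal (2 powr p * (C powr p * (M * norm v powr p) + ?b * (V + V)))"
      using M by (simp add: V_def ennreal_mult[symmetric] ennreal_plus[symmetric] del: ennreal_plus)
    also have "2 powr p * (C powr p * (M * norm v powr p) + ?b * (V + V)) = M' * norm v powr p"
      using B by (simp add: M'_def powr_mult algebra_simps)
    finally show ?thesis .
  qed
  moreover have "0 <= M'" using M by (simp add: M'_def V_def)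
  ultimately have "banach_sobolev_map ?\<phi> 1 M' p" using p by unfold_locales (auto simp: cutoff_outside, measurable)
  then show ?thesis by blast
qed

lemma dens0_UN_finite:
  assumes "finite I" "\<And>i. i \<in> I ==> dens0 (S i) a" "\<And>i. i \<in> I ==> S i \<in> sets borel"
  shows "dens0 (\<Union>i\<in>I. S i) a" using assms
proof (induction rule: finite_induct)
  case empty
  then show ?case by (auto simp: dens0_def intro: exI[of _ 1])
next
  case (insert i I)
  then have "dens0 (S i \<union> (\<Union>i\<in>I. S i)) a" by (intro dens0_Un sets.finite_UN) auto
  then show ?case by simp
qed

text \<open>The sets \<open>P\<close>, on each of which one of countably many selections reproduces
  \<open>f\<close>, cover the space. Almost every point is a density point of every \<open>P\<close>
  containing it and a point of approximate differentiability of all cut off entries; there the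
  affine approximations of the entries together approximate \<open>f\<close> off a set of density
  zero.\<close>

lemma AE_approx_affine:
  fixes f :: "'a::euclidean_space => 'b::{real_inner, banach, second_countable_topology} multiset"
  assumes f [measurable]: "f \<in> borel \<rightarrow>\<^sub>M qborel Q" and T: "transl_bound p f M" and p: "1 < p" and M: "0 <= M"
  shows "AE a in lborel. a \<in> unit_disk --> (\<exists>As. length As = Q \<and> (\<forall>A\<in>set As. affine_map A) \<and>
    mset (map (\<lambda>A. A a) As) = f a \<and>
    (\<forall>\<e>>0. \<exists>S\<in>sets borel. dens0 S a \<and> (\<exists>\<delta>>0. \<forall>x. dist a x <= \<delta> --> x \<notin> S -->
       qdist (f x) (mset (map (\<lambda>A. A x) As)) <= \<e> * norm (x - a))))"
proof -
  have size: "size (f x) = Q" for x using measurable_space[OF f, of x] by simp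
  obtain I :: "(real \<times> 'b list) set" where I: "countable I" 
    "\<And>\<rho> c. (\<rho>, c) \<in> I ==> 0 < \<rho> \<and> length c = Q"
    "\<And>Y. size Y = Q ==> \<exists>(\<rho>, c)\<in>I. selected \<rho> c Y = Y" by (rule countable_selections[where 'b='b and Q=Q]) blast
  define P where "P \<rho> c = {x. selected \<rho> c (f x) = f x}" for \<rho> c
  have P: "P \<rho> c \<in> sets borel" if "(\<rho>, c) \<in> I" for \<rho> c
  proof -
    have \<rho>: "0 < \<rho>" "length c = Q" using I(2)[OF that] by auto
    have "(\<lambda>Y. qdist (selected \<rho> c Y) Y) \<in> borel_measurable (qborel Q)"
    proof (rule lipschitz_borel_measurable_qborel[where C="real Q * (3 * real Q) + 1"])
      fix Y Z :: "'b multiset" assume Y: "size Y = Q" and Z: "size Z = Q"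
      have "\<bar>qdist (selected \<rho> c Y) Y - qdist (selected \<rho> c Z) Z\<bar>
          <= \<bar>qdist (selected \<rho> c Y) Y - qdist (selected \<rho> c Z) Y\<bar> + \<bar>qdist Y (selected \<rho> c Z) - qdist Z (selected \<rho> c Z)\<bar>"
        by (simp add: qdist_commute)
      also have "... <= qdist (selected \<rho> c Y) (selected \<rho> c Z) + qdist Y Z"
        using Y Z \<rho> by (intro add_mono qdist_triangle2) auto
      also have "... <= real Q * (3 * real Q * qdist Y Z) + qdist Y Z" using selected_lipschitz[OF \<rho> Y Z] by simp
      finally show "dist (qdist (selected \<rho> c Y) Y) (qdist (selected \<rho> c Z) Z) <= (real Q * (3 * real Q) + 1) * qdist Y Z"
        by (simp add: dist_real_def algebra_simps)
    qed
    then have [measurable]: "(\<lambda>x. qdist (selected \<rho> c (f x)) (f x)) \<in> borel_measurable borel"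
      by (rule measurable_compose[OF f])
    have "P \<rho> c = {x. qdist (selected \<rho> c (f x)) (f x) = 0}" unfolding P_def using size \<rho> by (auto simp: qdist_eq_0)
    also have "... \<in> sets borel" by measurable
    finally show ?thesis .
  qed
  define \<phi> where "\<phi> \<rho> c i n x = cutoff n x *\<^sub>R entry_near \<rho> c i (f x)" for \<rho> c i n x
  have sob: "\<exists>M'. banach_sobolev_map (\<phi> \<rho> c i n) 1 M' p" if "(\<rho>, c) \<in> I" "i < Q" for \<rho> c i n unfolding \<phi>_def
    by (rule cutoff_sobolev_map[OF f T p M, where C="3 * real Q" and B="2 * real Q * \<rho>"])
      (use I(2)[OF that(1)] that(2) in \<open>auto intro!: entry_near_lipschitz entry_near_bound\<close>)
  have "AE a in lborel. \<forall>k\<in>I. \<forall>i\<in>{..<Q}. \<forall>n. \<exists>L. linear L \<and> (\<forall>\<e>>0. dens0 {y. \<e> * norm (y - a)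
      < norm (\<phi> (fst k) (snd k) i n y - \<phi> (fst k) (snd k) i n a - L (y - a))} a)"
    unfolding AE_all_countable AE_ball_countable[OF I(1)] AE_ball_countable[OF countable_finite[OF finite_lessThan]]
  proof (intro ballI allI)
    fix k i n assume k: "k \<in> I" and i: "i \<in> {..<Q}"
    obtain M' where "banach_sobolev_map (\<phi> (fst k) (snd k) i n) 1 M' p" using sob[of "fst k" "snd k" i n] k i by auto
    then show "AE a in lborel. \<exists>L. linear L \<and> (\<forall>\<e>>0. dens0 {y. \<e> * norm (y - a)
      < norm (\<phi> (fst k) (snd k) i n y - \<phi> (fst k) (snd k) i n a - L (y - a))} a)"
      by (rule banach_sobolev_map.AE_approx_differentiable)
  qed
  moreover have "AE a in lborel. \<forall>k\<in>I. a \<in> P (fst k) (snd k) --> dens0 (- P (fst k) (snd k)) a"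
    unfolding AE_ball_countable[OF I(1)]
  proof
    fix k assume k: "k \<in> I"
    have eq: "- X \<inter> cball a r = cball a r - X" for X and a :: 'a and r by auto
    show "AE a in lborel. a \<in> P (fst k) (snd k) --> dens0 (- P (fst k) (snd k)) a"
      unfolding dens0_def eq by (rule density_points) (use P k in auto)
  qed
  ultimately show ?thesis
  proof (eventually_elim, intro impI)
    fix a assume diff: "\<forall>k\<in>I. \<forall>i\<in>{..<Q}. \<forall>n. \<exists>L. linear L \<and> (\<forall>\<e>>0. dens0 {y. \<e> * norm (y - a)
      < norm (\<phi> (fst k) (snd k) i n y - \<phi> (fst k) (snd k) i n a - L (y - a))} a)"
      and dens: "\<forall>k\<in>I. a \<in> P (fst k) (snd k) --> dens0 (- P (fst k) (snd k)) a"
      and a: "a \<in> unit_disk"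
    obtain \<rho> c where k: "(\<rho>, c) \<in> I" "selected \<rho> c (f a) = f a" using I(3)[OF size[of a]] by blast
    have \<rho>: "0 < \<rho>" "length c = Q" using I(2)[OF k(1)] by auto
    have dP: "dens0 (- P \<rho> c) a" using dens[rule_format, OF k(1)] k(2) by (simp add: P_def)
    define \<delta>0 where "\<delta>0 = (1 - norm a) / 2"
    have \<delta>0: "0 < \<delta>0" using a by (simp add: \<delta>0_def)
    \<comment> \<open>\<open>n\<close> is so large that the cutoff equals 1 on the ball of radius
      \<open>\<delta>0\<close> about \<open>a\<close>.\<close>
    obtain n where n: "1 / \<delta>0 < real n" using reals_Archimedean2 by blast
    have cut: "cutoff n x = 1" if "dist a x <= \<delta>0" for x
    proof -
      have "norm x <= norm a + dist a x" by (metis dist_norm norm_triangle_sub norm_minus_commute)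
      then have "\<delta>0 <= 1 - norm x" using that unfolding \<delta>0_def by (simp add: field_simps)
      then have "real n * \<delta>0 <= real n * (1 - norm x)" by (intro mult_left_mono) auto
      moreover have "1 < real n * \<delta>0" using n \<delta>0 by (simp add: field_simps)
      ultimately show ?thesis by (simp add: cutoff_def)
    qed
    have "\<forall>i\<in>{..<Q}. \<exists>L. linear L \<and> (\<forall>\<e>>0. dens0 {y. \<e> * norm (y - a) < norm (\<phi> \<rho> c i n y - \<phi> \<rho> c i n a - L (y - a))} a)"
      using diff k(1) by fastforce
    then obtain L where "\<forall>i\<in>{..<Q}. linear (L i) \<and> (\<forall>\<e>>0. dens0 {y. \<e> * norm (y - a) < norm (\<phi> \<rho> c i n y - \<phi> \<rho> c i n a - L i (y - a))} a)"
      unfolding bchoice_iff by blast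
    then have L: "\<And>i. i < Q ==> linear (L i)"
      "\<And>i \<e>. i < Q ==> 0 < \<e> ==> dens0 {y. \<e> * norm (y - a) < norm (\<phi> \<rho> c i n y - \<phi> \<rho> c i n a - L i (y - a))} a" by auto
    define As where "As = map (\<lambda>i x. c ! i + entry_near \<rho> c i (f a) + L i (x - a)) [0..<Q]"
    have lenA: "length As = Q" by (simp add: As_def)
    have mapA: "map (\<lambda>A. A x) As = map (\<lambda>i. c ! i + entry_near \<rho> c i (f a) + L i (x - a)) [0..<Q]" for x
      by (simp add: As_def)
    have "affine_map A" if A: "A \<in> set As" for A
    proof -
      obtain i where i: "i < Q" "A = (\<lambda>x. c ! i + entry_near \<rho> c i (f a) + L i (x - a))"
        using A unfolding As_def by auto
      have "(\<lambda>x. A x - A 0) = L i"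
        unfolding i(2) using linear_diff[OF L(1)[OF i(1)]] linear_neg[OF L(1)[OF i(1)]] by auto
      then show ?thesis unfolding affine_map_def using L(1)[OF i(1)] by simp
    qed
    moreover have "mset (map (\<lambda>A. A a) As) = f a"
    proof -
      have "map (\<lambda>A. A a) As = map (\<lambda>i. c ! i + entry_near \<rho> c i (f a)) [0..<length c]"
        unfolding mapA \<rho>(2) using L(1) by (auto simp: linear_0)
      then have "mset (map (\<lambda>A. A a) As) = selected \<rho> c (f a)" by (simp only: selected_def)
      then show ?thesis using k(2) by simp
    qed
    moreover have "\<exists>S\<in>sets borel. dens0 S a \<and> (\<exists>\<delta>>0. \<forall>x. dist a x <= \<delta> --> x \<notin> S -->
       qdist (f x) (mset (map (\<lambda>A. A x) As)) <= \<e> * norm (x - a))" if \<e>: "0 < \<e>" for \<e>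
    proof -
      define \<e>' where "\<e>' = \<e> / (real Q + 1)"
      have \<e>': "0 < \<e>'" "real Q * \<e>' <= \<e>" using \<e> by (auto simp: \<e>'_def field_simps)
      define S where "S i = {y. \<e>' * norm (y - a) < norm (\<phi> \<rho> c i n y - \<phi> \<rho> c i n a - L i (y - a))}" for i
      have Sb: "S i \<in> sets borel" if i: "i < Q" for i
      proof -
        obtain M' where "banach_sobolev_map (\<phi> \<rho> c i n) 1 M' p" using sob[OF k(1) i] by blast
        then interpret banach_sobolev_map "\<phi> \<rho> c i n" 1 M' p .
        have [measurable]: "L i \<in> borel_measurable borel"
          using L(1)[OF i] by (auto intro!: borel_measurable_continuous_onI linear_continuous_on linear_conv_bounded_linear[THEN iffD1])
        show ?thesis unfolding S_def by measurable
      qed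
      have PB: "- P \<rho> c \<in> sets borel" using P[OF k(1)] by auto
      have "dens0 (- P \<rho> c \<union> (\<Union>i\<in>{..<Q}. S i)) a"
        using L(2) \<e>'(1) Sb PB by (intro dens0_Un dP dens0_UN_finite sets.finite_UN) (auto simp: S_def)
      moreover have "qdist (f x) (mset (map (\<lambda>A. A x) As)) <= \<e> * norm (x - a)"
        if x: "dist a x <= \<delta>0" "x \<notin> - P \<rho> c \<union> (\<Union>i\<in>{..<Q}. S i)" for x
      proof -
        let ?xs = "map (\<lambda>i. c ! i + entry_near \<rho> c i (f x)) [0..<length c]"
        have fx: "f x = mset ?xs" using x(2) by (auto simp: P_def selected_def)
        have "qdist (f x) (mset (map (\<lambda>A. A x) As)) = qdist (mset ?xs) (mset (map (\<lambda>A. A x) As))"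
          by (rule arg_cong2[where f=qdist, OF fx refl])
        also have "... <= L2_set (\<lambda>i. norm (?xs ! i - map (\<lambda>A. A x) As ! i)) {..<Q}"
          using qdist_le[of ?xs "map (\<lambda>A. A x) As"] \<rho>(2) lenA by simp
        also have "... <= real Q * (\<e>' * norm (x - a))"
        proof (rule L2_le_sum_bound)
          fix i assume i: "i < Q"
          have "norm (\<phi> \<rho> c i n x - \<phi> \<rho> c i n a - L i (x - a)) <= \<e>' * norm (x - a)"
            using x(2) i by (auto simp: S_def not_less)
          then show "norm (?xs ! i - map (\<lambda>A. A x) As ! i) <= \<e>' * norm (x - a)"
            unfolding mapA \<phi>_def using i \<rho>(2) cut[OF x(1)] cut[of a] \<delta>0 by (simp add: algebra_simps)
        qed
        also have "... <= \<e> * norm (x - a)" using \<e>'(2) by (simp add: mult.assoc[symmetric] mult_right_mono)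
        finally show ?thesis .
      qed
      moreover have "- P \<rho> c \<union> (\<Union>i\<in>{..<Q}. S i) \<in> sets borel" using Sb PB by (intro sets.Un sets.finite_UN) auto
      ultimately show ?thesis using \<delta>0 by blast
    qed
    ultimately show "\<exists>As. length As = Q \<and> (\<forall>A\<in>set As. affine_map A) \<and> mset (map (\<lambda>A. A a) As) = f a \<and>
      (\<forall>\<e>>0. \<exists>S\<in>sets borel. dens0 S a \<and> (\<exists>\<delta>>0. \<forall>x. dist a x <= \<delta> --> x \<notin> S -->
       qdist (f x) (mset (map (\<lambda>A. A x) As)) <= \<e> * norm (x - a)))" using lenA by blast
  qed
qed

section \<open>The approximate differential\<close>

lemma measure_lebesgue_cball: "0 <= r ==> measure lebesgue (cball (a :: real^'m) r) = unit_ball_vol CARD('m) * r ^ CARD('m)"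
  by (simp add: content_cball)

lemma density_zeroI:
  fixes S T :: "(real^'m) set"
  assumes T: "dens0 T a" "T \<in> sets borel" and \<delta>: "0 < \<delta>" "\<And>x. dist a x <= \<delta> ==> x \<in> S ==> x \<in> T"
  shows "density_zero S a" unfolding density_zero_def
proof (rule tendstoI)
  fix \<kappa> :: real assume \<kappa>: "0 < \<kappa>"
  then obtain \<delta>' where d: "0 < \<delta>'" 
    "\<And>r. 0 < r ==> r <= \<delta>' ==> leb (T \<inter> cball a r) <= ennreal (\<kappa> / 2) * leb (cball a r)"
    using T(1)[unfolded dens0_def, rule_format, of "\<kappa> / 2"] by auto
  have "dist (measure lebesgue (S \<inter> cball a r) / measure lebesgue (cball a r)) 0 < \<kappa>"
    if r: "0 < r" "r < min \<delta> \<delta>'" for r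
  proof -
    have sub: "S \<inter> cball a r \<subseteq> T \<inter> cball a r" using \<delta>(2) r by auto
    define V where "V = unit_ball_vol CARD('m) * r ^ CARD('m)"
    have V: "0 < V" using r by (simp add: V_def)
    have "leb (T \<inter> cball a r) <= ennreal (\<kappa> / 2) * ennreal V" using d(2)[of r] r by (simp add: emeasure_cball V_def)
    then have T_le: "leb (T \<inter> cball a r) <= ennreal (\<kappa> / 2 * V)" using \<kappa> V by (subst ennreal_mult) auto
    have "measure lebesgue (S \<inter> cball a r) <= \<kappa> / 2 * V"
    proof (cases "S \<inter> cball a r \<in> sets lebesgue")
      case True
      have "emeasure lebesgue (S \<inter> cball a r) <= emeasure lebesgue (T \<inter> cball a r)"
        using T(2) by (intro emeasure_mono sub) auto
      also have "... = leb (T \<inter> cball a r)" using T(2) by simp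
      finally have "emeasure lebesgue (S \<inter> cball a r) <= ennreal (\<kappa> / 2 * V)" using T_le by simp
      then show ?thesis unfolding measure_def using \<kappa> V by (intro enn2real_leI) auto
    next
      \<comment> \<open>\<open>measure\<close> is 0 on nonmeasurable sets, so the estimate holds for
        them as well.\<close>
      case False
      then show ?thesis using \<kappa> V by (simp add: measure_notin_sets)
    qed
    then have "measure lebesgue (S \<inter> cball a r) / V <= \<kappa> / 2" using V by (simp only: pos_divide_le_eq)
    then have "measure lebesgue (S \<inter> cball a r) / V < \<kappa>" using \<kappa> by linarith
    then show ?thesis using r by (simp add: measure_lebesgue_cball V_def dist_real_def del: measure_completion)
  qed
  then show "\<forall>\<^sub>F r in at_right 0. dist (measure lebesgue (S \<inter> cball a r) / measure lebesgue (cball a r)) 0 < \<kappa>"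
    using \<delta>(1) d(1) unfolding eventually_at_right_field by (intro exI[of _ "min \<delta> \<delta>'"]) auto
qed

text \<open>The points \<open>a + r *\<^sub>R v\<close> with \<open>v\<close> near \<open>v0\<close>
  form a ball that occupies the fixed proportion \<open>\<kappa>\<close> of
  \<open>cball a (r * b)\<close>, too much to be contained in \<open>S\<close> for small
  \<open>r\<close>.\<close>

lemma density_zero_good_direction:
  fixes S :: "(real^'m) set"
  assumes S: "density_zero S a" "S \<in> sets borel" and \<rho>: "0 < \<rho>"
  shows "\<exists>\<delta>>0. \<forall>r. 0 < r --> r <= \<delta> --> (\<exists>v\<in>ball v0 \<rho>. a + r *\<^sub>R v \<notin> S)"
proof -
  define b where "b = norm v0 + \<rho>"
  have b: "0 < b" using \<rho> by (simp add: b_def add_nonneg_pos)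
  define \<kappa> where "\<kappa> = (\<rho> / b) ^ CARD('m)"
  have \<kappa>: "0 < \<kappa>" using \<rho> b by (simp add: \<kappa>_def)
  obtain d where d: "0 < d" "\<And>r. 0 < r ==> r < d ==> dist (measure lebesgue (S \<inter> cball a r) / measure lebesgue (cball a r)) 0 < \<kappa>"
    using tendstoD[OF S(1)[unfolded density_zero_def] \<kappa>] unfolding eventually_at_right_field by auto
  have "\<exists>v\<in>ball v0 \<rho>. a + r *\<^sub>R v \<notin> S" if r: "0 < r" "r <= d / (2 * b)" for r
  proof (rule ccontr)
    assume *: "\<not> (\<exists>v\<in>ball v0 \<rho>. a + r *\<^sub>R v \<notin> S)"
    have sub: "ball (a + r *\<^sub>R v0) (r * \<rho>) \<subseteq> S \<inter> cball a (r * b)"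
    proof
      fix x assume x: "x \<in> ball (a + r *\<^sub>R v0) (r * \<rho>)"
      define v where "v = (x - a) /\<^sub>R r"
      have xv: "x = a + r *\<^sub>R v" using r by (simp add: v_def)
      have "r * norm (v0 - v) < r * \<rho>" using x r by (simp add: xv dist_norm flip: scaleR_diff_right)
      then have v: "v \<in> ball v0 \<rho>" using r by (simp add: dist_norm)
      then have "norm v <= b" unfolding b_def using norm_triangle_sub[of v v0] by (simp add: dist_norm norm_minus_commute)
      then have "x \<in> cball a (r * b)" using r by (simp add: xv dist_norm)
      then show "x \<in> S \<inter> cball a (r * b)" using * v xv by auto
    qed
    define w where "w = unit_ball_vol CARD('m)"
    have w: "0 < w" by (simp add: w_def)
    have "w * (r * \<rho>) ^ CARD('m) = measure lebesgue (ball (a + r *\<^sub>R v0) (r * \<rho>))"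
      using r \<rho> by (simp add: content_ball w_def)
    also have "... <= measure lebesgue (S \<inter> cball a (r * b))"
    proof (intro measure_mono_fmeasurable sub)
      show "S \<inter> cball a (r * b) \<in> lmeasurable"
        using fmeasurable_Int_fmeasurable[of "cball a (r * b)" lebesgue S] S(2) by (simp add: Int_commute)
    qed auto
    also have "... < \<kappa> * (w * (r * b) ^ CARD('m))"
    proof -
      have "r * b < d" using r b d(1) by (simp add: field_simps)
      then have "dist (measure lebesgue (S \<inter> cball a (r * b)) / measure lebesgue (cball a (r * b))) 0 < \<kappa>"
        using r b by (intro d) auto
      then show ?thesis
        using r b w by (simp add: measure_lebesgue_cball w_def[symmetric] dist_real_def field_simps del: measure_completion)
    qed
    also have "... = w * (r * \<rho>) ^ CARD('m)" using b by (simp add: \<kappa>_def power_divide power_mult_distrib)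
    finally show False by simp
  qed
  then show ?thesis using d(1) b by (intro exI[of _ "d / (2 * b)"]) auto
qed

definition lin_part :: "('a::real_vector => 'b::real_vector) => 'a => 'b" where
  "lin_part A x = A x - A 0"

lemma affine_lin_part:
  assumes "affine_map A"
  shows "linear (lin_part A)" "A y = A a + lin_part A (y - a)"
  using assms linear_diff[of "lin_part A" y a] by (simp_all add: affine_map_def lin_part_def[abs_def])

lemma affine_map_eqI:
  assumes "affine_map A" "affine_map B" "A a = B a" "\<And>v. lin_part A v = lin_part B v"
  shows "A = B"
proof
  fix x show "A x = B x"
    using affine_lin_part(2)[OF assms(1), of x a] affine_lin_part(2)[OF assms(2), of x a] assms(3,4) by simp
qed

text \<open>A real vector space is not a finite union of proper subspaces: on a line through a
  vector good for \<open>Ds\<close>, in a direction good for \<open>D\<close>, each of the maps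
  vanishes for at most one parameter.\<close>

lemma finite_linear_nonzero:
  fixes Ds :: "('a::real_vector => 'b::real_vector) set"
  assumes "finite Ds" "\<And>D. D \<in> Ds ==> linear D \<and> (\<exists>v. D v \<noteq> 0)"
  shows "\<exists>v. \<forall>D\<in>Ds. D v \<noteq> 0" using assms
proof (induction rule: finite_induct)
  case (insert D Ds)
  then obtain v where v: "\<forall>D\<in>Ds. D v \<noteq> 0" by auto
  obtain u where u: "D u \<noteq> 0" "linear D" using insert.prems by auto
  define bad where "bad D' = {t :: real. D' (v + t *\<^sub>R u) = 0}" for D' :: "'a => 'b"
  have fin: "finite (bad D')" if D': "linear D'" "D' v \<noteq> 0 \<or> D' u \<noteq> 0" for D' :: "'a => 'b"
  proof -
    have "s = t" if "s \<in> bad D'" "t \<in> bad D'" for s t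
    proof -
      have s: "D' v + s *\<^sub>R D' u = 0" and t: "D' v + t *\<^sub>R D' u = 0"
        using that by (auto simp: bad_def linear_add[OF D'(1)] linear_scale[OF D'(1)])
      then have "(s - t) *\<^sub>R D' u = 0" by (metis add_diff_cancel_left cancel_comm_monoid_add_class.diff_cancel scaleR_left_diff_distrib)
      then show ?thesis using D'(2) s by auto
    qed
    then have "bad D' = {} \<or> (\<exists>t. bad D' = {t})" by blast
    then show ?thesis by (elim disjE exE) simp_all
  qed
  have "finite (\<Union>D'\<in>insert D Ds. bad D')" using insert.hyps(1) insert.prems v u by (intro finite_UN_I fin) auto
  then obtain t where "t \<notin> (\<Union>D'\<in>insert D Ds. bad D')" using ex_new_if_finite infinite_UNIV_char_0 by blast
  then show ?case by (auto simp: bad_def)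
qed simp

lemma density_zero_Un:
  fixes S T :: "(real^'m) set"
  assumes "density_zero S a" "density_zero T a" and [measurable]: "S \<in> sets borel" "T \<in> sets borel"
  shows "density_zero (S \<union> T) a"
proof -
  let ?m = "\<lambda>S r. measure lebesgue (S \<inter> cball a r) / measure lebesgue (cball a r)"
  have sum: "((\<lambda>r. ?m S r + ?m T r) \<longlongrightarrow> 0) (at_right 0)"
    using tendsto_add[OF assms(1,2)[unfolded density_zero_def]] by (simp only: add_0)
  have "?m (S \<union> T) r <= ?m S r + ?m T r" for r
  proof -
    have "measure lebesgue ((S \<union> T) \<inter> cball a r) <= measure lebesgue (S \<inter> cball a r) + measure lebesgue (T \<inter> cball a r)"
      unfolding Int_Un_distrib2 using assms(3,4) by (intro measure_Un_le) auto
    then show ?thesis unfolding add_divide_distrib[symmetric] by (intro divide_right_mono) auto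
  qed
  then show ?thesis
    unfolding density_zero_def by (intro tendsto_sandwich[OF _ _ tendsto_const sum]) (auto intro!: always_eventually)
qed

text \<open>The sets may vary with \<open>n\<close>, so that \<open>S n\<close> can be the bad set
  for a tolerance tending to 0; the points approach \<open>a\<close> along the direction
  \<open>v0\<close>.\<close>

lemma density_zero_good_sequence:
  fixes S :: "nat => (real^'m) set"
  assumes S: "\<And>n. density_zero (S n) a" "\<And>n. S n \<in> sets borel" and \<delta>: "0 < \<delta>"
  obtains r v where "\<And>n. 0 < r n" "\<And>n. a + r n *\<^sub>R v n \<notin> S n" "\<And>n. dist (a + r n *\<^sub>R v n) a < \<delta>"
    "r \<longlonglongrightarrow> 0" "v \<longlonglongrightarrow> v0"
proof -
  let ?i = "\<lambda>n. inverse (real (Suc n))"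
  have "\<exists>r v. 0 < r \<and> r <= ?i n \<and> dist v v0 < ?i n \<and> a + r *\<^sub>R v \<notin> S n \<and> dist (a + r *\<^sub>R v) a < \<delta>" for n
  proof -
    obtain d where d: "d > 0" "\<And>r. 0 < r ==> r <= d ==> \<exists>v\<in>ball v0 (?i n). a + r *\<^sub>R v \<notin> S n"
      using density_zero_good_direction[OF S(1)[of n] S(2)[of n], of "?i n" v0] by auto
    define r where "r = Min {d, ?i n, \<delta> / (norm v0 + 2)}"
    have pos: "0 < norm v0 + 2" using norm_ge_zero[of v0] by linarith
    have r: "0 < r" "r <= d" "r <= ?i n" "r <= \<delta> / (norm v0 + 2)" using d(1) \<delta> pos by (auto simp: r_def)
    obtain v where v: "v \<in> ball v0 (?i n)" "a + r *\<^sub>R v \<notin> S n" using d(2)[OF r(1,2)] by blast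
    have "?i n <= 1" by (simp add: field_simps)
    then have "norm v < norm v0 + 2" using v(1) norm_triangle_ineq2[of v v0] by (simp add: dist_norm norm_minus_commute)
    then have "r * norm v < r * (norm v0 + 2)" using r(1) by simp
    also have "... <= \<delta>" using r(4) pos by (simp add: pos_le_divide_eq)
    finally show ?thesis using r v by (intro exI[of _ r] exI[of _ v]) (auto simp: dist_norm norm_minus_commute)
  qed
  then obtain r v where rv: "\<And>n. 0 < r n" "\<And>n. r n <= ?i n" "\<And>n. dist (v n) v0 < ?i n"
    "\<And>n. a + r n *\<^sub>R v n \<notin> S n" "\<And>n. dist (a + r n *\<^sub>R v n) a < \<delta>" by metis
  have "r \<longlonglongrightarrow> 0"
    using rv(1,2) by (intro tendsto_sandwich[OF _ _ tendsto_const LIMSEQ_inverse_real_of_nat]) (auto intro!: always_eventually less_imp_le)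
  moreover have "v \<longlonglongrightarrow> v0"
    using rv(3) by (subst tendsto_dist_iff, intro tendsto_sandwich[OF _ _ tendsto_const LIMSEQ_inverse_real_of_nat])
      (auto intro!: always_eventually less_imp_le)
  ultimately show ?thesis using that rv by blast
qed

lemma tendsto_frequently_le:
  fixes l m :: real
  assumes "(f \<longlongrightarrow> l) F" "(g \<longlongrightarrow> m) F" "\<exists>\<^sub>F n in F. f n <= g n"
  shows "l <= m"
proof (rule ccontr)
  assume "\<not> l <= m"
  then have "\<forall>\<^sub>F n in F. 0 < f n - g n" by (intro order_tendstoD(1)[OF tendsto_diff[OF assms(1,2)]]) auto
  then have "\<forall>\<^sub>F n in F. \<not> f n <= g n" by (rule eventually_mono) simp
  then show False using assms(3) by (simp add: frequently_def)
qed

text \<open>One permutation matches the two tuples at infinitely many of the points \<open>a + r\<^sub>n v\<^sub>n\<close>.\<close>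

lemma affine_tuples_first_order:
  fixes As Bs :: "(real^'m => 'b::real_normed_vector) list"
  assumes len: "length As = Q" "length Bs = Q" and aff: "\<forall>A\<in>set As \<union> set Bs. affine_map A"
    and r: "\<And>n. 0 < r n" "r \<longlonglongrightarrow> 0" and v: "v \<longlonglongrightarrow> v0" and c: "c \<longlonglongrightarrow> c0"
    and close: "\<And>n. qdist (mset (map (\<lambda>A. A (a + r n *\<^sub>R v n)) As)) (mset (map (\<lambda>A. A (a + r n *\<^sub>R v n)) Bs)) <= c n * r n"
  obtains \<sigma> where "\<sigma> permutes {..<Q}"
    "\<And>i. i < Q ==> (As ! i) a = (Bs ! \<sigma> i) a \<and> norm (lin_part (As ! i) v0 - lin_part (Bs ! \<sigma> i) v0) <= c0"
proof -
  let ?x = "\<lambda>n. a + r n *\<^sub>R v n"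
  define P where "P n \<sigma> \<longleftrightarrow> (\<forall>i<Q. norm ((As ! i) (?x n) - (Bs ! \<sigma> i) (?x n)) <= c n * r n)" for n \<sigma>
  have "\<exists>\<sigma>\<in>{\<sigma>. \<sigma> permutes {..<Q}}. P n \<sigma>" for n
  proof -
    let ?as = "map (\<lambda>A. A (?x n)) As" and ?bs = "map (\<lambda>A. A (?x n)) Bs"
    obtain \<sigma> where \<sigma>: "\<sigma> permutes {..<Q}" "qdist (mset ?as) (mset ?bs) = L2_set (\<lambda>i. norm (?as ! i - ?bs ! \<sigma> i)) {..<Q}"
      by (rule qdist_permutation[of ?as Q ?bs]) (auto simp: len)
    have "norm (?as ! i - ?bs ! \<sigma> i) <= c n * r n" if "i < Q" for i
      using norm_le_L2[OF that, of "\<lambda>i. ?as ! i - ?bs ! \<sigma> i"] close[of n] \<sigma>(2) by linarith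
    then show ?thesis using \<sigma>(1) permutes_in_image[OF \<sigma>(1)] len unfolding P_def by (intro bexI[of _ \<sigma>]) auto
  qed
  then have "\<exists>\<^sub>F n in sequentially. \<exists>\<sigma>\<in>{\<sigma>. \<sigma> permutes {..<Q}}. P n \<sigma>" by simp
  then obtain \<sigma> where \<sigma>: "\<sigma> permutes {..<Q}" "\<exists>\<^sub>F n in sequentially. P n \<sigma>"
    using frequently_bex_finite[OF finite_permutations[of "{..<Q}"]] by auto
  show ?thesis
  proof (rule that[OF \<sigma>(1)])
    fix i assume i: "i < Q"
    define A B where "A = As ! i" and "B = Bs ! \<sigma> i"
    have AB: "affine_map A" "affine_map B" using i permutes_in_image[OF \<sigma>(1), of i] aff len by (auto simp: A_def B_def)
    define D where "D w = lin_part A w - lin_part B w" for w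
    have D: "linear D" unfolding D_def[abs_def] by (intro linear_compose_sub affine_lin_part(1) AB)
    then have Dv: "(\<lambda>n. D (v n)) \<longlonglongrightarrow> D v0" by (rule bounded_linear.tendsto[OF linear_conv_bounded_linear[THEN iffD1] v])
    have eq: "A (?x n) - B (?x n) = (A a - B a) + r n *\<^sub>R D (v n)" for n
      using affine_lin_part(2)[of A "?x n" a] affine_lin_part(2)[of B "?x n" a] AB linear_scale[OF D, of "r n" "v n"]
      by (simp add: D_def)
    have nm: "norm ((A a - B a) + r n *\<^sub>R D (v n)) = norm ((As ! i) (?x n) - (Bs ! \<sigma> i) (?x n))" for n
      using eq[of n] unfolding A_def B_def by (rule arg_cong[OF sym])
    have fr: "\<exists>\<^sub>F n in sequentially. norm ((A a - B a) + r n *\<^sub>R D (v n)) <= c n * r n"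
      using \<sigma>(2) by (rule frequently_elim1) (use i in \<open>auto simp only: P_def nm\<close>)
    \<comment> \<open>Letting \<open>r n\<close> tend to 0 gives equality at \<open>a\<close>; once
      these values cancel, division by \<open>r n\<close> compares the linear parts at
      \<open>v0\<close>.\<close>
    have "(\<lambda>n. norm ((A a - B a) + r n *\<^sub>R D (v n))) \<longlonglongrightarrow> norm ((A a - B a) + 0 *\<^sub>R D v0)"
      by (intro tendsto_norm tendsto_add tendsto_scaleR tendsto_const r Dv)
    from tendsto_frequently_le[OF this tendsto_mult[OF c r(2)] fr] have Aa: "A a = B a" by simp
    have "\<exists>\<^sub>F n in sequentially. norm (D (v n)) <= c n"
      using fr by (rule frequently_elim1) (use r(1) in \<open>simp add: Aa mult.commute[of "c _"] less_imp_le\<close>)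
    from tendsto_frequently_le[OF tendsto_norm[OF Dv] c this]
    show "(As ! i) a = (Bs ! \<sigma> i) a \<and> norm (lin_part (As ! i) v0 - lin_part (Bs ! \<sigma> i) v0) <= c0"
      using Aa by (simp add: A_def B_def D_def)
  qed
qed

context
  fixes f :: "real^'m => 'b::{real_normed_vector, second_countable_topology} multiset" and Q :: nat and U :: "(real^'m) set"
  assumes f [measurable]: "f \<in> borel \<rightarrow>\<^sub>M qborel Q" and U: "open U"
begin

lemma size_f: "size (f x) = Q" using measurable_space[OF f, of x] by simp

lemma affine_tuple_lipschitz:
  assumes "\<forall>A\<in>set As. affine_map A" "length As = Q"
  shows "\<exists>K\<ge>0. \<forall>x y. qdist (mset (map (\<lambda>A. A x) As)) (mset (map (\<lambda>A. A y) As)) <= K * dist x (y :: real^'m)"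
proof -
  have "\<exists>K\<ge>0. \<forall>x. norm (lin_part A x) <= K * norm x" if "A \<in> set As" for A
    using linear_conv_bounded_linear[THEN iffD1, OF affine_lin_part(1)] assms(1) that bounded_linear.nonneg_bounded
    by (metis mult.commute)
  then obtain K where K: "\<And>A. A \<in> set As ==> 0 <= K A" "\<And>A x. A \<in> set As ==> norm (lin_part A x) <= K A * norm x" by metis
  define K' where "K' = (\<Sum>A\<in>set As. K A)"
  have K': "K A <= K'" if "A \<in> set As" for A unfolding K'_def using K(1) that by (intro member_le_sum) auto
  have K'0: "0 <= K'" unfolding K'_def using K(1) by (intro sum_nonneg) auto
  have "qdist (mset (map (\<lambda>A. A x) As)) (mset (map (\<lambda>A. A y) As)) <= (real Q * K') * dist x y" for x y
  proof -
    have "qdist (mset (map (\<lambda>A. A x) As)) (mset (map (\<lambda>A. A y) As))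
        <= L2_set (\<lambda>i. norm (map (\<lambda>A. A x) As ! i - map (\<lambda>A. A y) As ! i)) {..<Q}"
      using qdist_le[of "map (\<lambda>A. A x) As" "map (\<lambda>A. A y) As"] assms(2) by simp
    also have "... <= real Q * (K' * dist x y)"
    proof (rule L2_le_sum_bound)
      fix i assume "i < Q"
      then have i: "As ! i \<in> set As" "i < length As" using assms(2) by auto
      have "norm ((As ! i) x - (As ! i) y) = norm (lin_part (As ! i) (x - y))"
        using affine_lin_part(2)[of "As ! i" x y] assms(1) i by simp
      also have "... <= K (As ! i) * norm (x - y)" by (rule K(2)[OF i(1)])
      also have "... <= K' * norm (x - y)" by (intro mult_right_mono K' i) auto
      finally show "norm (map (\<lambda>A. A x) As ! i - map (\<lambda>A. A y) As ! i) <= K' * dist x y"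
        using i by (simp add: dist_norm)
    qed
    finally show ?thesis by (simp add: mult.assoc)
  qed
  then show ?thesis using K'0 by (intro exI[of _ "real Q * K'"]) auto
qed

lemma approx_affine_list:
  assumes "approx_affine Q U f a \<A>"
  obtains As where "mset As = \<A>" "length As = Q" "\<forall>A\<in>set As. affine_map A"
    "\<And>\<e>. 0 < \<e> ==> density_zero {x \<in> U. \<e> * norm (x - a) < qdist (f x) (mset (map (\<lambda>A. A x) As))} a"
    "\<And>\<e>. {x \<in> U. \<e> * norm (x - a) < qdist (f x) (mset (map (\<lambda>A. A x) As))} \<in> sets borel"
proof -
  have A: "\<A> \<in> Qtuples Q (Collect affine_map)" using assms by (simp add: approx_affine_def)
  then obtain As where As: "mset As = \<A>" "length As = Q" using size_imp_list[of \<A> Q] by (auto simp: Qtuples_def)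
  have aff: "\<forall>A\<in>set As. affine_map A" using A As by (auto simp: Qtuples_def)
  have "image_mset (\<lambda>A. A x) \<A> = mset (map (\<lambda>A. A x) As)" for x using As(1) by simp
  then have "density_zero {x \<in> U. \<e> * norm (x - a) < qdist (f x) (mset (map (\<lambda>A. A x) As))} a" if "0 < \<e>" for \<e>
    using assms that by (simp add: approx_affine_def del: mset_map)
  moreover have "{x \<in> U. \<e> * norm (x - a) < qdist (f x) (mset (map (\<lambda>A. A x) As))} \<in> sets borel" for \<e>
  proof -
    obtain K where "\<And>x y. qdist (mset (map (\<lambda>A. A x) As)) (mset (map (\<lambda>A. A y) As)) <= K * dist x y"
      using affine_tuple_lipschitz[OF aff As(2)] by blast
    then have [measurable]: "(\<lambda>x. mset (map (\<lambda>A. A x) As)) \<in> borel \<rightarrow>\<^sub>M qborel Q"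
      using As(2) by (intro lipschitz_into_qborel) auto
    have [measurable]: "U \<in> sets borel" using U by simp
    show ?thesis by measurable
  qed
  ultimately show ?thesis using that As aff by blast
qed

text \<open>Matching along a sequence compares linear parts in one direction only, so
  \<open>v0\<close> is chosen such that no nonzero difference between a linear part from
  \<open>As\<close> and one from \<open>Bs\<close> vanishes there. Along points good for both tuples
  the distance is \<open>o(r n)\<close>, so matched entries agree at \<open>a\<close> and at
  \<open>v0\<close>, hence everywhere.\<close>

lemma approx_affine_unique:
  assumes a: "a \<in> U" and A: "approx_affine Q U f a \<A>" and B: "approx_affine Q U f a \<B>"
  shows "\<A> = \<B>"
proof -
  obtain As where As: "mset As = \<A>" "length As = Q" "\<forall>A\<in>set As. affine_map A"
    "\<And>\<e>. 0 < \<e> ==> density_zero {x \<in> U. \<e> * norm (x - a) < qdist (f x) (mset (map (\<lambda>A. A x) As))} a"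
    "\<And>\<e>. {x \<in> U. \<e> * norm (x - a) < qdist (f x) (mset (map (\<lambda>A. A x) As))} \<in> sets borel"
    by (rule approx_affine_list[OF A]) blast
  obtain Bs where Bs: "mset Bs = \<B>" "length Bs = Q" "\<forall>A\<in>set Bs. affine_map A"
    "\<And>\<e>. 0 < \<e> ==> density_zero {x \<in> U. \<e> * norm (x - a) < qdist (f x) (mset (map (\<lambda>A. A x) Bs))} a"
    "\<And>\<e>. {x \<in> U. \<e> * norm (x - a) < qdist (f x) (mset (map (\<lambda>A. A x) Bs))} \<in> sets borel"
    by (rule approx_affine_list[OF B]) blast
  define N where "N = (\<lambda>(A, B) w. lin_part A w - lin_part B w) ` (set As \<times> set Bs)"
  have linN: "linear D" if "D \<in> N" for D
    using that As(3) Bs(3) unfolding N_def by (auto intro!: linear_compose_sub affine_lin_part(1))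
  have "finite {D \<in> N. \<exists>w. D w \<noteq> 0}" by (simp add: N_def)
  then have "\<exists>v. \<forall>D\<in>{D \<in> N. \<exists>w. D w \<noteq> 0}. D v \<noteq> 0" by (rule finite_linear_nonzero) (use linN in blast)
  then obtain v0 where v0: "\<And>D. D \<in> N ==> (\<exists>w. D w \<noteq> 0) ==> D v0 \<noteq> 0" by blast
  define S where "S As n = {x \<in> U. inverse (real (Suc n)) * norm (x - a) < qdist (f x) (mset (map (\<lambda>A. A x) As))}" for As n
  obtain \<delta> where \<delta>: "0 < \<delta>" "ball a \<delta> \<subseteq> U" using U a open_contains_ball by blast
  have dS: "density_zero (S As n \<union> S Bs n) a" "S As n \<union> S Bs n \<in> sets borel" for n
    using As(4,5) Bs(4,5) by (auto simp: S_def intro!: density_zero_Un sets.Un)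
  obtain r v where rv: "\<And>n. 0 < r n" "\<And>n. a + r n *\<^sub>R v n \<notin> S As n \<union> S Bs n" "\<And>n. dist (a + r n *\<^sub>R v n) a < \<delta>"
    "r \<longlonglongrightarrow> 0" "v \<longlonglongrightarrow> v0"
    by (rule density_zero_good_sequence[where S="\<lambda>n. S As n \<union> S Bs n" and ?v0.0=v0, OF dS \<delta>(1)]) (rule that)
  let ?F = "\<lambda>As n. mset (map (\<lambda>A. A (a + r n *\<^sub>R v n)) As)"
  have close: "qdist (?F As n) (?F Bs n) <= (2 * inverse (real (Suc n)) * norm (v n)) * r n" for n
  proof -
    let ?x = "a + r n *\<^sub>R v n"
    have "?x \<in> U" using \<delta>(2) rv(3)[of n] by (auto simp: dist_commute)
    then have "qdist (f ?x) (?F As n) <= inverse (real (Suc n)) * (r n * norm (v n))"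
      "qdist (f ?x) (?F Bs n) <= inverse (real (Suc n)) * (r n * norm (v n))"
      using rv(1,2)[of n] by (auto simp: S_def not_less)
    moreover have "qdist (?F As n) (?F Bs n) <= qdist (f ?x) (?F As n) + qdist (f ?x) (?F Bs n)"
      by (subst (2) qdist_commute, rule qdist_triangle[where Q=Q]) (auto simp: As(2) Bs(2) size_f)
    ultimately show ?thesis by (simp add: algebra_simps)
  qed
  have "(\<lambda>n. 2 * inverse (real (Suc n)) * norm (v n)) \<longlonglongrightarrow> 2 * 0 * norm v0"
    by (intro tendsto_intros LIMSEQ_inverse_real_of_nat rv(5))
  from affine_tuples_first_order[OF As(2) Bs(2) _ rv(1,4,5) this close] As(3) Bs(3)
  obtain \<sigma> where \<sigma>: "\<sigma> permutes {..<Q}"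
    "\<And>i. i < Q ==> (As ! i) a = (Bs ! \<sigma> i) a \<and> norm (lin_part (As ! i) v0 - lin_part (Bs ! \<sigma> i) v0) <= 2 * 0 * norm v0"
    by blast
  have "As ! i = Bs ! \<sigma> i" if i: "i < Q" for i
  proof -
    have AB: "As ! i \<in> set As" "Bs ! \<sigma> i \<in> set Bs" using i permutes_in_image[OF \<sigma>(1), of i] As(2) Bs(2) by auto
    have "(\<lambda>w. lin_part (As ! i) w - lin_part (Bs ! \<sigma> i) w) \<in> N" unfolding N_def using AB by force
    from v0[OF this] have "lin_part (As ! i) w = lin_part (Bs ! \<sigma> i) w" for w using \<sigma>(2)[OF i] by auto
    then show ?thesis using \<sigma>(2)[OF i] AB As(3) Bs(3) by (intro affine_map_eqI[of _ _ a]) auto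
  qed
  then have "As = permute_list \<sigma> Bs" using \<sigma>(1) As(2) Bs(2) by (intro nth_equalityI) (auto simp: permute_list_nth)
  then have "mset As = mset Bs" using mset_permute_list[of \<sigma> Bs] \<sigma>(1) Bs(2) by simp
  then show ?thesis using As(1) Bs(1) by simp
qed

end

lemma norm_Df_nonneg: "0 <= norm_Df Q U f a"
proof -
  have "0 <= (\<Sum>L\<in>#A. \<Sum>j\<in>UNIV. (norm (L (axis j 1)))\<^sup>2)" for A :: "(real^'m => 'b::real_normed_vector) multiset"
    by (induction A) (auto intro!: add_nonneg_nonneg sum_nonneg)
  then show ?thesis unfolding norm_Df_def by simp
qed

lemma norm_Df_eq:
  fixes f :: "real^'m => 'b::{real_normed_vector, second_countable_topology} multiset"
  assumes f: "f \<in> borel \<rightarrow>\<^sub>M qborel Q" and U: "open U" "a \<in> U" and A: "approx_affine Q U f a (mset As)"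
  shows "norm_Df Q U f a = sqrt (\<Sum>i<length As. \<Sum>j\<in>UNIV. (norm (lin_part (As ! i) (axis j 1)))\<^sup>2)"
proof -
  have "(THE \<A>. approx_affine Q U f a \<A>) = mset As"
    by (rule the1_equality) (use A approx_affine_unique[OF f U] in blast)+
  then have "Df Q U f a = image_mset lin_part (mset As)" unfolding Df_def lin_part_def[abs_def] by simp
  then show ?thesis unfolding norm_Df_def by (simp add: sum_mset_list image_mset.compositionality comp_def)
qed

text \<open>Entry by entry, the operator norm is at most the Hilbert-Schmidt norm that defines
  \<open>norm_Df\<close>.\<close>

lemma affine_tuple_growth:
  fixes As :: "(real^'m => 'b::real_normed_vector) list"
  assumes aff: "\<forall>A\<in>set As. affine_map A"
  shows "qdist (mset (map (\<lambda>A. A y) As)) (mset (map (\<lambda>A. A a) As))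
    <= sqrt (\<Sum>i<length As. \<Sum>j\<in>UNIV. (norm (lin_part (As ! i) (axis j 1)))\<^sup>2) * norm (y - a)"
proof -
  let ?l = "\<lambda>i j. norm (lin_part (As ! i) (axis j 1))"
  let ?v = "y - a"
  have row: "(norm (lin_part (As ! i) ?v))\<^sup>2 <= (norm ?v)\<^sup>2 * (\<Sum>j\<in>UNIV. (?l i j)\<^sup>2)" if i: "i < length As" for i
  proof -
    have lin: "linear (lin_part (As ! i))" by (rule affine_lin_part(1)) (use aff i in auto)
    have "lin_part (As ! i) ?v = lin_part (As ! i) (\<Sum>j\<in>UNIV. (?v $ j) *\<^sub>R axis j 1)"
      by (simp only: basis_expansion[of ?v, unfolded scalar_mult_eq_scaleR])
    also have "... = (\<Sum>j\<in>UNIV. (?v $ j) *\<^sub>R lin_part (As ! i) (axis j 1))"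
      by (simp only: linear_sum[OF lin] linear_scale[OF lin])
    finally have "norm (lin_part (As ! i) ?v) = norm (\<Sum>j\<in>UNIV. (?v $ j) *\<^sub>R lin_part (As ! i) (axis j 1))" by (rule arg_cong)
    also have "... <= (\<Sum>j\<in>UNIV. \<bar>?v $ j\<bar> * ?l i j)" by (rule order_trans[OF norm_sum]) simp
    finally have "(norm (lin_part (As ! i) ?v))\<^sup>2 <= (\<Sum>j\<in>UNIV. \<bar>?v $ j\<bar> * ?l i j)\<^sup>2" by (intro power_mono) auto
    also have "... <= (\<Sum>j\<in>UNIV. \<bar>?v $ j\<bar>\<^sup>2) * (\<Sum>j\<in>UNIV. (?l i j)\<^sup>2)" by (rule Cauchy_Schwarz_ineq_sum)
    also have "(\<Sum>j\<in>UNIV. \<bar>?v $ j\<bar>\<^sup>2) = (norm ?v)\<^sup>2" by (simp add: norm_vec_def L2_set_def sum_nonneg)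
    finally show ?thesis .
  qed
  have "qdist (mset (map (\<lambda>A. A y) As)) (mset (map (\<lambda>A. A a) As))
      <= L2_set (\<lambda>i. norm (map (\<lambda>A. A y) As ! i - map (\<lambda>A. A a) As ! i)) {..<length As}"
    using qdist_le[of "map (\<lambda>A. A y) As" "map (\<lambda>A. A a) As"] by simp
  also have "... = L2_set (\<lambda>i. norm (lin_part (As ! i) ?v)) {..<length As}"
  proof (rule L2_set_cong[OF refl])
    fix i assume i: "i \<in> {..<length As}"
    then have "affine_map (As ! i)" using aff by auto
    then show "norm (map (\<lambda>A. A y) As ! i - map (\<lambda>A. A a) As ! i) = norm (lin_part (As ! i) ?v)"
      using affine_lin_part(2)[of "As ! i" y a] i by simp
  qed
  also have "... <= sqrt (\<Sum>i<length As. (norm ?v)\<^sup>2 * (\<Sum>j\<in>UNIV. (?l i j)\<^sup>2))"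
    unfolding L2_set_def by (intro real_sqrt_le_mono sum_mono row) auto
  also have "... = sqrt (\<Sum>i<length As. \<Sum>j\<in>UNIV. (?l i j)\<^sup>2) * norm ?v"
    by (simp add: sum_distrib_left[symmetric] real_sqrt_mult mult.commute)
  finally show ?thesis .
qed

text \<open>This is the first order information that the translation estimate uses. The affine maps
  found by selection are those behind \<open>Df\<close>, by uniqueness, and their growth is at most
  \<open>norm_Df\<close>.\<close>

lemma AE_approx_differential:
  fixes f :: "real^'m => 'b::{real_inner, banach, second_countable_topology} multiset"
  assumes f: "f \<in> borel \<rightarrow>\<^sub>M qborel Q" and T: "transl_bound p f M" and p: "1 < p" and M: "0 <= M"
  shows "AE a in lborel. a \<in> ball 0 1 --> (\<forall>\<e>>0. \<exists>S\<in>sets borel. dens0 S a \<and> (\<exists>\<delta>>0. \<forall>x. dist a x <= \<delta> --> x \<notin> S -->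
       qdist (f a) (f x) <= (norm_Df Q (ball 0 1) f a + \<e>) * norm (x - a)))" using AE_approx_affine[OF f T p M]
proof (eventually_elim, intro impI allI)
  fix a :: "real^'m" and \<e> :: real
  assume "a \<in> ball 0 1 --> (\<exists>As. length As = Q \<and> (\<forall>A\<in>set As. affine_map A) \<and>
    mset (map (\<lambda>A. A a) As) = f a \<and>
    (\<forall>\<e>>0. \<exists>S\<in>sets borel. dens0 S a \<and> (\<exists>\<delta>>0. \<forall>x. dist a x <= \<delta> --> x \<notin> S -->
       qdist (f x) (mset (map (\<lambda>A. A x) As)) <= \<e> * norm (x - a))))"
    and a: "a \<in> ball 0 1" and \<e>: "0 < \<e>"
  then obtain As where As: "length As = Q" "\<forall>A\<in>set As. affine_map A" "mset (map (\<lambda>A. A a) As) = f a"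
    and S: "\<And>\<e>. 0 < \<e> ==> \<exists>S\<in>sets borel. dens0 S a \<and> (\<exists>\<delta>>0. \<forall>x. dist a x <= \<delta> --> x \<notin> S -->
       qdist (f x) (mset (map (\<lambda>A. A x) As)) <= \<e> * norm (x - a))" by blast
  have size: "size (f x) = Q" for x using measurable_space[OF f, of x] by simp
  have "approx_affine Q (ball 0 1) f a (mset As)" unfolding approx_affine_def
  proof (intro conjI allI impI)
    show "mset As \<in> Qtuples Q (Collect affine_map)" using As by (auto simp: Qtuples_def)
    fix e :: real assume "0 < e"
    then obtain S \<delta> where "S \<in> sets borel" "dens0 S a" "0 < \<delta>"
      "\<And>x. dist a x <= \<delta> ==> x \<notin> S ==> qdist (f x) (mset (map (\<lambda>A. A x) As)) <= e * norm (x - a)" using S by blast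
    then show "density_zero {x \<in> ball 0 1. e * norm (x - a) < qdist (f x) (image_mset (\<lambda>A. A x) (mset As))} a"
      by (intro density_zeroI[of S a \<delta>]) (auto simp: not_less[symmetric])
  qed
  then have nD: "norm_Df Q (ball 0 1) f a = sqrt (\<Sum>i<length As. \<Sum>j\<in>UNIV. (norm (lin_part (As ! i) (axis j 1)))\<^sup>2)"
    by (intro norm_Df_eq[OF f _ a]) auto
  obtain S \<delta> where S: "S \<in> sets borel" "dens0 S a" "0 < \<delta>"
      "\<And>x. dist a x <= \<delta> ==> x \<notin> S ==> qdist (f x) (mset (map (\<lambda>A. A x) As)) <= \<e> * norm (x - a)" using S[OF \<e>] by blast
  have "qdist (f a) (f x) <= (norm_Df Q (ball 0 1) f a + \<e>) * norm (x - a)" if x: "dist a x <= \<delta>" "x \<notin> S" for x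
  proof -
    have "qdist (f a) (f x) <= qdist (f a) (mset (map (\<lambda>A. A x) As)) + qdist (mset (map (\<lambda>A. A x) As)) (f x)"
      using size As(1) by (intro qdist_triangle[where Q=Q]) auto
    also have "... <= norm_Df Q (ball 0 1) f a * norm (x - a) + \<e> * norm (x - a)"
      using affine_tuple_growth[OF As(2), of x a] S(4)[OF x] unfolding nD As(3)
      by (intro add_mono) (simp_all only: qdist_commute)
    finally show ?thesis by (simp add: algebra_simps)
  qed
  then show "\<exists>S\<in>sets borel. dens0 S a \<and> (\<exists>\<delta>>0. \<forall>x. dist a x <= \<delta> --> x \<notin> S -->
       qdist (f a) (f x) <= (norm_Df Q (ball 0 1) f a + \<e>) * norm (x - a))" using S(1-3) by blast
qed

section \<open>The translation estimate by the energy\<close>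

text \<open>Truncation makes the averages of difference quotients insensitive to sets of
  density zero, and their upper limits are bounded by the norm of the approximate differential.\<close>

context
  fixes f :: "real^'m => 'b::{real_inner, banach, second_countable_topology} multiset" and Q :: nat and p M R :: real
  assumes f [measurable]: "f \<in> borel \<rightarrow>\<^sub>M qborel Q" and T: "transl_bound p f M" and p: "1 < p" and M: "0 <= M" and R: "0 <= R"
begin

private definition "quot r x y = min (qdist (f x) (f y) / r) R"
private definition "avg r x = enn2real (\<integral>\<^sup>+y. ennreal (quot r x y) * indicator (cball x r) y)
   / (unit_ball_vol CARD('m) * r ^ CARD('m))"

private lemma quot_measurable [measurable]: "case_prod (quot r) \<in> borel_measurable (borel \<Otimes>\<^sub>M borel)"
  unfolding quot_def by measurable

private lemma avg_measurable [measurable]: "avg r \<in> borel_measurable borel" unfolding avg_def by measurable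

private lemma size_val: "size (f x) = Q" using measurable_space[OF f, of x] by simp

private lemma quot_bounds: "0 < r ==> 0 <= quot r x y" "quot r x y <= R" using R by (auto simp: quot_def qdist_nonneg)

private lemma avg_integral:
  assumes "0 < r"
  shows "(\<integral>\<^sup>+y. ennreal (quot r x y) * indicator (cball x r) y) = ennreal (avg r x * (unit_ball_vol CARD('m) * r ^ CARD('m)))"
    and "0 <= avg r x" "avg r x <= R"
proof -
  let ?I = "\<integral>\<^sup>+y. ennreal (quot r x y) * indicator (cball x r) y"
  let ?V = "unit_ball_vol CARD('m) * r ^ CARD('m)"
  have V: "0 < ?V" using assms by simp
  have "?I <= (\<integral>\<^sup>+y. ennreal R * indicator (cball x r) y)"
    by (intro nn_integral_mono mult_right_mono ennreal_leI quot_bounds) auto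
  also have "... = ennreal (R * ?V)" using assms R by (subst nn_integral_cmult) (auto simp: emeasure_cball ennreal_mult)
  finally have le: "?I <= ennreal (R * ?V)" .
  from le have "?I < top" by (auto simp: less_top[symmetric] top_unique)
  moreover have "avg r x * ?V = enn2real ?I" 
  proof -
    have "s / t * t = s" if "0 < t" for s t :: real using that by simp
    then show ?thesis unfolding avg_def using V by blast
  qed
  ultimately show "?I = ennreal (avg r x * ?V)" by simp
  show "0 <= avg r x" using assms by (simp add: avg_def)
  have "enn2real ?I <= R * ?V" using le R V by (intro enn2real_leI) auto
  then show "avg r x <= R" unfolding avg_def using V by (simp only: pos_divide_le_eq)
qed

text \<open>Every point of the ball of radius \<open>r / 2\<close> about the midpoint of
  \<open>x\<close> and \<open>x + u\<close> is within \<open>r\<close> of both. Averaging the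
  triangle inequality through such points turns an increment between two given points into ball
  averages; \<open>2 ^ CARD('m)\<close> is the ratio of the volumes.\<close>

private lemma quot_le_avg:
  assumes r: "0 < r" and u: "norm u = r"
  shows "quot r x (x + u) <= 2 ^ CARD('m) * (avg r x + avg r (x + u))"
proof -
  define V where "V = unit_ball_vol CARD('m) * r ^ CARD('m)"
  have V: "0 < V" using r by (simp add: V_def)
  let ?c = "x + u /\<^sub>R 2"
  let ?B = "cball ?c (r / 2)"
  have "ennreal (quot r x (x + u)) * leb ?B = (\<integral>\<^sup>+y. ennreal (quot r x (x + u)) * indicator ?B y)"
    by (subst nn_integral_cmult) auto
  also have "... <= (\<integral>\<^sup>+y. ennreal (quot r x y) * indicator (cball x r) y + ennreal (quot r (x + u) y) * indicator (cball (x + u) r) y)"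
  proof (rule nn_integral_mono, goal_cases)
    case (1 y)
    show ?case
    proof (cases "y \<in> ?B")
      case True
      have h: "dist x ?c = r / 2" "dist (x + u) ?c = r / 2"
      proof -
        show "dist x ?c = r / 2" using u by (simp add: dist_norm)
        have "x + u - ?c = u /\<^sub>R 2" by (simp add: algebra_simps flip: scaleR_add_left)
        then have "dist (x + u) ?c = norm (u /\<^sub>R 2)" by (simp only: dist_norm)
        then show "dist (x + u) ?c = r / 2" using u by simp
      qed
      have mem: "y \<in> cball x r" "y \<in> cball (x + u) r"
        using True h dist_triangle[of x y ?c] dist_triangle[of "x + u" y ?c] by auto
      have "qdist (f x) (f (x + u)) <= qdist (f x) (f y) + qdist (f (x + u)) (f y)"
        using qdist_triangle[of "f x" Q "f y" "f (x + u)"] size_val by (simp add: qdist_commute)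
      then have "qdist (f x) (f (x + u)) / r <= qdist (f x) (f y) / r + qdist (f (x + u)) (f y) / r"
        using r by (simp add: add_divide_distrib[symmetric] divide_right_mono)
      moreover have "0 <= qdist (f x) (f y) / r" "0 <= qdist (f (x + u)) (f y) / r" using r by (auto simp: qdist_nonneg)
      ultimately have "quot r x (x + u) <= quot r x y + quot r (x + u) y" unfolding quot_def using R by linarith
      then have "ennreal (quot r x (x + u)) <= ennreal (quot r x y) + ennreal (quot r (x + u) y)"
        using quot_bounds(1)[OF r] by (subst ennreal_plus[symmetric]) (auto simp del: ennreal_plus intro: ennreal_leI)
      then show ?thesis using True mem by simp
    qed simp
  qed
  also have "... = ennreal (avg r x * V) + ennreal (avg r (x + u) * V)"
    unfolding V_def avg_integral(1)[OF r, symmetric] by (rule nn_integral_add) measurable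
  also have "... = ennreal ((avg r x + avg r (x + u)) * V)" using V avg_integral(2)[OF r] by (simp add: distrib_right)
  also have "leb ?B = ennreal (V / 2 ^ CARD('m))" using r by (simp add: emeasure_cball V_def power_divide)
  also have "ennreal (quot r x (x + u)) * ennreal (V / 2 ^ CARD('m)) = ennreal (quot r x (x + u) * (V / 2 ^ CARD('m)))"
    using V quot_bounds(1)[OF r] by (intro ennreal_mult[symmetric]) auto
  finally have "quot r x (x + u) * (V / 2 ^ CARD('m)) <= (avg r x + avg r (x + u)) * V"
    using V avg_integral(2)[OF r] by (subst (asm) ennreal_le_iff) auto
  then have "(quot r x (x + u) / 2 ^ CARD('m)) * V <= (avg r x + avg r (x + u)) * V" by simp
  then have "quot r x (x + u) / 2 ^ CARD('m) <= avg r x + avg r (x + u)" using V by (simp only: mult_le_cancel_right_pos)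
  then show ?thesis by (simp add: field_simps)
qed

private lemma AE_avg_le:
  "AE a in lborel. a \<in> ball 0 1 --> (\<forall>\<kappa>>0. \<exists>\<delta>>0. \<forall>r. 0 < r --> r <= \<delta> --> avg r a <= norm_Df Q (ball 0 1) f a + \<kappa>)"
  using AE_approx_differential[OF f T p M]
proof (eventually_elim, intro impI allI)
  fix a :: "real^'m" and \<kappa> :: real
  assume *: "a \<in> ball 0 1 --> (\<forall>\<e>>0. \<exists>S\<in>sets borel. dens0 S a \<and> (\<exists>\<delta>>0. \<forall>x. dist a x <= \<delta> --> x \<notin> S -->
       qdist (f a) (f x) <= (norm_Df Q (ball 0 1) f a + \<e>) * norm (x - a)))"
    and a: "a \<in> ball 0 1" and \<kappa>: "0 < \<kappa>"
  define W where "W = norm_Df Q (ball 0 1) f a"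
  have W: "0 <= W" by (simp add: W_def norm_Df_nonneg)
  obtain S \<delta> where S: "S \<in> sets borel" "dens0 S a" "0 < \<delta>"
    "\<And>x. dist a x <= \<delta> ==> x \<notin> S ==> qdist (f a) (f x) <= (W + \<kappa> / 2) * norm (x - a)"
    using *[rule_format, OF a, of "\<kappa> / 2"] \<kappa> unfolding W_def by auto
  \<comment> \<open>The bad set has relative measure at most \<open>\<kappa>'\<close>, and the
    truncated quotient is at most \<open>R\<close> there; together this costs at most
    \<open>\<kappa> / 2\<close>.\<close>
  define \<kappa>' where "\<kappa>' = \<kappa> / (2 * (R + 1))"
  have \<kappa>': "0 < \<kappa>'" "R * \<kappa>' <= \<kappa> / 2"
  proof -
    show k: "0 < \<kappa>'" using \<kappa> R by (simp add: \<kappa>'_def)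
    have "R * \<kappa>' <= (R + 1) * \<kappa>'" using k by (intro mult_right_mono) auto
    also have "... = \<kappa> / 2"
    proof -
      have "Y * (\<kappa> / (2 * Y)) = \<kappa> / 2" if "0 < Y" for Y :: real using that by simp
      from this[of "R + 1"] show ?thesis using R unfolding \<kappa>'_def by linarith
    qed
    finally show "R * \<kappa>' <= \<kappa> / 2" .
  qed
  obtain \<delta>' where d': "0 < \<delta>'" "\<And>r. 0 < r ==> r <= \<delta>' ==> leb (S \<inter> cball a r) <= ennreal \<kappa>' * leb (cball a r)"
    using S(2) \<kappa>'(1) unfolding dens0_def by blast
  have "avg r a <= W + \<kappa>" if r: "0 < r" "r <= min \<delta> \<delta>'" for r
  proof -
    define V where "V = unit_ball_vol CARD('m) * r ^ CARD('m)"
    have V: "0 < V" "leb (cball a r) = ennreal V" using r by (simp_all add: V_def emeasure_cball)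
    have "ennreal (avg r a * V) = (\<integral>\<^sup>+y. ennreal (quot r a y) * indicator (cball a r) y)"
      unfolding V_def using avg_integral(1)[OF r(1)] by simp
    also have "... <= (\<integral>\<^sup>+y. ennreal (W + \<kappa> / 2) * indicator (cball a r) y + ennreal R * indicator (S \<inter> cball a r) y)"
    proof (rule nn_integral_mono, goal_cases)
      case (1 y)
      show ?case
      proof (cases "y \<in> cball a r")
        case y: True
        show ?thesis
        proof (cases "y \<in> S")
          case True
          then show ?thesis using y ennreal_leI[OF quot_bounds(2)[of r a y]] by (simp add: add_increasing)
        next
          case False
          have "qdist (f a) (f y) <= (W + \<kappa> / 2) * norm (y - a)" using y r False by (intro S(4)) auto
          also have "... <= (W + \<kappa> / 2) * r" using y W \<kappa> by (intro mult_left_mono) (auto simp: dist_norm norm_minus_commute)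
          finally have "qdist (f a) (f y) / r <= W + \<kappa> / 2" using r by (simp only: pos_divide_le_eq)
          then have "quot r a y <= W + \<kappa> / 2" by (simp add: quot_def)
          then show ?thesis using y False ennreal_leI by simp
        qed
      qed simp
    qed
    also have "... = ennreal (W + \<kappa> / 2) * ennreal V + ennreal R * leb (S \<inter> cball a r)"
      using S(1) by (subst nn_integral_add) (auto simp: nn_integral_cmult V)
    also have "... <= ennreal (W + \<kappa> / 2) * ennreal V + ennreal R * (ennreal \<kappa>' * ennreal V)"
      using d'(2)[of r] r V by (intro add_left_mono mult_left_mono) auto
    also have "... = ennreal ((W + \<kappa> / 2) * V + R * (\<kappa>' * V))"
      using W \<kappa> \<kappa>' V R by (simp add: ennreal_mult[symmetric] ennreal_plus[symmetric] del: ennreal_plus)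
    finally have "avg r a * V <= (W + \<kappa> / 2) * V + R * (\<kappa>' * V)" using W \<kappa> \<kappa>' V R by (subst (asm) ennreal_le_iff) auto
    also have "... = (W + \<kappa> / 2 + R * \<kappa>') * V" by (simp add: algebra_simps)
    finally have "avg r a <= W + \<kappa> / 2 + R * \<kappa>'" using V(1) by (simp only: mult_le_cancel_right_pos)
    then show ?thesis using \<kappa>' by linarith
  qed
  then show "\<exists>\<delta>>0. \<forall>r. 0 < r --> r <= \<delta> --> avg r a <= norm_Df Q (ball 0 1) f a + \<kappa>"
    using S(3) d'(1) unfolding W_def by (intro exI[of _ "min \<delta> \<delta>'"]) auto
qed

text \<open>The averages at both endpoints are at most \<open>R\<close>, so the reverse Fatou lemma
  applies on the disk, and \<open>AE_avg_le\<close> bounds the upper limit. The constant consists of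
  \<open>2 powr (CARD('m) * q)\<close> from \<open>quot_le_avg\<close>, \<open>2 powr q\<close> from
  the power of a sum, and 2 from the two endpoints.\<close>

lemma limsup_truncated_quotient_integral:
  assumes v: "v \<noteq> 0" and q: "1 <= q"
  shows "limsup (\<lambda>N. \<integral>\<^sup>+x. ennreal (min (qdist (f x) (f (x + v /\<^sub>R real (Suc N))) / (norm v / real (Suc N))) R powr q)
      * indicator {x. x \<in> ball 0 1 \<and> x + v /\<^sub>R real (Suc N) \<in> ball 0 1} x \<partial>lborel)
    <= ennreal (2 * 2 powr ((real CARD('m) + 1) * q)) * energy Q q (ball 0 1) f"
proof -
  let ?U = "ball 0 1 :: (real^'m) set"
  define r where "r N = norm v / real (Suc N)" for N
  have r: "0 < r N" for N using v by (simp add: r_def)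
  define u where "u N = v /\<^sub>R real (Suc N)" for N
  have u: "norm (u N) = r N" for N by (simp add: u_def r_def divide_inverse mult.commute)
  define C where "C = 2 powr ((real CARD('m) + 1) * q)"
  have pt: "quot (r N) x (x + u N) powr q <= C * (avg (r N) x powr q + avg (r N) (x + u N) powr q)" for N x
  proof -
    have "quot (r N) x (x + u N) powr q <= (2 ^ CARD('m) * (avg (r N) x + avg (r N) (x + u N))) powr q"
      using q quot_bounds(1)[OF r] by (intro powr_mono2 quot_le_avg r u) auto
    also have "... = 2 powr (real CARD('m) * q) * (avg (r N) x + avg (r N) (x + u N)) powr q"
      using avg_integral(2)[OF r] by (simp add: powr_mult powr_powr powr_realpow[symmetric])
    also have "... <= 2 powr (real CARD('m) * q) * (2 powr q * (avg (r N) x powr q + avg (r N) (x + u N) powr q))"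
      using avg_integral(2)[OF r] q by (intro mult_left_mono powr_add_le) auto
    also have "... = C * (avg (r N) x powr q + avg (r N) (x + u N) powr q)" by (simp add: C_def distrib_right powr_add)
    finally show ?thesis .
  qed
  have step: "(\<integral>\<^sup>+x. ennreal (quot (r N) x (x + u N) powr q) * indicator {x. x \<in> ?U \<and> x + u N \<in> ?U} x)
      <= ennreal (2 * C) * (\<integral>\<^sup>+x. ennreal (avg (r N) x powr q) * indicator ?U x)" for N
  proof -
    let ?a = "\<lambda>x. ennreal (avg (r N) x powr q) * indicator ?U x"
    have "(\<integral>\<^sup>+x. ennreal (quot (r N) x (x + u N) powr q) * indicator {x. x \<in> ?U \<and> x + u N \<in> ?U} x)
        <= (\<integral>\<^sup>+x. ennreal C * (?a x + ?a (x + u N)))"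
    proof (rule nn_integral_mono, goal_cases)
      case (1 x)
      have "ennreal (quot (r N) x (x + u N) powr q) <= ennreal (C * (avg (r N) x powr q + avg (r N) (x + u N) powr q))"
        by (intro ennreal_leI pt)
      also have "... = ennreal C * (ennreal (avg (r N) x powr q) + ennreal (avg (r N) (x + u N) powr q))"
        by (simp add: C_def ennreal_mult)
      finally show ?case by (auto simp: indicator_def)
    qed
    also have "... = ennreal C * ((\<integral>\<^sup>+x. ?a x) + (\<integral>\<^sup>+x. ?a (x + u N)))"
      by (subst nn_integral_cmult, measurable) (subst nn_integral_add, auto)
    also have "(\<integral>\<^sup>+x. ?a (x + u N)) = (\<integral>\<^sup>+x. ?a x)" by (rule nn_integral_translate) measurable
    also have "ennreal C * ((\<integral>\<^sup>+x. ?a x) + (\<integral>\<^sup>+x. ?a x)) = ennreal (2 * C) * (\<integral>\<^sup>+x. ?a x)"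
    proof -
      have "ennreal (2 * C) = ennreal C + ennreal C" by (subst ennreal_plus[symmetric]) (auto simp: C_def)
      then show ?thesis by (simp only: distrib_left distrib_right)
    qed
    finally show ?thesis .
  qed
  have "limsup (\<lambda>N. \<integral>\<^sup>+x. ennreal (quot (r N) x (x + u N) powr q) * indicator {x. x \<in> ?U \<and> x + u N \<in> ?U} x \<partial>lborel)
      <= limsup (\<lambda>N. ennreal (2 * C) * (\<integral>\<^sup>+x. ennreal (avg (r N) x powr q) * indicator ?U x))"
    using step by (intro Limsup_mono always_eventually) auto
  also have "... = ennreal (2 * C) * limsup (\<lambda>N. \<integral>\<^sup>+x. ennreal (avg (r N) x powr q) * indicator ?U x \<partial>lborel)"
    by (rule Limsup_compose_continuous_mono)
      (auto simp: continuous_on_def mono_def intro: ennreal_tendsto_cmult mult_left_mono)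
  also have "limsup (\<lambda>N. \<integral>\<^sup>+x. ennreal (avg (r N) x powr q) * indicator ?U x \<partial>lborel)
      <= (\<integral>\<^sup>+x. limsup (\<lambda>N. ennreal (avg (r N) x powr q) * indicator ?U x))"
  proof (rule nn_integral_limsup[where w="\<lambda>x. ennreal (R powr q) * indicator ?U x"])
    show "AE x in lborel. ennreal (avg (r N) x powr q) * indicator ?U x <= ennreal (R powr q) * indicator ?U x" for N
      using q avg_integral(2,3)[OF r] by (intro AE_I2 mult_right_mono ennreal_leI powr_mono2) auto
    show "(\<integral>\<^sup>+x. ennreal (R powr q) * indicator ?U x) < \<infinity>"
      by (subst nn_integral_cmult) (auto simp: emeasure_ball ennreal_mult_less_top)
  qed measurable
  also have "... <= (\<integral>\<^sup>+x. ennreal (norm_Df Q ?U f x powr q) * indicator ?U x)"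
  proof (rule nn_integral_mono_AE)
    show "AE x in lborel. limsup (\<lambda>N. ennreal (avg (r N) x powr q) * indicator ?U x) <= ennreal (norm_Df Q ?U f x powr q) * indicator ?U x"
      using AE_avg_le
    proof eventually_elim
      case (elim x)
      show ?case
      proof (cases "x \<in> ?U")
        case True
        define W where "W = norm_Df Q ?U f x"
        have W: "0 <= W" by (simp add: W_def norm_Df_nonneg)
        have "limsup (\<lambda>N. ennreal (avg (r N) x powr q)) <= ennreal ((W + 1 / real (Suc k)) powr q)" for k
        proof (rule Limsup_bounded)
          obtain \<delta> where \<delta>: "0 < \<delta>" "\<And>r. 0 < r ==> r <= \<delta> ==> avg r x <= W + 1 / real (Suc k)"
            using elim True unfolding W_def by (metis zero_less_divide_1_iff of_nat_0_less_iff zero_less_Suc)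
          have "r \<longlonglongrightarrow> 0" unfolding r_def by (rule LIMSEQ_Suc[OF lim_const_over_n])
          then have "\<forall>\<^sub>F N in sequentially. r N < \<delta>" using \<delta>(1) by (rule order_tendstoD)
          then show "\<forall>\<^sub>F N in sequentially. ennreal (avg (r N) x powr q) <= ennreal ((W + 1 / real (Suc k)) powr q)"
            by eventually_elim (use q avg_integral(2)[OF r] \<delta>(2) r in \<open>auto intro!: ennreal_leI powr_mono2\<close>)
        qed
        note le = this
        have "(\<lambda>k. ennreal ((W + 1 / real (Suc k)) powr q)) \<longlonglongrightarrow> ennreal ((W + 0) powr q)"
          using q W by (intro tendsto_ennrealI tendsto_powr' tendsto_add tendsto_const LIMSEQ_Suc[OF lim_1_over_n]) auto
        then have "limsup (\<lambda>N. ennreal (avg (r N) x powr q)) <= ennreal ((W + 0) powr q)"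
          by (rule LIMSEQ_le_const) (use le in blast)
        then show ?thesis using True by (simp add: W_def)
      qed (simp add: Limsup_const)
    qed
  qed
  also have "... = energy Q q ?U f" unfolding energy_def by (rule nn_integral_completion[symmetric])
  finally show ?thesis unfolding quot_def r_def u_def C_def by (simp add: mult_left_mono)
qed

end

text \<open>Here \<open>g\<close> may be nonmeasurable, as \<open>norm_Df\<close> might be. The
  integral is then a supremum over simple functions from below, for which subadditivity can fail in
  general; measurability of one summand rescues it.\<close>

lemma nn_integral_add_le:
  assumes [measurable]: "h \<in> borel_measurable M" and fin: "\<And>x. h x \<noteq> top"
  shows "(\<integral>\<^sup>+x. g x + h x \<partial>M) <= (\<integral>\<^sup>+x. g x \<partial>M) + (\<integral>\<^sup>+x. h x \<partial>M)" unfolding nn_integral_def[of M "\<lambda>x. g x + h x"]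
proof (rule SUP_least)
  fix s assume "s \<in> {s. simple_function M s \<and> s <= (\<lambda>x. g x + h x)}"
  then have s: "simple_function M s" "\<And>x. s x <= g x + h x" by (auto simp: le_fun_def)
  have [measurable]: "s \<in> borel_measurable M" using s(1) by (rule borel_measurable_simple_function)
  have "integral\<^sup>S M s = (\<integral>\<^sup>+x. s x \<partial>M)" using s(1) by (rule nn_integral_eq_simple_integral[symmetric])
  also have "... <= (\<integral>\<^sup>+x. (s x - h x) + h x \<partial>M)"
    by (intro nn_integral_mono) (metis add.commute ennreal_minus_le_iff order_refl)
  also have "... = (\<integral>\<^sup>+x. s x - h x \<partial>M) + (\<integral>\<^sup>+x. h x \<partial>M)" by (rule nn_integral_add) measurable
  also have "... <= (\<integral>\<^sup>+x. g x \<partial>M) + (\<integral>\<^sup>+x. h x \<partial>M)"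
    using s(2) fin by (intro add_right_mono nn_integral_mono) (simp add: ennreal_minus_le_iff add.commute)
  finally show "integral\<^sup>S M s <= (\<integral>\<^sup>+x. g x \<partial>M) + (\<integral>\<^sup>+x. h x \<partial>M)" .
qed

lemma energy_smaller_exponent:
  assumes "0 <= q" "q <= p" and E: "energy Q p (ball 0 1) f <= ennreal E" "0 <= E"
  shows "energy Q q (ball 0 1) (f :: real^'m => _) <= ennreal (unit_ball_vol CARD('m) + E)"
proof -
  let ?U = "ball 0 1 :: (real^'m) set"
  let ?n = "\<lambda>x. norm_Df Q ?U f x"
  have pw: "?n x powr q <= ?n x powr p + 1" for x
  proof (cases "?n x <= 1")
    case True
    then have "?n x powr q <= 1" using norm_Df_nonneg[of Q ?U f x] assms(1) by (intro powr_le1) auto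
    then show ?thesis using powr_ge_zero[of "?n x" p] by linarith
  next
    case False
    then have "?n x powr q <= ?n x powr p" using assms by (intro powr_mono) auto
    then show ?thesis by linarith
  qed
  have "energy Q q ?U f <= (\<integral>\<^sup>+x. ennreal (?n x powr p) * indicator ?U x + indicator ?U x \<partial>lebesgue)"
    unfolding energy_def
  proof (rule nn_integral_mono, goal_cases)
    case (1 x)
    have "ennreal (?n x powr q) <= ennreal (?n x powr p) + 1"
      using pw[of x] by (metis ennreal_leI ennreal_plus ennreal_1 powr_ge_zero zero_le_one)
    then show ?case by (auto simp: indicator_def)
  qed
  also have "... <= energy Q p ?U f + (\<integral>\<^sup>+x. indicator ?U x \<partial>lebesgue)"
    unfolding energy_def by (rule nn_integral_add_le) (rule borel_measurable_indicator, simp, simp add: indicator_def)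
  also have "(\<integral>\<^sup>+x. indicator ?U x \<partial>lebesgue) = ennreal (unit_ball_vol CARD('m))"
    by (simp add: nn_integral_completion emeasure_ball)
  also have "energy Q p ?U f + ennreal (unit_ball_vol CARD('m)) <= ennreal E + ennreal (unit_ball_vol CARD('m))"
    by (intro add_right_mono E)
  also have "... = ennreal (unit_ball_vol CARD('m) + E)" using E by (simp add: add.commute)
  finally show ?thesis .
qed

text \<open>Divide the increment into many parts and truncate their quotients at \<open>R\<close>.
  Since \<open>q < p\<close>, the part above \<open>R\<close> is at most
  \<open>R powr (q - p) * M\<close> by the a priori bound, so \<open>M\<close> disappears as
  \<open>R\<close> tends to infinity and the energy alone is left.\<close>

lemma transl_bound_energy_lower_exponent:
  fixes f :: "real^'m => 'b::{real_inner, banach, second_countable_topology} multiset"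
  assumes f [measurable]: "f \<in> borel \<rightarrow>\<^sub>M qborel Q" and T: "transl_bound p f M" and p: "1 < p" and M: "0 <= M"
    and q: "1 <= q" "q < p" and v: "v \<noteq> 0"
  shows "(\<integral>\<^sup>+x. qcost q (f x) (f (x + v)) * indicator {x. x \<in> ball 0 1 \<and> x + v \<in> ball 0 1} x)
    <= ennreal (norm v powr q) * (ennreal (2 * 2 powr ((real CARD('m) + 1) * q)) * energy Q q (ball 0 1) f)"
proof -
  let ?U = "ball 0 1 :: (real^'m) set"
  let ?c = "ennreal (norm v powr q)"
  let ?D = "\<lambda>u. {x. x \<in> ?U \<and> x + u \<in> ?U}"
  have size: "size (f x) = Q" for x using measurable_space[OF f, of x] by simp
  define I where "I = (\<integral>\<^sup>+x. qcost q (f x) (f (x + v)) * indicator (?D v) x)"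
  define A where "A R N = (\<integral>\<^sup>+x. ennreal (min (qdist (f x) (f (x + v /\<^sub>R real (Suc N))) / (norm v / real (Suc N))) R powr q)
      * indicator (?D (v /\<^sub>R real (Suc N))) x)" for R N
  have bound: "I <= ?c * (A R N + ennreal (R powr (q - p) * M))" if R: "1 <= R" for R N
  proof -
    define n where "n = real (Suc N)"
    have n: "0 < n" by (simp add: n_def)
    define u where "u = v /\<^sub>R n"
    define r where "r = norm v / n"
    have r: "0 < r" "norm u = r" using v n by (auto simp: r_def u_def divide_inverse mult.commute)
    let ?d = "\<lambda>x. qdist (f x) (f (x + u))"
    have "I = (\<integral>\<^sup>+x. qcost q (f x) (f (x + n *\<^sub>R u)) * indicator (?D (n *\<^sub>R u)) x)" using n by (simp add: I_def u_def)
    also have "... <= ennreal (n powr q) * (\<integral>\<^sup>+x. ennreal (?d x powr q) * indicator (?D u) x)" unfolding n_def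
      by (rule translation_subdivide[where d="\<lambda>x y. qdist (f x) (f y)"])
        (use q size in \<open>auto simp: qdist_nonneg intro: qdist_triangle\<close>)
    also have "(\<integral>\<^sup>+x. ennreal (?d x powr q) * indicator (?D u) x)
        <= (\<integral>\<^sup>+x. ennreal (r powr q) * (ennreal (min (?d x / r) R powr q) * indicator (?D u) x
           + ennreal (R powr (q - p) * r powr - p) * (ennreal (?d x powr p) * indicator (?D u) x)))"
    proof (rule nn_integral_mono, goal_cases)
      case (1 x)
      have "?d x powr q <= r powr q * (min (?d x / r) R powr q + R powr (q - p) * r powr - p * ?d x powr p)"
      proof -
        define z where "z = ?d x / r"
        have z: "0 <= z" "?d x = r * z" using r by (auto simp: z_def qdist_nonneg)
        have "?d x powr q = r powr q * z powr q" "?d x powr p = r powr p * z powr p"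
          unfolding z(2) using r z by (simp_all add: powr_mult)
        note dz = this
        have "z powr q <= min z R powr q + R powr (q - p) * z powr p"
        proof (cases "z <= R")
          case False
          then have "z powr q = z powr (q - p) * z powr p" by (simp add: powr_add[symmetric])
          also have "... <= R powr (q - p) * z powr p" using False R q by (intro mult_right_mono powr_mono2') auto
          finally show ?thesis by (simp add: add_increasing)
        qed (simp add: min_def)
        then have "r powr q * z powr q <= r powr q * (min z R powr q + R powr (q - p) * z powr p)"
          by (intro mult_left_mono) auto
        moreover have "R powr (q - p) * r powr - p * ?d x powr p = R powr (q - p) * z powr p"
          unfolding dz using r(1) by (simp add: powr_minus)
        moreover note dz(1)
        ultimately show ?thesis unfolding z_def by (simp only:)
      qed
      then have "ennreal (?d x powr q) <= ennreal (r powr q * (min (?d x / r) R powr q + R powr (q - p) * r powr - p * ?d x powr p))"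
        by (rule ennreal_leI)
      also have "... = ennreal (r powr q) * (ennreal (min (?d x / r) R powr q) + ennreal (R powr (q - p) * r powr - p) * ennreal (?d x powr p))"
        by (simp add: ennreal_mult)
      finally show ?case by (auto simp: indicator_def)
    qed
    also have "... = ennreal (r powr q) * (A R N + ennreal (R powr (q - p) * r powr - p) * (\<integral>\<^sup>+x. ennreal (?d x powr p) * indicator (?D u) x))"
      unfolding A_def n_def[symmetric] u_def[symmetric] r_def[symmetric]
      by (subst nn_integral_cmult, measurable) (subst nn_integral_add, auto simp: nn_integral_cmult)
    also have "... <= ennreal (r powr q) * (A R N + ennreal (R powr (q - p) * r powr - p) * ennreal (M * r powr p))"
      using T r unfolding transl_bound_def by (intro mult_left_mono add_left_mono) auto
    also have "ennreal (R powr (q - p) * r powr - p) * ennreal (M * r powr p) = ennreal (R powr (q - p) * M)"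
      using M r by (simp add: ennreal_mult[symmetric] powr_minus)
    finally have "I <= ennreal (n powr q) * (ennreal (r powr q) * (A R N + ennreal (R powr (q - p) * M)))"
      by (simp add: mult_left_mono)
    also have "... = ?c * (A R N + ennreal (R powr (q - p) * M))"
      using n v by (simp add: mult.assoc[symmetric] ennreal_mult[symmetric] powr_mult[symmetric] r_def)
    finally show ?thesis .
  qed
  define W where "W = ennreal (2 * 2 powr ((real CARD('m) + 1) * q)) * energy Q q ?U f"
  have I_R: "I <= ?c * (W + ennreal (R powr (q - p) * M))" if R: "1 <= R" for R
  proof -
    let ?b = "ennreal (R powr (q - p) * M)"
    have "I = limsup (\<lambda>N::nat. I)" by (simp add: Limsup_const)
    also have "... <= limsup (\<lambda>N. ?c * (A R N + ?b))" using bound[OF R] by (intro Limsup_mono always_eventually) auto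
    also have "... = ?c * (limsup (A R) + ?b)"
    proof (rule Limsup_compose_continuous_mono[where f="\<lambda>y. ?c * (y + ?b)"])
      show "continuous_on UNIV (\<lambda>y. ?c * (y + ?b))"
        unfolding continuous_on_def by (intro ballI ennreal_tendsto_cmult tendsto_add tendsto_intros) auto
    qed (auto simp: mono_def intro!: mult_left_mono add_right_mono)
    also have "... <= ?c * (W + ?b)"
      unfolding W_def A_def using limsup_truncated_quotient_integral[OF f T p M _ v q(1), of R] R
      by (intro mult_left_mono add_right_mono) auto
    finally show ?thesis .
  qed
  have "(\<lambda>k. ?c * (W + ennreal (real (Suc k) powr (q - p) * M))) \<longlonglongrightarrow> ?c * (W + ennreal (0 * M))"
  proof (intro ennreal_tendsto_cmult tendsto_add tendsto_const tendsto_ennrealI tendsto_mult)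
    have "((\<lambda>x::real. x powr (q - p)) \<longlongrightarrow> 0) at_top" using q by (intro tendsto_neg_powr filterlim_ident) auto
    then have "(\<lambda>k. real k powr (q - p)) \<longlonglongrightarrow> 0" by (rule filterlim_compose) (rule filterlim_real_sequentially)
    then show "(\<lambda>k. real (Suc k) powr (q - p)) \<longlonglongrightarrow> 0" by (rule LIMSEQ_Suc)
  qed auto
  then have "I <= ?c * (W + ennreal (0 * M))" by (rule LIMSEQ_le_const) (auto intro!: I_R)
  then show ?thesis by (simp add: I_def W_def)
qed

text \<open>The a priori constant \<open>M\<close> is exchanged for one that depends on the energy
  only. The exponents \<open>q k\<close> increase from 1 to \<open>p\<close> with bounded constants,
  and Fatou's lemma gives the limit case.\<close>

lemma transl_bound_energy:
  fixes f :: "real^'m => 'b::{real_inner, banach, second_countable_topology} multiset"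
  assumes f [measurable]: "f \<in> borel \<rightarrow>\<^sub>M qborel Q" and T: "transl_bound p f M" and p: "1 < p" and M: "0 <= M"
    and E: "energy Q p (ball 0 1) f <= ennreal E" "0 <= E"
  shows "transl_bound p f (2 * 2 powr ((real CARD('m) + 1) * p) * (unit_ball_vol CARD('m) + E))"
  unfolding transl_bound_def
proof
  fix v :: "real^'m"
  define K where "K = 2 * 2 powr ((real CARD('m) + 1) * p) * (unit_ball_vol CARD('m) + E)"
  have K: "0 <= K" using E by (simp add: K_def)
  let ?D = "{x. x \<in> unit_disk \<and> x + v \<in> unit_disk}"
  let ?d = "\<lambda>x. qdist (f x) (f (x + v))"
  show "(\<integral>\<^sup>+x. ennreal (?d x powr p) * indicator ?D x) <= ennreal (K * norm v powr p)"
  proof (cases "v = 0")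
    case False
    define q where "q k = p - (p - 1) / real (Suc k)" for k
    have q: "1 <= q k" "q k < p" for k
    proof -
      have "(p - 1) / real (Suc k) <= p - 1" using p divide_left_mono[of 1 "real (Suc k)" "p - 1"] by simp
      then show "1 <= q k" by (simp add: q_def)
      show "q k < p" using p by (simp add: q_def)
    qed
    have "q \<longlonglongrightarrow> p - 0" unfolding q_def by (intro tendsto_diff tendsto_const LIMSEQ_Suc[OF lim_const_over_n])
    then have ql: "q \<longlonglongrightarrow> p" by simp
    have pl: "(\<lambda>k. t powr q k) \<longlonglongrightarrow> t powr p" if "0 <= t" for t
      using that by (cases "t = 0") (auto intro!: tendsto_powr ql)
    have Iq: "(\<integral>\<^sup>+x. ennreal (?d x powr q k) * indicator ?D x) <= ennreal (norm v powr q k * K)" for k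
    proof -
      have "(\<integral>\<^sup>+x. ennreal (?d x powr q k) * indicator ?D x)
          <= ennreal (norm v powr q k) * (ennreal (2 * 2 powr ((real CARD('m) + 1) * q k)) * energy Q (q k) (ball 0 1) f)"
        by (rule transl_bound_energy_lower_exponent[OF f T p M q False])
      also have "... <= ennreal (norm v powr q k) * (ennreal (2 * 2 powr ((real CARD('m) + 1) * p)) * ennreal (unit_ball_vol CARD('m) + E))"
      proof (intro mult_left_mono mult_mono)
        show "energy Q (q k) (ball 0 1) f <= ennreal (unit_ball_vol CARD('m) + E)"
          using q[of k] by (intro energy_smaller_exponent[OF _ _ E]) auto
        show "ennreal (2 * 2 powr ((real CARD('m) + 1) * q k)) <= ennreal (2 * 2 powr ((real CARD('m) + 1) * p))"
          using q[of k] by (intro ennreal_leI mult_left_mono powr_mono) auto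
      qed auto
      also have "... = ennreal (norm v powr q k * K)" using E unfolding K_def
        by (simp add: ennreal_mult[symmetric] mult_ac del: ennreal_plus)
      finally show ?thesis .
    qed
    have "(\<integral>\<^sup>+x. ennreal (?d x powr p) * indicator ?D x) = (\<integral>\<^sup>+x. liminf (\<lambda>k. ennreal (?d x powr q k) * indicator ?D x))"
    proof (rule nn_integral_cong, goal_cases)
      case (1 x)
      have "(\<lambda>k. ennreal (?d x powr q k)) \<longlonglongrightarrow> ennreal (?d x powr p)" by (intro tendsto_ennrealI pl qdist_nonneg)
      then have "liminf (\<lambda>k. ennreal (?d x powr q k)) = ennreal (?d x powr p)" by (intro lim_imp_Liminf) auto
      then show ?case by (auto simp: indicator_def Liminf_const)
    qed
    also have "... <= liminf (\<lambda>k. \<integral>\<^sup>+x. ennreal (?d x powr q k) * indicator ?D x \<partial>lborel)"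
      by (rule nn_integral_liminf) measurable
    also have "... <= liminf (\<lambda>k. ennreal (norm v powr q k * K))" using Iq by (intro Liminf_mono always_eventually) auto
    also have "... = ennreal (norm v powr p * K)"
      by (intro lim_imp_Liminf tendsto_ennrealI tendsto_mult tendsto_const pl) auto
    finally show ?thesis by (simp add: mult.commute)
  qed simp
qed

section \<open>Translation estimates for Sobolev maps\<close>

lemma powr_add3_le:
  fixes a b c p :: real
  assumes "0 <= a" "0 <= b" "0 <= c" "1 <= p"
  shows "(a + b + c) powr p <= 4 powr p * (a powr p + b powr p + c powr p)"
proof -
  have "(a + b + c) powr p <= 2 powr p * ((a + b) powr p + c powr p)" using assms by (intro powr_add_le) auto
  also have "... <= 2 powr p * (2 powr p * (a powr p + b powr p) + 2 powr p * c powr p)"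
  proof (intro mult_left_mono add_mono)
    show "(a + b) powr p <= 2 powr p * (a powr p + b powr p)" using assms by (intro powr_add_le) auto
    have "1 * c powr p <= 2 powr p * c powr p" using assms ge_one_powr_ge_zero[of 2 p] by (intro mult_right_mono) auto
    then show "c powr p <= 2 powr p * c powr p" by simp
  qed auto
  also have "... = (2 powr p * 2 powr p) * (a powr p + b powr p + c powr p)" by (simp add: algebra_simps)
  also have "2 powr p * 2 powr p = (4::real) powr p" by (simp add: powr_mult[symmetric])
  finally show ?thesis .
qed

text \<open>The \<open>p\<close>-th power of \<open>dp\<close> over the unit ball, but with values
  in \<open>ennreal\<close>, so that it is meaningful before integrability is known. The triangle
  inequality holds up to the factor \<open>2 powr p\<close>.\<close>

definition Lp_dist :: "real => ('a::euclidean_space => 'b::real_normed_vector multiset) => ('a => 'b multiset) => ennreal" where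
  "Lp_dist p f g = (\<integral>\<^sup>+x. qcost p (f x) (g x) * indicator unit_disk x)"

lemma Lp_dist_commute: "Lp_dist p f g = Lp_dist p g f" by (simp add: Lp_dist_def qdist_commute)

lemma qdist_powr_triangle:
  assumes "size X = Q" "size Y = Q" "size Z = Q" "0 <= p"
  shows "qcost p X Z <= ennreal (2 powr p) * (qcost p X Y + qcost p Y Z)"
proof -
  have "qdist X Z powr p <= (qdist X Y + qdist Y Z) powr p"
    using assms by (intro powr_mono2 qdist_triangle[where Q=Q] qdist_nonneg)
  also have "... <= 2 powr p * (qdist X Y powr p + qdist Y Z powr p)" using assms(4) by (intro powr_add_le qdist_nonneg)
  finally show ?thesis
    by (subst ennreal_plus[symmetric]) (auto simp flip: ennreal_mult simp del: ennreal_plus intro!: ennreal_leI)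
qed

lemma Lp_dist_triangle:
  fixes f g h :: "'a::euclidean_space => 'b::{real_normed_vector, second_countable_topology} multiset"
  assumes [measurable]: "f \<in> borel \<rightarrow>\<^sub>M qborel Q" "g \<in> borel \<rightarrow>\<^sub>M qborel Q" "h \<in> borel \<rightarrow>\<^sub>M qborel Q" and p: "0 <= p"
  shows "Lp_dist p f h <= ennreal (2 powr p) * (Lp_dist p f g + Lp_dist p g h)"
proof -
  have size: "size (f x) = Q" "size (g x) = Q" "size (h x) = Q" for x
    using assms(1-3)[THEN measurable_space, of x] by auto
  have "Lp_dist p f h <= (\<integral>\<^sup>+x. ennreal (2 powr p) * (qcost p (f x) (g x) * indicator unit_disk x
      + qcost p (g x) (h x) * indicator unit_disk x))" unfolding Lp_dist_def
  proof (rule nn_integral_mono, goal_cases)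
    case (1 x)
    show ?case using qdist_powr_triangle[OF size p] by (auto simp: indicator_def)
  qed
  also have "... = ennreal (2 powr p) * (Lp_dist p f g + Lp_dist p g h)"
    unfolding Lp_dist_def by (subst nn_integral_cmult, measurable) (subst nn_integral_add, auto)
  finally show ?thesis .
qed

text \<open>Go from \<open>f x\<close> to \<open>f (x + v)\<close> through \<open>g j x\<close> and
  \<open>g j (x + v)\<close>; \<open>4 powr p\<close> is the constant of the power inequality for
  three terms.\<close>

lemma transl_bound_limit:
  fixes f :: "'a::euclidean_space => 'b::{real_normed_vector, second_countable_topology} multiset"
  assumes f [measurable]: "f \<in> borel \<rightarrow>\<^sub>M qborel Q" and g [measurable]: "\<And>j. g j \<in> borel \<rightarrow>\<^sub>M qborel Q"
    and T: "\<And>j::nat. transl_bound p (g j) M" and p: "1 <= p" and M: "0 <= M"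
    and lim: "(\<lambda>j. Lp_dist p f (g j)) \<longlonglongrightarrow> 0"
  shows "transl_bound p f (4 powr p * M)" unfolding transl_bound_def
proof
  fix v :: 'a
  let ?U = "unit_disk :: 'a set"
  let ?D = "{x. x \<in> ?U \<and> x + v \<in> ?U}"
  have size: "size (f x) = Q" "size (g j x) = Q" for x j
    using measurable_space[OF f, of x] measurable_space[OF g, of x] by auto
  define I where "I = (\<integral>\<^sup>+x. qcost p (f x) (f (x + v)) * indicator ?D x)"
  have "I <= ennreal (4 powr p) * (Lp_dist p f (g j) + ennreal (M * norm v powr p) + Lp_dist p f (g j))" for j
  proof -
    let ?e = "\<lambda>x. qcost p (f x) (g j x) * indicator ?U x"
    let ?G = "\<lambda>x. qcost p (g j x) (g j (x + v)) * indicator ?D x"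
    have "I <= (\<integral>\<^sup>+x. ennreal (4 powr p) * (?e x + ?G x + ?e (x + v)))" unfolding I_def
    proof (rule nn_integral_mono, goal_cases)
      case (1 x)
      let ?a = "qdist (f x) (g j x)" and ?b = "qdist (g j x) (g j (x + v))" and ?c = "qdist (f (x + v)) (g j (x + v))"
      have "qdist (f x) (f (x + v)) <= qdist (f x) (g j x) + qdist (g j x) (f (x + v))"
        by (rule qdist_triangle[where Q=Q]) (auto simp: size)
      also have "qdist (g j x) (f (x + v)) <= ?b + qdist (g j (x + v)) (f (x + v))"
        by (rule qdist_triangle[where Q=Q]) (auto simp: size)
      finally have "qdist (f x) (f (x + v)) <= ?a + ?b + ?c" by (simp add: qdist_commute)
      then have "qdist (f x) (f (x + v)) powr p <= (?a + ?b + ?c) powr p"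
        using p by (intro powr_mono2 qdist_nonneg) auto
      also have "... <= 4 powr p * (?a powr p + ?b powr p + ?c powr p)"
        using p by (intro powr_add3_le qdist_nonneg) auto
      finally have "qcost p (f x) (f (x + v)) <= ennreal (4 powr p * (?a powr p + ?b powr p + ?c powr p))"
        by (rule ennreal_leI)
      then show ?case by (auto simp: indicator_def ennreal_mult)
    qed
    also have "... = ennreal (4 powr p) * ((\<integral>\<^sup>+x. ?e x) + (\<integral>\<^sup>+x. ?G x) + (\<integral>\<^sup>+x. ?e (x + v)))"
      by (simp add: nn_integral_cmult nn_integral_add)
    also have "(\<integral>\<^sup>+x. ?e (x + v)) = (\<integral>\<^sup>+x. ?e x)" by (rule nn_integral_translate) measurable
    also have "ennreal (4 powr p) * ((\<integral>\<^sup>+x. ?e x) + (\<integral>\<^sup>+x. ?G x) + (\<integral>\<^sup>+x. ?e x))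
        <= ennreal (4 powr p) * (Lp_dist p f (g j) + ennreal (M * norm v powr p) + Lp_dist p f (g j))"
      using T[of j] unfolding transl_bound_def Lp_dist_def by (intro mult_left_mono add_mono) auto
    finally show ?thesis .
  qed
  moreover have "(\<lambda>j. ennreal (4 powr p) * (Lp_dist p f (g j) + ennreal (M * norm v powr p) + Lp_dist p f (g j)))
      \<longlonglongrightarrow> ennreal (4 powr p) * (0 + ennreal (M * norm v powr p) + 0)"
    by (intro ennreal_tendsto_cmult tendsto_add tendsto_const lim) auto
  ultimately have "I <= ennreal (4 powr p) * (0 + ennreal (M * norm v powr p) + 0)" by (intro LIMSEQ_le_const) auto
  then show "(\<integral>\<^sup>+x. qcost p (f x) (f (x + v)) * indicator ?D x) <= ennreal (4 powr p * M * norm v powr p)"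
    using M by (simp add: I_def ennreal_mult mult.assoc)
qed

lemma lipschitz_map_qspace:
  fixes g :: "real^'m => 'b::real_normed_vector multiset"
  shows "Lipschitz_continuous_map euclidean_metric (qspace Q) g \<longleftrightarrow>
    (\<forall>x. size (g x) = Q) \<and> (\<exists>C\<ge>0. \<forall>x y. qdist (g x) (g y) <= C * dist x y)"
proof
  assume "Lipschitz_continuous_map euclidean_metric (qspace Q) g"
  then obtain B where "\<forall>x. size (g x) = Q" "\<And>x y. qdist (g x) (g y) <= B * dist x y"
    unfolding Lipschitz_continuous_map_def by (fastforce simp: Pi_iff)
  then show "(\<forall>x. size (g x) = Q) \<and> (\<exists>C\<ge>0. \<forall>x y. qdist (g x) (g y) <= C * dist x y)"
    by (intro conjI exI[of _ "\<bar>B\<bar>"] allI)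
      (simp_all, meson abs_ge_self mult_right_mono order_trans zero_le_dist)
next
  assume "(\<forall>x. size (g x) = Q) \<and> (\<exists>C\<ge>0. \<forall>x y. qdist (g x) (g y) <= C * dist x y)"
  then show "Lipschitz_continuous_map euclidean_metric (qspace Q) g"
    unfolding Lipschitz_continuous_map_def by (auto simp: image_subset_iff)
qed

lemma transl_bound_lipschitz:
  fixes g :: "real^'m => 'b::real_normed_vector multiset"
  assumes "0 <= C" "\<And>x y. qdist (g x) (g y) <= C * dist x y" "0 <= p"
  shows "transl_bound p g (C powr p * unit_ball_vol CARD('m))" unfolding transl_bound_def
proof
  fix v :: "real^'m"
  let ?U = "unit_disk :: (real^'m) set"
  have "(\<integral>\<^sup>+x. qcost p (g x) (g (x + v)) * indicator {x. x \<in> ?U \<and> x + v \<in> ?U} x)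
      <= (\<integral>\<^sup>+x. ennreal (C powr p * norm v powr p) * indicator ?U x)"
  proof (rule nn_integral_mono, goal_cases)
    case (1 x)
    have "qdist (g x) (g (x + v)) powr p <= (C * norm v) powr p"
      using assms(2)[of x "x + v"] assms(3) by (intro powr_mono2 qdist_nonneg) (auto simp: dist_norm)
    also have "... = C powr p * norm v powr p" using assms by (simp add: powr_mult)
    finally show ?case by (auto simp: indicator_def intro: ennreal_leI)
  qed
  also have "... = ennreal (C powr p * unit_ball_vol CARD('m) * norm v powr p)"
    by (subst nn_integral_cmult) (auto simp: emeasure_ball ennreal_mult mult_ac)
  finally show "(\<integral>\<^sup>+x. qcost p (g x) (g (x + v)) * indicator {x. x \<in> ?U \<and> x + v \<in> ?U} x)
      <= ennreal (C powr p * unit_ball_vol CARD('m) * norm v powr p)" .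
qed

lemma Lp_iff:
  fixes f :: "real^'m => 'b::real_normed_vector multiset"
  assumes "f \<in> borel \<rightarrow>\<^sub>M qborel Q"
  shows "f \<in> Lp Q p (ball 0 1) \<longleftrightarrow> Lp_dist p f (\<lambda>_. replicate_mset Q 0) < \<infinity>"
  using assms unfolding Lp_def borel_maps_def Lp_dist_def
  by (auto simp: nn_integral_completion measurable_restrict_space1)

lemma dp_eq: "dp p (ball 0 1) f g = enn2real (Lp_dist p f g) powr (1 / p)"
  by (simp add: dp_def Lp_dist_def nn_integral_completion)

lemma dp_tendsto_0_iff:
  fixes f :: "real^'m => 'b::{real_normed_vector, second_countable_topology} multiset"
  assumes f: "f \<in> borel \<rightarrow>\<^sub>M qborel Q" "f \<in> Lp Q p (ball 0 1)"
    and g: "\<And>j. g j \<in> borel \<rightarrow>\<^sub>M qborel Q" "\<And>j. g j \<in> Lp Q p (ball 0 1)" and p: "0 < p"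
  shows "(\<lambda>j::nat. dp p (ball 0 1) f (g j)) \<longlonglongrightarrow> 0 \<longleftrightarrow> (\<lambda>j. Lp_dist p f (g j)) \<longlonglongrightarrow> 0"
proof -
  have c: "(\<lambda>_. replicate_mset Q 0) \<in> borel \<rightarrow>\<^sub>M qborel Q" by (intro measurable_const) simp
  have fin: "Lp_dist p f (g j) < \<infinity>" for j
  proof -
    have "Lp_dist p f (g j) <= ennreal (2 powr p) * (Lp_dist p f (\<lambda>_. replicate_mset Q 0) + Lp_dist p (\<lambda>_. replicate_mset Q 0) (g j))"
      using p by (intro Lp_dist_triangle[OF f(1) c g(1)]) auto
    also have "... < \<infinity>" using f(2) g(2)[of j] unfolding Lp_iff[OF f(1)] Lp_iff[OF g(1)]
      by (auto simp: Lp_dist_commute[of p "\<lambda>_. replicate_mset Q 0"] ennreal_mult_less_top)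
    finally show ?thesis .
  qed
  define a where "a j = enn2real (Lp_dist p f (g j))" for j
  have a: "0 <= a j" "Lp_dist p f (g j) = ennreal (a j)" for j using fin[of j] by (auto simp: a_def)
  have "(\<lambda>j. a j powr (1 / p)) \<longlonglongrightarrow> 0 \<longleftrightarrow> a \<longlonglongrightarrow> 0"
  proof
    assume "(\<lambda>j. a j powr (1 / p)) \<longlonglongrightarrow> 0"
    then have "(\<lambda>j. (a j powr (1 / p)) powr p) \<longlonglongrightarrow> 0 powr p" using p a(1) by (intro tendsto_powr') auto
    then show "a \<longlonglongrightarrow> 0" using p a(1) by (simp add: powr_powr)
  next
    assume "a \<longlonglongrightarrow> 0"
    then have "(\<lambda>j. a j powr (1 / p)) \<longlonglongrightarrow> 0 powr (1 / p)" using p a(1) by (intro tendsto_powr') auto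
    then show "(\<lambda>j. a j powr (1 / p)) \<longlonglongrightarrow> 0" by simp
  qed
  also have "a \<longlonglongrightarrow> 0 \<longleftrightarrow> (\<lambda>j. ennreal (a j)) \<longlonglongrightarrow> ennreal 0"
    using a(1) by (intro tendsto_ennreal_iff[symmetric] always_eventually) auto
  finally show ?thesis unfolding dp_eq a_def[symmetric] using a(2) by simp
qed

text \<open>\<open>transl_bound_energy\<close> is applied twice. The approximants are Lipschitz with
  constants that may blow up, and the first application makes their translation constants uniform.
  After the passage to the limit the second one brings in the energy of \<open>f\<close>
  itself.\<close>

lemma W1p_transl_bound:
  fixes f :: "real^'m => 'b::{real_inner, banach, second_countable_topology} multiset"
  assumes f: "f \<in> borel \<rightarrow>\<^sub>M qborel Q" "f \<in> W1p Q p (ball 0 1)" and p: "1 < p"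
    and E: "energy Q p (ball 0 1) f <= ennreal E" "0 <= E"
  shows "transl_bound p f (2 * 2 powr ((real CARD('m) + 1) * p) * (unit_ball_vol CARD('m) + E))"
proof -
  let ?U = "ball 0 1 :: (real^'m) set"
  obtain g where fLp: "f \<in> Lp Q p ?U" and g: "\<And>j::nat. Lipschitz_continuous_map euclidean_metric (qspace Q) (g j)" "\<And>j. g j \<in> Lp Q p ?U"
    and sup: "(SUP j. energy Q p ?U (g j)) < \<infinity>" and lim: "(\<lambda>j. dp p ?U f (g j)) \<longlonglongrightarrow> 0"
    using f(2) unfolding W1p_def by blast
  have gL: "\<exists>C\<ge>0. \<forall>x y. qdist (g j x) (g j y) <= C * dist x y" "\<And>x. size (g j x) = Q" for j
    using g(1)[of j] unfolding lipschitz_map_qspace by auto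
  then have gm: "g j \<in> borel \<rightarrow>\<^sub>M qborel Q" for j by (meson lipschitz_into_qborel)
  obtain E' where E': "0 <= E'" "(SUP j. energy Q p ?U (g j)) = ennreal E'"
    using sup by (cases "SUP j. energy Q p ?U (g j)") auto
  have gE: "energy Q p ?U (g j) <= ennreal E'" for j unfolding E'(2)[symmetric] by (rule SUP_upper) simp
  define M0 where "M0 = 2 * 2 powr ((real CARD('m) + 1) * p) * (unit_ball_vol CARD('m) + E')"
  have M0: "0 <= M0" using E' by (simp add: M0_def)
  have "transl_bound p (g j) M0" for j
  proof -
    obtain C where C: "0 <= C" "\<And>x y. qdist (g j x) (g j y) <= C * dist x y" using gL(1) by blast
    have "transl_bound p (g j) (C powr p * unit_ball_vol CARD('m))" using p by (intro transl_bound_lipschitz C) auto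
    then show ?thesis unfolding M0_def by (rule transl_bound_energy[OF gm _ p _ gE E'(1)]) simp
  qed
  moreover have "(\<lambda>j. Lp_dist p f (g j)) \<longlonglongrightarrow> 0" using lim dp_tendsto_0_iff[OF f(1) fLp gm g(2)] p by simp
  ultimately have "transl_bound p f (4 powr p * M0)" using p M0 by (intro transl_bound_limit[OF f(1) gm]) auto
  then show ?thesis by (rule transl_bound_energy[OF f(1) _ p _ E]) (use M0 in simp)
qed

section \<open>Extension of tuple valued maps from a lattice\<close>

lemma qdist_le_permutation:
  assumes "\<sigma> permutes {..<Q}" "length xs = Q" "length ys = Q"
  shows "qdist (mset xs) (mset ys) <= L2_set (\<lambda>i. norm (xs ! i - ys ! \<sigma> i)) {..<Q}"
  using assms by (subst qdist_mset) (auto simp: L2_set_def finite_permutations intro!: Min_le)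

text \<open>The entries of the centre are grouped into clusters of
  diameter comparable with the radius, and every entry moves linearly to a point of its
  cluster.\<close>

lemma cone_extension:
  fixes Y0 :: "'b::real_normed_vector multiset"
  assumes Y0: "size Y0 = Q" and \<mu>: "0 <= \<mu>"
  obtains E :: "'b multiset => real => 'b multiset" where
    "\<And>Y t. size (E Y t) = Q"
    "\<And>Y. size Y = Q ==> qdist Y Y0 <= \<mu> ==> E Y 1 = Y"
    "\<And>Y Y' t t'. size Y = Q ==> size Y' = Q ==> qdist Y Y0 <= \<mu> ==> qdist Y' Y0 <= \<mu> ==> 0 <= t ==>
      qdist (E Y t) (E Y' t') <= t * qdist Y Y' + real Q * (1 + 4 * real (Q * Q)) * \<mu> * \<bar>t - t'\<bar>"
proof -
  obtain ys where ys: "mset ys = Y0" "length ys = Q" using size_imp_list[OF Y0] by blast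
  \<comment> \<open>Two tuples within \<open>\<mu>\<close> of \<open>Y0\<close> are within
    \<open>2 * \<mu>\<close> of each other, so the entries of \<open>Y0\<close> next to two matched
    entries differ by at most \<open>4 * \<mu>\<close>. Clusters generated by this threshold are
    therefore respected by optimal matchings.\<close>
  define r where "r = {(i, j). i < Q \<and> j < Q \<and> norm (ys ! i - ys ! j) <= 4 * \<mu>}"
  have r_sub: "r \<subseteq> {..<Q} \<times> {..<Q}" by (auto simp: r_def)
  then have fin: "finite r" by (rule finite_subset) auto
  have card_r: "card r <= Q * Q" using card_mono[OF _ r_sub] by (simp add: card_cartesian_product)
  have "sym r" by (auto simp: sym_def r_def norm_minus_commute)
  then have sym: "(j, i) \<in> r\<^sup>*" if "(i, j) \<in> r\<^sup>*" for i j using that sym_rtrancl[of r] by (auto simp: sym_def)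
  have pow: "norm (ys ! i - ys ! j) <= real n * (4 * \<mu>)" if "(i, j) \<in> r ^^ n" for i j n using that
  proof (induction n arbitrary: j)
    case (Suc n)
    then obtain k where k: "(i, k) \<in> r ^^ n" "(k, j) \<in> r" by auto
    have "norm (ys ! i - ys ! j) <= norm (ys ! i - ys ! k) + norm (ys ! k - ys ! j)"
      using norm_triangle_ineq[of "ys ! i - ys ! k" "ys ! k - ys ! j"] by simp
    then show ?case using Suc.IH[OF k(1)] k(2) by (simp add: r_def algebra_simps)
  qed simp
  \<comment> \<open>A path inside a cluster can be taken with at most \<open>card r\<close>, hence
    at most \<open>Q * Q\<close>, steps of length \<open>4 * \<mu>\<close>.\<close>
  have diam: "norm (ys ! i - ys ! j) <= 4 * real (Q * Q) * \<mu>" if ij: "(i, j) \<in> r\<^sup>*" for i j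
  proof -
    obtain n where n: "n <= card r" "(i, j) \<in> r ^^ n" using ij unfolding rtrancl_finite_eq_relpow[OF fin] by auto
    have "norm (ys ! i - ys ! j) <= real n * (4 * \<mu>)" by (rule pow[OF n(2)])
    also have "... <= real (Q * Q) * (4 * \<mu>)" using n(1) card_r \<mu> by (intro mult_right_mono of_nat_mono) auto
    finally show ?thesis by simp
  qed
  define rep where "rep i = (LEAST j. (i, j) \<in> r\<^sup>*)" for i
  define c where "c i = ys ! rep i" for i
  have rep: "(i, rep i) \<in> r\<^sup>*" for i unfolding rep_def by (rule LeastI[of _ i]) simp
  have c_eq: "c i = c j" if "(i, j) \<in> r\<^sup>*" for i j
  proof -
    have "(i, k) \<in> r\<^sup>* \<longleftrightarrow> (j, k) \<in> r\<^sup>*" for k using that sym[OF that] by (meson rtrancl_trans)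
    then show ?thesis by (simp add: c_def rep_def)
  qed
  \<comment> \<open>The enumeration aligned with \<open>ys\<close> is a mere choice and need not
    depend continuously on \<open>Y\<close>. Since \<open>c\<close> is constant on clusters,
    different alignments of two tuples do not spoil the estimate.\<close>
  define sel where "sel Y = (SOME xs. mset xs = Y \<and> length xs = Q \<and> (\<forall>i<Q. norm (xs ! i - ys ! i) <= \<mu>))" for Y
  have sel: "mset (sel Y) = Y" "length (sel Y) = Q" "\<And>i. i < Q ==> norm (sel Y ! i - ys ! i) <= \<mu>"
    if Y: "size Y = Q" "qdist Y Y0 <= \<mu>" for Y
  proof -
    obtain xs where xs: "mset xs = Y" "length xs = Q" "qdist Y0 Y = L2_set (\<lambda>i. norm (ys ! i - xs ! i)) {..<Q}"
      using qdist_matching[OF Y(1) ys] by blast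
    have "norm (xs ! i - ys ! i) <= \<mu>" if "i < Q" for i
      using norm_le_L2[OF that, of "\<lambda>i. ys ! i - xs ! i"] xs(3) Y(2) by (simp add: qdist_commute norm_minus_commute)
    then have "\<exists>xs. mset xs = Y \<and> length xs = Q \<and> (\<forall>i<Q. norm (xs ! i - ys ! i) <= \<mu>)" using xs by blast
    then have "mset (sel Y) = Y \<and> length (sel Y) = Q \<and> (\<forall>i<Q. norm (sel Y ! i - ys ! i) <= \<mu>)"
      unfolding sel_def by (rule someI_ex)
    then show "mset (sel Y) = Y" "length (sel Y) = Q" "\<And>i. i < Q ==> norm (sel Y ! i - ys ! i) <= \<mu>" by auto
  qed
  define e where "e Y t = map (\<lambda>i. c i + t *\<^sub>R (sel Y ! i - c i)) [0..<Q]" for Y t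
  show ?thesis
  proof (rule that[of "\<lambda>Y t. mset (e Y t)"])
    show "size (mset (e Y t)) = Q" for Y t by (simp add: e_def)
    show "mset (e Y 1) = Y" if "size Y = Q" "qdist Y Y0 <= \<mu>" for Y
    proof -
      have "e Y 1 = sel Y" unfolding e_def using sel(2)[OF that] by (intro nth_equalityI) auto
      then show ?thesis using sel(1)[OF that] by simp
    qed
    fix Y Y' :: "'b multiset" and t t' :: real
    assume Y: "size Y = Q" "size Y' = Q" "qdist Y Y0 <= \<mu>" "qdist Y' Y0 <= \<mu>" and t: "0 <= t"
    note s = sel[OF Y(1,3)] and s' = sel[OF Y(2,4)]
    obtain \<sigma> where \<sigma>: "\<sigma> permutes {..<Q}" "qdist Y Y' = L2_set (\<lambda>i. norm (sel Y ! i - sel Y' ! \<sigma> i)) {..<Q}"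
      using qdist_permutation[OF s(2) s'(2)] s(1) s'(1) by metis
    have \<sigma>Q: "\<sigma> i < Q" if "i < Q" for i using permutes_in_image[OF \<sigma>(1), of i] that by simp
    have "qdist Y Y' <= qdist Y Y0 + qdist Y0 Y'" using Y Y0 by (intro qdist_triangle[where Q=Q])
    then have YY: "qdist Y Y' <= 2 * \<mu>" using Y by (simp add: qdist_commute)
    have cl: "(i, \<sigma> i) \<in> r\<^sup>*" if i: "i < Q" for i
    proof (rule ccontr)
      assume "(i, \<sigma> i) \<notin> r\<^sup>*"
      then have far: "4 * \<mu> < norm (ys ! i - ys ! \<sigma> i)" using i \<sigma>Q[OF i] by (auto simp: r_def)
      have "norm (ys ! i - ys ! \<sigma> i) <= norm (sel Y ! i - ys ! i) + norm (sel Y ! i - sel Y' ! \<sigma> i) + norm (sel Y' ! \<sigma> i - ys ! \<sigma> i)"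
      proof -
        have eq: "ys ! i - ys ! \<sigma> i = ((sel Y ! i - sel Y' ! \<sigma> i) - (sel Y ! i - ys ! i)) + (sel Y' ! \<sigma> i - ys ! \<sigma> i)" by simp
        show ?thesis unfolding eq
          using norm_triangle_ineq[of "(sel Y ! i - sel Y' ! \<sigma> i) - (sel Y ! i - ys ! i)" "sel Y' ! \<sigma> i - ys ! \<sigma> i"]
            norm_triangle_ineq4[of "sel Y ! i - sel Y' ! \<sigma> i" "sel Y ! i - ys ! i"] by linarith
      qed
      moreover have "norm (sel Y ! i - sel Y' ! \<sigma> i) <= 2 * \<mu>"
        using norm_le_L2[OF i, of "\<lambda>i. sel Y ! i - sel Y' ! \<sigma> i"] \<sigma>(2) YY by simp
      ultimately show False using far s(3)[OF i] s'(3)[OF \<sigma>Q[OF i]] by linarith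
    qed
    define b where "b = (1 + 4 * real (Q * Q)) * \<mu> * \<bar>t - t'\<bar>"
    have "qdist (mset (e Y t)) (mset (e Y' t')) <= L2_set (\<lambda>i. norm (e Y t ! i - e Y' t' ! \<sigma> i)) {..<Q}"
      by (rule qdist_le_permutation[OF \<sigma>(1)]) (auto simp: e_def)
    also have "... <= L2_set (\<lambda>i. t * norm (sel Y ! i - sel Y' ! \<sigma> i) + norm b) {..<Q}"
    proof (rule L2_set_mono)
      fix i assume "i \<in> {..<Q}"
      then have i: "i < Q" by simp
      have "e Y t ! i - e Y' t' ! \<sigma> i = t *\<^sub>R (sel Y ! i - sel Y' ! \<sigma> i) + (t - t') *\<^sub>R (sel Y' ! \<sigma> i - c (\<sigma> i))"
        using i \<sigma>Q[OF i] c_eq[OF cl[OF i]] by (simp add: e_def algebra_simps)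
      then have "norm (e Y t ! i - e Y' t' ! \<sigma> i) <= t * norm (sel Y ! i - sel Y' ! \<sigma> i) + \<bar>t - t'\<bar> * norm (sel Y' ! \<sigma> i - c (\<sigma> i))"
        using norm_triangle_ineq[of "t *\<^sub>R (sel Y ! i - sel Y' ! \<sigma> i)" "(t - t') *\<^sub>R (sel Y' ! \<sigma> i - c (\<sigma> i))"] t by simp
      also have "norm (sel Y' ! \<sigma> i - c (\<sigma> i)) <= norm (sel Y' ! \<sigma> i - ys ! \<sigma> i) + norm (ys ! \<sigma> i - c (\<sigma> i))"
        using norm_triangle_ineq[of "sel Y' ! \<sigma> i - ys ! \<sigma> i" "ys ! \<sigma> i - c (\<sigma> i)"] by simp
      also have "... <= \<mu> + 4 * real (Q * Q) * \<mu>" unfolding c_def by (intro add_mono s' \<sigma>Q i diam rep)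
      finally have "norm (e Y t ! i - e Y' t' ! \<sigma> i) <= t * norm (sel Y ! i - sel Y' ! \<sigma> i) + \<bar>t - t'\<bar> * (\<mu> + 4 * real (Q * Q) * \<mu>)"
        by (simp add: mult_left_mono)
      moreover have "\<bar>t - t'\<bar> * (\<mu> + 4 * real (Q * Q) * \<mu>) = b" by (simp add: b_def algebra_simps)
      moreover have "b <= norm b" by simp
      ultimately show "norm (e Y t ! i - e Y' t' ! \<sigma> i) <= t * norm (sel Y ! i - sel Y' ! \<sigma> i) + norm b" by linarith
    qed auto
    also have "... <= L2_set (\<lambda>i. t * norm (sel Y ! i - sel Y' ! \<sigma> i)) {..<Q} + L2_set (\<lambda>i. norm b) {..<Q}"
      by (rule L2_set_triangle_ineq)
    also have "L2_set (\<lambda>i. t * norm (sel Y ! i - sel Y' ! \<sigma> i)) {..<Q} = t * qdist Y Y'"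
      using t by (simp add: \<sigma>(2) L2_set_right_distrib)
    also have "L2_set (\<lambda>i. norm b) {..<Q} <= real Q * b" using L2_le_sum_bound[of Q "\<lambda>_. b" b] \<mu> by (simp add: b_def)
    finally show "qdist (mset (e Y t)) (mset (e Y' t')) <= t * qdist Y Y' + real Q * (1 + 4 * real (Q * Q)) * \<mu> * \<bar>t - t'\<bar>"
      by (simp add: b_def mult.assoc)
  qed
qed

section \<open>The integer lattice and its separated classes\<close>

definition lattice :: "(real^'m) set" where
  "lattice = {z. \<forall>i. z $ i \<in> \<int>}"

definition vfloor :: "real^'m => real^'m" where
  "vfloor x = (\<chi> i. of_int \<lfloor>x $ i\<rfloor>)"

text \<open>The radius leaves room for all interactions in the construction; the longest reaches
  less than \<open>2 * CARD('m) + 6\<close>.\<close>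

definition near :: "real^'m => (real^'m) set" where
  "near z = {w \<in> lattice. dist w z <= 3 * real CARD('m) + 6}"

lemma vfloor_lattice [simp]: "vfloor x \<in> lattice" by (simp add: lattice_def vfloor_def)

lemma dist_vfloor:
  fixes x :: "real^'m"
  shows "dist (vfloor x) x <= real CARD('m)"
proof -
  have "dist (vfloor x) x <= (\<Sum>i\<in>UNIV. \<bar>(vfloor x - x) $ i\<bar>)" unfolding dist_norm by (rule norm_le_l1_cart)
  also have "... <= (\<Sum>i\<in>(UNIV :: 'm set). 1)"
  proof (rule sum_mono)
    fix i :: 'm
    show "\<bar>(vfloor x - x) $ i\<bar> <= 1" unfolding vfloor_def by simp linarith
  qed
  finally show ?thesis by simp
qed

lemma finite_lattice_bounded:
  fixes z :: "real^'m"
  shows "finite {w \<in> lattice. dist w z <= R}"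
proof (rule finite_subset)
  define I where "I = (\<Union>i. real_of_int ` {\<lfloor>z $ i - R\<rfloor>..\<lceil>z $ i + R\<rceil>})"
  have fI: "finite I" by (simp add: I_def)
  have "finite {f :: 'm => real. \<forall>i. f i \<in> I}"
    using finite_set_of_finite_funs[of "UNIV :: 'm set" I undefined] fI by simp
  then show "finite (vec_lambda ` {f :: 'm => real. \<forall>i. f i \<in> I})" by simp
  show "{w \<in> lattice. dist w z <= R} \<subseteq> vec_lambda ` {f :: 'm => real. \<forall>i. f i \<in> I}"
  proof
    fix w assume w: "w \<in> {w \<in> lattice. dist w z <= R}"
    have "w $ i \<in> I" for i
    proof -
      obtain a where a: "w $ i = of_int a" using w by (auto simp: lattice_def elim!: Ints_cases)
      have "\<bar>w $ i - z $ i\<bar> <= R" using component_le_norm_cart[of "w - z" i] w by (auto simp: dist_norm)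
      then have "a \<in> {\<lfloor>z $ i - R\<rfloor>..\<lceil>z $ i + R\<rceil>}" using a by auto linarith+
      then show ?thesis unfolding I_def using a by (intro UN_I[of i] image_eqI[of _ _ a]) auto
    qed
    then show "w \<in> vec_lambda ` {f :: 'm => real. \<forall>i. f i \<in> I}"
      by (intro image_eqI[of _ _ "vec_nth w"]) (auto simp: vec_nth_inverse)
  qed
qed

lemma finite_near [simp]: "finite (near z)" unfolding near_def by (rule finite_lattice_bounded)

lemma lattice_diff: "z \<in> lattice ==> w \<in> lattice ==> w - z \<in> lattice"
  and lattice_add: "z \<in> lattice ==> w \<in> lattice ==> w + z \<in> lattice" by (auto simp: lattice_def)

lemma card_near:
  fixes z :: "real^'m"
  assumes "z \<in> lattice"
  shows "card (near z) = card (near (0 :: real^'m))"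
proof -
  have "near z = (\<lambda>w. w + z) ` near 0"
  proof
    show "near z \<subseteq> (\<lambda>w. w + z) ` near 0"
      using assms by (auto simp: near_def dist_norm lattice_diff intro!: image_eqI[of _ _ "_ - z"])
    show "(\<lambda>w. w + z) ` near 0 \<subseteq> near z" using assms by (auto simp: near_def dist_norm lattice_add)
  qed
  then show ?thesis using card_image[of "\<lambda>w. w + z" "near 0"] by (simp add: inj_on_def)
qed

text \<open>Classes are given by the residues of the coordinates modulo \<open>K\<close>: different
  points of one class differ by at least \<open>K\<close> in some coordinate.\<close>

lemma lattice_classes:
  obtains N and S :: "nat => (real^'m) set" where
    "(\<Union>i<N. S i) = lattice"
    "\<And>i z z'. z \<in> S i ==> z' \<in> S i ==> dist z z' < 2 * real CARD('m) + 6 ==> z = z'"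
proof -
  define K :: int where "K = 2 * int CARD('m) + 6"
  have K: "0 < K" by (simp add: K_def)
  define F where "F = {c :: 'm => int. \<forall>i. c i \<in> {0..<K}}"
  have "finite F" using finite_set_of_finite_funs[of "UNIV :: 'm set" "{0..<K}" undefined] by (simp add: F_def)
  then obtain cs where cs: "set cs = F" using finite_list by blast
  define S where "S i = {z :: real^'m. z \<in> lattice \<and> (\<lambda>j. \<lfloor>z $ j\<rfloor> mod K) = cs ! i}" for i
  show ?thesis
  proof (rule that[of S "length cs"])
    show "(\<Union>i<length cs. S i) = lattice"
    proof
      show "lattice \<subseteq> (\<Union>i<length cs. S i)"
      proof
        fix z :: "real^'m" assume z: "z \<in> lattice"
        have "(\<lambda>j. \<lfloor>z $ j\<rfloor> mod K) \<in> set cs" using K by (simp add: cs F_def)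
        then obtain i where "i < length cs" "cs ! i = (\<lambda>j. \<lfloor>z $ j\<rfloor> mod K)" by (auto simp only: in_set_conv_nth)
        then show "z \<in> (\<Union>i<length cs. S i)" using z by (intro UN_I[of i]) (simp_all add: S_def)
      qed
    qed (auto simp: S_def)
    fix i and z z' :: "real^'m"
    assume z: "z \<in> S i" "z' \<in> S i" and d: "dist z z' < 2 * real CARD('m) + 6"
    show "z = z'"
    proof (unfold vec_eq_iff, rule allI)
      fix j
      obtain a b where ab: "z $ j = of_int a" "z' $ j = of_int b"
        using z by (auto simp: S_def lattice_def) (meson Ints_cases)
      have "\<bar>z $ j - z' $ j\<bar> < real_of_int K"
        using component_le_norm_cart[of "z - z'" j] d by (simp add: dist_norm K_def)
      then have lt: "\<bar>a - b\<bar> < K" unfolding ab by linarith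
      have "(\<lambda>j. \<lfloor>z $ j\<rfloor> mod K) = (\<lambda>j. \<lfloor>z' $ j\<rfloor> mod K)" using z by (simp add: S_def)
      then have "a mod K = b mod K" using ab by (metis floor_of_int)
      then have "K dvd a - b" by (simp add: mod_eq_dvd_iff)
      then have "a - b = 0" using lt dvd_imp_le_int[of "a - b" K] K by auto
      then show "z $ j = z' $ j" using ab by simp
    qed
  qed
qed

text \<open>The constant of \<open>cone_extension\<close> in front of \<open>\<mu>\<close>, for
  changes of the radial parameter.\<close>

definition blend_const :: "nat => real" where
  "blend_const Q = real Q * (1 + 4 * real (Q * Q))"

lemma blend_const_nonneg [simp]: "0 <= blend_const Q" by (simp add: blend_const_def)

text \<open>Near every point \<open>z\<close> of the separated set \<open>S\<close> the map \<open>h\<close> is contracted to a constant.\<close>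

lemma blend_step:
  fixes Y h :: "real^'m => 'b::real_normed_vector multiset"
  assumes Y: "\<And>z. size (Y z) = Q" and h: "\<And>x. size (h x) = Q"
    and M: "\<And>z. 0 <= M z"
    and close: "\<And>z y. z \<in> lattice ==> dist y z <= real CARD('m) + 4 ==> qdist (h y) (Y z) <= M z"
    and S: "S \<subseteq> lattice"
      "\<And>z z'. z \<in> S ==> z' \<in> S ==> dist z z' < 2 * real CARD('m) + 6 ==> z = z'"
  obtains h' where "\<And>x. size (h' x) = Q"
    "\<And>z y. z \<in> lattice ==> dist y z <= real CARD('m) + 4 ==>
      qdist (h' y) (Y z) <= M z + blend_const Q * (\<Sum>w\<in>near z. M w)"
    "\<And>x y y' z. z \<in> S ==> dist x z <= real CARD('m) ==> y \<in> ball x 1 ==> y' \<in> ball x 1 ==>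
      qdist (h' y) (h' y') = 0"
    "\<And>x L. (\<And>y y'. y \<in> ball x 1 ==> y' \<in> ball x 1 ==> qdist (h y) (h y') <= L * dist y y') ==>
      (\<And>y y'. y \<in> ball x 1 ==> y' \<in> ball x 1 ==>
        qdist (h' y) (h' y') <= (L + blend_const Q * (\<Sum>w\<in>near (vfloor x). M w)) * dist y y')"
proof -
  define m where "m = real CARD('m)"
  have m0: "0 <= m" by (simp add: m_def)
  let ?C = "blend_const Q"
  define P where "P z E \<longleftrightarrow> (\<forall>Z t. size (E Z t) = Q) \<and> (\<forall>Z. size Z = Q --> qdist Z (Y z) <= M z --> E Z 1 = Z) \<and>
    (\<forall>Z Z' t t'. size Z = Q --> size Z' = Q --> qdist Z (Y z) <= M z --> qdist Z' (Y z) <= M z --> 0 <= t -->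
      qdist (E Z t) (E Z' t') <= t * qdist Z Z' + ?C * M z * \<bar>t - t'\<bar>)" for z and E :: "'b multiset => real => 'b multiset"
  have "\<exists>E. P z E" for z
  proof -
    obtain E where "P z E" unfolding P_def blend_const_def using cone_extension[OF Y M, of z z] by metis
    then show ?thesis by blast
  qed
  then obtain E where "\<And>z. P z (E z)" by metis
  then have E: "size (E z Z t) = Q" "size Z = Q ==> qdist Z (Y z) <= M z ==> E z Z 1 = Z"
    "size Z = Q ==> size Z' = Q ==> qdist Z (Y z) <= M z ==> qdist Z' (Y z) <= M z ==> 0 <= t ==>
      qdist (E z Z t) (E z Z' t') <= t * qdist Z Z' + ?C * M z * \<bar>t - t'\<bar>" for z Z Z' t t' by (auto simp: P_def)
  \<comment> \<open>Zero within \<open>m + 1\<close> of \<open>z\<close>, so that the unit ball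
    about a point within \<open>m\<close> of \<open>z\<close> is mapped to a single tuple, and one
    from \<open>m + 2\<close> on, where \<open>h\<close> is left alone.\<close>
  define \<tau> where "\<tau> y z = max 0 (min 1 (dist y z - (m + 1)))" for y z :: "real^'m"
  have \<tau>: "0 <= \<tau> y z" "\<tau> y z <= 1" "\<bar>\<tau> y z - \<tau> y' z\<bar> <= dist y y'" for y y' z
  proof -
    have "\<bar>dist y z - dist y' z\<bar> <= dist y y'" by (metis abs_dist_diff_le dist_commute)
    then show "\<bar>\<tau> y z - \<tau> y' z\<bar> <= dist y y'" by (auto simp: \<tau>_def max_def min_def)
  qed (auto simp: \<tau>_def)
  \<comment> \<open>The centre is unique: a point within \<open>m + 2\<close> of one centre and
    within \<open>m + 4\<close> of another would bring them closer than the separation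
    \<open>2 * m + 6\<close>.\<close>
  define Z where "Z y = (SOME z. z \<in> S \<and> dist y z < m + 2)" for y
  define h' where "h' y = (if \<exists>z\<in>S. dist y z < m + 2 then E (Z y) (h y) (\<tau> y (Z y)) else h y)" for y
  have Z: "Z y = z" if "z \<in> S" "dist y z < m + 4" "z' \<in> S" "dist y z' < m + 2" for y z z'
  proof -
    have "Z y \<in> S \<and> dist y (Z y) < m + 2" unfolding Z_def by (rule someI[of _ z']) (use that in auto)
    then show ?thesis using S(2)[of "Z y" z] that dist_triangle[of "Z y" z y] by (simp add: dist_commute m_def)
  qed
  have h'_eq: "h' y = E z (h y) (\<tau> y z)" if z: "z \<in> S" "dist y z < m + 4" for y z
  proof (cases "\<exists>z\<in>S. dist y z < m + 2")
    case True
    then show ?thesis using Z[OF z] by (auto simp: h'_def)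
  next
    case False
    then have "\<tau> y z = 1" using z by (auto simp: \<tau>_def)
    then show ?thesis using False E(2)[OF h close, of z y] z S(1) by (auto simp: h'_def m_def)
  qed
  have sum_M: "M w <= (\<Sum>w\<in>near z. M w)" if "w \<in> lattice" "dist w z <= 3 * m + 6" for w z
    by (rule member_le_sum) (use that M finite_near[of z] in \<open>auto simp: near_def m_def\<close>)
  have sum_nonneg: "0 <= (\<Sum>w\<in>near z. M w)" for z by (simp add: sum_nonneg M)
  show ?thesis
  proof (rule that[of h'])
    show "size (h' x) = Q" for x by (simp add: h'_def E(1) h)
    show "qdist (h' y) (Y z) <= M z + ?C * (\<Sum>w\<in>near z. M w)"
      if zy: "z \<in> lattice" "dist y z <= real CARD('m) + 4" for z y
    proof (cases "\<exists>w\<in>S. dist y w < m + 2")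
      case True
      then obtain w where w: "w \<in> S" "dist y w < m + 2" by blast
      have c: "qdist (h y) (Y w) <= M w" using close[of w y] w S(1) by (auto simp: m_def)
      have "qdist (h' y) (h y) = qdist (E w (h y) 1) (E w (h y) (\<tau> y w))"
        using h'_eq[OF w(1), of y] w E(2)[OF h c] by (simp add: qdist_commute)
      also have "... <= 1 * qdist (h y) (h y) + ?C * M w * \<bar>1 - \<tau> y w\<bar>" by (rule E(3)[OF h h c c]) simp
      also have "... <= ?C * M w * 1" using \<tau>[of y w] M[of w] by (simp add: qdist_self mult_left_le)
      also have "... <= ?C * (\<Sum>w\<in>near z. M w)" using w zy S(1) dist_triangle[of w z y]
        by (auto simp: m_def dist_commute intro!: mult_left_mono sum_M)
      finally have "qdist (h' y) (h y) <= ?C * (\<Sum>w\<in>near z. M w)" .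
      moreover have "qdist (h' y) (Y z) <= qdist (h' y) (h y) + qdist (h y) (Y z)"
        using Y h by (intro qdist_triangle[where Q=Q]) (simp_all add: h'_def E(1))
      ultimately show ?thesis using close[OF zy] by linarith
    next
      case False
      then show ?thesis using close[OF zy] sum_nonneg[of z] by (simp add: h'_def add_increasing2)
    qed
    show "qdist (h' y) (h' y') = 0"
      if z: "z \<in> S" "dist x z <= real CARD('m)" and y: "y \<in> ball x 1" "y' \<in> ball x 1" for x y y' z
    proof -
      have d: "dist y z < m + 1" "dist y' z < m + 1"
        using y z(2) dist_triangle[of y z x] dist_triangle[of y' z x] by (auto simp: m_def dist_commute)
      then have \<tau>0: "\<tau> y z = 0" "\<tau> y' z = 0" by (auto simp: \<tau>_def)
      have "qdist (h' y) (h' y') = qdist (E z (h y) 0) (E z (h y') 0)" using h'_eq[OF z(1)] d \<tau>0 by simp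
      also have "... <= 0 * qdist (h y) (h y') + ?C * M z * \<bar>0 - 0\<bar>"
        using S(1) z(1) d by (intro E(3) h close) (auto simp: m_def)
      finally show ?thesis using qdist_nonneg[of "h' y" "h' y'"] by simp
    qed
    show "qdist (h' y) (h' y') <= (L + ?C * (\<Sum>w\<in>near (vfloor x). M w)) * dist y y'"
      if L: "\<And>y y'. y \<in> ball x 1 ==> y' \<in> ball x 1 ==> qdist (h y) (h y') <= L * dist y y'"
        and y: "y \<in> ball x 1" "y' \<in> ball x 1" for x L y y'
    proof (cases "\<exists>z\<in>S. dist x z < m + 3")
      case True
      then obtain z where z: "z \<in> S" "dist x z < m + 3" by blast
      have d: "dist y z < m + 4" "dist y' z < m + 4"
        using y z(2) dist_triangle[of y z x] dist_triangle[of y' z x] by (auto simp: dist_commute)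
      have "qdist (h' y) (h' y') = qdist (E z (h y) (\<tau> y z)) (E z (h y') (\<tau> y' z))" using h'_eq[OF z(1)] d by simp
      also have "... <= \<tau> y z * qdist (h y) (h y') + ?C * M z * \<bar>\<tau> y z - \<tau> y' z\<bar>"
        using S(1) z(1) d \<tau> by (intro E(3) h close) (auto simp: m_def)
      also have "... <= 1 * (L * dist y y') + ?C * M z * dist y y'"
        using M[of z] by (intro add_mono mult_mono L y \<tau> mult_nonneg_nonneg qdist_nonneg) auto
      also have "... = (L + ?C * M z) * dist y y'" by (simp add: algebra_simps)
      also have "... <= (L + ?C * (\<Sum>w\<in>near (vfloor x). M w)) * dist y y'"
        using z S(1) dist_triangle[of z "vfloor x" x] dist_vfloor[of x] m0
        by (intro mult_right_mono add_left_mono mult_left_mono sum_M) (auto simp: dist_commute m_def)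
      finally show ?thesis .
    next
      case False
      have "h' u = h u" if "u \<in> ball x 1" for u
      proof -
        have "\<not> dist u z < m + 2" if "z \<in> S" for z
          using False \<open>u \<in> ball x 1\<close> that dist_triangle[of x z u] by (force simp: dist_commute)
        then show ?thesis by (auto simp: h'_def)
      qed
      then have "qdist (h' y) (h' y') <= L * dist y y'" using L y by simp
      also have "... <= (L + ?C * (\<Sum>w\<in>near (vfloor x). M w)) * dist y y'"
        using sum_nonneg by (intro mult_right_mono) simp_all
      finally show ?thesis .
    qed
  qed
qed

text \<open>After \<open>k\<close> classes have been treated this bounds both the distance to the
  samples and the local Lipschitz constant; the recursion is that of \<open>blend_step\<close>. It
  is built from differences of neighbouring samples, so its \<open>p\<close>-th powers can be
  summed.\<close>

primrec roughness :: "nat => (real^'m => 'b::real_normed_vector multiset) => nat => real^'m => real" where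
  "roughness Q Y 0 z = (\<Sum>w\<in>near z. qdist (Y w) (Y z))"
| "roughness Q Y (Suc k) z = roughness Q Y k z + blend_const Q * (\<Sum>w\<in>near z. roughness Q Y k w)"

lemma roughness_nonneg: "0 <= roughness Q Y k z"
  by (induction k arbitrary: z) (auto intro!: sum_nonneg add_nonneg_nonneg mult_nonneg_nonneg qdist_nonneg)

text \<open>The mesh is 1 here. The Lipschitz constant is local, as an estimate of the energy in the
  mean requires.\<close>

definition extends_lattice :: "nat => (real^'m => 'b::real_normed_vector multiset) => (real^'m => real) => (real^'m => 'b multiset) => bool" where
  "extends_lattice Q Y \<rho> H \<longleftrightarrow> (\<forall>x. size (H x) = Q) \<and> (\<forall>x. qdist (H x) (Y (vfloor x)) <= \<rho> (vfloor x)) \<and>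
      (\<forall>x. \<forall>y\<in>ball x 1. \<forall>y'\<in>ball x 1. qdist (H y) (H y') <= \<rho> (vfloor x) * dist y y')"

text \<open>Start with the step function \<open>Y (vfloor y)\<close> and blend once for each class.
  Around the points of a treated class there is a Lipschitz bound, which later blendings only
  enlarge; every \<open>x\<close> is within \<open>CARD('m)\<close> of the lattice point
  \<open>vfloor x\<close>, so in the end there is one everywhere. The number \<open>N\<close> of
  classes is chosen before the samples.\<close>

lemma lattice_extension:
  obtains N where "\<And>Y :: real^'m => 'b::real_normed_vector multiset. (\<And>z. size (Y z) = Q) ==>
    \<exists>H. extends_lattice Q Y (roughness Q Y N) H"
proof -
  obtain N and S :: "nat => (real^'m) set" where S: "(\<Union>i<N. S i) = lattice"
    "\<And>i z z'. z \<in> S i ==> z' \<in> S i ==> dist z z' < 2 * real CARD('m) + 6 ==> z = z'"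
    by (rule lattice_classes, rule that; assumption)
  have main: "\<exists>h. (\<forall>x. size (h x) = Q) \<and>
      (\<forall>z\<in>lattice. \<forall>y. dist y z <= real CARD('m) + 4 --> qdist (h y) (Y z) <= roughness Q Y k z) \<and>
      (\<forall>x. (\<exists>i<k. \<exists>z\<in>S i. dist x z <= real CARD('m)) -->
        (\<forall>y\<in>ball x 1. \<forall>y'\<in>ball x 1. qdist (h y) (h y') <= roughness Q Y k (vfloor x) * dist y y'))"
    if Y: "\<And>z. size (Y z) = Q" and "k <= N" for k and Y :: "real^'m => 'b multiset" using that(2)
  proof (induction k)
    \<comment> \<open>The Lipschitz claim is void for \<open>k = 0\<close>, where the map is still
      discontinuous.\<close>
    case 0
    have "qdist (Y (vfloor y)) (Y z) <= (\<Sum>w\<in>near z. qdist (Y w) (Y z))"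
      if z: "z \<in> lattice" "dist y z <= real CARD('m) + 4" for z y
      using z(2) dist_vfloor[of y] dist_triangle[of "vfloor y" z y]
      by (intro member_le_sum finite_near) (auto simp: near_def qdist_nonneg)
    then show ?case using Y by (intro exI[of _ "\<lambda>y. Y (vfloor y)"]) simp
  next
    case (Suc k)
    obtain h where h0: "\<forall>x. size (h x) = Q"
      "\<forall>z\<in>lattice. \<forall>y. dist y z <= real CARD('m) + 4 --> qdist (h y) (Y z) <= roughness Q Y k z"
      "\<forall>x. (\<exists>i<k. \<exists>z\<in>S i. dist x z <= real CARD('m)) -->
        (\<forall>y\<in>ball x 1. \<forall>y'\<in>ball x 1. qdist (h y) (h y') <= roughness Q Y k (vfloor x) * dist y y')"
      using Suc.IH[OF Suc_leD[OF Suc.prems]] by blast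
    have h: "\<And>x. size (h x) = Q"
      "\<And>z y. z \<in> lattice ==> dist y z <= real CARD('m) + 4 ==> qdist (h y) (Y z) <= roughness Q Y k z"
      "\<And>x y y' i z. i < k ==> z \<in> S i ==> dist x z <= real CARD('m) ==> y \<in> ball x 1 ==> y' \<in> ball x 1 ==>
        qdist (h y) (h y') <= roughness Q Y k (vfloor x) * dist y y'" using h0 by blast+
    have Sk: "S k \<subseteq> lattice" using S(1) Suc.prems by auto
    obtain h' where h': "\<And>x. size (h' x) = Q"
      "\<And>z y. z \<in> lattice ==> dist y z <= real CARD('m) + 4 ==> qdist (h' y) (Y z) <= roughness Q Y (Suc k) z"
      "\<And>x y y' z. z \<in> S k ==> dist x z <= real CARD('m) ==> y \<in> ball x 1 ==> y' \<in> ball x 1 ==> qdist (h' y) (h' y') = 0"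
      "\<And>x L y y'. (\<And>y y'. y \<in> ball x 1 ==> y' \<in> ball x 1 ==> qdist (h y) (h y') <= L * dist y y') ==>
        y \<in> ball x 1 ==> y' \<in> ball x 1 ==>
        qdist (h' y) (h' y') <= (L + blend_const Q * (\<Sum>w\<in>near (vfloor x). roughness Q Y k w)) * dist y y'"
      unfolding roughness.simps
    proof (rule blend_step[where Q=Q and Y=Y and h=h and M="roughness Q Y k" and S="S k"])
      show "qdist (h y) (Y z) <= roughness Q Y k z" if "z \<in> lattice" "dist y z <= real CARD('m) + 4" for z y
        by (rule h(2)[OF that])
      show "z = z'" if "z \<in> S k" "z' \<in> S k" "dist z z' < 2 * real CARD('m) + 6" for z z' by (rule S(2)[OF that])
    qed (use Y h(1) roughness_nonneg Sk that in blast)+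
    have "qdist (h' y) (h' y') <= roughness Q Y (Suc k) (vfloor x) * dist y y'"
      if i: "i < Suc k" "z \<in> S i" "dist x z <= real CARD('m)" and y: "y \<in> ball x 1" "y' \<in> ball x 1" for x y y' i z
    proof (cases "i = k")
      case True
      then show ?thesis using h'(3)[of z x y y'] i y roughness_nonneg[of Q Y "Suc k" "vfloor x"]
        by (simp del: roughness.simps)
    next
      case False
      then have "i < k" using i(1) by simp
      then show ?thesis using h'(4)[OF h(3)[OF _ i(2,3)] y] by simp
    qed
    then show ?case using h'(1,2) by (intro exI[of _ h']) (auto simp del: roughness.simps mem_ball)
  qed
  show ?thesis
  proof (rule that[of N])
    fix Y :: "real^'m => 'b multiset" assume Y: "\<And>z. size (Y z) = Q"
    obtain h where h: "\<forall>x. size (h x) = Q"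
      "\<forall>z\<in>lattice. \<forall>y. dist y z <= real CARD('m) + 4 --> qdist (h y) (Y z) <= roughness Q Y N z"
      "\<forall>x. (\<exists>i<N. \<exists>z\<in>S i. dist x z <= real CARD('m)) -->
        (\<forall>y\<in>ball x 1. \<forall>y'\<in>ball x 1. qdist (h y) (h y') <= roughness Q Y N (vfloor x) * dist y y')"
      using main[of Y N] Y by blast
    have "qdist (h x) (Y (vfloor x)) <= roughness Q Y N (vfloor x)" for x
      using h(2) dist_vfloor[of x] by (simp add: dist_commute)
    moreover have "qdist (h y) (h y') <= roughness Q Y N (vfloor x) * dist y y'"
      if "y \<in> ball x 1" "y' \<in> ball x 1" for x y y'
    proof -
      have "vfloor x \<in> (\<Union>i<N. S i)" unfolding S(1) by simp
      then obtain i where "i < N" "vfloor x \<in> S i" by blast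
      then have "\<exists>i<N. \<exists>z\<in>S i. dist x z <= real CARD('m)" using dist_vfloor[of x] by (metis dist_commute)
      then show ?thesis using h(3) that by blast
    qed
    ultimately show "\<exists>H. extends_lattice Q Y (roughness Q Y N) H" using h(1) unfolding extends_lattice_def by blast
  qed
qed

section \<open>Differentials of locally Lipschitz maps\<close>

lemma lin_part_bound_locally_lipschitz:
  fixes f :: "real^'m => 'b::{real_normed_vector, second_countable_topology} multiset"
  assumes f: "f \<in> borel \<rightarrow>\<^sub>M qborel Q" and U: "open U" "a \<in> U" and \<A>: "approx_affine Q U f a (mset As)"
    and lip: "0 < \<delta>" "0 <= L" "\<And>y. dist y a < \<delta> ==> qdist (f y) (f a) <= L * dist y a"
    and k: "k < length As"
  shows "norm (lin_part (As ! k) (axis j 1)) <= L"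
proof -
  let ?e = "axis j (1::real) :: real^'m"
  have len: "length As = Q" and aff: "\<forall>A\<in>set As. affine_map A" using \<A> by (auto simp: approx_affine_def Qtuples_def)
  obtain Cs where Cs: "mset Cs = mset As" "\<And>\<e>. 0 < \<e> ==> density_zero {x \<in> U. \<e> * norm (x - a) < qdist (f x) (mset (map (\<lambda>A. A x) Cs))} a"
      "\<And>\<e>. {x \<in> U. \<e> * norm (x - a) < qdist (f x) (mset (map (\<lambda>A. A x) Cs))} \<in> sets borel"
    by (rule approx_affine_list[OF f U(1) \<A>]) blast
  have "mset (map (\<lambda>A. A x) Cs) = mset (map (\<lambda>A. A x) As)" for x using Cs(1) by simp
  note dens = Cs(2,3)[unfolded this]
  obtain ys where ys: "mset ys = f a" "length ys = Q" using size_imp_list[OF size_f[OF f U(1)]] by blast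
  obtain d where d: "0 < d" "ball a d \<subseteq> U" using U by (meson open_contains_ball)
  let ?i = "\<lambda>n. inverse (real (Suc n))"
  let ?S = "\<lambda>n. {x \<in> U. ?i n * norm (x - a) < qdist (f x) (mset (map (\<lambda>A. A x) As))}"
  obtain r v where rv: "\<And>n. 0 < r n" "\<And>n. a + r n *\<^sub>R v n \<notin> ?S n" "\<And>n. dist (a + r n *\<^sub>R v n) a < min d \<delta>"
    "r \<longlonglongrightarrow> 0" "v \<longlonglongrightarrow> ?e" by (rule density_zero_good_sequence[of ?S a "min d \<delta>" ?e]) (use dens d(1) lip(1) that in auto)
  \<comment> \<open>The constant tuple \<open>f a\<close>, regarded as affine maps with linear part
    0. Along the direction \<open>axis j 1\<close> the Lipschitz bound and approximate
    differentiability keep the affine tuple within \<open>(L + o(1)) * r n\<close> of it, so its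
    slopes in that direction are at most \<open>L\<close>.\<close>
  define Bs where "Bs = map (\<lambda>y (x :: real^'m). y) ys"
  have close: "qdist (mset (map (\<lambda>A. A (a + r n *\<^sub>R v n)) As)) (mset (map (\<lambda>A. A (a + r n *\<^sub>R v n)) Bs))
      <= ((?i n + L) * norm (v n)) * r n" for n
  proof -
    let ?x = "a + r n *\<^sub>R v n"
    let ?F = "mset (map (\<lambda>A. A ?x) As)"
    have "?x \<in> U" using d(2) rv(3)[of n] by (auto simp: dist_commute)
    then have "qdist (f ?x) ?F <= ?i n * (r n * norm (v n))" using rv(1,2)[of n] by (auto simp: not_less)
    moreover have "qdist (f ?x) (f a) <= L * (r n * norm (v n))"
      using lip(3)[of ?x] rv(1)[of n] rv(3)[of n] by (simp add: dist_norm)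
    moreover have "qdist ?F (f a) <= qdist (f ?x) ?F + qdist (f ?x) (f a)"
      by (subst (2) qdist_commute, rule qdist_triangle[where Q=Q]) (auto simp: len size_f[OF f U(1)])
    moreover have "map (\<lambda>A. A ?x) Bs = ys" by (simp add: Bs_def comp_def)
    ultimately show ?thesis by (simp add: ys(1) algebra_simps)
  qed
  have c: "(\<lambda>n. (?i n + L) * norm (v n)) \<longlonglongrightarrow> (0 + L) * norm ?e" by (intro tendsto_intros LIMSEQ_inverse_real_of_nat rv(5))
  have "length Bs = Q" "\<forall>A\<in>set As \<union> set Bs. affine_map A" using aff ys(2) by (auto simp: Bs_def affine_map_def module_hom_zero)
  from affine_tuples_first_order[OF len this rv(1,4,5) c close]
  obtain \<sigma> where \<sigma>: "\<sigma> permutes {..<Q}" "\<And>i. i < Q ==> (As ! i) a = (Bs ! \<sigma> i) a \<and>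
      norm (lin_part (As ! i) ?e - lin_part (Bs ! \<sigma> i) ?e) <= (0 + L) * norm ?e" by metis
  have "lin_part (Bs ! \<sigma> k) ?e = 0"
    using permutes_in_image[OF \<sigma>(1), of k] k len ys(2) by (simp add: Bs_def lin_part_def)
  then show ?thesis using \<sigma>(2)[of k] k len by simp
qed

lemma norm_Df_locally_lipschitz:
  fixes f :: "real^'m => 'b::{real_normed_vector, second_countable_topology} multiset"
  assumes f: "f \<in> borel \<rightarrow>\<^sub>M qborel Q" and U: "open U" "a \<in> U" and \<A>: "approx_affine Q U f a \<A>"
    and lip: "0 < \<delta>" "0 <= L" "\<And>y. dist y a < \<delta> ==> qdist (f y) (f a) <= L * dist y a"
  shows "norm_Df Q U f a <= sqrt (real Q * real CARD('m)) * L"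
proof -
  obtain As where As: "mset As = \<A>" by (metis ex_mset)
  then have A: "approx_affine Q U f a (mset As)" using \<A> by simp
  then have len: "length As = Q" by (auto simp: approx_affine_def Qtuples_def)
  have "norm_Df Q U f a <= sqrt (\<Sum>i<length As. \<Sum>j\<in>(UNIV :: 'm set). L\<^sup>2)" unfolding norm_Df_eq[OF f U A]
    by (intro real_sqrt_le_mono sum_mono power_mono lin_part_bound_locally_lipschitz[OF f U A lip]) auto
  also have "... = sqrt (real Q * real CARD('m)) * L" using lip(2) by (simp add: len real_sqrt_mult)
  finally show ?thesis .
qed

lemma lipschitz_from_local:
  fixes h :: "real^'m => 'b::real_normed_vector multiset"
  assumes size: "\<And>x. size (h x) = Q" and \<delta>: "0 < \<delta>"
    and loc: "\<And>x y. dist x y < \<delta> ==> qdist (h x) (h y) <= C * dist x y"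
  shows "qdist (h x) (h y) <= C * dist x y"
proof -
  define N where "N = nat \<lceil>dist x y / \<delta>\<rceil> + 1"
  define u where "u = (y - x) /\<^sub>R real N"
  have N: "0 < real N" by (simp add: N_def)
  have "dist x y / \<delta> < real N" unfolding N_def by linarith
  then have "dist x y / real N < \<delta>" using N \<delta> by (simp add: field_simps)
  then have u: "norm u < \<delta>" by (simp add: u_def dist_norm norm_minus_commute divide_inverse mult.commute)
  have y: "y = x + real N *\<^sub>R u" using N by (simp add: u_def)
  have "qdist (h x) (h y) <= (\<Sum>i<N. qdist (h (x + real i *\<^sub>R u)) (h (x + real (Suc i) *\<^sub>R u)))"
    unfolding y by (rule dist_chain_le[where d="\<lambda>x y. qdist (h x) (h y)"]) (auto intro: qdist_triangle size)
  also have "... <= (\<Sum>i<N. C * norm u)"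
  proof (rule sum_mono)
    fix i
    have "dist (x + real i *\<^sub>R u) (x + real (Suc i) *\<^sub>R u) = norm u" by (simp add: dist_norm algebra_simps)
    then show "qdist (h (x + real i *\<^sub>R u)) (h (x + real (Suc i) *\<^sub>R u)) <= C * norm u"
      using loc[of "x + real i *\<^sub>R u" "x + real (Suc i) *\<^sub>R u"] u by simp
  qed
  also have "... = C * dist x y" unfolding y by (simp add: dist_norm)
  finally show ?thesis .
qed

section \<open>Sums of the roughness over the lattice\<close>

lemma roughness_bounded:
  fixes Y :: "real^'m => 'b::real_normed_vector multiset"
  assumes "finite (range Y)"
  shows "\<exists>B. \<forall>z\<in>lattice. roughness Q Y k z <= B"
proof (induction k)
  case 0
  have "finite ((\<lambda>(a, b). qdist a b) ` (range Y \<times> range Y))" using assms by simp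
  then have "bdd_above ((\<lambda>(a, b). qdist a b) ` (range Y \<times> range Y))" by (rule bdd_above_finite)
  then obtain B where "\<And>w z. qdist (Y w) (Y z) <= B" by (auto simp: bdd_above_def)
  then have "roughness Q Y 0 z <= real (card (near z)) * B" for z by (simp add: sum_bounded_above)
  then show ?case by (metis card_near)
next
  case (Suc k)
  then obtain B where B: "\<And>z. z \<in> lattice ==> roughness Q Y k z <= B" by blast
  have "roughness Q Y (Suc k) z <= B + blend_const Q * (real (card (near (0 :: real^'m))) * B)" if z: "z \<in> lattice" for z
  proof -
    have "(\<Sum>w\<in>near z. roughness Q Y k w) <= real (card (near z)) * B"
      using B by (intro sum_bounded_above) (auto simp: near_def)
    then show ?thesis using B[OF z] card_near[OF z] by (auto intro!: add_mono mult_left_mono)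
  qed
  then show ?case by blast
qed

text \<open>Nearness is symmetric on the lattice, so each \<open>w\<close> is counted for at most as
  many \<open>z\<close> as there are points near \<open>w\<close>.\<close>

lemma near_sum_le:
  fixes a :: "real^'m => real"
  assumes F: "finite F" "F \<subseteq> lattice" and G: "finite G" "\<And>z. z \<in> F ==> near z \<subseteq> G" and a: "\<And>z. 0 <= a z"
  shows "(\<Sum>z\<in>F. \<Sum>w\<in>near z. a w) <= real (card (near (0 :: real^'m))) * (\<Sum>w\<in>G. a w)"
proof -
  have "(\<Sum>z\<in>F. \<Sum>w\<in>near z. a w) = (\<Sum>z\<in>F. \<Sum>w\<in>G. if w \<in> near z then a w else 0)"
    using G by (intro sum.cong sum.mono_neutral_cong_left refl) auto
  also have "... = (\<Sum>w\<in>G. \<Sum>z\<in>F. if w \<in> near z then a w else 0)" by (rule sum.swap)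
  also have "... <= (\<Sum>w\<in>G. real (card (near (0 :: real^'m))) * a w)"
  proof (rule sum_mono)
    fix w
    have "(\<Sum>z\<in>F. if w \<in> near z then a w else 0) = real (card {z \<in> F. w \<in> near z}) * a w"
      using F(1) by (simp add: sum.If_cases Int_def)
    also have "... <= real (card (near (0 :: real^'m))) * a w"
    proof (cases "w \<in> lattice")
      case True
      have "{z \<in> F. w \<in> near z} \<subseteq> near w" using F(2) by (auto simp: near_def dist_commute)
      then have "card {z \<in> F. w \<in> near z} <= card (near w)" by (rule card_mono[OF finite_near])
      then show ?thesis using card_near[OF True] a by (intro mult_right_mono) auto
    next
      case False
      then have "{z \<in> F. w \<in> near z} = {}" by (auto simp: near_def)
      then show ?thesis using a by (simp only:) simp
    qed
    finally show "(\<Sum>z\<in>F. if w \<in> near z then a w else 0) <= real (card (near (0 :: real^'m))) * a w" .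
  qed
  also have "... = real (card (near (0 :: real^'m))) * (\<Sum>w\<in>G. a w)" by (simp add: sum_distrib_left)
  finally show ?thesis .
qed

lemma powr_sum_le_finite:
  assumes "finite A" "1 <= p" "\<And>i. 0 <= a i"
  shows "(\<Sum>i\<in>A. a i :: real) powr p <= real (card A) powr (p - 1) * (\<Sum>i\<in>A. a i powr p)"
proof -
  obtain b where b: "bij_betw b {..<card A} A"
    using ex_bij_betw_nat_finite[OF assms(1)] by (auto simp: atLeast0LessThan)
  show ?thesis using powr_sum_le[OF assms(2), of "a \<circ> b" "card A"] assms(3)
    by (simp add: sum.reindex_bij_betw[OF b, symmetric])
qed

text \<open>One constant serves all \<open>Y\<close> and \<open>r\<close>; each level of the
  recursion enlarges the region of summation by the radius of \<open>near\<close>.\<close>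

lemma roughness_powr_sum:
  assumes p: "1 <= p"
  shows "\<exists>C\<ge>0. \<forall>(Y :: real^'m => 'b::real_normed_vector multiset) r.
    (\<Sum>z | z \<in> lattice \<and> norm z <= r. roughness Q Y k z powr p)
      <= C * (\<Sum>z | z \<in> lattice \<and> norm z <= r + real k * (3 * real CARD('m) + 6). \<Sum>w\<in>near z. qdist (Y w) (Y z) powr p)"
proof (induction k)
  case 0
  let ?n = "real (card (near (0 :: real^'m)))"
  have "roughness Q Y 0 z powr p <= ?n powr (p - 1) * (\<Sum>w\<in>near z. qdist (Y w) (Y z) powr p)"
    if "z \<in> lattice" for Y :: "real^'m => 'b multiset" and z
    using powr_sum_le_finite[OF finite_near p, of "\<lambda>w. qdist (Y w) (Y z)" z] card_near[OF that] by (simp add: qdist_nonneg)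
  then show ?case
    by (intro exI[of _ "?n powr (p - 1)"]) (auto simp: sum_distrib_left intro!: sum_mono simp del: roughness.simps)
next
  case (Suc k)
  let ?n = "real (card (near (0 :: real^'m)))" and ?R = "3 * real CARD('m) + 6"
  obtain C where C: "0 <= C" "\<And>(Y :: real^'m => 'b multiset) r. (\<Sum>z | z \<in> lattice \<and> norm z <= r. roughness Q Y k z powr p)
      <= C * (\<Sum>z | z \<in> lattice \<and> norm z <= r + real k * ?R. \<Sum>w\<in>near z. qdist (Y w) (Y z) powr p)" using Suc by blast
  have fin: "finite {z :: real^'m. z \<in> lattice \<and> norm z <= r}" for r using finite_lattice_bounded[of 0 r] by simp
  define D where "D = 2 powr p * (1 + blend_const Q powr p * ?n powr (p - 1) * ?n)"
  have D: "0 <= D" by (simp add: D_def)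
  have "(\<Sum>z | z \<in> lattice \<and> norm z <= r. roughness Q Y (Suc k) z powr p)
      <= D * C * (\<Sum>z | z \<in> lattice \<and> norm z <= r + real (Suc k) * ?R. \<Sum>w\<in>near z. qdist (Y w) (Y z) powr p)"
    for Y :: "real^'m => 'b multiset" and r
  proof -
    let ?F = "{z :: real^'m. z \<in> lattice \<and> norm z <= r}" and ?G = "{z :: real^'m. z \<in> lattice \<and> norm z <= r + ?R}"
    define a where "a z = roughness Q Y k z powr p" for z
    have one: "roughness Q Y (Suc k) z powr p <= 2 powr p * (a z + blend_const Q powr p * ?n powr (p - 1) * (\<Sum>w\<in>near z. a w))"
      if z: "z \<in> ?F" for z
    proof -
      have "roughness Q Y (Suc k) z powr p <= 2 powr p * (a z + (blend_const Q * (\<Sum>w\<in>near z. roughness Q Y k w)) powr p)"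
        unfolding roughness.simps a_def using p
        by (intro powr_add_le) (auto intro!: mult_nonneg_nonneg sum_nonneg roughness_nonneg)
      also have "(blend_const Q * (\<Sum>w\<in>near z. roughness Q Y k w)) powr p
          = blend_const Q powr p * (\<Sum>w\<in>near z. roughness Q Y k w) powr p" by (rule powr_mult)
      also have "(\<Sum>w\<in>near z. roughness Q Y k w) powr p <= ?n powr (p - 1) * (\<Sum>w\<in>near z. a w)"
        using powr_sum_le_finite[OF finite_near p, of "roughness Q Y k" z] card_near[of z] z
        by (simp add: roughness_nonneg a_def)
      finally show ?thesis by (simp add: mult_left_mono mult.assoc)
    qed
    have "(\<Sum>z\<in>?F. roughness Q Y (Suc k) z powr p)
        <= (\<Sum>z\<in>?F. 2 powr p * (a z + blend_const Q powr p * ?n powr (p - 1) * (\<Sum>w\<in>near z. a w)))"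
      by (rule sum_mono) (rule one)
    also have "... = 2 powr p * ((\<Sum>z\<in>?F. a z) + blend_const Q powr p * ?n powr (p - 1) * (\<Sum>z\<in>?F. \<Sum>w\<in>near z. a w))"
      by (simp only: sum.distrib sum_distrib_left[symmetric])
    also have "... <= 2 powr p * ((\<Sum>z\<in>?G. a z) + blend_const Q powr p * ?n powr (p - 1) * (?n * (\<Sum>z\<in>?G. a z)))"
    proof (intro mult_left_mono add_mono near_sum_le)
      show "(\<Sum>z\<in>?F. a z) <= (\<Sum>z\<in>?G. a z)" by (rule sum_mono2) (use fin in \<open>auto simp: a_def\<close>)
      show "near z \<subseteq> ?G" if "z \<in> ?F" for z
      proof
        fix w assume "w \<in> near z"
        then show "w \<in> ?G" using that norm_triangle_ineq[of "w - z" z] by (auto simp: near_def dist_norm)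
      qed
    qed (use fin in \<open>auto simp: a_def\<close>)
    also have "... = D * (\<Sum>z\<in>?G. a z)" by (simp add: D_def algebra_simps)
    also have "... <= D * (C * (\<Sum>z | z \<in> lattice \<and> norm z <= (r + ?R) + real k * ?R. \<Sum>w\<in>near z. qdist (Y w) (Y z) powr p))"
      unfolding a_def by (intro mult_left_mono C(2) D)
    finally show ?thesis by (simp add: algebra_simps)
  qed
  then show ?case using C(1) D by (intro exI[of _ "D * C"]) auto
qed

section \<open>Sampling at average points\<close>

lemma nn_integral_attains_average:
  fixes h :: "'a => ennreal"
  assumes [measurable]: "h \<in> borel_measurable M" "A \<in> sets M" and A: "0 < emeasure M A" "emeasure M A < \<infinity>"
  obtains x where "x \<in> A" "h x * emeasure M A <= (\<integral>\<^sup>+x\<in>A. h x \<partial>M)"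
proof (rule ccontr)
  let ?I = "\<integral>\<^sup>+x\<in>A. h x \<partial>M"
  assume no: "\<not> thesis"
  note res = that
  have gt: "?I < h x * emeasure M A" if "x \<in> A" for x using res[OF that] no by (meson not_le)
  define c where "c = ?I / emeasure M A"
  have A_ne: "A \<noteq> {}" using A by auto
  then have fin: "?I < \<infinity>" using gt by (metis equals0I infinity_ennreal_def top.not_eq_extremum order_less_imp_not_less not_less_iff_gr_or_eq top_greatest leD)
  have c: "c * emeasure M A = ?I" unfolding c_def using A by (simp add: ennreal_divide_times ennreal_divide_self)
  have less: "c < h x" if "x \<in> A" for x
    using gt[OF that] unfolding c[symmetric] by (metis leD leI mult_right_mono zero_le)
  have I_c: "(\<integral>\<^sup>+x\<in>A. c \<partial>M) = ?I" using c by (simp add: nn_integral_cmult)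
  have "(\<integral>\<^sup>+x\<in>A. c \<partial>M) < ?I"
  proof (rule nn_integral_less)
    show "(\<integral>\<^sup>+x\<in>A. c \<partial>M) \<noteq> \<infinity>" using I_c fin by simp
    show "AE x in M. c * indicator A x <= h x * indicator A x"
      using less by (auto simp: indicator_def intro: less_imp_le)
    show "\<not> (AE x in M. h x * indicator A x <= c * indicator A x)"
    proof
      assume "AE x in M. h x * indicator A x <= c * indicator A x"
      then have "AE x in M. x \<notin> A"
        by eventually_elim (use less in \<open>auto simp: indicator_def not_le split: if_splits dest: leD\<close>)
      then have "emeasure M A = 0" using sets.sets_into_space[OF \<open>A \<in> sets M\<close>] by (subst (asm) AE_iff_measurable[OF \<open>A \<in> sets M\<close>]) auto
      then show False using A by simp
    qed
  qed auto
  then show False using I_c by simp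
qed

text \<open>Connect \<open>x\<close> with \<open>y0\<close> through a variable point
  \<open>y\<close> of \<open>B\<close> and average over \<open>y\<close>. A point that is average
  for the distances within \<open>B\<close> thus also represents any comparable set \<open>A\<close>
  in \<open>V\<close>.\<close>

lemma one_point_estimate:
  fixes f :: "'a::euclidean_space => 'b::{real_normed_vector, second_countable_topology} multiset"
  defines "g \<equiv> \<lambda>p x y. qcost p (f x) (f y)"
  assumes f [measurable]: "f \<in> borel \<rightarrow>\<^sub>M qborel Q"
    and [measurable]: "A \<in> sets borel" "B \<in> sets borel" "V \<in> sets borel" and V: "A \<subseteq> V" "B \<subseteq> V"
    and B: "leb B = ennreal b" "0 < b" and A: "leb A <= ennreal (K * b)" "0 <= K" and p: "0 <= p"
    and y0: "(\<integral>\<^sup>+y\<in>B. g p y0 y \<partial>lborel) * ennreal b <= (\<integral>\<^sup>+x\<in>V. (\<integral>\<^sup>+y\<in>V. g p x y \<partial>lborel) \<partial>lborel)"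
  shows "(\<integral>\<^sup>+x\<in>A. g p x y0 \<partial>lborel) * ennreal b
    <= ennreal (2 powr p * (1 + K)) * (\<integral>\<^sup>+x\<in>V. (\<integral>\<^sup>+y\<in>V. g p x y \<partial>lborel) \<partial>lborel)"
proof -
  let ?P = "\<integral>\<^sup>+x\<in>V. (\<integral>\<^sup>+y\<in>V. g p x y \<partial>lborel) \<partial>lborel" and ?J = "\<integral>\<^sup>+y\<in>B. g p y0 y \<partial>lborel"
  have size_f: "size (f x) = Q" for x using measurable_space[OF f, of x] by simp
  have [measurable]: "case_prod (g p) \<in> borel_measurable (borel \<Otimes>\<^sub>M borel)" "g p y0 \<in> borel_measurable borel"
    "(\<lambda>x. g p x y0) \<in> borel_measurable borel" unfolding g_def by measurable
  have tri: "g p x y0 <= ennreal (2 powr p) * (g p x y + g p y0 y)" for x y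
    using qdist_powr_triangle[OF size_f[of x] size_f[of y] size_f[of y0] p] by (simp add: g_def qdist_commute)
  have inner: "(\<integral>\<^sup>+y\<in>B. g p x y0 \<partial>lborel) = g p x y0 * ennreal b" for x
    by (subst nn_integral_cmult_indicator) (auto simp: B(1))
  have "(\<integral>\<^sup>+x\<in>A. g p x y0 \<partial>lborel) * ennreal b = (\<integral>\<^sup>+x\<in>A. (\<integral>\<^sup>+y\<in>B. g p x y0 \<partial>lborel) \<partial>lborel)"
    unfolding inner by (subst nn_integral_multc[symmetric]) (auto simp: mult_ac)
  also have "... <= (\<integral>\<^sup>+x. ennreal (2 powr p) * ((\<integral>\<^sup>+y\<in>B. g p x y \<partial>lborel) * indicator A x + ?J * indicator A x))"
  proof (rule nn_integral_mono, goal_cases)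
    case (1 x)
    have "(\<integral>\<^sup>+y\<in>B. g p x y0 \<partial>lborel) <= (\<integral>\<^sup>+y. ennreal (2 powr p) * (g p x y * indicator B y + g p y0 y * indicator B y))"
      using tri by (intro nn_integral_mono) (auto simp: indicator_def)
    also have "... = ennreal (2 powr p) * ((\<integral>\<^sup>+y\<in>B. g p x y \<partial>lborel) + ?J)"
      by (subst nn_integral_cmult, measurable) (subst nn_integral_add, auto)
    finally show ?case by (auto simp: indicator_def)
  qed
  also have "... = ennreal (2 powr p) * ((\<integral>\<^sup>+x\<in>A. (\<integral>\<^sup>+y\<in>B. g p x y \<partial>lborel) \<partial>lborel) + ?J * leb A)"
    by (subst nn_integral_cmult, measurable) (subst nn_integral_add, auto simp: nn_integral_cmult)
  also have "... <= ennreal (2 powr p) * (?P + ennreal K * ?P)"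
  proof (intro mult_left_mono add_mono)
    show "(\<integral>\<^sup>+x\<in>A. (\<integral>\<^sup>+y\<in>B. g p x y \<partial>lborel) \<partial>lborel) <= ?P"
      using V by (intro nn_integral_mono mult_mono) (auto simp: indicator_def)
    have "?J * leb A <= ?J * (ennreal K * ennreal b)" using A B(2) by (intro mult_left_mono) (auto simp: ennreal_mult)
    also have "... = ennreal K * (?J * ennreal b)" by (simp add: mult_ac)
    also have "... <= ennreal K * ?P" by (intro mult_left_mono y0) auto
    finally show "?J * leb A <= ennreal K * ?P" .
  qed auto
  also have "... = ennreal (2 powr p * (1 + K)) * ?P" using A(2) by (simp add: ennreal_mult distrib_right mult.assoc)
  finally show ?thesis .
qed

lemma measurable_vfloor [measurable]: "(\<lambda>x. vfloor (x /\<^sub>R \<e>)) \<in> borel_measurable borel"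
proof (subst borel_measurable_euclidean_space, rule ballI)
  fix i :: "real^'m" assume "i \<in> Basis"
  then obtain j where i: "i = axis j 1" by (auto simp: Basis_vec_def)
  have [measurable]: "(\<lambda>x :: real^'m. x $ j) \<in> borel_measurable borel"
    by (intro borel_measurable_continuous_onI continuous_intros)
  show "(\<lambda>x :: real^'m. vfloor (x /\<^sub>R \<e>) \<bullet> i) \<in> borel_measurable borel" unfolding i by (simp add: inner_axis vfloor_def)
qed

lemma countable_lattice: "countable (lattice :: (real^'m) set)"
proof -
  have "(lattice :: (real^'m) set) \<subseteq> (\<Union>n::nat. {w \<in> lattice. dist w 0 <= real n})"
  proof
    fix w :: "real^'m" assume "w \<in> lattice"
    moreover obtain n :: nat where "dist w 0 <= real n" using real_arch_simple by blast
    ultimately show "w \<in> (\<Union>n::nat. {w \<in> lattice. dist w 0 <= real n})" by blast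
  qed
  moreover have "countable (\<Union>n::nat. {w \<in> lattice. dist w (0 :: real^'m) <= real n})"
    by (rule countable_UN, rule countableI_type, rule countable_finite, rule finite_lattice_bounded)
  ultimately show ?thesis by (rule countable_subset)
qed

lemma step_function_measurable:
  fixes Y :: "real^'m => 'b::real_normed_vector multiset"
  assumes "\<And>z. size (Y z) = Q"
  shows "(\<lambda>x. Y (vfloor (x /\<^sub>R \<e>))) \<in> borel \<rightarrow>\<^sub>M qborel Q"
proof (rule measurable_compose_countable'[where I=lattice])
  show "(\<lambda>x :: real^'m. Y z) \<in> borel \<rightarrow>\<^sub>M qborel Q" for z using assms by (intro measurable_const) simp
  show "(\<lambda>x :: real^'m. vfloor (x /\<^sub>R \<e>)) \<in> borel \<rightarrow>\<^sub>M count_space lattice"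
    by (subst measurable_count_space_eq_countable[OF countable_lattice]) (auto intro!: measurable_sets_borel[OF measurable_vfloor])
qed (rule countable_lattice)

text \<open>Bounds the overlap of the balls used for sampling, uniformly in the mesh
  \<open>c\<close> and in the contraction factor \<open>s\<close>.\<close>

lemma card_lattice_near_point:
  fixes x :: "real^'m"
  assumes c: "0 < c" "1/2 <= s" and r: "0 < r"
  shows "card {z \<in> lattice. dist x ((s * c) *\<^sub>R z) < r * c} <= card {w \<in> lattice. dist w (0 :: real^'m) <= 2 * r + real CARD('m)}"
proof (rule card_inj_on_le)
  define z0 where "z0 = vfloor (x /\<^sub>R (s * c))"
  show "inj_on (\<lambda>z. z - z0) {z \<in> lattice. dist x ((s * c) *\<^sub>R z) < r * c}" by (simp add: inj_on_def)
  show "(\<lambda>z. z - z0) ` {z \<in> lattice. dist x ((s * c) *\<^sub>R z) < r * c} \<subseteq> {w \<in> lattice. dist w 0 <= 2 * r + real CARD('m)}"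
  proof clarsimp
    fix z :: "real^'m" assume z: "z \<in> lattice" "dist x ((s * c) *\<^sub>R z) < r * c"
    have sc: "0 < s * c" and k: "s * c * (inverse s * inverse c) = 1" using c by (auto simp: field_simps)
    have "x - (s * c) *\<^sub>R z = (s * c) *\<^sub>R (x /\<^sub>R (s * c) - z)" by (simp add: scaleR_diff_right k)
    then have "s * c * dist (x /\<^sub>R (s * c)) z < r * c" using z(2) sc by (simp add: dist_norm)
    then have "s * dist (x /\<^sub>R (s * c)) z < r" using c(1) by (simp add: mult.assoc mult.commute mult_less_cancel_left)
    moreover have "1/2 * dist (x /\<^sub>R (s * c)) z <= s * dist (x /\<^sub>R (s * c)) z" using c(2) by (intro mult_right_mono) auto
    ultimately have "dist (x /\<^sub>R (s * c)) z <= 2 * r" by linarith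
    then have "norm (z - z0) <= 2 * r + real CARD('m)"
      using dist_triangle[of z z0 "x /\<^sub>R (s * c)"] dist_vfloor[of "x /\<^sub>R (s * c)"]
      by (simp add: z0_def dist_norm[symmetric] dist_commute)
    then show "z - z0 \<in> lattice \<and> norm (z - z0) <= 2 * r + real CARD('m)" using z(1) by (simp add: lattice_diff z0_def)
  qed
  show "finite {w \<in> lattice. dist w (0 :: real^'m) <= 2 * r + real CARD('m)}" by (rule finite_lattice_bounded)
qed

lemma close_pairs_measurable [measurable]:
  "{(x, y). x \<in> unit_disk \<and> y \<in> unit_disk \<and> dist x y < r} \<in> sets (borel \<Otimes>\<^sub>M (borel :: 'a::euclidean_space measure))"
proof -
  have "{(x, y). x \<in> unit_disk \<and> y \<in> unit_disk \<and> dist x y < r}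
      = {z :: 'a \<times> 'a. dist 0 (fst z) < 1 \<and> dist 0 (snd z) < 1 \<and> dist (fst z) (snd z) < r}" by auto
  then show ?thesis unfolding borel_prod
    by (simp only:) (intro borel_open open_Collect_conj open_Collect_less continuous_intros)
qed

lemma norm_vfloor_unit_disk:
  fixes x :: "real^'m"
  assumes "x \<in> unit_disk" "0 < \<e>"
  shows "norm (vfloor (x /\<^sub>R \<e>)) <= 1 / \<e> + real CARD('m)"
proof -
  have "norm (vfloor (x /\<^sub>R \<e>)) <= norm (x /\<^sub>R \<e>) + real CARD('m)"
    using dist_vfloor[of "x /\<^sub>R \<e>"] norm_triangle_ineq[of "vfloor (x /\<^sub>R \<e>) - x /\<^sub>R \<e>" "x /\<^sub>R \<e>"] by (simp add: dist_norm)
  moreover have "norm (x /\<^sub>R \<e>) <= 1 / \<e>" using assms by (simp add: field_simps)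
  ultimately show ?thesis by linarith
qed

text \<open>Substitute \<open>y = x + v\<close> and exchange the integrals; the translation bound is
  then integrated over the ball of admissible \<open>v\<close>.\<close>

lemma transl_bound_double_integral:
  fixes f :: "'a::euclidean_space => 'b::{real_normed_vector, second_countable_topology} multiset"
  assumes f [measurable]: "f \<in> borel \<rightarrow>\<^sub>M qborel Q" and T: "transl_bound p f M" and p: "0 <= p" and M: "0 <= M" and r: "0 <= r"
  shows "(\<integral>\<^sup>+x. (\<integral>\<^sup>+y. qcost p (f x) (f y) * indicator {(x, y). x \<in> unit_disk \<and> y \<in> unit_disk \<and> dist x y < r} (x, y)))
    <= ennreal (M * r powr p) * leb (ball (0 :: 'a) r)"
proof -
  define G where "G x y = qcost p (f x) (f y) * indicator {(x, y). x \<in> unit_disk \<and> y \<in> unit_disk \<and> dist x y < r} (x, y)" for x y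
  have [measurable]: "case_prod G \<in> borel_measurable (borel \<Otimes>\<^sub>M borel)" unfolding G_def by measurable
  have "(\<integral>\<^sup>+x. (\<integral>\<^sup>+y. G x y)) = (\<integral>\<^sup>+x. (\<integral>\<^sup>+v. G x (v + x)))" by (subst nn_integral_translate) auto
  also have "... = (\<integral>\<^sup>+v. (\<integral>\<^sup>+x. G x (v + x)))" by (rule lborel_pair.Fubini'[symmetric]) measurable
  also have "... <= (\<integral>\<^sup>+v. ennreal (M * r powr p) * indicator (ball (0 :: 'a) r) v)"
  proof (rule nn_integral_mono)
    fix v :: 'a
    show "(\<integral>\<^sup>+x. G x (v + x)) <= ennreal (M * r powr p) * indicator (ball 0 r) v"
    proof (cases "v \<in> ball 0 r")
      case True
      have "(\<integral>\<^sup>+x. G x (v + x)) = (\<integral>\<^sup>+x. qcost p (f x) (f (x + v))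
          * indicator {x. x \<in> unit_disk \<and> x + v \<in> unit_disk} x)"
        using True norm_minus_cancel[of "_ + v"] by (intro nn_integral_cong) (auto simp: G_def indicator_def dist_norm add.commute)
      also have "... <= ennreal (M * norm v powr p)" using T unfolding transl_bound_def by blast
      also have "... <= ennreal (M * r powr p)" using True M p by (intro ennreal_leI mult_left_mono powr_mono2) auto
      finally show ?thesis using True by simp
    next
      case False
      then have "G x (v + x) = 0" for x by (auto simp: G_def indicator_def dist_norm)
      then show ?thesis by simp
    qed
  qed
  also have "... = ennreal (M * r powr p) * leb (ball (0 :: 'a) r)" by (simp add: nn_integral_cmult)
  finally show ?thesis unfolding G_def .
qed

text \<open>The normalisation: there are about \<open>1 / \<e> ^ CARD('m)\<close> cells, and
  neighbouring samples differ by order \<open>\<e>\<close> in the mean. The margin \<open>D\<close>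
  reaches beyond the cells that meet the unit ball, because the roughness involves neighbours of
  neighbours.\<close>

definition discretizes :: "real => real => real => (real^'m => 'b::real_normed_vector multiset) => real => (real^'m => 'b multiset) => bool" where
  "discretizes p D K f \<e> Y \<longleftrightarrow> (\<forall>z. Y z \<in> f ` unit_disk) \<and> finite (range Y) \<and>
     Lp_dist p f (\<lambda>x. Y (vfloor (x /\<^sub>R \<e>))) <= ennreal (K * \<e> powr p) \<and>
     (\<Sum>z | z \<in> lattice \<and> norm z <= 1 / \<e> + D. \<Sum>w\<in>near z. qdist (Y w) (Y z) powr p) <= K * \<e> powr p / \<e> ^ CARD('m)"

text \<open>The value at a lattice point \<open>z\<close> is a value of \<open>f\<close> at an average point of the ball of radius
  \<open>\<e>\<close> around \<open>s \<e> z\<close>; the factor \<open>s < 1\<close> keeps these balls inside the unit ball.\<close>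

lemma discretization:
  fixes p D :: real
  assumes p: "1 <= p" and D: "real CARD('m) <= D"
  obtains C \<e>0 where "0 <= C" "0 < \<e>0"
    "\<And>(f :: real^'m => 'b::{real_normed_vector, second_countable_topology} multiset) M \<e>.
      f \<in> borel \<rightarrow>\<^sub>M qborel Q ==> transl_bound p f M ==> 0 <= M ==> 0 < \<e> ==> \<e> <= \<e>0 ==>
      \<exists>Y. discretizes p D (C * M) f \<e> Y"
proof -
  define m where "m = real CARD('m)"
  define \<beta> where "\<beta> = unit_ball_vol m"
  have \<beta>: "0 < \<beta>" by (simp add: \<beta>_def m_def unit_ball_vol_pos)
  have m: "1 <= m" by (simp add: m_def Suc_leI)
  define R where "R = 3 * m + 6"
  \<comment> \<open>Samples are needed at neighbours, too, whence the additional margin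
    \<open>R\<close>; the factor \<open>s\<close> below is adapted to lattice points of norm up to
    \<open>1 / \<e> + D'\<close>.\<close>
  define D' where "D' = D + R"
  \<comment> \<open>So large that the ball of radius \<open>C2 * \<e>\<close> about a contracted
    lattice point contains its cell in the disk and the sampling balls of its neighbours.\<close>
  define C2 where "C2 = m + 2 * D' + 2"
  define \<e>0 where "\<e>0 = 1 / (2 * (D' + 1))"
  define N2 where "N2 = real (card {w \<in> lattice. dist w (0 :: real^'m) <= 2 * C2 + m})"
  define N0 where "N0 = real (card (near (0 :: real^'m)))"
  define W where "W = N2 * ((2 * C2) powr p * (2 * C2) ^ CARD('m))"
  define K1 where "K1 = 2 powr p * (1 + C2 ^ CARD('m))"
  define K2 where "K2 = 2 powr p * (1 + 2 powr p * (1 + 1))"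
  define C where "C = K1 * W + N0 * K2 * W / \<beta>"
  have pos: "0 < R" "0 < D'" "R <= D'" "m <= D'" "1 <= C2" "R + 1 <= C2" "0 < \<e>0" "0 <= N2" "0 <= N0"
    using m D by (auto simp: R_def D'_def C2_def \<e>0_def N2_def N0_def m_def)
  have nonneg: "0 <= W" "0 <= K1" "0 <= K2" using pos by (auto simp: W_def K1_def K2_def)
  then have C0: "0 <= C" using pos \<beta> by (simp add: C_def)
  have main: "\<exists>Y. discretizes p D (C * M) f \<e> Y"
    if f [measurable]: "f \<in> borel \<rightarrow>\<^sub>M qborel Q" and T: "transl_bound p f M" and M: "0 <= M" and \<e>: "0 < \<e>" "\<e> <= \<e>0"
    for f :: "real^'m => 'b multiset" and M \<e>
  proof -
    have size_f: "size (f x) = Q" for x using measurable_space[OF f, of x] by simp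
    define G where "G x y = qcost p (f x) (f y)" for x y
    have [measurable]: "case_prod G \<in> borel_measurable (borel \<Otimes>\<^sub>M borel)" "\<And>x. G x \<in> borel_measurable borel"
      unfolding G_def by measurable
    have G_sym: "G x y = G y x" for x y by (simp add: G_def qdist_commute)
    define b where "b = \<beta> * \<e> ^ CARD('m)"
    have b: "0 < b" using \<beta> \<e> by (simp add: b_def)
    have ball_b: "leb (ball x (r * \<e>)) = ennreal (r ^ CARD('m) * b)" if "0 <= r" for r and x :: "real^'m"
      using \<e> that by (simp add: emeasure_ball b_def \<beta>_def m_def power_mult_distrib mult_ac)
    define s where "s = 1 - (D' + 1) * \<e>"
    have "(D' + 1) * \<e> <= (D' + 1) * \<e>0" using \<e> pos by (intro mult_left_mono) auto
    also have "... = 1/2" using pos by (simp add: \<e>0_def field_simps)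
    finally have De: "(D' + 1) * \<e> <= 1/2" .
    then have s: "1/2 <= s" "s <= 1" using \<e> pos by (auto simp: s_def)
    define Z where "Z = {z :: real^'m. z \<in> lattice \<and> norm z <= 1 / \<e> + D'}"
    have finZ: "finite Z" using finite_lattice_bounded[of 0 "1 / \<e> + D'"] by (simp add: Z_def)
    define c where "c z = (s * \<e>) *\<^sub>R z" for z :: "real^'m"
    define B where "B z = ball (c z) \<e>" for z
    define V where "V z = ball (c z) (C2 * \<e>) \<inter> unit_disk" for z
    define S where "S z = {x \<in> unit_disk. vfloor (x /\<^sub>R \<e>) = z}" for z :: "real^'m"
    have nz: "\<e> * norm z <= 1 + D' * \<e>" if "z \<in> Z" for z
    proof -
      have "\<e> * norm z <= \<e> * (1 / \<e> + D')" using that \<e> by (intro mult_left_mono) (auto simp: Z_def)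
      then show ?thesis using \<e> by (simp add: algebra_simps)
    qed
    have B_disk: "B z \<subseteq> unit_disk" if z: "z \<in> Z" for z
    proof
      fix x assume x: "x \<in> B z"
      have "norm (c z) = s * (\<e> * norm z)" using s \<e> by (simp add: c_def)
      also have "... <= s * (1 + D' * \<e>)" using nz[OF z] s by (intro mult_left_mono) auto
      also have "... = 1 - \<e> - D' * (D' + 1) * (\<e> * \<e>)" by (simp add: s_def algebra_simps)
      also have "... <= 1 - \<e>" using pos \<e> by simp
      finally show "x \<in> unit_disk"
        using x norm_triangle_ineq[of "x - c z" "c z"] by (simp add: B_def dist_norm norm_minus_commute)
    qed
    have BV: "B w \<subseteq> V z" if w: "w \<in> Z" "dist w z <= R" for w z
    proof
      fix x assume x: "x \<in> B w"
      have "dist (c w) (c z) = s * (\<e> * dist w z)" using s \<e> by (simp add: c_def dist_norm flip: scaleR_diff_right)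
      also have "... <= 1 * (\<e> * R)" using s \<e> w(2) by (intro mult_mono) auto
      finally have "dist (c z) x < R * \<e> + \<e>"
        using x dist_triangle[of "c z" x "c w"] by (simp add: B_def dist_commute mult.commute)
      also have "... = (R + 1) * \<e>" by (simp add: algebra_simps)
      also have "... <= C2 * \<e>" using pos \<e> by (intro mult_right_mono) auto
      finally show "x \<in> V z" using B_disk[OF w(1)] x by (auto simp: V_def)
    qed
    have SV: "S z \<subseteq> V z" if z: "z \<in> Z" for z
    proof
      fix x assume x: "x \<in> S z"
      have "x - \<e> *\<^sub>R z = \<e> *\<^sub>R (x /\<^sub>R \<e> - z)" using \<e> by (simp add: scaleR_diff_right)
      then have "dist x (\<e> *\<^sub>R z) = \<e> * dist (x /\<^sub>R \<e>) z" using \<e> by (simp add: dist_norm)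
      also have "... <= \<e> * m"
        using x dist_vfloor[of "x /\<^sub>R \<e>"] \<e> by (intro mult_left_mono) (auto simp: S_def m_def dist_commute)
      finally have 1: "dist x (\<e> *\<^sub>R z) <= \<e> * m" .
      have "\<e> *\<^sub>R z - c z = ((D' + 1) * \<e> * \<e>) *\<^sub>R z" by (simp add: c_def s_def algebra_simps)
      then have "dist (\<e> *\<^sub>R z) (c z) = ((D' + 1) * \<e>) * (\<e> * norm z)" using pos \<e> by (simp add: dist_norm)
      also have "... <= ((D' + 1) * \<e>) * (3/2)"
      proof (rule mult_left_mono)
        have "D' * \<e> <= (D' + 1) * \<e>" using \<e> by simp
        then show "\<e> * norm z <= 3/2" using nz[OF z] De by linarith
      qed (use pos \<e> in auto)
      also have "... < ((D' + 1) * \<e>) * 2" using pos \<e> by (intro mult_strict_left_mono) auto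
      finally have "dist (c z) x < \<e> * m + ((D' + 1) * \<e>) * 2"
        using 1 dist_triangle[of "c z" x "\<e> *\<^sub>R z"] by (simp add: dist_commute)
      also have "... = C2 * \<e>" by (simp add: C2_def algebra_simps)
      finally show "x \<in> V z" using x by (auto simp: V_def S_def)
    qed
    have meas [measurable]: "B z \<in> sets borel" "V z \<in> sets borel" "S z \<in> sets borel" for z
    proof -
      have "S z = unit_disk \<inter> (\<lambda>x. vfloor (x /\<^sub>R \<e>)) -` {z}" by (auto simp: S_def)
      then show "S z \<in> sets borel" using measurable_sets_borel[OF measurable_vfloor, of "{z}" \<e>] by simp
    qed (auto simp: B_def V_def)
    have mB: "leb (B z) = ennreal b" for z using ball_b[of 1 "c z"] by (simp add: B_def)
    define P where "P z = (\<integral>\<^sup>+x\<in>V z. (\<integral>\<^sup>+y\<in>V z. G x y \<partial>lborel) \<partial>lborel)" for z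
    have ex: "\<forall>z. \<exists>y. y \<in> B z \<and> (\<integral>\<^sup>+x\<in>B z. G y x \<partial>lborel) * ennreal b <= (\<integral>\<^sup>+y\<in>B z. (\<integral>\<^sup>+x\<in>B z. G y x \<partial>lborel) \<partial>lborel)"
    proof
      fix z
      obtain y where "y \<in> B z" "(\<integral>\<^sup>+x\<in>B z. G y x \<partial>lborel) * leb (B z) <= (\<integral>\<^sup>+y\<in>B z. (\<integral>\<^sup>+x\<in>B z. G y x \<partial>lborel) \<partial>lborel)"
      proof (rule nn_integral_attains_average[of "\<lambda>y. \<integral>\<^sup>+x\<in>B z. G y x \<partial>lborel" lborel "B z"])
        show "0 < leb (B z)" "leb (B z) < \<infinity>" using b by (simp_all add: mB)
        show "(\<lambda>y. \<integral>\<^sup>+x\<in>B z. G y x \<partial>lborel) \<in> borel_measurable lborel" "B z \<in> sets lborel" by measurable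
      qed (rule that)
      then show "\<exists>y. y \<in> B z \<and> (\<integral>\<^sup>+x\<in>B z. G y x \<partial>lborel) * ennreal b
        <= (\<integral>\<^sup>+y\<in>B z. (\<integral>\<^sup>+x\<in>B z. G y x \<partial>lborel) \<partial>lborel)" unfolding mB by blast
    qed
    obtain y0 where y0': "\<forall>z. y0 z \<in> B z \<and> (\<integral>\<^sup>+x\<in>B z. G (y0 z) x \<partial>lborel) * ennreal b
        <= (\<integral>\<^sup>+y\<in>B z. (\<integral>\<^sup>+x\<in>B z. G y x \<partial>lborel) \<partial>lborel)" using choice[OF ex] by blast
    note y0 = conjunct1[OF spec[OF y0']] conjunct2[OF spec[OF y0']]
    \<comment> \<open>The default 0 for lattice points far out keeps the set of samples
      finite.\<close>
    define y where "y z = (if z \<in> Z then y0 z else 0)" for z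
    have y_avg: "(\<integral>\<^sup>+x\<in>B w. G (y w) x \<partial>lborel) * ennreal b <= P z" if "w \<in> Z" "dist w z <= R" for w z
    proof -
      have "(\<integral>\<^sup>+x\<in>B w. G (y w) x \<partial>lborel) * ennreal b <= (\<integral>\<^sup>+y\<in>B w. (\<integral>\<^sup>+x\<in>B w. G y x \<partial>lborel) \<partial>lborel)"
        using y0(2)[of w] that by (simp add: y_def)
      also have "... <= P z" unfolding P_def
        using BV[OF that] by (intro nn_integral_mono mult_mono) (auto simp: indicator_def)
      finally show ?thesis .
    qed
    have one: "(\<integral>\<^sup>+x\<in>A. G x (y z) \<partial>lborel) * ennreal b <= ennreal (2 powr p * (1 + K)) * P z"
      if "A \<subseteq> V z" "A \<in> sets borel" "leb A <= ennreal (K * b)" "0 <= K" "z \<in> Z" for A z K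
      using one_point_estimate[OF f that(2) meas(1,2) that(1) BV mB b that(3,4), where p=p and ?y0.0="y z"] that(5) p pos y_avg[of z z]
      unfolding G_def P_def by simp
    have mV: "leb (V z) <= ennreal (C2 ^ CARD('m) * b)" for z
      using ball_b[of C2 "c z"] pos emeasure_mono[of "V z" "ball (c z) (C2 * \<e>)" lborel] by (simp add: V_def)
    have cell: "(\<integral>\<^sup>+x\<in>S z. G x (y z) \<partial>lborel) * ennreal b <= ennreal K1 * P z" if z: "z \<in> Z" for z
      unfolding K1_def using SV[OF z] order_trans[OF emeasure_mono mV] pos by (intro one z) auto
    have pair: "G (y w) (y z) * (ennreal b * ennreal b) <= ennreal K2 * P z" if w: "w \<in> Z" "z \<in> Z" "dist w z <= R" for w z
    proof -
      have tri: "G (y w) (y z) <= ennreal (2 powr p) * (G (y w) x + G x (y z))" for x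
        unfolding G_def using p by (intro qdist_powr_triangle[where Q=Q] size_f) auto
      have "G (y w) (y z) * ennreal b = (\<integral>\<^sup>+x\<in>B w. G (y w) (y z) \<partial>lborel)"
        by (subst nn_integral_cmult_indicator) (auto simp: mB)
      also have "... <= (\<integral>\<^sup>+x. ennreal (2 powr p) * (G (y w) x * indicator (B w) x + G x (y z) * indicator (B w) x))"
        using tri by (intro nn_integral_mono) (auto simp: indicator_def)
      also have "... = ennreal (2 powr p) * ((\<integral>\<^sup>+x\<in>B w. G (y w) x \<partial>lborel) + (\<integral>\<^sup>+x\<in>B w. G x (y z) \<partial>lborel))"
        by (subst nn_integral_cmult, measurable) (subst nn_integral_add, auto)
      finally have "G (y w) (y z) * ennreal b * ennreal b
          <= ennreal (2 powr p) * ((\<integral>\<^sup>+x\<in>B w. G (y w) x \<partial>lborel) + (\<integral>\<^sup>+x\<in>B w. G x (y z) \<partial>lborel)) * ennreal b"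
        by (rule mult_right_mono) simp
      also have "... = ennreal (2 powr p) * ((\<integral>\<^sup>+x\<in>B w. G (y w) x \<partial>lborel) * ennreal b + (\<integral>\<^sup>+x\<in>B w. G x (y z) \<partial>lborel) * ennreal b)"
        by (simp add: algebra_simps)
      also have "... <= ennreal (2 powr p) * (P z + ennreal (2 powr p * (1 + 1)) * P z)"
        using w by (intro mult_left_mono add_mono y_avg one BV) (auto simp: mB)
      also have "... = ennreal K2 * P z"
      proof -
        have "P z + ennreal c * P z = ennreal (1 + c) * P z" if "0 <= c" for c using that by (simp add: distrib_right)
        from this[of "2 powr p * (1 + 1)"] show ?thesis unfolding K2_def
          by (subst ennreal_mult) (simp_all add: mult.assoc)
      qed
      finally show ?thesis by (simp add: mult.assoc)
    qed
    \<comment> \<open>Every point lies in at most \<open>N2\<close> of the sets \<open>V z\<close>,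
      and two points of one \<open>V z\<close> are closer than \<open>2 * C2 * \<e>\<close>, so the
      sum is at most \<open>N2\<close> times the double integral over close pairs.\<close>
    have sum_P: "(\<Sum>z\<in>Z. P z) <= ennreal (W * (M * \<e> powr p)) * ennreal b"
    proof -
      define E :: "((real^'m) \<times> (real^'m)) set" where "E = {(x, y). x \<in> unit_disk \<and> y \<in> unit_disk \<and> dist x y < 2 * C2 * \<e>}"
      have [measurable]: "E \<in> sets (borel \<Otimes>\<^sub>M borel)" unfolding E_def by (rule close_pairs_measurable)
      have "(\<Sum>z\<in>Z. P z) = (\<integral>\<^sup>+x. (\<Sum>z\<in>Z. (\<integral>\<^sup>+y\<in>V z. G x y \<partial>lborel) * indicator (V z) x))"
        unfolding P_def by (subst nn_integral_sum) auto
      also have "... = (\<integral>\<^sup>+x. (\<integral>\<^sup>+y. (\<Sum>z\<in>Z. G x y * indicator (V z) y * indicator (V z) x)))"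
        by (subst nn_integral_sum) (auto simp: nn_integral_multc)
      also have "... <= (\<integral>\<^sup>+x. (\<integral>\<^sup>+y. ennreal N2 * (G x y * indicator E (x, y))))"
      proof (intro nn_integral_mono, goal_cases)
        case (1 x y)
        show ?case
        proof (cases "(x, y) \<in> E")
          case True
          have "(\<Sum>z\<in>Z. G x y * indicator (V z) y * indicator (V z) x) <= (\<Sum>z\<in>{z \<in> Z. x \<in> V z}. G x y)"
            unfolding sum.inter_filter[OF finZ] by (rule sum_mono) (auto simp: indicator_def)
          also have "... = of_nat (card {z \<in> Z. x \<in> V z}) * G x y" by simp
          also have "card {z \<in> Z. x \<in> V z} <= card {z \<in> lattice. dist x ((s * \<e>) *\<^sub>R z) < C2 * \<e>}"
          proof (rule card_mono)
            have "{z \<in> lattice. dist x ((s * \<e>) *\<^sub>R z) < C2 * \<e>} \<subseteq> {z \<in> lattice. dist z 0 <= (norm x + C2 * \<e>) / (s * \<e>)}"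
            proof clarsimp
              fix z assume "dist x ((s * \<e>) *\<^sub>R z) < C2 * \<e>"
              then have "s * \<e> * norm z <= norm x + C2 * \<e>"
                using norm_triangle_ineq4[of x "x - (s * \<e>) *\<^sub>R z"] s \<e> by (simp add: dist_norm)
              then show "norm z <= (norm x + C2 * \<e>) / (s * \<e>)" using s \<e> by (simp add: field_simps)
            qed
            then show "finite {z \<in> lattice. dist x ((s * \<e>) *\<^sub>R z) < C2 * \<e>}"
              by (rule finite_subset) (rule finite_lattice_bounded)
          qed (auto simp: Z_def V_def c_def dist_commute)
          also have "... <= card {w \<in> lattice. dist w (0 :: real^'m) <= 2 * C2 + real CARD('m)}"
            using \<e> s pos by (intro card_lattice_near_point) auto
          finally have "(\<Sum>z\<in>Z. G x y * indicator (V z) y * indicator (V z) x)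
              <= of_nat (card {w \<in> lattice. dist w (0 :: real^'m) <= 2 * C2 + m}) * G x y"
            by (simp add: mult_right_mono m_def)
          then show ?thesis using True by (simp add: N2_def ennreal_of_nat_eq_real_of_nat)
        next
          case False
          have "indicator (V z) y * indicator (V z) x = (0 :: ennreal)" for z
          proof (rule ccontr)
            assume "indicator (V z) y * indicator (V z) x \<noteq> (0 :: ennreal)"
            then have "x \<in> V z" "y \<in> V z" by (auto simp: indicator_def split: if_splits)
            then have "(x, y) \<in> E" using dist_triangle[of x y "c z"] by (auto simp: V_def E_def dist_commute)
            then show False using False by simp
          qed
          then have "G x y * indicator (V z) y * indicator (V z) x = 0" for z by (simp add: mult.assoc)
          then show ?thesis by (simp only: sum.neutral_const zero_le)
        qed
      qed
      also have "... = ennreal N2 * (\<integral>\<^sup>+x. (\<integral>\<^sup>+y. G x y * indicator E (x, y)))" by (simp add: nn_integral_cmult)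
      also have "... <= ennreal N2 * (ennreal (M * (2 * C2 * \<e>) powr p) * leb (ball (0 :: real^'m) (2 * C2 * \<e>)))"
        unfolding G_def E_def using p pos \<e> by (intro mult_left_mono transl_bound_double_integral[OF f T _ M]) auto
      also have "... = ennreal N2 * (ennreal (M * (2 * C2 * \<e>) powr p) * ennreal ((2 * C2) ^ CARD('m) * b))"
        using ball_b[of "2 * C2"] pos by simp
      also have "... = ennreal (N2 * (M * (2 * C2 * \<e>) powr p * ((2 * C2) ^ CARD('m) * b)))"
        using pos M b by (simp add: ennreal_mult)
      also have "N2 * (M * (2 * C2 * \<e>) powr p * ((2 * C2) ^ CARD('m) * b)) = (W * (M * \<e> powr p)) * b"
        using pos \<e> by (simp add: W_def powr_mult)
      finally show ?thesis using nonneg M b by (simp add: ennreal_mult)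
    qed
    show ?thesis unfolding discretizes_def
    proof (intro exI[of _ "\<lambda>z. f (y z)"] conjI allI)
      show "f (y z) \<in> f ` unit_disk" for z using y0(1)[of z] B_disk[of z] by (auto simp: y_def)
      have "range (\<lambda>z. f (y z)) \<subseteq> (\<lambda>z. f (y z)) ` Z \<union> {f 0}" by (auto simp: y_def)
      then show "finite (range (\<lambda>z. f (y z)))" by (rule finite_subset) (use finZ in auto)
      have "Lp_dist p f (\<lambda>x. f (y (vfloor (x /\<^sub>R \<e>)))) <= (\<integral>\<^sup>+x. (\<Sum>z\<in>Z. G x (y z) * indicator (S z) x))"
        unfolding Lp_dist_def G_def[symmetric]
      proof (rule nn_integral_mono, goal_cases)
        case (1 x)
        let ?z = "vfloor (x /\<^sub>R \<e>)"
        show ?case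
        proof (cases "x \<in> unit_disk")
          case True
          have "?z \<in> Z" using norm_vfloor_unit_disk[OF True \<e>(1)] pos by (simp add: Z_def m_def)
          then have "G x (y ?z) * indicator (S ?z) x <= (\<Sum>z\<in>Z. G x (y z) * indicator (S z) x)"
            by (intro member_le_sum finZ) auto
          then show ?thesis using True by (simp add: S_def)
        qed simp
      qed
      also have "... = (\<Sum>z\<in>Z. \<integral>\<^sup>+x\<in>S z. G x (y z) \<partial>lborel)" by (rule nn_integral_sum) (simp_all add: G_sym[of _ "y _"])
      finally have "Lp_dist p f (\<lambda>x. f (y (vfloor (x /\<^sub>R \<e>)))) * ennreal b <= (\<Sum>z\<in>Z. \<integral>\<^sup>+x\<in>S z. G x (y z) \<partial>lborel) * ennreal b"
        by (rule mult_right_mono) simp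
      also have "... <= ennreal K1 * (\<Sum>z\<in>Z. P z)" by (simp add: sum_distrib_right sum_distrib_left cell sum_mono)
      also have "... <= ennreal K1 * (ennreal (W * (M * \<e> powr p)) * ennreal b)" by (intro mult_left_mono sum_P) simp
      also have "... = ennreal (K1 * W * (M * \<e> powr p)) * ennreal b"
        using nonneg M by (simp add: ennreal_mult mult.assoc)
      finally have "Lp_dist p f (\<lambda>x. f (y (vfloor (x /\<^sub>R \<e>)))) <= ennreal (K1 * W * (M * \<e> powr p))"
        using b by (subst (asm) (1 2) mult.commute) (simp add: ennreal_mult_le_mult_iff)
      also have "... <= ennreal (C * M * \<e> powr p)"
        using nonneg pos M \<beta> by (intro ennreal_leI) (simp add: C_def algebra_simps)
      finally show "Lp_dist p f (\<lambda>x. f (y (vfloor (x /\<^sub>R \<e>)))) <= ennreal (C * M * \<e> powr p)" .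
      let ?q = "\<lambda>w z. qdist (f (y w)) (f (y z)) powr p" and ?F = "{z :: real^'m. z \<in> lattice \<and> norm z <= 1 / \<e> + D}"
      have FZ: "?F \<subseteq> Z" using pos by (auto simp: Z_def D'_def)
      have nearZ: "w \<in> Z" "dist w z <= R" if "z \<in> ?F" "w \<in> near z" for w z
        using that norm_triangle_ineq[of "w - z" z] by (auto simp: near_def Z_def D'_def R_def m_def dist_norm)
      have "ennreal ((\<Sum>z\<in>?F. \<Sum>w\<in>near z. ?q w z) * (b * b)) = (\<Sum>z\<in>?F. \<Sum>w\<in>near z. G (y w) (y z) * (ennreal b * ennreal b))"
        using b by (simp add: G_def sum_distrib_right sum_nonneg flip: sum_ennreal ennreal_mult)
      also have "... <= (\<Sum>z\<in>?F. \<Sum>w\<in>near z. ennreal K2 * P z)" using FZ nearZ by (intro sum_mono pair) auto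
      also have "... = (\<Sum>z\<in>?F. ennreal (N0 * K2) * P z)"
        using nonneg by (intro sum.cong refl) (simp add: N0_def card_near ennreal_of_nat_eq_real_of_nat ennreal_mult mult.assoc)
      also have "... = ennreal (N0 * K2) * (\<Sum>z\<in>?F. P z)" by (simp add: sum_distrib_left)
      also have "... <= ennreal (N0 * K2) * (\<Sum>z\<in>Z. P z)" using finZ FZ by (intro mult_left_mono sum_mono2) auto
      also have "... <= ennreal (N0 * K2) * (ennreal (W * (M * \<e> powr p)) * ennreal b)" by (intro mult_left_mono sum_P) simp
      also have "... = ennreal (N0 * K2 * (W * (M * \<e> powr p) * b))" using nonneg M b pos by (simp add: ennreal_mult)
      finally have "(\<Sum>z\<in>?F. \<Sum>w\<in>near z. ?q w z) * (b * b) <= N0 * K2 * (W * (M * \<e> powr p) * b)"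
        using nonneg M b pos by (subst (asm) ennreal_le_iff) auto
      then have "(\<Sum>z\<in>?F. \<Sum>w\<in>near z. ?q w z) * b * b <= (N0 * K2 * W * (M * \<e> powr p)) * b" by (simp add: mult_ac)
      then have "(\<Sum>z\<in>?F. \<Sum>w\<in>near z. ?q w z) * b <= N0 * K2 * W * (M * \<e> powr p)" using b by simp
      then have "(\<Sum>z\<in>?F. \<Sum>w\<in>near z. ?q w z) <= N0 * K2 * W * (M * \<e> powr p) / b" using b by (simp add: field_simps)
      also have "... = (N0 * K2 * W / \<beta>) * (M * \<e> powr p / \<e> ^ CARD('m))" by (simp add: b_def)
      also have "... <= C * (M * \<e> powr p / \<e> ^ CARD('m))"
        using nonneg M \<e> by (intro mult_right_mono) (auto simp: C_def)
      finally show "(\<Sum>z\<in>?F. \<Sum>w\<in>near z. ?q w z) <= C * M * \<e> powr p / \<e> ^ CARD('m)" by simp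
    qed
  qed
  show ?thesis by (rule that[OF C0 pos(7) main])
qed

section \<open>Lipschitz approximation with bounded energy\<close>

lemma lattice_cell_integral:
  fixes a :: "real^'m => real"
  assumes \<e>: "0 < \<e>" and a: "\<And>z. 0 <= a z"
  shows "(\<integral>\<^sup>+x. ennreal (a (vfloor (x /\<^sub>R \<e>))) * indicator unit_disk x)
    <= ennreal (unit_ball_vol CARD('m) * (real CARD('m) + 1) ^ CARD('m) * \<e> ^ CARD('m)
      * (\<Sum>z | z \<in> lattice \<and> norm z <= 1 / \<e> + real CARD('m). a z))"
proof -
  let ?F = "{z :: real^'m. z \<in> lattice \<and> norm z <= 1 / \<e> + real CARD('m)}"
  define S where "S z = (\<lambda>x. vfloor (x /\<^sub>R \<e>)) -` {z}" for z :: "real^'m"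
  have [measurable]: "S z \<in> sets borel" for z
    unfolding S_def using measurable_sets_borel[OF measurable_vfloor, of "{z}"] by simp
  have fin: "finite ?F" using finite_lattice_bounded[of 0 "1 / \<e> + real CARD('m)"] by simp
  have S: "leb (S z) <= ennreal (unit_ball_vol CARD('m) * ((real CARD('m) + 1) ^ CARD('m) * \<e> ^ CARD('m)))" for z
  proof -
    have "S z \<subseteq> ball (\<e> *\<^sub>R z) ((real CARD('m) + 1) * \<e>)"
    proof
      fix x assume "x \<in> S z"
      then have z: "z = vfloor (x /\<^sub>R \<e>)" by (simp add: S_def)
      have "\<e> *\<^sub>R z - x = \<e> *\<^sub>R (z - x /\<^sub>R \<e>)" using \<e> by (simp add: scaleR_diff_right)
      then have "dist (\<e> *\<^sub>R z) x = \<e> * dist z (x /\<^sub>R \<e>)" using \<e> by (simp add: dist_norm)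
      also have "... <= \<e> * real CARD('m)" unfolding z using \<e> by (intro mult_left_mono dist_vfloor) auto
      also have "... < (real CARD('m) + 1) * \<e>" using \<e> by (simp add: algebra_simps)
      finally show "x \<in> ball (\<e> *\<^sub>R z) ((real CARD('m) + 1) * \<e>)" by simp
    qed
    then have "leb (S z) <= leb (ball (\<e> *\<^sub>R z) ((real CARD('m) + 1) * \<e>))" by (intro emeasure_mono) auto
    then show ?thesis using \<e> by (simp add: emeasure_ball power_mult_distrib)
  qed
  have "(\<integral>\<^sup>+x. ennreal (a (vfloor (x /\<^sub>R \<e>))) * indicator unit_disk x)
      <= (\<integral>\<^sup>+x. (\<Sum>z\<in>?F. ennreal (a z) * indicator (S z) x))"
  proof (rule nn_integral_mono, goal_cases)
    case (1 x)
    let ?z = "vfloor (x /\<^sub>R \<e>)"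
    show ?case
    proof (cases "x \<in> unit_disk")
      case True
      have "?z \<in> ?F" using norm_vfloor_unit_disk[OF True \<e>] by simp
      then have "ennreal (a ?z) * indicator (S ?z) x <= (\<Sum>z\<in>?F. ennreal (a z) * indicator (S z) x)"
        using fin by (intro member_le_sum) auto
      then show ?thesis using True by (simp add: S_def)
    qed simp
  qed
  also have "... = (\<Sum>z\<in>?F. ennreal (a z) * leb (S z))" by (subst nn_integral_sum) (auto simp: nn_integral_cmult)
  also have "... <= (\<Sum>z\<in>?F. ennreal (a z) * ennreal (unit_ball_vol CARD('m) * ((real CARD('m) + 1) ^ CARD('m) * \<e> ^ CARD('m))))"
    by (intro sum_mono mult_left_mono S) auto
  also have "... = ennreal (\<Sum>z\<in>?F. a z * (unit_ball_vol CARD('m) * ((real CARD('m) + 1) ^ CARD('m) * \<e> ^ CARD('m))))"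
    using a \<e> by (subst sum_ennreal[symmetric]) (auto simp: ennreal_mult)
  finally show ?thesis by (simp add: sum_distrib_right[symmetric] mult_ac)
qed

text \<open>Wherever a map is not approximately differentiable, \<^const>\<open>norm_Df\<close> has one fixed value, the one
  belonging to \<open>THE\<close> applied to an empty predicate. Hence no almost everywhere
  differentiability is needed to bound energies from above.\<close>

lemma norm_Df_not_differentiable:
  assumes "\<nexists>\<A>. approx_affine Q U f a \<A>"
  shows "norm_Df Q U (f :: real^'m => 'b::real_normed_vector multiset) a
    = sqrt (\<Sum>L\<in>#image_mset (\<lambda>A x. A x - A 0) (THE \<A> :: (real^'m => 'b) multiset. False). \<Sum>j\<in>UNIV. (norm (L (axis j 1)))\<^sup>2)"
  using assms by (simp add: norm_Df_def Df_def)

text \<open>At mesh \<open>\<e>\<close> the rescaled extension has the roughness divided by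
  \<open>\<e>\<close> as local Lipschitz constant, and the \<open>p\<close>-th powers of the
  roughness sum up to order \<open>\<e> powr p / \<e> ^ CARD('m)\<close>. These powers of
  \<open>\<e>\<close> cancel against the division and the volume of the cells, so the energy stays
  bounded as the mesh shrinks. The same sum controls the distance to the step function.\<close>

lemma lipschitz_approximation:
  assumes p: "1 <= p" and M: "0 <= M"
  obtains K \<e>0 where "0 <= K" "0 < \<e>0"
    "\<And>(f :: real^'m => 'b::{real_normed_vector, second_countable_topology} multiset) \<e>.
      f \<in> borel \<rightarrow>\<^sub>M qborel Q ==> transl_bound p f M ==> 0 < \<e> ==> \<e> <= \<e>0 ==>
      \<exists>h. Lipschitz_continuous_map euclidean_metric (qspace Q) h \<and>
        energy Q p unit_disk h <= ennreal K \<and> Lp_dist p f h <= ennreal (K * \<e> powr p)"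
proof -
  define m where "m = real CARD('m)"
  obtain N where N: "\<And>Y :: real^'m => 'b multiset. (\<And>z. size (Y z) = Q) ==>
    \<exists>H. extends_lattice Q Y (roughness Q Y N) H" by (rule lattice_extension[where 'm='m and 'b='b and Q=Q]) blast
  \<comment> \<open>The margin consumed by the \<open>N\<close> levels of the roughness, plus
    \<open>m\<close> for the lattice points of cells that meet the unit ball.\<close>
  define D where "D = m + real N * (3 * m + 6)"
  obtain C \<e>0 where C: "0 <= C" "0 < \<e>0"
    "\<And>(f :: real^'m => 'b multiset) M \<e>.
      f \<in> borel \<rightarrow>\<^sub>M qborel Q ==> transl_bound p f M ==> 0 <= M ==> 0 < \<e> ==> \<e> <= \<e>0 ==>
      \<exists>Y. discretizes p D (C * M) f \<e> Y"
    by (rule discretization[OF p, of D, where 'm='m and 'b='b and Q=Q]) (simp add: D_def m_def, blast)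
  obtain C' where C': "0 <= C'" "\<And>(Y :: real^'m => 'b multiset) r.
    (\<Sum>z | z \<in> lattice \<and> norm z <= r. roughness Q Y N z powr p)
      <= C' * (\<Sum>z | z \<in> lattice \<and> norm z <= r + real N * (3 * real CARD('m) + 6). \<Sum>w\<in>near z. qdist (Y w) (Y z) powr p)"
    using roughness_powr_sum[OF p, of Q N, where 'm='m and 'b='b] by blast
  \<comment> \<open>The value of \<open>norm_Df\<close> at points without an approximate
    differential; it adds a constant to the energy.\<close>
  define k0 where "k0 = sqrt (\<Sum>L\<in>#image_mset (\<lambda>A x. A x - A 0) (THE \<A> :: (real^'m => 'b) multiset. False). \<Sum>j\<in>UNIV. (norm (L (axis j 1)))\<^sup>2)"
  define k1 where "k1 = sqrt (real Q * m)"
  define \<beta> where "\<beta> = unit_ball_vol m"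
  define K1 where "K1 = \<beta> * (m + 1) ^ CARD('m) * (C' * (C * M))"
  define K where "K = (k0 powr p * \<beta> + k1 powr p * K1) + 2 powr p * (C * M + K1)"
  have pos: "0 <= m" "0 <= \<beta>" "0 <= k1" by (auto simp: m_def \<beta>_def k1_def)
  then have K1: "0 <= K1" using C C' M by (simp add: K1_def)
  then have K0: "0 <= K" using C M pos by (simp add: K_def)
  have main: "\<exists>h. Lipschitz_continuous_map euclidean_metric (qspace Q) h \<and>
        energy Q p unit_disk h <= ennreal K \<and> Lp_dist p f h <= ennreal (K * \<e> powr p)"
    if f: "f \<in> borel \<rightarrow>\<^sub>M qborel Q" and T: "transl_bound p f M" and \<e>: "0 < \<e>" "\<e> <= \<e>0" for f :: "real^'m => 'b multiset" and \<e>
  proof -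
    have size_f: "size (f x) = Q" for x using measurable_space[OF f, of x] by simp
    obtain Y where Y: "\<And>z. Y z \<in> f ` unit_disk" "finite (range Y)"
        "Lp_dist p f (\<lambda>x. Y (vfloor (x /\<^sub>R \<e>))) <= ennreal (C * M * \<e> powr p)"
        "(\<Sum>z | z \<in> lattice \<and> norm z <= 1 / \<e> + D. \<Sum>w\<in>near z. qdist (Y w) (Y z) powr p)
          <= C * M * \<e> powr p / \<e> ^ CARD('m)" using C(3)[OF f T M \<e>] unfolding discretizes_def by blast
    have size_Y: "size (Y z) = Q" for z using Y(1)[of z] size_f by auto
    define \<rho> where "\<rho> z = roughness Q Y N z" for z
    have \<rho>0: "0 <= \<rho> z" for z by (simp add: \<rho>_def roughness_nonneg)
    obtain H where H: "\<And>x. size (H x) = Q" "\<And>x. qdist (H x) (Y (vfloor x)) <= \<rho> (vfloor x)"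
      "\<And>x y y'. y \<in> ball x 1 ==> y' \<in> ball x 1 ==> qdist (H y) (H y') <= \<rho> (vfloor x) * dist y y'"
      using N[of Y] size_Y unfolding \<rho>_def extends_lattice_def by blast
    define h where "h x = H (x /\<^sub>R \<e>)" for x
    have size_h: "size (h x) = Q" for x by (simp add: h_def H)
    have scale: "dist (y /\<^sub>R \<e>) (x /\<^sub>R \<e>) = dist y x / \<e>" for x y :: "real^'m"
      using \<e> by (simp add: dist_norm divide_inverse flip: scaleR_diff_right)
    have h_loc: "qdist (h y) (h x) <= \<rho> (vfloor (x /\<^sub>R \<e>)) / \<e> * dist y x" if "dist y x < \<e>" for x y
      using H(3)[of "y /\<^sub>R \<e>" "x /\<^sub>R \<e>" "x /\<^sub>R \<e>"] \<e> that scale[of y x] by (simp add: h_def dist_commute)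
    \<comment> \<open>Finitely many samples give a global Lipschitz constant, though one that may
      blow up as \<open>\<e>\<close> shrinks; the energy is estimated from the local constants
      instead.\<close>
    obtain B where B: "\<And>z. z \<in> lattice ==> \<rho> z <= B" using roughness_bounded[OF Y(2)] unfolding \<rho>_def by blast
    have B0: "0 <= B" using \<rho>0[of "vfloor 0"] B[of "vfloor 0"] by simp
    have h_lip: "qdist (h x) (h y) <= B / \<e> * dist x y" for x y
    proof (rule lipschitz_from_local[OF size_h \<e>(1)])
      fix x y :: "real^'m" assume xy: "dist x y < \<e>"
      have "qdist (h x) (h y) <= \<rho> (vfloor (y /\<^sub>R \<e>)) / \<e> * dist x y" by (rule h_loc[OF xy])
      also have "... <= B / \<e> * dist x y" using \<e> by (intro mult_right_mono divide_right_mono B) auto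
      finally show "qdist (h x) (h y) <= B / \<e> * dist x y" .
    qed
    have h: "h \<in> borel \<rightarrow>\<^sub>M qborel Q" by (rule lipschitz_into_qborel[OF size_h h_lip])
    let ?F = "{z :: real^'m. z \<in> lattice \<and> norm z <= 1 / \<e> + m}"
    have "(\<Sum>z\<in>?F. \<rho> z powr p) <= C' * (C * M * \<e> powr p / \<e> ^ CARD('m))"
    proof -
      have "(\<Sum>z\<in>?F. \<rho> z powr p) <= C' * (\<Sum>z | z \<in> lattice \<and> norm z <= 1 / \<e> + D. \<Sum>w\<in>near z. qdist (Y w) (Y z) powr p)"
        using C'(2)[of Y "1 / \<e> + m"] by (simp add: \<rho>_def D_def m_def add.assoc)
      also have "... <= C' * (C * M * \<e> powr p / \<e> ^ CARD('m))" by (intro mult_left_mono Y C')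
      finally show ?thesis .
    qed
    then have "\<beta> * (m + 1) ^ CARD('m) * \<e> ^ CARD('m) * (\<Sum>z\<in>?F. \<rho> z powr p)
        <= \<beta> * (m + 1) ^ CARD('m) * \<e> ^ CARD('m) * (C' * (C * M * \<e> powr p / \<e> ^ CARD('m)))"
      using pos \<e> by (intro mult_left_mono) auto
    also have "... = K1 * \<e> powr p" using \<e> by (simp add: K1_def)
    finally have sum_\<rho>: "\<beta> * (m + 1) ^ CARD('m) * \<e> ^ CARD('m) * (\<Sum>z\<in>?F. \<rho> z powr p) <= K1 * \<e> powr p" .
    have int_\<rho>: "(\<integral>\<^sup>+x. ennreal (\<rho> (vfloor (x /\<^sub>R \<e>)) powr p) * indicator unit_disk x) <= ennreal (K1 * \<e> powr p)"
      using order_trans[OF lattice_cell_integral[OF \<e>(1), of "\<lambda>z. \<rho> z powr p"] ennreal_leI] sum_\<rho>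
      by (simp add: \<beta>_def m_def)
    have "Lp_dist p (\<lambda>x. Y (vfloor (x /\<^sub>R \<e>))) h
        <= (\<integral>\<^sup>+x. ennreal (\<rho> (vfloor (x /\<^sub>R \<e>)) powr p) * indicator unit_disk x)" unfolding Lp_dist_def using p H(2)
      by (intro nn_integral_mono mult_right_mono ennreal_leI powr_mono2 qdist_nonneg)
         (auto simp: h_def qdist_commute)
    then have st: "Lp_dist p (\<lambda>x. Y (vfloor (x /\<^sub>R \<e>))) h <= ennreal (K1 * \<e> powr p)" using int_\<rho> by (rule order_trans)
    have "Lp_dist p f h <= ennreal (2 powr p) * (Lp_dist p f (\<lambda>x. Y (vfloor (x /\<^sub>R \<e>))) + Lp_dist p (\<lambda>x. Y (vfloor (x /\<^sub>R \<e>))) h)"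
      using p by (intro Lp_dist_triangle[OF f step_function_measurable[OF size_Y] h]) auto
    also have "... <= ennreal (2 powr p) * (ennreal (C * M * \<e> powr p) + ennreal (K1 * \<e> powr p))"
      by (intro mult_left_mono add_mono Y st) auto
    also have "... = ennreal (2 powr p * (C * M + K1) * \<e> powr p)"
      using C M K1 by (simp add: algebra_simps flip: ennreal_plus ennreal_mult)
    also have "... <= ennreal (K * \<e> powr p)" using pos K1 by (intro ennreal_leI mult_right_mono) (auto simp: K_def)
    finally have dist_h: "Lp_dist p f h <= ennreal (K * \<e> powr p)" .
    define \<Phi> where "\<Phi> x = ennreal (k0 powr p) * indicator unit_disk x
      + ennreal ((k1 / \<e>) powr p) * (ennreal (\<rho> (vfloor (x /\<^sub>R \<e>)) powr p) * indicator unit_disk x)" for x :: "real^'m"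
    have "(\<lambda>x. \<rho> (vfloor (x /\<^sub>R \<e>))) \<in> borel_measurable borel"
    proof (rule measurable_compose_countable'[where I=lattice])
      show "(\<lambda>x :: real^'m. vfloor (x /\<^sub>R \<e>)) \<in> borel \<rightarrow>\<^sub>M count_space lattice"
        by (subst measurable_count_space_eq_countable[OF countable_lattice]) (auto intro!: measurable_sets_borel[OF measurable_vfloor])
    qed (simp_all add: countable_lattice)
    then have [measurable]: "\<Phi> \<in> borel_measurable borel" unfolding \<Phi>_def by measurable
    have "energy Q p unit_disk h <= (\<integral>\<^sup>+x. \<Phi> x \<partial>lebesgue)" unfolding energy_def
    proof (rule nn_integral_mono, goal_cases)
      case (1 x)
      have "norm_Df Q unit_disk h x powr p <= k0 powr p + (k1 / \<e>) powr p * \<rho> (vfloor (x /\<^sub>R \<e>)) powr p" if x: "x \<in> unit_disk"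
      proof (cases "\<exists>\<A>. approx_affine Q unit_disk h x \<A>")
        case True
        then obtain \<A> where \<A>: "approx_affine Q unit_disk h x \<A>" by blast
        have "norm_Df Q unit_disk h x <= sqrt (real Q * real CARD('m)) * (\<rho> (vfloor (x /\<^sub>R \<e>)) / \<e>)"
          using \<rho>0 \<e> h_loc by (intro norm_Df_locally_lipschitz[OF h open_ball x \<A> \<e>(1)]) auto
        also have "... = k1 / \<e> * \<rho> (vfloor (x /\<^sub>R \<e>))" by (simp add: k1_def m_def)
        finally have "norm_Df Q unit_disk h x powr p <= (k1 / \<e> * \<rho> (vfloor (x /\<^sub>R \<e>))) powr p"
          using p norm_Df_nonneg by (intro powr_mono2) auto
        also have "... = (k1 / \<e>) powr p * \<rho> (vfloor (x /\<^sub>R \<e>)) powr p" by (rule powr_mult)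
        finally show ?thesis by (rule add_increasing[OF powr_ge_zero])
      next
        case False
        then show ?thesis unfolding norm_Df_not_differentiable[OF False] k0_def by simp
      qed
      then show ?case by (auto simp: \<Phi>_def indicator_def ennreal_leI simp flip: ennreal_plus ennreal_mult)
    qed
    also have "... = (\<integral>\<^sup>+x. \<Phi> x)" by (rule nn_integral_completion)
    also have "... = ennreal (k0 powr p) * ennreal \<beta>
        + ennreal ((k1 / \<e>) powr p) * (\<integral>\<^sup>+x. ennreal (\<rho> (vfloor (x /\<^sub>R \<e>)) powr p) * indicator unit_disk x)"
      using \<open>(\<lambda>x. \<rho> (vfloor (x /\<^sub>R \<e>))) \<in> borel_measurable borel\<close> unfolding \<Phi>_def
      by (subst nn_integral_add) (auto simp: nn_integral_cmult emeasure_ball \<beta>_def m_def)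
    also have "... <= ennreal (k0 powr p) * ennreal \<beta> + ennreal ((k1 / \<e>) powr p) * ennreal (K1 * \<e> powr p)"
      by (intro add_left_mono mult_left_mono int_\<rho>) simp
    also have "... = ennreal (k0 powr p * \<beta> + (k1 / \<e>) powr p * (K1 * \<e> powr p))"
      using pos K1 by (simp flip: ennreal_plus ennreal_mult)
    also have "(k1 / \<e>) powr p * (K1 * \<e> powr p) = k1 powr p * K1" using \<e> pos by (simp add: powr_divide)
    also have "ennreal (k0 powr p * \<beta> + k1 powr p * K1) <= ennreal K"
      using K1 C M by (intro ennreal_leI) (simp add: K_def)
    finally have "energy Q p unit_disk h <= ennreal K" .
    moreover have "\<exists>L\<ge>0. \<forall>x y. qdist (h x) (h y) <= L * dist x y" using h_lip B0 \<e> by (intro exI[of _ "B / \<e>"]) auto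
    ultimately show ?thesis unfolding lipschitz_map_qspace using dist_h size_h by (intro exI[of _ h]) auto
  qed
  show ?thesis by (rule that[OF K0 C(2) main])
qed

lemma transl_bound_imp_W1p:
  fixes f :: "real^'m => 'b::{real_normed_vector, second_countable_topology} multiset"
  assumes f: "f \<in> borel \<rightarrow>\<^sub>M qborel Q" "f \<in> Lp Q p (ball 0 1)" and T: "transl_bound p f M"
    and p: "1 <= p" and M: "0 <= M"
  shows "f \<in> W1p Q p (ball 0 1)"
proof -
  obtain K \<e>0 where K: "0 <= K" "0 < \<e>0"
    "\<And>\<e>. 0 < \<e> ==> \<e> <= \<e>0 ==>
      \<exists>h. Lipschitz_continuous_map euclidean_metric (qspace Q) h \<and>
        energy Q p unit_disk h <= ennreal K \<and> Lp_dist p f h <= ennreal (K * \<e> powr p)"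
    by (rule lipschitz_approximation[OF p M, where 'm='m and 'b='b and Q=Q]) (use f T in blast)
  define \<e> where "\<e> j = \<e>0 / real (Suc j)" for j
  have \<e>: "0 < \<e> j" "\<e> j <= \<e>0" for j using K(2) by (auto simp: \<e>_def field_simps)
  have "\<forall>j. \<exists>h. Lipschitz_continuous_map euclidean_metric (qspace Q) h \<and>
        energy Q p unit_disk h <= ennreal K \<and> Lp_dist p f h <= ennreal (K * \<e> j powr p)" using K(3)[OF \<e>] by blast
  from choice[OF this[unfolded lipschitz_map_qspace]] obtain g where g: "\<And>j x. size (g j x) = Q"
    "\<And>j. \<exists>L\<ge>0. \<forall>x y. qdist (g j x) (g j y) <= L * dist x y"
    "\<And>j. energy Q p unit_disk (g j) <= ennreal K" "\<And>j. Lp_dist p f (g j) <= ennreal (K * \<e> j powr p)" by blast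
  have gm: "g j \<in> borel \<rightarrow>\<^sub>M qborel Q" for j using g(2)[of j] lipschitz_into_qborel[of "g j" Q, OF g(1)] by blast
  have c: "(\<lambda>_. replicate_mset Q 0) \<in> borel \<rightarrow>\<^sub>M qborel Q" by (intro measurable_const) simp
  have gLp: "g j \<in> Lp Q p (ball 0 1)" for j
  proof -
    have "Lp_dist p (g j) (\<lambda>_. replicate_mset Q 0) <= ennreal (2 powr p) * (Lp_dist p (g j) f + Lp_dist p f (\<lambda>_. replicate_mset Q 0))"
      using p by (intro Lp_dist_triangle[OF gm f(1) c]) auto
    also have "... < \<infinity>" using f(2) g(4)[of j] unfolding Lp_iff[OF f(1)]
      by (auto simp: Lp_dist_commute[of p "g j"] ennreal_mult_less_top intro: le_less_trans)
    finally show ?thesis unfolding Lp_iff[OF gm] .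
  qed
  have "(\<lambda>j. K * \<e> j powr p) \<longlonglongrightarrow> K * 0 powr p"
  proof (intro tendsto_mult tendsto_const tendsto_powr')
    show "\<e> \<longlonglongrightarrow> 0" unfolding \<e>_def by (rule LIMSEQ_Suc[OF lim_const_over_n])
    show "0 \<noteq> (0::real) \<or> 0 < p \<and> (\<forall>\<^sub>F j in sequentially. 0 <= \<e> j)" using p \<e> by (auto intro!: always_eventually less_imp_le)
  qed
  then have "(\<lambda>j. ennreal (K * \<e> j powr p)) \<longlonglongrightarrow> 0" using tendsto_ennrealI by fastforce
  then have "(\<lambda>j. Lp_dist p f (g j)) \<longlonglongrightarrow> 0" by (rule tendsto_sandwich[OF _ _ tendsto_const, rotated 2]) (use g(4) in auto)
  then have "(\<lambda>j. dp p (ball 0 1) f (g j)) \<longlonglongrightarrow> 0" using p by (subst dp_tendsto_0_iff[OF f gm gLp]) auto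
  moreover have "(SUP j. energy Q p (ball 0 1) (g j)) < \<infinity>"
    using SUP_least[of UNIV "\<lambda>j. energy Q p (ball 0 1) (g j)", OF g(3)] by (simp add: le_less_trans[OF _ ennreal_less_top])
  ultimately show ?thesis unfolding W1p_def using f(2) g(1,2) gLp by (auto simp: lipschitz_map_qspace intro!: exI[of _ g])
qed

section \<open>Total boundedness and Cauchy subsequences\<close>

lemma Qtuples_totally_bounded:
  fixes C :: "'b::real_normed_vector set"
  assumes "compact C" "0 < \<eta>"
  obtains A where "finite A" "\<And>a. a \<in> A ==> size a = Q" "\<And>Y. Y \<in> Qtuples Q C ==> \<exists>a\<in>A. qdist Y a <= \<eta>"
proof -
  define r where "r = \<eta> / (real Q + 1)"
  have r: "0 < r" "real Q * r <= \<eta>" using assms(2) by (auto simp: r_def field_simps)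
  obtain k where k: "finite k" "C \<subseteq> (\<Union>x\<in>k. ball x r)" using assms(1) r(1) unfolding compact_eq_totally_bounded by blast
  have "\<exists>c. c \<in> k \<and> dist c y < r" if "y \<in> C" for y
  proof -
    have "y \<in> (\<Union>x\<in>k. ball x r)" using k(2) that by blast
    then show ?thesis by auto
  qed
  then obtain c where c: "\<And>y. y \<in> C ==> c y \<in> k" "\<And>y. y \<in> C ==> dist (c y) y < r" by metis
  show ?thesis
  proof (rule that[of "mset ` {ds. set ds \<subseteq> k \<and> length ds = Q}"])
    show "finite (mset ` {ds. set ds \<subseteq> k \<and> length ds = Q})" by (intro finite_imageI finite_lists_length_eq k)
    fix Y assume Y: "Y \<in> Qtuples Q C"
    then obtain ys where ys: "mset ys = Y" "length ys = Q" using size_imp_list[of Y Q] by (auto simp: Qtuples_def)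
    have ysC: "ys ! i \<in> C" if "i < Q" for i using Y ys that by (auto simp: Qtuples_def)
    have "qdist Y (mset (map c ys)) <= L2_set (\<lambda>i. norm (ys ! i - map c ys ! i)) {..<Q}"
      using qdist_le[of ys "map c ys"] ys by simp
    also have "... <= real Q * r"
      using c(2)[OF ysC] ys(2) by (intro L2_le_sum_bound) (auto simp: dist_norm norm_minus_commute intro: less_imp_le)
    finally have "qdist Y (mset (map c ys)) <= \<eta>" using r(2) by simp
    moreover have "set (map c ys) \<subseteq> k" using c(1) Y ys by (auto simp: Qtuples_def)
    ultimately show "\<exists>a\<in>mset ` {ds. set ds \<subseteq> k \<and> length ds = Q}. qdist Y a <= \<eta>"
      using ys(2) by (intro bexI[of _ "mset (map c ys)"] imageI) auto
  qed auto
qed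

lemma small_powr_factor:
  fixes c \<delta> e0 p :: real
  assumes "0 <= c" "0 < \<delta>" "0 < e0" "0 < p"
  obtains e where "0 < e" "e <= e0" "c * e powr p <= \<delta>"
proof -
  define e where "e = min e0 ((\<delta> / (c + 1)) powr (1 / p))"
  have "e powr p <= ((\<delta> / (c + 1)) powr (1 / p)) powr p" using assms by (intro powr_mono2) (auto simp: e_def)
  also have "... = \<delta> / (c + 1)" using assms by (simp add: powr_powr)
  finally have "c * e powr p <= c * (\<delta> / (c + 1))" using assms by (intro mult_left_mono) auto
  also have "... <= \<delta>" using assms by (simp add: field_simps)
  finally show ?thesis using assms by (intro that[of e]) (auto simp: e_def)
qed

lemma Lp_dist_constant_on_cells:
  fixes Y Y' :: "real^'m => 'b::real_normed_vector multiset"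
  assumes "0 < \<e>" "0 <= p"
    and "\<And>z. z \<in> lattice ==> norm z <= 1 / \<e> + real CARD('m) ==> qdist (Y z) (Y' z) <= \<eta>"
  shows "Lp_dist p (\<lambda>x. Y (vfloor (x /\<^sub>R \<e>))) (\<lambda>x. Y' (vfloor (x /\<^sub>R \<e>))) <= ennreal (unit_ball_vol CARD('m) * \<eta> powr p)"
proof -
  have "Lp_dist p (\<lambda>x. Y (vfloor (x /\<^sub>R \<e>))) (\<lambda>x. Y' (vfloor (x /\<^sub>R \<e>))) <= (\<integral>\<^sup>+x\<in>(unit_disk :: (real^'m) set). ennreal (\<eta> powr p) \<partial>lborel)"
    unfolding Lp_dist_def
  proof (rule nn_integral_mono, goal_cases)
    case (1 x)
    let ?z = "vfloor (x /\<^sub>R \<e>)"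
    show ?case
    proof (cases "x \<in> unit_disk")
      case True
      then have "qdist (Y ?z) (Y' ?z) <= \<eta>" using norm_vfloor_unit_disk[OF True assms(1)] by (intro assms(3)) auto
      then show ?thesis using assms(2) by (intro mult_right_mono ennreal_leI powr_mono2 qdist_nonneg) auto
    qed simp
  qed
  also have "... = ennreal (unit_ball_vol CARD('m) * \<eta> powr p)"
    by (simp add: nn_integral_cmult emeasure_ball ennreal_mult mult.commute)
  finally show ?thesis .
qed

text \<open>A label records the samples at one mesh, rounded to a finite net of tuples. The mesh
  works for all \<open>j\<close> because of the common \<open>M\<close>, and only finitely many
  lattice points matter, so there are finitely many labels. Equal labels make the step functions
  close, and with them the maps.\<close>

lemma finite_labelling:
  fixes f :: "nat => real^'m => 'b::{real_normed_vector, second_countable_topology} multiset"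
  assumes f: "\<And>j. f j \<in> borel \<rightarrow>\<^sub>M qborel Q" and T: "\<And>j. transl_bound p (f j) M" and p: "1 <= p" and M: "0 <= M"
    and C: "compact C" "\<And>j x. x \<in> unit_disk ==> f j x \<in> Qtuples Q C" and \<delta>: "0 < \<delta>"
  obtains lab :: "nat => real^'m => 'b multiset"
  where "finite (range lab)" "\<And>i j. lab i = lab j ==> Lp_dist p (f i) (f j) <= ennreal \<delta>"
proof -
  \<comment> \<open>The cost of two uses of the triangle inequality for \<open>Lp_dist\<close>,
    through the two step functions, when each of the three distances is at most
    \<open>\<delta>1\<close>.\<close>
  define \<kappa> where "\<kappa> = 2 powr p * (1 + 2 powr p * 2)"
  have \<kappa>: "0 < \<kappa>" unfolding \<kappa>_def by (intro mult_pos_pos add_pos_pos) auto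
  define \<delta>1 where "\<delta>1 = \<delta> / \<kappa>"
  have "2 powr p * (\<delta>1 + 2 powr p * (\<delta>1 + \<delta>1)) = \<kappa> * \<delta>1" by (simp add: \<kappa>_def algebra_simps)
  then have \<delta>1: "0 < \<delta>1" "2 powr p * (\<delta>1 + 2 powr p * (\<delta>1 + \<delta>1)) = \<delta>" using \<delta> \<kappa> by (auto simp: \<delta>1_def)
  obtain K \<e>0 where K: "0 <= K" "0 < \<e>0"
    "\<And>(f :: real^'m => 'b multiset) M \<e>.
      f \<in> borel \<rightarrow>\<^sub>M qborel Q ==> transl_bound p f M ==> 0 <= M ==> 0 < \<e> ==> \<e> <= \<e>0 ==>
      \<exists>Y. discretizes p (real CARD('m)) (K * M) f \<e> Y"
    by (rule discretization[OF p order_refl, where 'm='m and 'b='b and Q=Q]) blast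
  obtain \<e> where \<e>: "0 < \<e>" "\<e> <= \<e>0" "K * M * \<e> powr p <= \<delta>1"
    using small_powr_factor[of "K * M" \<delta>1 \<e>0 p] K M \<delta>1(1) p by auto
  obtain \<eta> where \<eta>: "0 < \<eta>" "unit_ball_vol CARD('m) * 2 powr p * \<eta> powr p <= \<delta>1"
    using small_powr_factor[of "unit_ball_vol CARD('m) * 2 powr p" \<delta>1 1 p] \<delta>1(1) p by auto
  obtain A :: "'b multiset set" where A: "finite A" "\<And>a. a \<in> A ==> size a = Q" "\<And>Y. Y \<in> Qtuples Q C ==> \<exists>a\<in>A. qdist Y a <= \<eta>"
    using Qtuples_totally_bounded[OF C(1) \<eta>(1)] by blast
  have "\<forall>j. \<exists>Y. (\<forall>z. Y z \<in> f j ` unit_disk) \<and> Lp_dist p (f j) (\<lambda>x. Y (vfloor (x /\<^sub>R \<e>))) <= ennreal (K * M * \<e> powr p)"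
    using K(3)[OF f T M \<e>(1,2)] unfolding discretizes_def by blast
  from choice[OF this] obtain Y where Y: "\<And>j z. Y j z \<in> f j ` unit_disk"
    "\<And>j. Lp_dist p (f j) (\<lambda>x. Y j (vfloor (x /\<^sub>R \<e>))) <= ennreal (K * M * \<e> powr p)" by blast
  have YC: "Y j z \<in> Qtuples Q C" for j z using Y(1)[of j z] C(2) by auto
  then have size_Y: "size (Y j z) = Q" for j z by (simp add: Qtuples_def)
  have "\<exists>a\<in>A. qdist (Y j z) a <= \<eta>" for j z by (rule A(3)[OF YC])
  then obtain a where a: "\<And>j z. a j z \<in> A" "\<And>j z. qdist (Y j z) (a j z) <= \<eta>" by metis
  let ?F = "{z :: real^'m. z \<in> lattice \<and> norm z <= 1 / \<e> + real CARD('m)}"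
  have fin: "finite ?F" using finite_lattice_bounded[of 0 "1 / \<e> + real CARD('m)"] by simp
  define lab where "lab j = restrict (a j) ?F" for j
  show ?thesis
  proof (rule that[of lab])
    have "lab j \<in> ?F \<rightarrow>\<^sub>E A" for j unfolding lab_def restrict_PiE_iff using a(1) by blast
    then have "range lab \<subseteq> ?F \<rightarrow>\<^sub>E A" by blast
    then show "finite (range lab)" by (rule finite_subset) (intro finite_PiE fin A(1))
    fix i j assume eq: "lab i = lab j"
    let ?Y = "\<lambda>j x. Y j (vfloor (x /\<^sub>R \<e>))"
    have "qdist (Y i z) (Y j z) <= 2 * \<eta>" if "z \<in> lattice" "norm z <= 1 / \<e> + real CARD('m)" for z
    proof -
      have "a i z = a j z" using fun_cong[OF eq, of z] that by (simp add: lab_def)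
      moreover have "qdist (Y i z) (Y j z) <= qdist (Y i z) (a i z) + qdist (a i z) (Y j z)"
        using A(2)[OF a(1)] size_Y by (intro qdist_triangle[where Q=Q])
      ultimately show ?thesis using a(2)[of i z] a(2)[of j z] by (simp add: qdist_commute)
    qed
    then have "Lp_dist p (?Y i) (?Y j) <= ennreal (unit_ball_vol CARD('m) * (2 * \<eta>) powr p)"
      using p by (intro Lp_dist_constant_on_cells \<e>) auto
    also have "... <= ennreal \<delta>1" using \<eta> by (intro ennreal_leI) (simp add: powr_mult mult.assoc)
    finally have Yij: "Lp_dist p (?Y i) (?Y j) <= ennreal \<delta>1" .
    have fY: "Lp_dist p (f j) (?Y j) <= ennreal \<delta>1" for j using Y(2)[of j] ennreal_leI[OF \<e>(3)] by (rule order_trans)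
    note m = f step_function_measurable[OF size_Y]
    have "Lp_dist p (f i) (f j) <= ennreal (2 powr p) * (Lp_dist p (f i) (?Y i) + Lp_dist p (?Y i) (f j))"
      using p by (intro Lp_dist_triangle[where Q=Q] m) auto
    also have "... <= ennreal (2 powr p) * (Lp_dist p (f i) (?Y i) + ennreal (2 powr p) * (Lp_dist p (?Y i) (?Y j) + Lp_dist p (?Y j) (f j)))"
      using p by (intro mult_left_mono add_left_mono Lp_dist_triangle[where Q=Q] m) auto
    also have "... <= ennreal (2 powr p) * (ennreal \<delta>1 + ennreal (2 powr p) * (ennreal \<delta>1 + ennreal \<delta>1))"
      unfolding Lp_dist_commute[of p "?Y j" "f j"] by (intro mult_left_mono add_mono fY Yij) auto
    also have "... = ennreal \<delta>" unfolding \<delta>1(2)[symmetric] using \<delta>1(1) by (simp flip: ennreal_plus ennreal_mult)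
    finally show "Lp_dist p (f i) (f j) <= ennreal \<delta>" .
  qed
qed

text \<open>Some label occurs infinitely often, which for each level gives a subsequence with
  pairwise distances at most \<open>c n\<close>; the diagonal sequence serves all levels. The rates
  are left free, to be chosen for a weighted series.\<close>

lemma fast_Cauchy_subsequence:
  fixes f :: "nat => real^'m => 'b::{real_normed_vector, second_countable_topology} multiset"
  assumes f: "\<And>j. f j \<in> borel \<rightarrow>\<^sub>M qborel Q" and T: "\<And>j. transl_bound p (f j) M" and p: "1 <= p" and M: "0 <= M"
    and C: "compact C" "\<And>j x. x \<in> unit_disk ==> f j x \<in> Qtuples Q C" and c: "\<And>n. 0 < c n"
  obtains k :: "nat => nat" where "strict_mono k" "\<And>i j. j <= i ==> Lp_dist p (f (k i)) (f (k j)) <= ennreal (c j)"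
proof -
  define P where "P n s \<longleftrightarrow> (\<forall>i j. Lp_dist p (f (s i)) (f (s j)) <= ennreal (c n))" for n and s :: "nat => nat"
  interpret subseqs P
  proof
    fix n and s :: "nat => nat" assume s: "strict_mono s"
    obtain lab :: "nat => real^'m => 'b multiset" where lab: "finite (range lab)" "\<And>i j. lab i = lab j ==> Lp_dist p (f i) (f j) <= ennreal (c n)"
      by (rule finite_labelling[OF f T p M C c[of n]]) (assumption, rule that)
    have "finite (range (lab \<circ> s))" using lab(1) by (rule finite_subset[rotated]) auto
    then obtain i0 where inf: "infinite {i. (lab \<circ> s) i = (lab \<circ> s) i0}"
      using pigeonhole_infinite[of UNIV "lab \<circ> s"] by auto
    have "lab (s (enumerate {i. (lab \<circ> s) i = (lab \<circ> s) i0} n)) = lab (s i0)" for n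
      using enumerate_in_set[OF inf, of n] by simp
    then have "P n (s \<circ> enumerate {i. (lab \<circ> s) i = (lab \<circ> s) i0})" unfolding P_def o_def by (intro allI lab(2)) simp
    then show "\<exists>r. strict_mono r \<and> P n (s \<circ> r)" using strict_mono_enumerate[OF inf] by blast
  qed
  have PD: "Lp_dist p (f (s i)) (f (s j)) <= ennreal (c n)" if "P n s" for n s i j using that by (simp add: P_def)
  have holds: "P k (diagseq \<circ> (+) (Suc k))" for k by (rule diagseq_holds) (simp add: P_def)
  show ?thesis
  \<comment> \<open>Level \<open>j\<close> holds for the diagonal sequence from the index
    \<open>Suc j\<close> on, hence the shift by one.\<close>
  proof (rule that[of "\<lambda>j. diagseq (Suc j)"])
    show "strict_mono (\<lambda>j. diagseq (Suc j))" using subseq_diagseq by (simp add: strict_mono_def)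
    fix i j :: nat assume "j <= i"
    then show "Lp_dist p (f (diagseq (Suc i))) (f (diagseq (Suc j))) <= ennreal (c j)"
      using PD[OF holds[of j], of "i - j" 0] by simp
  qed
qed

section \<open>Completeness of the tuple space and convergence in the mean\<close>

lemma tuple_sequence_convergent:
  fixes Y :: "nat => 'b::banach multiset"
  assumes size: "\<And>j. size (Y j) = Q" and Y: "\<And>j. qdist (Y j) (Y (Suc j)) <= c * (1/2) ^ j"
  shows "\<exists>Z. size Z = Q \<and> (\<lambda>j. qdist (Y j) Z) \<longlonglongrightarrow> 0"
proof -
  \<comment> \<open>Enumerations are chosen one after another, each optimally matched to its
    predecessor, so that every position carries a Cauchy sequence of its own.\<close>
  have "\<exists>xs. \<forall>n. (mset (xs n) = Y n \<and> length (xs n) = Q) \<and>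
      (\<forall>i<Q. norm (xs n ! i - xs (Suc n) ! i) <= c * (1/2) ^ n)"
  proof (rule dependent_nat_choice)
    show "\<exists>x. mset x = Y 0 \<and> length x = Q" using size_imp_list[OF size] by blast
    fix xs n assume xs: "mset xs = Y n \<and> length xs = Q"
    obtain ys where ys: "mset ys = Y (Suc n)" "length ys = Q" "qdist (Y n) (Y (Suc n)) = L2_set (\<lambda>i. norm (xs ! i - ys ! i)) {..<Q}"
      using qdist_matching[OF size] xs by metis
    have "norm (xs ! i - ys ! i) <= c * (1/2) ^ n" if "i < Q" for i
      using norm_le_L2[OF that, of "\<lambda>i. xs ! i - ys ! i"] ys(3) Y[of n] by simp
    then show "\<exists>y. (mset y = Y (Suc n) \<and> length y = Q) \<and> (\<forall>i<Q. norm (xs ! i - y ! i) <= c * (1/2) ^ n)"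
      using ys by blast
  qed
  then obtain xs where xs: "\<And>n. mset (xs n) = Y n" "\<And>n. length (xs n) = Q"
    "\<And>n i. i < Q ==> norm (xs n ! i - xs (Suc n) ! i) <= c * (1/2) ^ n" by metis
  have "\<exists>l. (\<lambda>n. xs n ! i) \<longlonglongrightarrow> l" if i: "i < Q" for i
  proof -
    have "summable (\<lambda>n. c * (1/2::real) ^ n)" by (intro summable_mult summable_geometric) auto
    then have "summable (\<lambda>n. xs (Suc n) ! i - xs n ! i)"
      by (rule summable_comparison_test') (use xs(3)[OF i] in \<open>simp add: norm_minus_commute\<close>)
    then have "(\<lambda>n. \<Sum>j<n. xs (Suc j) ! i - xs j ! i) \<longlonglongrightarrow> (\<Sum>j. xs (Suc j) ! i - xs j ! i)" by (rule summable_LIMSEQ)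
    then have "(\<lambda>n. xs n ! i - xs 0 ! i) \<longlonglongrightarrow> (\<Sum>j. xs (Suc j) ! i - xs j ! i)"
      by (simp add: sum_lessThan_telescope[of "\<lambda>j. xs j ! i"])
    from tendsto_add[OF this tendsto_const[of "xs 0 ! i"]] show ?thesis by auto
  qed
  then obtain l where l: "\<And>i. i < Q ==> (\<lambda>n. xs n ! i) \<longlonglongrightarrow> l i" by metis
  define Z where "Z = mset (map l [0..<Q])"
  have "qdist (Y n) Z <= (\<Sum>i<Q. norm (xs n ! i - l i))" for n
  proof -
    have "qdist (Y n) Z <= L2_set (\<lambda>i. norm (xs n ! i - map l [0..<Q] ! i)) {..<Q}"
      using qdist_le[of "xs n" "map l [0..<Q]"] xs(1,2)[of n] by (simp add: Z_def)
    also have "... = L2_set (\<lambda>i. norm (xs n ! i - l i)) {..<Q}" by (intro L2_set_cong) auto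
    also have "... <= (\<Sum>i<Q. norm (xs n ! i - l i))" by (rule L2_set_le_sum) auto
    finally show ?thesis .
  qed
  moreover have "(\<lambda>n. \<Sum>i<Q. norm (xs n ! i - l i)) \<longlonglongrightarrow> (\<Sum>i<Q. 0)"
    using l by (intro tendsto_sum tendsto_norm_zero) (auto simp: LIM_zero_iff)
  ultimately have "(\<lambda>n. qdist (Y n) Z) \<longlonglongrightarrow> 0"
    using tendsto_sandwich[of "\<lambda>_. 0" "\<lambda>n. qdist (Y n) Z" sequentially "\<lambda>n. \<Sum>i<Q. norm (xs n ! i - l i)" 0]
    by (simp add: qdist_nonneg)
  then show ?thesis by (intro exI[of _ Z]) (simp add: Z_def)
qed

text \<open>Open sets of tuples are countable unions of balls about the members of a dense set, so
  it is enough to measure distances to fixed tuples.\<close>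

lemma measurable_qborelI:
  fixes g :: "'a => 'b::{real_normed_vector, second_countable_topology} multiset"
  assumes size: "\<And>x. x \<in> space M ==> size (g x) = Q"
    and g: "\<And>Z. size Z = Q ==> (\<lambda>x. qdist (g x) Z) \<in> borel_measurable M"
  shows "g \<in> M \<rightarrow>\<^sub>M qborel Q" unfolding qborel_def
proof (rule measurable_measure_of)
  show "{V. openin (mtopology_of (qspace Q)) V} \<subseteq> Pow (Qtuples Q UNIV)" by (rule openin_qspace_subset)
  show "g \<in> space M \<rightarrow> Qtuples Q UNIV" using size by auto
  fix V :: "'b multiset set" assume "V \<in> {V. openin (mtopology_of (qspace Q)) V}"
  then have V: "openin (mtopology_of (qspace Q)) V" by simp
  obtain D :: "'b multiset set" where D: "countable D" "\<And>d. d \<in> D ==> size d = Q"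
    "\<And>Y e. size Y = Q ==> 0 < e ==> \<exists>d\<in>D. qdist Y d < e" by (rule dense_Qtuples[where 'b='b and Q=Q]) blast
  define I where "I = {(d, n). d \<in> D \<and> (\<forall>Z. size Z = Q --> qdist d Z < 1 / real (Suc n) --> Z \<in> V)}"
  have "I \<subseteq> D \<times> UNIV" by (auto simp: I_def)
  then have I: "countable I" by (rule countable_subset) (intro countable_SIGMA D(1) countableI_type)
  have "g -` V \<inter> space M = (\<Union>(d, n)\<in>I. {x \<in> space M. qdist (g x) d < 1 / real (Suc n)})"
  proof (intro equalityI subsetI)
    fix x assume x: "x \<in> g -` V \<inter> space M"
    then obtain r where r: "0 < r" "\<And>Z. size Z = Q ==> qdist (g x) Z < r ==> Z \<in> V"
      using V unfolding openin_qspace_iff by blast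
    obtain n where n: "1 / real (Suc n) < r / 2" using r(1) reals_Archimedean[of "r / 2"] by (auto simp: inverse_eq_divide)
    obtain d where d: "d \<in> D" "qdist (g x) d < 1 / real (Suc n)" using D(3)[OF size, of x "1 / real (Suc n)"] x by auto
    have "Z \<in> V" if Z: "size Z = Q" "qdist d Z < 1 / real (Suc n)" for Z
    proof (rule r(2)[OF Z(1)])
      have "qdist (g x) Z <= qdist (g x) d + qdist d Z"
        using x size D(2)[OF d(1)] Z(1) by (intro qdist_triangle[where Q=Q]) auto
      then show "qdist (g x) Z < r" using d(2) Z(2) n by linarith
    qed
    then have "(d, n) \<in> I" using d(1) by (simp add: I_def)
    then show "x \<in> (\<Union>(d, n)\<in>I. {x \<in> space M. qdist (g x) d < 1 / real (Suc n)})" using d(2) x by blast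
  next
    fix x assume "x \<in> (\<Union>(d, n)\<in>I. {x \<in> space M. qdist (g x) d < 1 / real (Suc n)})"
    then show "x \<in> g -` V \<inter> space M" using size by (auto simp: I_def qdist_commute)
  qed
  also have "... \<in> sets M"
  proof (rule sets.countable_UN''[OF I])
    fix dn assume "dn \<in> I"
    then have [measurable]: "(\<lambda>x. qdist (g x) (fst dn)) \<in> borel_measurable M" using D(2) by (intro g) (auto simp: I_def)
    show "(case dn of (d, n) => {x \<in> space M. qdist (g x) d < 1 / real (Suc n)}) \<in> sets M"
      unfolding case_prod_beta by measurable
  qed
  finally show "g -` V \<inter> space M \<in> sets M" .
qed

text \<open>The rate is such that the \<open>p\<close>-th powers of the distances of consecutive
  maps, multiplied by \<open>(2 ^ j) powr p\<close>, still have integrals of order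
  \<open>(1/2) ^ j\<close>. Hence almost everywhere consecutive values are within a multiple of
  \<open>(1/2) ^ j\<close> and converge; Fatou's lemma turns this into convergence in the
  mean.\<close>

lemma Lp_fast_Cauchy_convergent:
  fixes h :: "nat => 'a::euclidean_space => 'b::{banach, second_countable_topology} multiset"
  assumes h [measurable]: "\<And>j. h j \<in> borel \<rightarrow>\<^sub>M qborel Q" and p: "0 < p"
    and Cau: "\<And>i j. j <= i ==> Lp_dist p (h i) (h j) <= ennreal ((1/2) ^ j * ((1/2) ^ j) powr p)"
  obtains g where "g \<in> borel \<rightarrow>\<^sub>M qborel Q" "(\<lambda>j. Lp_dist p g (h j)) \<longlonglongrightarrow> 0"
proof -
  let ?c = "\<lambda>j. (1/2 :: real) ^ j * ((1/2) ^ j) powr p"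
  have size_h: "size (h j x) = Q" for j x using measurable_space[OF h, of x j] by simp
  define X where "X = {x. \<exists>n::nat. \<forall>j. qdist (h j x) (h (Suc j) x) <= real n * (1/2) ^ j}"
  have [measurable]: "X \<in> sets borel" unfolding X_def by measurable
  have conv: "\<exists>Z. size Z = Q \<and> (\<lambda>j. qdist (h j x) Z) \<longlonglongrightarrow> 0" if "x \<in> X" for x
    using that tuple_sequence_convergent[of "\<lambda>j. h j x" Q] size_h unfolding X_def by blast
  \<comment> \<open>A fixed tuple off the Borel set \<open>X\<close> of fast convergence keeps the
    limit Borel and of size \<open>Q\<close> everywhere.\<close>
  define g where "g x = (if x \<in> X then SOME Z. size Z = Q \<and> (\<lambda>j. qdist (h j x) Z) \<longlonglongrightarrow> 0 else replicate_mset Q 0)" for x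
  have gX: "size (g x) = Q" "(\<lambda>j. qdist (h j x) (g x)) \<longlonglongrightarrow> 0" if "x \<in> X" for x
    using someI_ex[OF conv[OF that]] that by (simp_all add: g_def)
  have size_g: "size (g x) = Q" for x using gX(1)[of x] by (cases "x \<in> X") (auto simp: g_def)
  have lim: "(\<lambda>j. qdist (h j x) Z) \<longlonglongrightarrow> qdist (g x) Z" if "x \<in> X" "size Z = Q" for x Z
  proof (rule LIM_zero_cancel, rule tendsto_rabs_zero_cancel, rule tendsto_sandwich[OF _ _ tendsto_const gX(2)[OF that(1)]])
    show "\<forall>\<^sub>F j in sequentially. \<bar>qdist (h j x) Z - qdist (g x) Z\<bar> <= qdist (h j x) (g x)"
      using qdist_triangle2[OF size_h size_g that(2)] by simp
  qed simp
  have g [measurable]: "g \<in> borel \<rightarrow>\<^sub>M qborel Q"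
  proof (rule measurable_qborelI)
    fix Z :: "'b multiset" assume Z: "size Z = Q"
    then have [measurable]: "(\<lambda>x. qdist (h j x) Z) \<in> borel_measurable borel" for j
      using measurable_compose[OF h qdist_const_measurable] by blast
    have "(\<lambda>x. if x \<in> X then qdist (g x) Z else qdist (replicate_mset Q 0) Z) \<in> borel_measurable borel"
    proof (rule borel_measurable_LIMSEQ_real)
      fix x
      show "(\<lambda>j. if x \<in> X then qdist (h j x) Z else qdist (replicate_mset Q 0) Z)
          \<longlonglongrightarrow> (if x \<in> X then qdist (g x) Z else qdist (replicate_mset Q 0) Z)" using lim[OF _ Z] by auto
    qed measurable
    moreover have "(\<lambda>x. if x \<in> X then qdist (g x) Z else qdist (replicate_mset Q 0) Z) = (\<lambda>x. qdist (g x) Z)"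
      by (auto simp: g_def)
    ultimately show "(\<lambda>x. qdist (g x) Z) \<in> borel_measurable borel" by simp
  qed (rule size_g)
  let ?u = "\<lambda>j x. ennreal ((2 ^ j) powr p) * (qcost p (h (Suc j) x) (h j x) * indicator unit_disk x)"
  have "(\<integral>\<^sup>+x. (\<Sum>j. ?u j x)) = (\<Sum>j. ennreal ((2 ^ j) powr p) * Lp_dist p (h (Suc j)) (h j))"
    unfolding Lp_dist_def by (subst nn_integral_suminf) (auto simp: nn_integral_cmult)
  also have "... <= (\<Sum>j. ennreal ((1/2) ^ j))"
  proof (rule suminf_le)
    fix j
    have "ennreal ((2 ^ j) powr p) * Lp_dist p (h (Suc j)) (h j) <= ennreal ((2 ^ j) powr p) * ennreal (?c j)"
      by (intro mult_left_mono Cau) auto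
    also have "... = ennreal ((2 ^ j) powr p * ?c j)" by (simp add: ennreal_mult)
    also have "(2 ^ j) powr p * ?c j = (1/2) ^ j"
    proof -
      have "(2 ^ j) powr p * ((1/2 :: real) ^ j) powr p = (2 ^ j * (1/2) ^ j) powr p" by (rule powr_mult[symmetric])
      also have "(2 :: real) ^ j * (1/2) ^ j = 1" by (simp flip: power_mult_distrib)
      finally show ?thesis by (simp add: mult.left_commute)
    qed
    finally show "ennreal ((2 ^ j) powr p) * Lp_dist p (h (Suc j)) (h j) <= ennreal ((1/2) ^ j)" .
  qed auto
  also have "... = ennreal (\<Sum>j. (1/2) ^ j)" by (rule suminf_ennreal2) (auto intro: summable_geometric)
  also have "... < \<infinity>" by simp
  finally have fin: "(\<integral>\<^sup>+x. (\<Sum>j. ?u j x)) \<noteq> \<infinity>" by simp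
  have "AE x in lborel. (\<Sum>j. ?u j x) \<noteq> \<infinity>" by (rule nn_integral_PInf_AE[OF _ fin]) measurable
  then have AE_X: "AE x in lborel. x \<in> unit_disk --> x \<in> X"
  proof eventually_elim
    case (elim x)
    show ?case
    proof
      assume x: "x \<in> unit_disk"
      define a where "a = enn2real (\<Sum>j. ?u j x)"
      have a: "0 <= a" "(\<Sum>j. ?u j x) = ennreal a" using elim by (auto simp: a_def less_top)
      obtain n :: nat where n: "a powr (1 / p) <= real n" using real_arch_simple by blast
      have "qdist (h j x) (h (Suc j) x) <= real n * (1/2) ^ j" for j
      proof -
        have "?u j x <= (\<Sum>j. ?u j x)" using sum_le_suminf[of "\<lambda>j. ?u j x" "{j}"] by simp
        then have "ennreal ((2 ^ j * qdist (h (Suc j) x) (h j x)) powr p) <= ennreal a"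
          unfolding a(2) using x by (simp add: powr_mult ennreal_mult)
        then have "(2 ^ j * qdist (h (Suc j) x) (h j x)) powr p <= a" using a(1) by (simp add: ennreal_le_iff)
        then have "((2 ^ j * qdist (h (Suc j) x) (h j x)) powr p) powr (1 / p) <= a powr (1 / p)"
          using p by (intro powr_mono2) auto
        then have "2 ^ j * qdist (h (Suc j) x) (h j x) <= real n" using p n by (simp add: powr_powr qdist_nonneg)
        then show ?thesis by (simp add: qdist_commute field_simps)
      qed
      then show "x \<in> X" unfolding X_def by blast
    qed
  qed
  have "Lp_dist p g (h j) <= ennreal (?c j)" for j
  proof -
    let ?v = "\<lambda>i x. qcost p (h i x) (h j x) * indicator unit_disk x"
    have "Lp_dist p g (h j) <= (\<integral>\<^sup>+x. liminf (\<lambda>i. ?v i x))" unfolding Lp_dist_def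
    proof (rule nn_integral_mono_AE)
      show "AE x in lborel. qcost p (g x) (h j x) * indicator unit_disk x <= liminf (\<lambda>i. ?v i x)" using AE_X
      proof eventually_elim
        case (elim x)
        show ?case
        proof (cases "x \<in> unit_disk")
          case True
          then have "x \<in> X" using elim by simp
          then have "(\<lambda>i. qdist (h i x) (h j x) powr p) \<longlonglongrightarrow> qdist (g x) (h j x) powr p"
            using p by (intro tendsto_powr' lim size_h tendsto_const) (auto simp: qdist_nonneg)
          then have "(\<lambda>i. qcost p (h i x) (h j x)) \<longlonglongrightarrow> qcost p (g x) (h j x)" by (rule tendsto_ennrealI)
          from lim_imp_Liminf[OF _ this] True show ?thesis by simp
        qed simp
      qed
    qed
    also have "... <= liminf (\<lambda>i. \<integral>\<^sup>+x. ?v i x \<partial>lborel)" by (rule nn_integral_liminf) measurable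
    also have "... <= liminf (\<lambda>i::nat. ennreal (?c j))"
    proof (rule Liminf_mono)
      show "\<forall>\<^sub>F i in sequentially. (\<integral>\<^sup>+x. ?v i x) <= ennreal (?c j)"
        using eventually_ge_at_top[of j] by eventually_elim (use Cau in \<open>simp add: Lp_dist_def\<close>)
    qed
    also have "... = ennreal (?c j)" by (simp add: Liminf_const)
    finally show ?thesis .
  qed
  moreover have "(\<lambda>j. ennreal (?c j)) \<longlonglongrightarrow> 0"
  proof -
    have le: "?c j <= (1/2) ^ j" for j
    proof -
      have "((1/2) ^ j) powr p <= (1 :: real)" using p by (intro powr_le1) (auto simp: power_le_one)
      then show ?thesis by (simp add: mult_left_le)
    qed
    have "?c \<longlonglongrightarrow> 0" by (rule tendsto_sandwich[OF _ _ tendsto_const LIMSEQ_power_zero[of "1/2"]]) (use le in auto)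
    then show ?thesis using tendsto_ennrealI by fastforce
  qed
  ultimately have "(\<lambda>j. Lp_dist p g (h j)) \<longlonglongrightarrow> 0"
    using tendsto_sandwich[of "\<lambda>_. 0" "\<lambda>j. Lp_dist p g (h j)" sequentially "\<lambda>j. ennreal (?c j)" 0] by simp
  then show ?thesis using that g by blast
qed

section \<open>The compactness theorem for tuples in \<open>ell2\<close>\<close>

instance ell2 :: banach ..

theorem theorem4p8p2:
  fixes Q :: nat and p :: real
    and f :: "nat \<Rightarrow> real^'m \<Rightarrow> ell2 multiset"
  assumes "Q \<ge> 1" and "1 < p"
    and "\<And>j. f j \<in> W1p Q p (ball 0 1)"
    and "\<exists>C. compact C \<and> (\<forall>j. \<forall>x\<in>ball 0 1. f j x \<in> Qtuples Q C)"
    and "(SUP j. energy Q p (ball 0 1) (f j)) < \<infinity>"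
  shows "\<exists>k g. strict_mono (k :: nat \<Rightarrow> nat) \<and> g \<in> W1p Q p (ball 0 1) \<and>
    (\<lambda>j. dp p (ball 0 1) g (f (k j))) \<longlonglongrightarrow> 0"
proof -
  \<comment> \<open>The given maps are Borel on the open ball only; extended by \<open>Q\<close>
    copies of 0 they are Borel on the whole space, and the notions over the ball do not notice the
    change.\<close>
  define F where "F j x = (if x \<in> ball 0 1 then f j x else replicate_mset Q 0)" for j and x :: "real^'m"
  have eq: "F j x = f j x" if "x \<in> ball 0 1" for j x using that by (simp add: F_def)
  have F: "F j \<in> borel \<rightarrow>\<^sub>M qborel Q" for j
  proof -
    have "f j \<in> restrict_space borel (ball 0 1) \<rightarrow>\<^sub>M qborel Q"
      using assms(3)[of j] by (simp add: W1p_def Lp_def borel_maps_def)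
    then show ?thesis unfolding F_def by (subst (asm) measurable_restrict_space_iff[of _ _ "replicate_mset Q 0"]) auto
  qed
  have int_eq: "(\<integral>\<^sup>+x\<in>ball 0 1. G (F j x) x \<partial>lebesgue) = (\<integral>\<^sup>+x\<in>ball 0 1. G (f j x) x \<partial>lebesgue)"
    for j and G :: "ell2 multiset \<Rightarrow> real^'m \<Rightarrow> ennreal" by (rule nn_integral_cong) (auto simp: indicator_def eq)
  have dp_eqF: "dp p (ball 0 1) g (F j) = dp p (ball 0 1) g (f j)" "dp p (ball 0 1) (F j) g = dp p (ball 0 1) (f j) g"
    for j and g :: "real^'m \<Rightarrow> ell2 multiset"
    using int_eq[of "\<lambda>Y x. qcost p (g x) Y" j] int_eq[of "\<lambda>Y x. qcost p Y (g x)" j] by (simp_all add: dp_def)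
  have LpF: "F j \<in> Lp Q p (ball 0 1)" for j
    using assms(3)[of j] F[of j] int_eq[of "\<lambda>Y x. qcost p Y (replicate_mset Q 0)" j]
    by (simp add: W1p_def Lp_def borel_maps_def measurable_restrict_space1)
  have W1pF: "F j \<in> W1p Q p (ball 0 1)" for j using assms(3)[of j] LpF[of j] by (simp add: W1p_def dp_eqF)
  \<comment> \<open>\<open>Df\<close> sees a map only through its values in the ball, so the two
    agree at every point, whether or not an approximate differential exists there.\<close>
  have "norm_Df Q (ball 0 1) (F j) a = norm_Df Q (ball 0 1) (f j) a" for j a
  proof -
    have "{x \<in> ball 0 1. qdist (F j x) (G x) > t x} = {x \<in> ball 0 1. qdist (f j x) (G x) > t x}" for G t
      using eq by auto
    then show ?thesis by (simp add: norm_Df_def Df_def approx_affine_def del: mem_ball)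
  qed
  then have energyF: "energy Q p (ball 0 1) (F j) = energy Q p (ball 0 1) (f j)" for j by (simp add: energy_def)
  obtain C where C: "compact C" "\<And>j x. x \<in> ball 0 1 \<Longrightarrow> F j x \<in> Qtuples Q C" using assms(4) eq by metis
  define E where "E = enn2real (SUP j. energy Q p (ball 0 1) (f j))"
  have "(SUP j. energy Q p (ball 0 1) (f j)) = ennreal E" using assms(5) by (simp add: E_def)
  then have E: "energy Q p (ball 0 1) (F j) \<le> ennreal E" "0 \<le> E" for j
    using SUP_upper[of j UNIV "\<lambda>j. energy Q p (ball 0 1) (f j)"] by (simp_all add: energyF E_def)
  define M where "M = 2 * 2 powr ((real CARD('m) + 1) * p) * (unit_ball_vol CARD('m) + E)"
  have M: "0 \<le> M" using E(2) by (simp add: M_def)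
  have T: "transl_bound p (F j) M" for j unfolding M_def by (rule W1p_transl_bound[OF F W1pF assms(2) E])
  have p: "1 \<le> p" "0 < p" using assms(2) by auto
  obtain k :: "nat \<Rightarrow> nat" where k: "strict_mono k"
    "\<And>i j. j \<le> i \<Longrightarrow> Lp_dist p (F (k i)) (F (k j)) \<le> ennreal ((1/2) ^ j * ((1/2) ^ j) powr p)"
    by (rule fast_Cauchy_subsequence[where f=F, OF F T p(1) M C, of "\<lambda>j. (1/2) ^ j * ((1/2) ^ j) powr p"]) auto
  obtain g where g: "g \<in> borel \<rightarrow>\<^sub>M qborel Q" "(\<lambda>j. Lp_dist p g (F (k j))) \<longlonglongrightarrow> 0"
    using Lp_fast_Cauchy_convergent[of "\<lambda>j. F (k j)", OF F p(2) k(2)] by blast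
  \<comment> \<open>The approximation of the limit works with any finite translation constant, so
    the factor \<open>4 powr p\<close> does no harm.\<close>
  have Tg: "transl_bound p g (4 powr p * M)" by (rule transl_bound_limit[OF g(1) F T p(1) M g(2)])
  have c: "(\<lambda>_. replicate_mset Q 0) \<in> borel \<rightarrow>\<^sub>M qborel Q" by (intro measurable_const) simp
  \<comment> \<open>A finite distance from one member of \<open>Lp\<close> is enough to put the
    limit into \<open>Lp\<close>.\<close>
  have "\<forall>\<^sub>F j in sequentially. Lp_dist p g (F (k j)) < 1" using g(2) by (rule order_tendstoD) simp
  then obtain j where j: "Lp_dist p g (F (k j)) < 1" by (auto simp: eventually_sequentially)
  have "Lp_dist p g (\<lambda>_. replicate_mset Q 0) \<le> ennreal (2 powr p) * (Lp_dist p g (F (k j)) + Lp_dist p (F (k j)) (\<lambda>_. replicate_mset Q 0))"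
    using p by (intro Lp_dist_triangle[OF g(1) F c]) auto
  also have "\<dots> < \<infinity>" using LpF[of "k j"] j unfolding Lp_iff[OF F] by (auto simp: ennreal_mult_less_top intro: less_trans)
  finally have Lpg: "g \<in> Lp Q p (ball 0 1)" unfolding Lp_iff[OF g(1)] .
  have "g \<in> W1p Q p (ball 0 1)" using M by (intro transl_bound_imp_W1p[OF g(1) Lpg Tg p(1)]) auto
  moreover have "(\<lambda>j. dp p (ball 0 1) g (F (k j))) \<longlonglongrightarrow> 0" using g(2) by (subst dp_tendsto_0_iff[OF g(1) Lpg F LpF p(2)])
  ultimately show ?thesis using k(1) unfolding dp_eqF by blast
qed

end
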